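(* Let $k$ be a field. If $A$ and $B$ are homologically smooth $k$-algebras, then so is $A\otimes_kB$. Likewise, if $A$ and $B$ are graded homologically smooth $\mathbb{N}$-graded $k$-algebras, then so is $A\otimes_kB$.
   Context: Algebras are unital and associative over the arbitrary field $k$. With $A^e=A\otimes_kA^{\mathrm{op}}$, $A$ is homologically smooth if $A$ has a finite-length resolution by finitely generated projective left $A^e$-modules. If $A=\bigoplus_{n\ge0}A_n$ is graded, it is graded homologically smooth if $A$ has a finite-length resolution, in the category of graded left $A^e$-modules with degree-preserving maps, by finitely generated graded projective modules. $A\otimes_kB$ carries the total grading when $A,B$ are graded. *)

theory Defs
  imports "HOL-Algebra.QuotRing" "HOL-Algebra.Module" "HOL.Hull"
begin

text \<open>
  The library locale \<open>algebra\<close> is restricted to commutative algebras. Here only the base ring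
  is commutative. The zero algebra is allowed.
\<close>

locale assoc_algebra = module K A + ring A
  for K (structure) and A (structure) +
  assumes smult_mult_left:
      "\<lbrakk>c \<in> carrier K; x \<in> carrier A; y \<in> carrier A\<rbrakk>
        \<Longrightarrow> (c \<odot>\<^bsub>A\<^esub> x) \<otimes>\<^bsub>A\<^esub> y = c \<odot>\<^bsub>A\<^esub> (x \<otimes>\<^bsub>A\<^esub> y)"
    and smult_mult_right:
      "\<lbrakk>c \<in> carrier K; x \<in> carrier A; y \<in> carrier A\<rbrakk>
        \<Longrightarrow> x \<otimes>\<^bsub>A\<^esub> (c \<odot>\<^bsub>A\<^esub> y) = c \<odot>\<^bsub>A\<^esub> (x \<otimes>\<^bsub>A\<^esub> y)"

definition opposite :: "('k, 'a) module \<Rightarrow> ('k, 'a) module"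
  where "opposite A = A\<lparr>mult := (\<lambda>x y. y \<otimes>\<^bsub>A\<^esub> x)\<rparr>"

text \<open>
  The free \<open>K\<close>-module on the carrier of \<open>G\<close>, consisting of finitely supported coefficient
  functions that vanish outside the carrier, with the convolution product.
\<close>

definition monoid_algebra :: "('k, 'c) ring_scheme \<Rightarrow> ('x, 'd) monoid_scheme \<Rightarrow> ('k, 'x \<Rightarrow> 'k) module"
  where "monoid_algebra K G =
    \<lparr>carrier = {f. range f \<subseteq> carrier K \<and> finite {x. f x \<noteq> \<zero>\<^bsub>K\<^esub>} \<and> {x. f x \<noteq> \<zero>\<^bsub>K\<^esub>} \<subseteq> carrier G},
     mult = (\<lambda>f g z. \<Oplus>\<^bsub>K\<^esub> p \<in> {(x, y). f x \<noteq> \<zero>\<^bsub>K\<^esub> \<and> g y \<noteq> \<zero>\<^bsub>K\<^esub> \<and> x \<otimes>\<^bsub>G\<^esub> y = z}.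
       f (fst p) \<otimes>\<^bsub>K\<^esub> g (snd p)),
     one = (\<lambda>x. if x = \<one>\<^bsub>G\<^esub> then \<one>\<^bsub>K\<^esub> else \<zero>\<^bsub>K\<^esub>),
     zero = (\<lambda>x. \<zero>\<^bsub>K\<^esub>),
     add = (\<lambda>f g x. f x \<oplus>\<^bsub>K\<^esub> g x),
     smult = (\<lambda>c f x. c \<otimes>\<^bsub>K\<^esub> f x)\<rparr>"

definition basis_elem :: "('k, 'c) ring_scheme \<Rightarrow> 'x \<Rightarrow> 'x \<Rightarrow> 'k"
  where "basis_elem K x = (\<lambda>y. if y = x then \<one>\<^bsub>K\<^esub> else \<zero>\<^bsub>K\<^esub>)"

definition bilinear_relators ::
    "('k, 'c) ring_scheme \<Rightarrow> ('k, 'a) module \<Rightarrow> ('k, 'b) module \<Rightarrow> ('a \<times> 'b \<Rightarrow> 'k) set"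
  where "bilinear_relators K A B =
    (let F = monoid_algebra K (A \<times>\<times> B); e = (\<lambda>a b. basis_elem K (a, b)) in
      {e (a \<oplus>\<^bsub>A\<^esub> a') b \<ominus>\<^bsub>F\<^esub> (e a b \<oplus>\<^bsub>F\<^esub> e a' b) | a a' b.
          a \<in> carrier A \<and> a' \<in> carrier A \<and> b \<in> carrier B} \<union>
      {e a (b \<oplus>\<^bsub>B\<^esub> b') \<ominus>\<^bsub>F\<^esub> (e a b \<oplus>\<^bsub>F\<^esub> e a b') | a b b'.
          a \<in> carrier A \<and> b \<in> carrier B \<and> b' \<in> carrier B} \<union>
      {e (c \<odot>\<^bsub>A\<^esub> a) b \<ominus>\<^bsub>F\<^esub> c \<odot>\<^bsub>F\<^esub> e a b | c a b.
          c \<in> carrier K \<and> a \<in> carrier A \<and> b \<in> carrier B} \<union>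
      {e a (c \<odot>\<^bsub>B\<^esub> b) \<ominus>\<^bsub>F\<^esub> c \<odot>\<^bsub>F\<^esub> e a b | c a b.
          c \<in> carrier K \<and> a \<in> carrier A \<and> b \<in> carrier B})"

definition tensor_kernel ::
    "('k, 'c) ring_scheme \<Rightarrow> ('k, 'a) module \<Rightarrow> ('k, 'b) module \<Rightarrow> ('a \<times> 'b \<Rightarrow> 'k) set"
  where "tensor_kernel K A B =
    (\<lambda>H. submodule H K (monoid_algebra K (A \<times>\<times> B))) hull bilinear_relators K A B"

text \<open>
  The usual quotient of the free module on pairs by the span of the bilinearity relations. On
  basis elements, convolution over \<open>A \<times>\<times> B\<close> is \<open>(a, b) * (a', b') = (a a', b b')\<close>, so it induces
  the product \<open>(a \<otimes> b) (a' \<otimes> b') = a a' \<otimes> b b'\<close>.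
\<close>

definition tensor_product ::
    "('k, 'c) ring_scheme \<Rightarrow> ('k, 'a) module \<Rightarrow> ('k, 'b) module \<Rightarrow> ('k, ('a \<times> 'b \<Rightarrow> 'k) set) module"
  where "tensor_product K A B =
    (let F = monoid_algebra K (A \<times>\<times> B); I = tensor_kernel K A B in
      ring.extend (F Quot I) \<lparr>smult = (\<lambda>c X. \<Union>f\<in>X. I +>\<^bsub>F\<^esub> (c \<odot>\<^bsub>F\<^esub> f))\<rparr>)"

definition pure_tensor ::
    "('k, 'c) ring_scheme \<Rightarrow> ('k, 'a) module \<Rightarrow> ('k, 'b) module \<Rightarrow> 'a \<Rightarrow> 'b \<Rightarrow> ('a \<times> 'b \<Rightarrow> 'k) set"
  where "pure_tensor K A B a b =
    tensor_kernel K A B +>\<^bsub>monoid_algebra K (A \<times>\<times> B)\<^esub> basis_elem K (a, b)"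

definition enveloping ::
    "('k, 'c) ring_scheme \<Rightarrow> ('k, 'a) module \<Rightarrow> ('k, ('a \<times> 'a \<Rightarrow> 'k) set) module"
  where "enveloping K A = tensor_product K A (opposite A)"

text \<open>
  The library locale \<open>module\<close> requires commutative scalars. As there, the multiplication and unit
  fields of the record of a module are ignored.
\<close>

locale left_module = R?: ring R + M?: abelian_group M
  for R (structure) and M (structure) +
  assumes smult_closed [simp, intro]:
      "\<lbrakk>a \<in> carrier R; x \<in> carrier M\<rbrakk> \<Longrightarrow> a \<odot>\<^bsub>M\<^esub> x \<in> carrier M"
    and smult_l_distr:
      "\<lbrakk>a \<in> carrier R; b \<in> carrier R; x \<in> carrier M\<rbrakk>
        \<Longrightarrow> (a \<oplus> b) \<odot>\<^bsub>M\<^esub> x = a \<odot>\<^bsub>M\<^esub> x \<oplus>\<^bsub>M\<^esub> b \<odot>\<^bsub>M\<^esub> x"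
    and smult_r_distr:
      "\<lbrakk>a \<in> carrier R; x \<in> carrier M; y \<in> carrier M\<rbrakk>
        \<Longrightarrow> a \<odot>\<^bsub>M\<^esub> (x \<oplus>\<^bsub>M\<^esub> y) = a \<odot>\<^bsub>M\<^esub> x \<oplus>\<^bsub>M\<^esub> a \<odot>\<^bsub>M\<^esub> y"
    and smult_assoc1:
      "\<lbrakk>a \<in> carrier R; b \<in> carrier R; x \<in> carrier M\<rbrakk>
        \<Longrightarrow> (a \<otimes> b) \<odot>\<^bsub>M\<^esub> x = a \<odot>\<^bsub>M\<^esub> (b \<odot>\<^bsub>M\<^esub> x)"
    and smult_one [simp]:
      "x \<in> carrier M \<Longrightarrow> \<one> \<odot>\<^bsub>M\<^esub> x = x"

definition left_module_hom ::
    "('r, 'c) ring_scheme \<Rightarrow> ('r, 'm) module \<Rightarrow> ('r, 'n) module \<Rightarrow> ('m \<Rightarrow> 'n) set"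
  where "left_module_hom R M N =
    {f \<in> carrier M \<rightarrow> carrier N.
      (\<forall>x\<in>carrier M. \<forall>y\<in>carrier M. f (x \<oplus>\<^bsub>M\<^esub> y) = f x \<oplus>\<^bsub>N\<^esub> f y) \<and>
      (\<forall>a\<in>carrier R. \<forall>x\<in>carrier M. f (a \<odot>\<^bsub>M\<^esub> x) = a \<odot>\<^bsub>N\<^esub> f x)}"

definition finitely_generated :: "('r, 'c) ring_scheme \<Rightarrow> ('r, 'm) module \<Rightarrow> bool"
  where "finitely_generated R M \<longleftrightarrow>
    (\<exists>S. finite S \<and> S \<subseteq> carrier M \<and> (\<lambda>H. submodule H R M) hull S = carrier M)"

text \<open>
  A formula cannot quantify over all modules of all types, so the lifting property is tested on
  modules whose elements have a given type \<open>'u\<close>.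
\<close>

definition projective_wrt :: "'u itself \<Rightarrow> ('r, 'c) ring_scheme \<Rightarrow> ('r, 'p) module \<Rightarrow> bool"
  where "projective_wrt (_ :: 'u itself) R P \<longleftrightarrow>
    (\<forall>(M :: ('r, 'u) module) (N :: ('r, 'u) module) g f.
      left_module R M \<and> left_module R N \<and>
      g \<in> left_module_hom R M N \<and> g ` carrier M = carrier N \<and> f \<in> left_module_hom R P N \<longrightarrow>
      (\<exists>h \<in> left_module_hom R P M. \<forall>x\<in>carrier P. g (h x) = f x))"

text \<open>
  Exactness of \<open>0 \<rightarrow> P n \<rightarrow> \<dots> \<rightarrow> P 0 \<rightarrow> M \<rightarrow> 0\<close>, with \<open>d i : P (i + 1) \<rightarrow> P i\<close> and augmentation
  \<open>\<epsilon> : P 0 \<rightarrow> M\<close>. Modules \<open>P i\<close> with \<open>i > n\<close> and maps \<open>d i\<close> with \<open>i \<ge> n\<close> are irrelevant.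
\<close>

definition finite_resolution ::
    "('r, 'c) ring_scheme \<Rightarrow> ('r, 'm) module \<Rightarrow> nat \<Rightarrow> (nat \<Rightarrow> ('r, 'p) module) \<Rightarrow>
      (nat \<Rightarrow> 'p \<Rightarrow> 'p) \<Rightarrow> ('p \<Rightarrow> 'm) \<Rightarrow> bool"
  where "finite_resolution R M n P d \<epsilon> \<longleftrightarrow>
    (let incoming = (\<lambda>i. if i < n then d i ` carrier (P (Suc i)) else {\<zero>\<^bsub>P i\<^esub>}) in
      (\<forall>i\<le>n. left_module R (P i)) \<and>
      (\<forall>i<n. d i \<in> left_module_hom R (P (Suc i)) (P i)) \<and>
      \<epsilon> \<in> left_module_hom R (P 0) M \<and>
      \<epsilon> ` carrier (P 0) = carrier M \<and>
      a_kernel (P 0) M \<epsilon> = incoming 0 \<and>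
      (\<forall>i<n. a_kernel (P (Suc i)) (P i) (d i) = incoming (Suc i)))"

text \<open>
  \<open>A\<close> as a left module over its enveloping algebra, \<open>(a \<otimes> b) x = a x b\<close>. The sum does not depend
  on the representative \<open>f\<close> of the class \<open>X\<close>, so the image is a singleton.
\<close>

definition regular_bimodule ::
    "('k, 'c) ring_scheme \<Rightarrow> ('k, 'a) module \<Rightarrow> (('a \<times> 'a \<Rightarrow> 'k) set, 'a) module"
  where "regular_bimodule K A =
    \<lparr>carrier = carrier A, mult = mult A, one = one A, zero = zero A, add = add A,
     smult = (\<lambda>X x. the_elem
       ((\<lambda>f. \<Oplus>\<^bsub>A\<^esub> p \<in> {p. f p \<noteq> \<zero>\<^bsub>K\<^esub>}. f p \<odot>\<^bsub>A\<^esub> (fst p \<otimes>\<^bsub>A\<^esub> x \<otimes>\<^bsub>A\<^esub> snd p)) ` X))\<rparr>"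

text \<open>
  With \<open>R = enveloping K A\<close> and \<open>'r\<close> its type of elements, the type \<open>nat \<Rightarrow> 'r\<close> restricts neither
  the resolution nor the lifting property. A finitely generated \<open>R\<close>-module \<open>P\<close> is a quotient of
  some \<open>R ^ m\<close>, so choosing coordinates for each element gives an isomorphic copy of \<open>P\<close> with
  elements in \<open>nat \<Rightarrow> 'r\<close>. The lifting property for test modules of this type then includes the
  surjection \<open>R ^ m \<rightarrow> P\<close>, which therefore splits. Hence \<open>P\<close> is a direct summand of \<open>R ^ m\<close> and has
  the lifting property for modules of every type.
\<close>

definition homologically_smooth :: "('k, 'c) ring_scheme \<Rightarrow> ('k, 'a) module \<Rightarrow> bool"
  where "homologically_smooth K (A :: ('k, 'a) module) \<longleftrightarrow>
    assoc_algebra K A \<and>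
    (\<exists>n (P :: nat \<Rightarrow> (('a \<times> 'a \<Rightarrow> 'k) set, nat \<Rightarrow> ('a \<times> 'a \<Rightarrow> 'k) set) module) d \<epsilon>.
      finite_resolution (enveloping K A) (regular_bimodule K A) n P d \<epsilon> \<and>
      (\<forall>i\<le>n. finitely_generated (enveloping K A) (P i) \<and>
             projective_wrt TYPE(nat \<Rightarrow> ('a \<times> 'a \<Rightarrow> 'k) set) (enveloping K A) (P i)))"

definition internal_direct_sum :: "('m, 'c) ring_scheme \<Rightarrow> ('i \<Rightarrow> 'm set) \<Rightarrow> bool"
  where "internal_direct_sum M G \<longleftrightarrow>
    (\<forall>i. subgroup (G i) (add_monoid M)) \<and>
    (\<forall>x\<in>carrier M. \<exists>!c. (\<forall>i. c i \<in> G i) \<and> finite {i. c i \<noteq> \<zero>\<^bsub>M\<^esub>} \<and>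
      x = (\<Oplus>\<^bsub>M\<^esub> i \<in> {i. c i \<noteq> \<zero>\<^bsub>M\<^esub>}. c i))"

locale graded_algebra = assoc_algebra K A
  for K (structure) and A (structure) and G :: "nat \<Rightarrow> 'a set" +
  assumes subspaces: "submodule (G n) K A"
    and direct_sum: "internal_direct_sum A G"
    and one_degree: "\<one>\<^bsub>A\<^esub> \<in> G 0"
    and mult_degree: "\<lbrakk>x \<in> G m; y \<in> G n\<rbrakk> \<Longrightarrow> x \<otimes>\<^bsub>A\<^esub> y \<in> G (m + n)"

definition total_grading ::
    "('k, 'c) ring_scheme \<Rightarrow> ('k, 'a) module \<Rightarrow> (nat \<Rightarrow> 'a set) \<Rightarrow> ('k, 'b) module \<Rightarrow> (nat \<Rightarrow> 'b set)
      \<Rightarrow> nat \<Rightarrow> ('a \<times> 'b \<Rightarrow> 'k) set set"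
  where "total_grading K A G B H n =
    (\<lambda>V. submodule V K (tensor_product K A B)) hull
      {pure_tensor K A B a b | a b i j. a \<in> G i \<and> b \<in> H j \<and> i + j = n}"

definition enveloping_grading ::
    "('k, 'c) ring_scheme \<Rightarrow> ('k, 'a) module \<Rightarrow> (nat \<Rightarrow> 'a set) \<Rightarrow> nat \<Rightarrow> ('a \<times> 'a \<Rightarrow> 'k) set set"
  where "enveloping_grading K A G = total_grading K A G (opposite A) G"

text \<open>
  Graded modules over an \<open>\<nat>\<close>-graded ring are graded by the integers; negative degrees may occur.
\<close>

locale graded_module = left_module R M
  for R (structure) and G :: "nat \<Rightarrow> 'r set" and M (structure) and H :: "int \<Rightarrow> 'm set" +
  assumes direct_sum: "internal_direct_sum M H"
    and smult_degree: "\<lbrakk>a \<in> G m; x \<in> H j\<rbrakk> \<Longrightarrow> a \<odot>\<^bsub>M\<^esub> x \<in> H (int m + j)"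

definition graded_hom ::
    "('r, 'c) ring_scheme \<Rightarrow> ('r, 'm) module \<Rightarrow> (int \<Rightarrow> 'm set) \<Rightarrow> ('r, 'n) module \<Rightarrow> (int \<Rightarrow> 'n set)
      \<Rightarrow> ('m \<Rightarrow> 'n) set"
  where "graded_hom R M H N L = {f \<in> left_module_hom R M N. \<forall>j. f ` H j \<subseteq> L j}"

definition graded_projective_wrt ::
    "'u itself \<Rightarrow> ('r, 'c) ring_scheme \<Rightarrow> (nat \<Rightarrow> 'r set) \<Rightarrow> ('r, 'p) module \<Rightarrow> (int \<Rightarrow> 'p set) \<Rightarrow> bool"
  where "graded_projective_wrt (_ :: 'u itself) R G P Q \<longleftrightarrow>
    (\<forall>(M :: ('r, 'u) module) H (N :: ('r, 'u) module) L g f.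
      graded_module R G M H \<and> graded_module R G N L \<and>
      g \<in> graded_hom R M H N L \<and> g ` carrier M = carrier N \<and> f \<in> graded_hom R P Q N L \<longrightarrow>
      (\<exists>h \<in> graded_hom R P Q M H. \<forall>x\<in>carrier P. g (h x) = f x))"

definition extend_by_zero :: "('m, 'c) ring_scheme \<Rightarrow> (nat \<Rightarrow> 'm set) \<Rightarrow> int \<Rightarrow> 'm set"
  where "extend_by_zero M G j = (if 0 \<le> j then G (nat j) else {\<zero>\<^bsub>M\<^esub>})"

text \<open>
  The type \<open>nat \<Rightarrow> 'r\<close> is again no restriction, by the same argument with homogeneous generators
  and shifted copies of \<open>R\<close>.
\<close>

definition graded_homologically_smooth ::
    "('k, 'c) ring_scheme \<Rightarrow> ('k, 'a) module \<Rightarrow> (nat \<Rightarrow> 'a set) \<Rightarrow> bool"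
  where "graded_homologically_smooth K (A :: ('k, 'a) module) G \<longleftrightarrow>
    graded_algebra K A G \<and>
    (\<exists>n (P :: nat \<Rightarrow> (('a \<times> 'a \<Rightarrow> 'k) set, nat \<Rightarrow> ('a \<times> 'a \<Rightarrow> 'k) set) module) Q d \<epsilon>.
      finite_resolution (enveloping K A) (regular_bimodule K A) n P d \<epsilon> \<and>
      (\<forall>i<n. d i \<in> graded_hom (enveloping K A) (P (Suc i)) (Q (Suc i)) (P i) (Q i)) \<and>
      \<epsilon> \<in> graded_hom (enveloping K A) (P 0) (Q 0) (regular_bimodule K A) (extend_by_zero A G) \<and>
      (\<forall>i\<le>n. graded_module (enveloping K A) (enveloping_grading K A G) (P i) (Q i) \<and>
             finitely_generated (enveloping K A) (P i) \<and>
             graded_projective_wrt TYPE(nat \<Rightarrow> ('a \<times> 'a \<Rightarrow> 'k) set)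
               (enveloping K A) (enveloping_grading K A G) (P i) (Q i)))"

end

theory Submission
  imports Defs "HOL-Library.Nat_Bijection"
begin

text \<open>
  Let \<open>f: R\<^sup>I \<rightarrow> M\<close> and \<open>g: S\<^sup>J \<rightarrow> N\<close> be presentations with kernels \<open>M'\<close> and \<open>N'\<close>. Over a field the kernel
  of \<open>f \<otimes> g\<close> is \<open>M' \<otimes> S\<^sup>J + R\<^sup>I \<otimes> N'\<close>, and the two summands meet in \<open>M' \<otimes> N'\<close>. Finite projective
  dimension passes to extensions, hence to such sums, so by induction on the lengths of the
  resolutions \<open>M \<otimes> N\<close> has finite projective dimension over \<open>R \<otimes> S\<close>, with finitely generated syzygies.
  This avoids the total complex of a double complex. It is applied to \<open>M = A\<close> over \<open>R = A\<^sup>e\<close> and \<open>N = B\<close>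
  over \<open>S = B\<^sup>e\<close>, where \<open>R \<otimes> S\<close> is \<open>(A \<otimes> B)\<^sup>e\<close>. The ungraded case is the graded one with everything in
  degree \<open>0\<close>.
\<close>

section \<open>Additive closures and additive maps\<close>

text \<open>Two formulas carry the argument, that for the kernel of \<open>f \<otimes> g\<close> and
  that for the intersection of its two summands, and both are instances of
  \<open>tensor_sep\<close>. The field enters there: a functional can vanish on a given subspace and
  not at a given vector outside it, and products of functionals detect tensors. No bases are chosen.
  Tensor products of general modules are not constructed. A bilinear map into some \<open>T\<close>
  counts as one (\<open>tens\<close>) if its values generate \<open>T\<close> and functionals
  separate them. This covers submodules of free modules as well as \<open>A \<otimes> B\<close> over
  its enveloping algebra. Resolutions are handled through covers by free modules with index sets in
  \<open>nat\<close>, so that every syzygy is a subset of one type, and projectivity is the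
  existence of a graded splitting of such a cover. The length obtained is not the sum of the two
  given lengths, because every sum of two submodules raises the bound by one. Only its finiteness
  matters.\<close>

inductive_set acl :: "('m, 'c) ring_scheme \<Rightarrow> 'm set \<Rightarrow> 'm set"
  for M (structure) and S where
  acl_zero: "\<zero> \<in> acl M S"
| acl_base: "x \<in> S \<Longrightarrow> x \<in> acl M S"
| acl_add: "x \<in> acl M S \<Longrightarrow> y \<in> acl M S \<Longrightarrow> x \<oplus> y \<in> acl M S"
| acl_minus: "x \<in> acl M S \<Longrightarrow> \<ominus> x \<in> acl M S"

definition add_closed :: "('m, 'c) ring_scheme \<Rightarrow> 'm set \<Rightarrow> bool"
  where "add_closed M H \<longleftrightarrow> H \<subseteq> carrier M \<and> \<zero>\<^bsub>M\<^esub> \<in> H \<and> (\<forall>x\<in>H. \<forall>y\<in>H. x \<oplus>\<^bsub>M\<^esub> y \<in> H) \<and>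
    (\<forall>x\<in>H. \<ominus>\<^bsub>M\<^esub> x \<in> H)"

lemma add_closedI:
  assumes "H \<subseteq> carrier M" "\<zero>\<^bsub>M\<^esub> \<in> H" "\<And>x y. x \<in> H \<Longrightarrow> y \<in> H \<Longrightarrow> x \<oplus>\<^bsub>M\<^esub> y \<in> H"
    "\<And>x. x \<in> H \<Longrightarrow> \<ominus>\<^bsub>M\<^esub> x \<in> H"
  shows "add_closed M H"
  using assms by (auto simp: add_closed_def)

lemma add_closedD:
  assumes "add_closed M H"
  shows "\<And>x. x \<in> H \<Longrightarrow> x \<in> carrier M" "\<zero>\<^bsub>M\<^esub> \<in> H" "\<And>x y. x \<in> H \<Longrightarrow> y \<in> H \<Longrightarrow> x \<oplus>\<^bsub>M\<^esub> y \<in> H"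
    "\<And>x. x \<in> H \<Longrightarrow> \<ominus>\<^bsub>M\<^esub> x \<in> H" "\<And>x y. x \<in> H \<Longrightarrow> y \<in> H \<Longrightarrow> x \<ominus>\<^bsub>M\<^esub> y \<in> H"
  using assms by (auto simp: add_closed_def a_minus_def)

lemma add_closed_iff_subgroup:
  assumes "abelian_group M"
  shows "add_closed M H \<longleftrightarrow> subgroup H (add_monoid M)"
proof -
  interpret abelian_group M by fact
  have "\<And>x. x \<in> H \<Longrightarrow> inv\<^bsub>add_monoid M\<^esub> x = \<ominus>\<^bsub>M\<^esub> x" by (simp add: a_inv_def)
  then show ?thesis by (auto simp: add_closed_def subgroup_def)
qed

lemma acl_least:
  assumes "add_closed M H" "S \<subseteq> H" "x \<in> acl M S"
  shows "x \<in> H"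
  using assms(3) by induction (use assms(1,2) in \<open>auto simp: add_closed_def\<close>)

lemma acl_mono:
  assumes "S \<subseteq> S'" "x \<in> acl M S"
  shows "x \<in> acl M S'"
  using assms(2) by induction (use assms(1) in \<open>auto intro: acl.intros\<close>)

lemma (in abelian_group) add_closed_carrier: "add_closed G (carrier G)"
  by (auto simp: add_closed_def)

lemma (in abelian_group) acl_carrier: "S \<subseteq> carrier G \<Longrightarrow> x \<in> acl G S \<Longrightarrow> x \<in> carrier G"
  using acl_least[OF add_closed_carrier] .

lemma (in abelian_group) add_closed_acl:
  assumes "S \<subseteq> carrier G"
  shows "add_closed G (acl G S)"
  using acl_least[OF add_closed_carrier assms] by (auto simp: add_closed_def intro: acl.intros)

lemma (in abelian_group) add_closed_finsum:
  assumes "add_closed G H" "\<And>i. i \<in> I \<Longrightarrow> f i \<in> H"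
  shows "finsum G f I \<in> H"
  using assms(2)
proof (induction I rule: infinite_finite_induct)
  case (insert i I)
  then have "f i \<in> carrier G" "f \<in> I \<rightarrow> carrier G" using add_closedD(1)[OF assms(1)] by auto
  then show ?case using insert add_closedD(3)[OF assms(1)] by (simp add: finsum_insert)
qed (use add_closedD(2)[OF assms(1)] in auto)

text \<open>A predicate rather than a locale, so that composites, sums and partial applications of
  bilinear maps are handled by introduction rules.\<close>

definition addm :: "('m, 'c) ring_scheme \<Rightarrow> ('n, 'd) ring_scheme \<Rightarrow> ('m \<Rightarrow> 'n) \<Rightarrow> bool"
  where "addm M N f \<longleftrightarrow> f \<in> carrier M \<rightarrow> carrier N \<and>
    (\<forall>x\<in>carrier M. \<forall>y\<in>carrier M. f (x \<oplus>\<^bsub>M\<^esub> y) = f x \<oplus>\<^bsub>N\<^esub> f y)"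

lemma addmI:
  assumes "\<And>x. x \<in> carrier M \<Longrightarrow> f x \<in> carrier N"
    "\<And>x y. x \<in> carrier M \<Longrightarrow> y \<in> carrier M \<Longrightarrow> f (x \<oplus>\<^bsub>M\<^esub> y) = f x \<oplus>\<^bsub>N\<^esub> f y"
  shows "addm M N f"
  using assms by (auto simp: addm_def)

lemma addm_closed: "addm M N f \<Longrightarrow> x \<in> carrier M \<Longrightarrow> f x \<in> carrier N"
  by (auto simp: addm_def)

lemma addm_add:
  "addm M N f \<Longrightarrow> x \<in> carrier M \<Longrightarrow> y \<in> carrier M \<Longrightarrow> f (x \<oplus>\<^bsub>M\<^esub> y) = f x \<oplus>\<^bsub>N\<^esub> f y"
  by (auto simp: addm_def)

lemma addm_zero:
  assumes "abelian_group M" "abelian_group N" "addm M N f"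
  shows "f \<zero>\<^bsub>M\<^esub> = \<zero>\<^bsub>N\<^esub>"
proof -
  interpret M: abelian_group M by fact
  interpret N: abelian_group N by fact
  have "f \<zero>\<^bsub>M\<^esub> \<oplus>\<^bsub>N\<^esub> f \<zero>\<^bsub>M\<^esub> = f \<zero>\<^bsub>M\<^esub>" using addm_add[OF assms(3), of "\<zero>\<^bsub>M\<^esub>" "\<zero>\<^bsub>M\<^esub>"] by simp
  then show ?thesis using addm_closed[OF assms(3) M.zero_closed] N.add.r_cancel_one' by metis
qed

lemma addm_minus:
  assumes "abelian_group M" "abelian_group N" "addm M N f" "x \<in> carrier M"
  shows "f (\<ominus>\<^bsub>M\<^esub> x) = \<ominus>\<^bsub>N\<^esub> f x"
proof -
  interpret M: abelian_group M by fact
  interpret N: abelian_group N by fact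
  have "f (\<ominus>\<^bsub>M\<^esub> x) \<oplus>\<^bsub>N\<^esub> f x = \<zero>\<^bsub>N\<^esub>"
    using addm_add[OF assms(3), of "\<ominus>\<^bsub>M\<^esub> x" x] addm_zero[OF assms(1-3)] assms(4)
    by (simp add: M.l_neg)
  then show ?thesis using addm_closed[OF assms(3)] assms(4) by (simp add: N.minus_equality)
qed

lemma addm_diff:
  assumes "abelian_group M" "abelian_group N" "addm M N f" "x \<in> carrier M" "y \<in> carrier M"
  shows "f (x \<ominus>\<^bsub>M\<^esub> y) = f x \<ominus>\<^bsub>N\<^esub> f y"
  using assms addm_add[of M N f x "\<ominus>\<^bsub>M\<^esub> y"] addm_minus[of M N f y]
  by (simp add: a_minus_def abelian_group.a_inv_closed)

lemma addm_finsum: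
  assumes "abelian_group M" "abelian_group N" "addm M N f" "finite I" "\<And>i. i \<in> I \<Longrightarrow> g i \<in> carrier M"
  shows "f (finsum M g I) = finsum N (\<lambda>i. f (g i)) I"
proof -
  interpret M: abelian_group M by fact
  interpret N: abelian_group N by fact
  show ?thesis using assms(4,5)
  proof (induction I)
    case empty then show ?case using addm_zero[OF assms(1-3)] by simp
  next
    case (insert i I)
    then have "g \<in> I \<rightarrow> carrier M" "(\<lambda>i. f (g i)) \<in> I \<rightarrow> carrier N"
      using addm_closed[OF assms(3)] by auto
    then show ?case using insert addm_closed[OF assms(3)]
      by (simp add: M.finsum_insert N.finsum_insert addm_add[OF assms(3)])
  qed
qed

lemma addm_comp:
  assumes "addm M N f" "addm N P g"
  shows "addm M P (\<lambda>x. g (f x))"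
  using assms by (auto simp: addm_def Pi_def)

lemma addm_plus:
  assumes "abelian_group N" "addm M N f" "addm M N g"
  shows "addm M N (\<lambda>x. f x \<oplus>\<^bsub>N\<^esub> g x)"
proof -
  interpret N: abelian_group N by fact
  show ?thesis
    by (rule addmI) (use assms(2,3) in \<open>auto simp: addm_add addm_closed N.a_ac\<close>)
qed

lemma addm_uminus:
  assumes "abelian_group N" "addm M N f"
  shows "addm M N (\<lambda>x. \<ominus>\<^bsub>N\<^esub> f x)"
proof -
  interpret N: abelian_group N by fact
  show ?thesis
    by (rule addmI) (use assms(2) in \<open>auto simp: addm_add addm_closed N.minus_add N.a_comm\<close>)
qed

lemma addm_const_zero:
  assumes "abelian_group N"
  shows "addm M N (\<lambda>x. \<zero>\<^bsub>N\<^esub>)"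
  by (rule addmI) (use abelian_group.axioms(1)[OF assms] in \<open>auto simp: abelian_monoid.zero_closed abelian_monoid.l_zero\<close>)

lemma addm_id: "addm M M (\<lambda>x. x)"
  by (rule addmI) auto

lemma addm_finsumf:
  assumes "abelian_group N" "finite I" "\<And>i. i \<in> I \<Longrightarrow> addm M N (f i)"
  shows "addm M N (\<lambda>x. finsum N (\<lambda>i. f i x) I)"
proof -
  interpret N: abelian_group N by fact
  show ?thesis
  proof (rule addmI)
    fix x y assume x: "x \<in> carrier M" "y \<in> carrier M"
    have "finsum N (\<lambda>i. f i (x \<oplus>\<^bsub>M\<^esub> y)) I = finsum N (\<lambda>i. f i x \<oplus>\<^bsub>N\<^esub> f i y) I"
      by (rule N.finsum_cong') (use assms(3) x addm_closed in \<open>fastforce simp: addm_add\<close>)+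
    also have "\<dots> = finsum N (\<lambda>i. f i x) I \<oplus>\<^bsub>N\<^esub> finsum N (\<lambda>i. f i y) I"
      by (rule N.finsum_addf) (use assms(3) x addm_closed in \<open>fastforce+\<close>)
    finally show "finsum N (\<lambda>i. f i (x \<oplus>\<^bsub>M\<^esub> y)) I = \<dots>" .
  qed (use assms(3) addm_closed in \<open>fastforce intro!: N.finsum_closed\<close>)
qed

lemma add_closed_vimage:
  assumes "abelian_group M" "abelian_group N" "addm M N f" "add_closed N H"
  shows "add_closed M {x \<in> carrier M. f x \<in> H}"
proof -
  interpret M: abelian_group M by fact
  show ?thesis
    by (rule add_closedI) (use assms addm_zero[OF assms(1-3)] addm_minus[OF assms(1-3)] addm_add[OF assms(3)]
        in \<open>auto simp: add_closed_def\<close>)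
qed

lemma add_closed_image:
  assumes "abelian_group M" "abelian_group N" "addm M N f" "add_closed M H"
  shows "add_closed N (f ` H)"
proof (rule add_closedI)
  note D = add_closedD[OF assms(4)]
  show "f ` H \<subseteq> carrier N" using D addm_closed[OF assms(3)] by auto
  show "\<zero>\<^bsub>N\<^esub> \<in> f ` H" using D(2) addm_zero[OF assms(1-3)] by force
  show "x \<oplus>\<^bsub>N\<^esub> y \<in> f ` H" if "x \<in> f ` H" "y \<in> f ` H" for x y
    using that D addm_add[OF assms(3)] by (smt (verit) image_iff)
  show "\<ominus>\<^bsub>N\<^esub> x \<in> f ` H" if "x \<in> f ` H" for x
    using that D addm_minus[OF assms(1-3)] by (smt (verit) image_iff)
qed

lemma add_closed_zero: "abelian_group M \<Longrightarrow> add_closed M {\<zero>\<^bsub>M\<^esub>}"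
proof -
  assume "abelian_group M" then interpret abelian_group M .
  show ?thesis by (rule add_closedI) auto
qed

text \<open>Identities are checked on generators by this rule throughout. A multiadditive identity
  takes one application per argument, with the other arguments fixed; this replaces expansions into
  finite sums of pure tensors.\<close>

lemma addm_eq_on_acl:
  assumes "abelian_group M" "abelian_group N" "addm M N f" "addm M N g" "S \<subseteq> carrier M"
    "\<And>x. x \<in> S \<Longrightarrow> f x = g x" "x \<in> acl M S"
  shows "f x = g x"
proof -
  interpret M: abelian_group M by fact
  have c: "y \<in> carrier M" if "y \<in> acl M S" for y
    using acl_least[OF M.add_closed_carrier assms(5)] that .
  show ?thesis using assms(7)
    by induction
      (use assms(6) in \<open>simp_all add: c addm_zero[OF assms(1,2,3)] addm_zero[OF assms(1,2,4)]
        addm_minus[OF assms(1,2,3)] addm_minus[OF assms(1,2,4)] addm_add[OF assms(3)] addm_add[OF assms(4)]\<close>)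
qed

lemma addm_acl:
  assumes "abelian_group M" "abelian_group N" "addm M N f" "S \<subseteq> carrier M"
    "\<And>x. x \<in> S \<Longrightarrow> f x \<in> H" "add_closed N H" "x \<in> acl M S"
  shows "f x \<in> H"
  using acl_least[OF add_closed_vimage[OF assms(1-3,6)] _ assms(7)] assms(4,5) by auto

section \<open>Gradings as families of projections\<close>

text \<open>Projections turn homogeneity into the equation \<open>q i x = x\<close> and graded maps
  into maps that commute with \<open>q\<close>. Asking only that homogeneous elements generate
  leaves finiteness of decompositions to \<open>finite_decomposition\<close>; generation is what can
  be checked directly for free modules and tensor products.\<close>

locale grading = abelian_group M for M (structure) and q :: "'i \<Rightarrow> 'm \<Rightarrow> 'm" +
  assumes q_addm: "addm M M (q i)"
    and q_orth: "x \<in> carrier M \<Longrightarrow> q i (q j x) = (if i = j then q j x else \<zero>)"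
    and q_gen: "x \<in> carrier M \<Longrightarrow> x \<in> acl M {y \<in> carrier M. \<exists>i. q i y = y}"
begin

lemma q_closed [simp, intro]: "x \<in> carrier M \<Longrightarrow> q i x \<in> carrier M"
  using addm_closed[OF q_addm] .

lemma q_add: "x \<in> carrier M \<Longrightarrow> y \<in> carrier M \<Longrightarrow> q i (x \<oplus> y) = q i x \<oplus> q i y"
  using addm_add[OF q_addm] .

lemma q_zero [simp]: "q i \<zero> = \<zero>"
  using addm_zero[OF abelian_group_axioms abelian_group_axioms q_addm] .

lemma q_minus: "x \<in> carrier M \<Longrightarrow> q i (\<ominus> x) = \<ominus> q i x"
  using addm_minus[OF abelian_group_axioms abelian_group_axioms q_addm] .

lemma q_other: "x \<in> carrier M \<Longrightarrow> q j x = x \<Longrightarrow> i \<noteq> j \<Longrightarrow> q i x = \<zero>"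
  using q_orth[of x i j] by simp

lemma add_closed_component: "add_closed M {x \<in> carrier M. q i x = x}"
  by (rule add_closedI) (auto simp: q_add q_minus)

lemma finite_decomposition:
  assumes "x \<in> carrier M"
  shows "\<exists>I. finite I \<and> (\<forall>i. i \<notin> I \<longrightarrow> q i x = \<zero>) \<and> x = (\<Oplus>i\<in>I. q i x)"
  using q_gen[OF assms]
proof induction
  case acl_zero
  show ?case by (rule exI[of _ "{}"]) auto
next
  case (acl_base x)
  then obtain i where i: "q i x = x" "x \<in> carrier M" by auto
  have "x = (\<Oplus>j\<in>{i}. q j x)" using i finsum_insert[of "{}" i "\<lambda>j. q j x"] by simp
  moreover have "\<forall>j. j \<notin> {i} \<longrightarrow> q j x = \<zero>"
    by (intro allI impI q_other[OF i(2,1)]) simp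
  ultimately have "finite {i} \<and> (\<forall>j. j \<notin> {i} \<longrightarrow> q j x = \<zero>) \<and> x = (\<Oplus>j\<in>{i}. q j x)" by (metis finite.simps)
  then show ?case by (rule exI)
next
  case (acl_add x y)
  have c: "x \<in> carrier M" "y \<in> carrier M"
    by (rule acl_carrier[OF _ acl_add(1)], blast, rule acl_carrier[OF _ acl_add(2)], blast)
  obtain I J where I: "finite I" "\<forall>i. i \<notin> I \<longrightarrow> q i x = \<zero>" "x = (\<Oplus>i\<in>I. q i x)"
    and J: "finite J" "\<forall>i. i \<notin> J \<longrightarrow> q i y = \<zero>" "y = (\<Oplus>i\<in>J. q i y)"
    using acl_add by blast
  have "(\<Oplus>i\<in>I. q i x) = (\<Oplus>i\<in>I\<union>J. q i x)"
    by (rule add.finprod_mono_neutral_cong_left) (use I(1,2) J(1,2) c in auto)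
  moreover have "(\<Oplus>i\<in>J. q i y) = (\<Oplus>i\<in>I\<union>J. q i y)"
    by (rule add.finprod_mono_neutral_cong_left) (use I(1,2) J(1,2) c in auto)
  ultimately have "x \<oplus> y = (\<Oplus>i\<in>I\<union>J. q i x) \<oplus> (\<Oplus>i\<in>I\<union>J. q i y)" using I(3) J(3) by metis
  also have "\<dots> = (\<Oplus>i\<in>I\<union>J. q i (x \<oplus> y))"
    using c by (simp add: q_add finsum_addf Pi_def)
  finally have s: "x \<oplus> y = (\<Oplus>i\<in>I\<union>J. q i (x \<oplus> y))" .
  show ?case by (intro exI[of _ "I \<union> J"] conjI s) (use I(1,2) J(1,2) c in \<open>auto simp: q_add\<close>)
next
  case (acl_minus x)
  have c: "x \<in> carrier M"
    by (rule acl_carrier[OF _ acl_minus(1)], blast)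
  obtain I where I: "finite I" "\<forall>i. i \<notin> I \<longrightarrow> q i x = \<zero>" "x = (\<Oplus>i\<in>I. q i x)"
    using acl_minus by blast
  have "\<ominus> x = (\<Oplus>i\<in>I. \<ominus> q i x)"
    using addm_finsum[OF abelian_group_axioms abelian_group_axioms addm_uminus[OF abelian_group_axioms addm_id] I(1), of "\<lambda>i. q i x"]
      I(3)[symmetric] c by auto
  also have "\<dots> = (\<Oplus>i\<in>I. q i (\<ominus> x))" using c by (simp only: q_minus)
  finally have s: "\<ominus> x = (\<Oplus>i\<in>I. q i (\<ominus> x))" .
  show ?case by (intro exI[of _ I] conjI s) (use I(1,2) c in \<open>auto simp: q_minus\<close>)
qed

lemma decomposition_over:
  assumes "x \<in> carrier M" "finite I" "\<And>i. i \<notin> I \<Longrightarrow> q i x = \<zero>"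
  shows "x = (\<Oplus>i\<in>I. q i x)"
proof -
  obtain J where J: "finite J" "\<forall>i. i \<notin> J \<longrightarrow> q i x = \<zero>" "x = (\<Oplus>i\<in>J. q i x)"
    using finite_decomposition[OF assms(1)] by blast
  have "(\<Oplus>i\<in>J. q i x) = (\<Oplus>i\<in>I\<union>J. q i x)"
    by (rule add.finprod_mono_neutral_cong_left) (use assms J(1,2) in auto)
  also have "\<dots> = (\<Oplus>i\<in>I. q i x)"
    by (rule add.finprod_mono_neutral_cong_right) (use assms J(1,2) in auto)
  finally show ?thesis using J(3) by metis
qed

lemma internal_direct_sum: "internal_direct_sum M (\<lambda>i. {x \<in> carrier M. q i x = x})"
  unfolding internal_direct_sum_def
proof (intro conjI allI ballI)
  show "subgroup {x \<in> carrier M. q i x = x} (add_monoid M)" for i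
    using add_closed_component add_closed_iff_subgroup[OF abelian_group_axioms] by blast
next
  fix x assume x: "x \<in> carrier M"
  obtain I where I: "finite I" "\<forall>i. i \<notin> I \<longrightarrow> q i x = \<zero>" using finite_decomposition[OF x] by metis
  have fin: "finite {i. q i x \<noteq> \<zero>}" by (rule finite_subset[OF _ I(1)]) (use I in auto)
  show "\<exists>!c. (\<forall>i. c i \<in> {x \<in> carrier M. q i x = x}) \<and> finite {i. c i \<noteq> \<zero>} \<and> x = (\<Oplus>i\<in>{i. c i \<noteq> \<zero>}. c i)"
  proof (rule ex1I[of _ "\<lambda>i. q i x"], intro conjI)
    show "x = (\<Oplus>i\<in>{i. q i x \<noteq> \<zero>}. q i x)" by (rule decomposition_over) (use x fin in auto)
  next
    fix c assume c: "(\<forall>i. c i \<in> {x \<in> carrier M. q i x = x}) \<and> finite {i. c i \<noteq> \<zero>} \<and> x = (\<Oplus>i\<in>{i. c i \<noteq> \<zero>}. c i)"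
    show "c = (\<lambda>i. q i x)"
    proof
      fix i
      have cl: "\<And>j. c j \<in> carrier M" "\<And>j. q j (c j) = c j" using c by auto
      \<comment> \<open>Uniqueness: \<open>q i\<close> applied to any decomposition annihilates all
        its terms except the one of degree \<open>i\<close>.\<close>
      have "q i x = q i (\<Oplus>j\<in>{i. c i \<noteq> \<zero>}. c j)" using c by auto
      also have "\<dots> = (\<Oplus>j\<in>{i. c i \<noteq> \<zero>}. q i (c j))"
        by (rule addm_finsum[OF abelian_group_axioms abelian_group_axioms q_addm]) (use c in auto)
      also have "\<dots> = (\<Oplus>j\<in>{i. c i \<noteq> \<zero>}. if i = j then c j else \<zero>)"
      proof (rule add.finprod_cong')
        fix j assume "j \<in> {i. c i \<noteq> \<zero>}"
        show "q i (c j) = (if i = j then c j else \<zero>)" using cl q_other[of "c j" j i] by auto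
      qed (use cl in auto)
      also have "\<dots> = c i"
      proof (cases "c i = \<zero>")
        case True
        then have "(\<Oplus>j\<in>{i. c i \<noteq> \<zero>}. if i = j then c j else \<zero>) = (\<Oplus>j\<in>{i. c i \<noteq> \<zero>}. \<zero>)"
          by (intro add.finprod_cong') auto
        then show ?thesis using True by (simp add: finsum_zero)
      next
        case False
        then show ?thesis using add.finprod_singleton[of i "{i. c i \<noteq> \<zero>}" c] c cl by auto
      qed
      finally show "c i = q i x" by simp
    qed
  qed (use x fin in \<open>auto simp: q_orth\<close>)
qed

end

text \<open>The projections are the coefficients of the unique decomposition, so their additivity
  and orthogonality are instances of uniqueness.\<close>

lemma internal_direct_sum_grading:
  assumes "abelian_group M" "internal_direct_sum M G"
  obtains q where "grading M q" "\<And>i. G i = {x \<in> carrier M. q i x = x}"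
proof -
  interpret abelian_group M by fact
  define P where "P x c \<longleftrightarrow> (\<forall>i. c i \<in> G i) \<and> finite {i. c i \<noteq> \<zero>\<^bsub>M\<^esub>} \<and>
      x = (\<Oplus>\<^bsub>M\<^esub> i \<in> {i. c i \<noteq> \<zero>\<^bsub>M\<^esub>}. c i)" for x c
  define q where "q i x = (THE c. P x c) i" for i x
  have ac: "add_closed M (G i)" for i
    using assms(2) add_closed_iff_subgroup[OF assms(1)] by (auto simp: internal_direct_sum_def)
  note acD = add_closedD[OF ac]
  have ex1: "\<exists>!c. P x c" if "x \<in> carrier M" for x
    using assms(2) that unfolding internal_direct_sum_def P_def by blast
  have Pq: "P x (\<lambda>i. q i x)" if "x \<in> carrier M" for x
    using theI'[OF ex1[OF that]] by (simp add: q_def)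
  have qI: "(\<lambda>i. q i x) = c" if "P x c" "x \<in> carrier M" for x c
    using ex1 Pq that by blast
  have qG: "q i x \<in> G i" if "x \<in> carrier M" for i x using Pq[OF that] by (simp add: P_def)
  \<comment> \<open>\<open>P\<close> sums over the exact support of \<open>c\<close>. Supports may
    shrink under addition, so \<open>P\<close> is also derived from any finite index set that
    contains the support.\<close>
  have PI: "P x c" if "finite I" "\<And>i. c i \<in> G i" "\<And>i. i \<notin> I \<Longrightarrow> c i = \<zero>\<^bsub>M\<^esub>" "x = (\<Oplus>\<^bsub>M\<^esub>i\<in>I. c i)" for x c I
  proof -
    have fin: "finite {i. c i \<noteq> \<zero>\<^bsub>M\<^esub>}" by (rule finite_subset[OF _ that(1)]) (use that in auto)
    have "(\<Oplus>\<^bsub>M\<^esub>i\<in>{i. c i \<noteq> \<zero>\<^bsub>M\<^esub>}. c i) = (\<Oplus>\<^bsub>M\<^esub>i\<in>I. c i)"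
      by (rule add.finprod_mono_neutral_cong_left) (use that acD(1) in auto)
    then show ?thesis using that fin by (auto simp: P_def)
  qed
  have hom: "q j x = (if j = i then x else \<zero>\<^bsub>M\<^esub>)" if "x \<in> G i" for x i j
  proof -
    have "P x (\<lambda>j. if j = i then x else \<zero>\<^bsub>M\<^esub>)"
      by (rule PI[of "{i}"]) (use that acD(1,2) in auto)
    from fun_cong[OF qI[OF this], of j] show ?thesis using that acD(1) by auto
  qed
  have add: "q i (x \<oplus>\<^bsub>M\<^esub> y) = q i x \<oplus>\<^bsub>M\<^esub> q i y" if x: "x \<in> carrier M" "y \<in> carrier M" for i x y
  proof -
    define I where "I = {i. q i x \<noteq> \<zero>\<^bsub>M\<^esub>} \<union> {i. q i y \<noteq> \<zero>\<^bsub>M\<^esub>}"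
    have qc: "q i x \<in> carrier M" "q i y \<in> carrier M" for i using qG acD(1) x by auto
    have finI: "finite I" using Pq x by (auto simp: I_def P_def)
    have sx: "x = (\<Oplus>\<^bsub>M\<^esub>i\<in>{i. q i x \<noteq> \<zero>\<^bsub>M\<^esub>}. q i x)" "y = (\<Oplus>\<^bsub>M\<^esub>i\<in>{i. q i y \<noteq> \<zero>\<^bsub>M\<^esub>}. q i y)"
      using Pq x unfolding P_def by blast+
    have "x = (\<Oplus>\<^bsub>M\<^esub>i\<in>I. q i x)"
      by (subst sx(1), rule add.finprod_mono_neutral_cong_left) (use finI qc in \<open>auto simp: I_def\<close>)
    moreover have "y = (\<Oplus>\<^bsub>M\<^esub>i\<in>I. q i y)"
      by (subst sx(2), rule add.finprod_mono_neutral_cong_left) (use finI qc in \<open>auto simp: I_def\<close>)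
    ultimately have "x \<oplus>\<^bsub>M\<^esub> y = (\<Oplus>\<^bsub>M\<^esub>i\<in>I. q i x) \<oplus>\<^bsub>M\<^esub> (\<Oplus>\<^bsub>M\<^esub>i\<in>I. q i y)" by simp
    also have "\<dots> = (\<Oplus>\<^bsub>M\<^esub>i\<in>I. q i x \<oplus>\<^bsub>M\<^esub> q i y)"
      using qc by (simp add: finsum_addf Pi_def)
    finally have "P (x \<oplus>\<^bsub>M\<^esub> y) (\<lambda>i. q i x \<oplus>\<^bsub>M\<^esub> q i y)"
      by (intro PI[OF finI]) (use qG acD(3) x in \<open>auto simp: I_def\<close>)
    from fun_cong[OF qI[OF this], of i] show ?thesis using x by auto
  qed
  have G: "G i = {x \<in> carrier M. q i x = x}" for i
  proof (intro equalityI subsetI)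
    show "x \<in> {x \<in> carrier M. q i x = x}" if "x \<in> G i" for x
      using that hom[OF that, of i] acD(1) by simp
    show "x \<in> G i" if "x \<in> {x \<in> carrier M. q i x = x}" for x
      using that qG[of x i] by simp
  qed
  have "grading M q"
  proof (intro grading.intro grading_axioms.intro abelian_group_axioms)
    show "addm M M (q i)" for i
      using add acD(1)[OF qG] by (intro addmI) blast+
  next
    fix x i j assume "x \<in> carrier M"
    then show "q i (q j x) = (if i = j then q j x else \<zero>\<^bsub>M\<^esub>)" using hom[OF qG[of x j], of i] by auto
  next
    fix x assume x: "x \<in> carrier M"
    let ?S = "{y \<in> carrier M. \<exists>i. q i y = y}"
    have "x = (\<Oplus>\<^bsub>M\<^esub>i\<in>{i. q i x \<noteq> \<zero>\<^bsub>M\<^esub>}. q i x)" using Pq[OF x] unfolding P_def by blast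
    also have "\<dots> \<in> acl M ?S"
      by (rule add_closed_finsum[OF add_closed_acl])
        (use qG[OF x] in \<open>unfold G, blast, blast intro: acl_base\<close>)
    finally show "x \<in> acl M ?S" .
  qed
  then show thesis using that G by blast
qed

section \<open>Graded modules\<close>

lemma abelian_group_sub:
  assumes "abelian_group M" "add_closed M H"
  shows "abelian_group (M\<lparr>carrier := H\<rparr>)"
proof -
  interpret abelian_group M by fact
  note D = add_closedD[OF assms(2)]
  show ?thesis
  proof (rule abelian_groupI)
    show "\<exists>y\<in>carrier (M\<lparr>carrier := H\<rparr>). y \<oplus>\<^bsub>M\<lparr>carrier := H\<rparr>\<^esub> x = \<zero>\<^bsub>M\<lparr>carrier := H\<rparr>\<^esub>"
      if "x \<in> carrier (M\<lparr>carrier := H\<rparr>)" for x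
      using that D(1,4) by (intro bexI[of _ "\<ominus>\<^bsub>M\<^esub> x"]) (auto simp: l_neg)
  qed (use D in \<open>auto simp: a_ac\<close>)
qed

text \<open>\<open>a_inv\<close> is a definite description over the carrier, so a smaller carrier
  changes the term. The value on \<open>H\<close> stays the same because \<open>H\<close> is closed
  under negation.\<close>

lemma a_inv_sub:
  assumes "abelian_group M" "add_closed M H" "x \<in> H"
  shows "\<ominus>\<^bsub>M\<lparr>carrier := H\<rparr>\<^esub> x = \<ominus>\<^bsub>M\<^esub> x"
proof -
  interpret M: abelian_group M by fact
  interpret H: abelian_group "M\<lparr>carrier := H\<rparr>" by (rule abelian_group_sub[OF assms(1,2)])
  note D = add_closedD[OF assms(2)]
  show ?thesis
    by (rule H.minus_equality) (use D(1,4) assms(3) in \<open>auto simp: M.l_neg\<close>)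
qed

lemma acl_sub:
  assumes "abelian_group M" "add_closed M H" "S \<subseteq> H" "x \<in> acl M S"
  shows "x \<in> acl (M\<lparr>carrier := H\<rparr>) S"
  using assms(4)
proof induction
  case acl_zero
  show ?case using acl.acl_zero[of "M\<lparr>carrier := H\<rparr>"] by simp
next
  case (acl_base x)
  then show ?case by (rule acl.acl_base)
next
  case (acl_add x y)
  show ?case using acl.acl_add[OF acl_add.IH] by simp
next
  case (acl_minus x)
  have "x \<in> H" by (rule acl_least[OF assms(2,3) acl_minus.hyps])
  then show ?case using acl.acl_minus[OF acl_minus.IH] a_inv_sub[OF assms(1,2)] by simp
qed

lemma (in abelian_group) diff_zero_eq:
  assumes "x \<ominus> y = \<zero>" "x \<in> carrier G" "y \<in> carrier G"
  shows "x = y"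
  using minus_equality[of x "\<ominus> y"] assms by (simp add: a_minus_def)

context left_module
begin

lemma smult_addm: "a \<in> carrier R \<Longrightarrow> addm M M (\<lambda>x. a \<odot>\<^bsub>M\<^esub> x)"
  by (rule addmI) (auto simp: smult_r_distr)

lemma smult_addm_left: "x \<in> carrier M \<Longrightarrow> addm R M (\<lambda>a. a \<odot>\<^bsub>M\<^esub> x)"
  by (rule addmI) (auto simp: smult_l_distr)

lemma smult_r_null [simp]: "a \<in> carrier R \<Longrightarrow> a \<odot>\<^bsub>M\<^esub> \<zero>\<^bsub>M\<^esub> = \<zero>\<^bsub>M\<^esub>"
  using addm_zero[OF M.abelian_group_axioms M.abelian_group_axioms smult_addm] .

lemma smult_l_null [simp]: "x \<in> carrier M \<Longrightarrow> \<zero> \<odot>\<^bsub>M\<^esub> x = \<zero>\<^bsub>M\<^esub>"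
  using addm_zero[OF R.abelian_group_axioms M.abelian_group_axioms smult_addm_left] .

lemma smult_r_minus: "a \<in> carrier R \<Longrightarrow> x \<in> carrier M \<Longrightarrow> a \<odot>\<^bsub>M\<^esub> (\<ominus>\<^bsub>M\<^esub> x) = \<ominus>\<^bsub>M\<^esub> (a \<odot>\<^bsub>M\<^esub> x)"
  using addm_minus[OF M.abelian_group_axioms M.abelian_group_axioms smult_addm] .

end

lemma lhomD:
  assumes "f \<in> left_module_hom R M N"
  shows "addm M N f" "\<And>a x. a \<in> carrier R \<Longrightarrow> x \<in> carrier M \<Longrightarrow> f (a \<odot>\<^bsub>M\<^esub> x) = a \<odot>\<^bsub>N\<^esub> f x"
  using assms by (auto simp: left_module_hom_def addm_def)

lemma lhomI:
  assumes "addm M N f" "\<And>a x. a \<in> carrier R \<Longrightarrow> x \<in> carrier M \<Longrightarrow> f (a \<odot>\<^bsub>M\<^esub> x) = a \<odot>\<^bsub>N\<^esub> f x"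
  shows "f \<in> left_module_hom R M N"
  using assms by (auto simp: left_module_hom_def addm_def)

text \<open>
  Stating that right multiplication by a homogeneous element shifts the projections is equivalent to
  \<open>R\<^sub>m R\<^sub>e \<subseteq> R\<^bsub>m+e\<^esub>\<close> and needs no decomposition into components when it is applied.
\<close>

locale gr_ring = ring R + grading R pr for R (structure) and pr :: "int \<Rightarrow> 'r \<Rightarrow> 'r" +
  assumes pr_mult: "x \<in> carrier R \<Longrightarrow> y \<in> carrier R \<Longrightarrow> pr e y = y \<Longrightarrow> pr n (x \<otimes> y) = pr (n - e) x \<otimes> y"
    and pr_one: "pr 0 \<one> = \<one>"

definition gmod :: "('r, 'c) ring_scheme \<Rightarrow> (int \<Rightarrow> 'r \<Rightarrow> 'r) \<Rightarrow> ('r, 'm) module \<Rightarrow> (int \<Rightarrow> 'm \<Rightarrow> 'm) \<Rightarrow> bool"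
  where "gmod R pr M q \<longleftrightarrow> left_module R M \<and> grading M q \<and>
    (\<forall>a\<in>carrier R. \<forall>y\<in>carrier M. \<forall>e n. q e y = y \<longrightarrow> q n (a \<odot>\<^bsub>M\<^esub> y) = pr (n - e) a \<odot>\<^bsub>M\<^esub> y)"

lemma gmodD:
  assumes "gmod R pr M q"
  shows "left_module R M" "grading M q" "abelian_group M"
    "\<And>a y e n. a \<in> carrier R \<Longrightarrow> y \<in> carrier M \<Longrightarrow> q e y = y \<Longrightarrow> q n (a \<odot>\<^bsub>M\<^esub> y) = pr (n - e) a \<odot>\<^bsub>M\<^esub> y"
  using assms by (auto simp: gmod_def grading_def)

definition gsubm :: "('r, 'c) ring_scheme \<Rightarrow> ('r, 'm) module \<Rightarrow> (int \<Rightarrow> 'm \<Rightarrow> 'm) \<Rightarrow> 'm set \<Rightarrow> bool"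
  where "gsubm R M q H \<longleftrightarrow> add_closed M H \<and> (\<forall>a\<in>carrier R. \<forall>x\<in>H. a \<odot>\<^bsub>M\<^esub> x \<in> H) \<and> (\<forall>j. \<forall>x\<in>H. q j x \<in> H)"

lemma gsubmD:
  assumes "gsubm R M q H"
  shows "add_closed M H" "\<And>a x. a \<in> carrier R \<Longrightarrow> x \<in> H \<Longrightarrow> a \<odot>\<^bsub>M\<^esub> x \<in> H" "\<And>j x. x \<in> H \<Longrightarrow> q j x \<in> H"
    "\<And>x. x \<in> H \<Longrightarrow> x \<in> carrier M"
  using assms by (auto simp: gsubm_def add_closed_def)

lemma gsubmI:
  assumes "add_closed M H" "\<And>a x. a \<in> carrier R \<Longrightarrow> x \<in> H \<Longrightarrow> a \<odot>\<^bsub>M\<^esub> x \<in> H" "\<And>j x. x \<in> H \<Longrightarrow> q j x \<in> H"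
  shows "gsubm R M q H"
  using assms by (auto simp: gsubm_def)

lemma gsubm_carrier:
  assumes "gmod R pr M q"
  shows "gsubm R M q (carrier M)"
proof -
  interpret left_module R M by (rule gmodD[OF assms])
  interpret g: grading M q by (rule gmodD[OF assms])
  show ?thesis by (rule gsubmI) (auto simp: M.add_closed_carrier)
qed

lemma gmod_sub:
  assumes M: "gmod R pr M q" and H: "gsubm R M q H"
  shows "gmod R pr (M\<lparr>carrier := H\<rparr>) q"
proof -
  interpret left_module R M by (rule gmodD[OF M])
  interpret g: grading M q by (rule gmodD[OF M])
  interpret S: abelian_group "M\<lparr>carrier := H\<rparr>"
    by (rule abelian_group_sub[OF M.abelian_group_axioms gsubmD(1)[OF H]])
  note D = gsubmD[OF H]
  have 1: "left_module R (M\<lparr>carrier := H\<rparr>)"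
    by (intro left_module.intro left_module_axioms.intro S.abelian_group_axioms R.ring_axioms)
      (use D in \<open>auto simp: smult_l_distr smult_r_distr smult_assoc1\<close>)
  have 2: "grading (M\<lparr>carrier := H\<rparr>) q"
  proof (intro grading.intro grading_axioms.intro S.abelian_group_axioms)
    show "addm (M\<lparr>carrier := H\<rparr>) (M\<lparr>carrier := H\<rparr>) (q i)" for i
      by (rule addmI) (use D in \<open>auto simp: g.q_add\<close>)
    show "q i (q j x) = (if i = j then q j x else \<zero>\<^bsub>M\<lparr>carrier := H\<rparr>\<^esub>)" if "x \<in> carrier (M\<lparr>carrier := H\<rparr>)" for x i j
      using g.q_orth[of x i j] that D(4) by auto
  next
    fix x assume "x \<in> carrier (M\<lparr>carrier := H\<rparr>)"
    then have x: "x \<in> H" by simp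
    let ?S = "{y \<in> H. \<exists>i. q i y = y}"
    have S: "?S \<subseteq> carrier M" using D(4) by auto
    obtain I where I: "finite I" "x = (\<Oplus>\<^bsub>M\<^esub>i\<in>I. q i x)"
      using g.finite_decomposition[OF D(4)[OF x]] by metis
    \<comment> \<open>The components of an element of \<open>H\<close> lie in \<open>H\<close>, so
      \<open>H\<close> is generated by homogeneous elements of its own.\<close>
    have "(\<Oplus>\<^bsub>M\<^esub>i\<in>I. q i x) \<in> acl M ?S"
    proof (rule M.add_closed_finsum[OF M.add_closed_acl[OF S]], rule acl_base)
      show "q i x \<in> ?S" for i
        using D(3)[OF x, of i] g.q_orth[OF D(4)[OF x], of i i] by auto
    qed
    then have "x \<in> acl M ?S" using I(2) by metis
    from acl_sub[OF M.abelian_group_axioms D(1) _ this]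
    show "x \<in> acl (M\<lparr>carrier := H\<rparr>) {y \<in> carrier (M\<lparr>carrier := H\<rparr>). \<exists>i. q i y = y}" by simp
  qed
  show ?thesis using 1 2 gmodD(4)[OF M] D(4) by (auto simp: gmod_def)
qed

definition ghom :: "('r, 'c) ring_scheme \<Rightarrow> ('r, 'm) module \<Rightarrow> (int \<Rightarrow> 'm \<Rightarrow> 'm) \<Rightarrow> ('r, 'n) module \<Rightarrow>
    (int \<Rightarrow> 'n \<Rightarrow> 'n) \<Rightarrow> ('m \<Rightarrow> 'n) \<Rightarrow> bool"
  where "ghom R M q N q' f \<longleftrightarrow> f \<in> left_module_hom R M N \<and> (\<forall>j. \<forall>x\<in>carrier M. f (q j x) = q' j (f x))"

lemma ghomD:
  assumes "ghom R M q N q' f"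
  shows "f \<in> left_module_hom R M N" "addm M N f" "\<And>x. x \<in> carrier M \<Longrightarrow> f x \<in> carrier N"
    "\<And>x y. x \<in> carrier M \<Longrightarrow> y \<in> carrier M \<Longrightarrow> f (x \<oplus>\<^bsub>M\<^esub> y) = f x \<oplus>\<^bsub>N\<^esub> f y"
    "\<And>a x. a \<in> carrier R \<Longrightarrow> x \<in> carrier M \<Longrightarrow> f (a \<odot>\<^bsub>M\<^esub> x) = a \<odot>\<^bsub>N\<^esub> f x"
    "\<And>j x. x \<in> carrier M \<Longrightarrow> f (q j x) = q' j (f x)"
  using assms lhomD[of f R M N] addm_closed[of M N f] addm_add[of M N f] by (auto simp: ghom_def)

lemma ghomI:
  assumes "addm M N f" "\<And>a x. a \<in> carrier R \<Longrightarrow> x \<in> carrier M \<Longrightarrow> f (a \<odot>\<^bsub>M\<^esub> x) = a \<odot>\<^bsub>N\<^esub> f x"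
    "\<And>j x. x \<in> carrier M \<Longrightarrow> f (q j x) = q' j (f x)"
  shows "ghom R M q N q' f"
  using assms lhomI[of M N f R] by (auto simp: ghom_def)

lemma ghom_id: "ghom R M q M q (\<lambda>x. x)"
  by (rule ghomI) (auto simp: addm_id)

lemma ghom_comp:
  assumes "ghom R M q N q' f" "ghom R N q' P q'' g"
  shows "ghom R M q P q'' (\<lambda>x. g (f x))"
  using addm_comp[OF ghomD(2)[OF assms(1)] ghomD(2)[OF assms(2)]]
  by (intro ghomI) (auto simp: ghomD[OF assms(1)] ghomD[OF assms(2)])

lemma ghom_plus:
  assumes "gmod R pr N q'" "ghom R M q N q' f" "ghom R M q N q' g"
  shows "ghom R M q N q' (\<lambda>x. f x \<oplus>\<^bsub>N\<^esub> g x)"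
proof -
  interpret left_module R N by (rule gmodD[OF assms(1)])
  interpret g: grading N q' by (rule gmodD[OF assms(1)])
  note f = ghomD[OF assms(2)] and g = ghomD[OF assms(3)]
  show ?thesis
    by (rule ghomI[OF addm_plus[OF M.abelian_group_axioms f(2) g(2)]])
      (auto simp: f(3,5,6) g(3,5,6) smult_r_distr g.q_add)
qed

lemma ghom_uminus:
  assumes "gmod R pr N q'" "ghom R M q N q' f"
  shows "ghom R M q N q' (\<lambda>x. \<ominus>\<^bsub>N\<^esub> f x)"
proof -
  interpret left_module R N by (rule gmodD[OF assms(1)])
  interpret g: grading N q' by (rule gmodD[OF assms(1)])
  note f = ghomD[OF assms(2)]
  show ?thesis
    by (rule ghomI[OF addm_uminus[OF M.abelian_group_axioms f(2)]])
      (auto simp: f(3,5,6) smult_r_minus g.q_minus)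
qed

lemma ghom_minus:
  assumes "gmod R pr N q'" "ghom R M q N q' f" "ghom R M q N q' g"
  shows "ghom R M q N q' (\<lambda>x. f x \<ominus>\<^bsub>N\<^esub> g x)"
  using ghom_plus[OF assms(1,2) ghom_uminus[OF assms(1,3)]] by (simp add: a_minus_def)

lemma ghom_restrict:
  assumes "ghom R M q N q' f" "\<And>x. x \<in> H \<Longrightarrow> x \<in> carrier M" "\<And>x. x \<in> H \<Longrightarrow> f x \<in> L"
  shows "ghom R (M\<lparr>carrier := H\<rparr>) q (N\<lparr>carrier := L\<rparr>) q' f"
  by (rule ghomI; (rule addmI)?) (auto simp: ghomD[OF assms(1)] assms(2,3))

lemma ghom_restrict_left:
  assumes "ghom R M q N q' f" "\<And>x. x \<in> H \<Longrightarrow> x \<in> carrier M"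
  shows "ghom R (M\<lparr>carrier := H\<rparr>) q N q' f"
  by (rule ghomI; (rule addmI)?) (auto simp: ghomD[OF assms(1)] assms(2))

lemma ghom_into:
  assumes "ghom R M q N q' f" "\<And>x. x \<in> carrier M \<Longrightarrow> f x \<in> L"
  shows "ghom R M q (N\<lparr>carrier := L\<rparr>) q' f"
  by (rule ghomI; (rule addmI)?) (auto simp: ghomD[OF assms(1)] assms(2))

lemma ghom_extend_codomain:
  assumes "ghom R M q (N\<lparr>carrier := L\<rparr>) q' f" "L \<subseteq> carrier N"
  shows "ghom R M q N q' f"
  by (rule ghomI; (rule addmI)?) (use ghomD[OF assms(1)] assms(2) in auto)

lemma gsubm_vimage:
  assumes "gmod R pr M q" "gmod R pr N q'" "ghom R M q N q' f" "gsubm R N q' L"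
  shows "gsubm R M q {x \<in> carrier M. f x \<in> L}"
proof -
  interpret left_module R M by (rule gmodD[OF assms(1)])
  interpret g: grading M q by (rule gmodD[OF assms(1)])
  note f = ghomD[OF assms(3)] and L = gsubmD[OF assms(4)]
  show ?thesis
    by (rule gsubmI[OF add_closed_vimage[OF gmodD(3)[OF assms(1)] gmodD(3)[OF assms(2)] f(2) L(1)]])
      (auto simp: f(5,6) L)
qed

lemma gsubm_image:
  assumes "gmod R pr M q" "gmod R pr N q'" "ghom R M q N q' f"
  shows "gsubm R N q' (f ` carrier M)"
proof -
  interpret left_module R M by (rule gmodD[OF assms(1)])
  interpret g: grading M q by (rule gmodD[OF assms(1)])
  note f = ghomD[OF assms(3)]
  show ?thesis
  proof (rule gsubmI[OF add_closed_image[OF gmodD(3)[OF assms(1)] gmodD(3)[OF assms(2)] f(2) M.add_closed_carrier]])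
    show "a \<odot>\<^bsub>N\<^esub> x \<in> f ` carrier M" if "a \<in> carrier R" "x \<in> f ` carrier M" for a x
      using that by (auto simp: f(5)[symmetric])
    show "q' j x \<in> f ` carrier M" if "x \<in> f ` carrier M" for j x
      using that by (auto simp: f(6)[symmetric])
  qed
qed

lemma gsubm_zero:
  assumes "gmod R pr N q'"
  shows "gsubm R N q' {\<zero>\<^bsub>N\<^esub>}"
proof -
  interpret left_module R N by (rule gmodD[OF assms(1)])
  interpret g: grading N q' by (rule gmodD[OF assms(1)])
  show ?thesis by (intro gsubmI add_closed_zero M.abelian_group_axioms) auto
qed

lemma gsubm_kernel:
  assumes "gmod R pr M q" "gmod R pr N q'" "ghom R M q N q' f"
  shows "gsubm R M q {x \<in> carrier M. f x = \<zero>\<^bsub>N\<^esub>}"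
  using gsubm_vimage[OF assms gsubm_zero[OF assms(2)]] by simp

text \<open>The homomorphism theorem for surjective \<open>f\<close>. A preimage is picked by
  \<open>inv_into\<close>; two preimages of one element differ by an element that \<open>f\<close>
  kills, and hence \<open>g\<close> kills it too.\<close>

lemma ghom_factor:
  assumes "gmod R pr M q" "gmod R pr N q'" "gmod R pr P q''" "ghom R M q N q' f" "f ` carrier M = carrier N"
    "ghom R M q P q'' g" "\<And>x. x \<in> carrier M \<Longrightarrow> f x = \<zero>\<^bsub>N\<^esub> \<Longrightarrow> g x = \<zero>\<^bsub>P\<^esub>"
  shows "\<exists>h. ghom R N q' P q'' h \<and> (\<forall>x\<in>carrier M. h (f x) = g x)"
proof -
  interpret M: left_module R M by (rule gmodD[OF assms(1)])
  interpret N: left_module R N by (rule gmodD[OF assms(2)])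
  interpret P: left_module R P by (rule gmodD[OF assms(3)])
  interpret gM: grading M q by (rule gmodD[OF assms(1)])
  note f = ghomD[OF assms(4)] and g = ghomD[OF assms(6)]
  have eq: "g x = g y" if "x \<in> carrier M" "y \<in> carrier M" "f x = f y" for x y
  proof -
    have "f (x \<ominus>\<^bsub>M\<^esub> y) = \<zero>\<^bsub>N\<^esub>"
      using addm_diff[OF gmodD(3)[OF assms(1)] gmodD(3)[OF assms(2)] f(2) that(1,2)] that f(3)
      by (simp add: N.r_neg a_minus_def)
    then have "g x \<ominus>\<^bsub>P\<^esub> g y = \<zero>\<^bsub>P\<^esub>"
      using assms(7)[of "x \<ominus>\<^bsub>M\<^esub> y"] that
        addm_diff[OF gmodD(3)[OF assms(1)] gmodD(3)[OF assms(3)] g(2) that(1,2)] by simp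
    then show ?thesis by (rule abelian_group.diff_zero_eq[OF gmodD(3)[OF assms(3)] _ g(3)[OF that(1)] g(3)[OF that(2)]])
  qed
  define h where "h y = g (inv_into (carrier M) f y)" for y
  have h: "h (f x) = g x" if "x \<in> carrier M" for x
  proof -
    have "f x \<in> f ` carrier M" using that by simp
    then show ?thesis
      unfolding h_def using eq[OF _ that, of "inv_into (carrier M) f (f x)"] inv_into_into f_inv_into_f by metis
  qed
  have "ghom R N q' P q'' h"
  proof (intro ghomI addmI)
    fix x assume "x \<in> carrier N"
    then obtain u where u: "u \<in> carrier M" "x = f u" using assms(5) by auto
    then show "h x \<in> carrier P" by (simp add: h g)
    show "h (a \<odot>\<^bsub>N\<^esub> x) = a \<odot>\<^bsub>P\<^esub> h x" if "a \<in> carrier R" for a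
      using u that h[of "a \<odot>\<^bsub>M\<^esub> u"] by (simp add: h f(5) g(5))
    show "h (q' j x) = q'' j (h x)" for j
      using u h[of "q j u"] by (simp add: h f(6) g(6))
    fix y assume "y \<in> carrier N"
    then obtain v where v: "v \<in> carrier M" "y = f v" using assms(5) by auto
    then show "h (x \<oplus>\<^bsub>N\<^esub> y) = h x \<oplus>\<^bsub>P\<^esub> h y"
      using u h[of "u \<oplus>\<^bsub>M\<^esub> v"] by (simp add: h f(4) g(4))
  qed
  then show ?thesis using h by auto
qed

section \<open>Graded submodules of free modules\<close>

text \<open>
  The scalar action is a parameter, because a submodule of a free \<open>R\<close>-module is also regarded as a
  vector space over \<open>K\<close>.
\<close>

definition fmod :: "('s \<Rightarrow> 'r \<Rightarrow> 'r) \<Rightarrow> ('r, 'c) ring_scheme \<Rightarrow> (nat \<Rightarrow> 'r) set \<Rightarrow> ('s, nat \<Rightarrow> 'r) module"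
  where "fmod sm R X = \<lparr>carrier = X, mult = (\<lambda>x y i. \<zero>\<^bsub>R\<^esub>), one = (\<lambda>i. \<zero>\<^bsub>R\<^esub>), zero = (\<lambda>i. \<zero>\<^bsub>R\<^esub>),
    add = (\<lambda>x y i. x i \<oplus>\<^bsub>R\<^esub> y i), smult = (\<lambda>a x i. sm a (x i))\<rparr>"

lemma fmod_simps [simp]:
  "carrier (fmod sm R X) = X" "zero (fmod sm R X) = (\<lambda>i. \<zero>\<^bsub>R\<^esub>)"
  "add (fmod sm R X) = (\<lambda>x y i. x i \<oplus>\<^bsub>R\<^esub> y i)" "smult (fmod sm R X) = (\<lambda>a x i. sm a (x i))"
  "(fmod sm R X)\<lparr>carrier := Y\<rparr> = fmod sm R Y"
  by (simp_all add: fmod_def)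

definition free :: "('r, 'c) ring_scheme \<Rightarrow> nat set \<Rightarrow> (nat \<Rightarrow> 'r) set"
  where "free R I = {f. (\<forall>i. f i \<in> carrier R) \<and> (\<forall>i. i \<notin> I \<longrightarrow> f i = \<zero>\<^bsub>R\<^esub>)}"

abbreviation lmod :: "('r, 'c) ring_scheme \<Rightarrow> (nat \<Rightarrow> 'r) set \<Rightarrow> ('r, nat \<Rightarrow> 'r) module"
  where "lmod R X \<equiv> fmod (mult R) R X"

definition elm :: "('r, 'c) ring_scheme \<Rightarrow> nat \<Rightarrow> 'r \<Rightarrow> nat \<Rightarrow> 'r"
  where "elm R i r = (\<lambda>j. if j = i then r else \<zero>\<^bsub>R\<^esub>)"

text \<open>The basis element of coordinate \<open>i\<close> has degree \<open>\<delta> i\<close>,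
  so module degree \<open>j\<close> means ring degree \<open>j - \<delta> i\<close> in that
  coordinate.\<close>

definition shift_pr :: "(int \<Rightarrow> 'r \<Rightarrow> 'r) \<Rightarrow> (nat \<Rightarrow> int) \<Rightarrow> int \<Rightarrow> (nat \<Rightarrow> 'r) \<Rightarrow> nat \<Rightarrow> 'r"
  where "shift_pr pr \<delta> j x = (\<lambda>i. pr (j - \<delta> i) (x i))"

definition flift :: "('r, 'm) module \<Rightarrow> (nat \<Rightarrow> 'm) \<Rightarrow> nat set \<Rightarrow> (nat \<Rightarrow> 'r) \<Rightarrow> 'm"
  where "flift M y I f = (\<Oplus>\<^bsub>M\<^esub>i\<in>I. f i \<odot>\<^bsub>M\<^esub> y i)"

lemma abelian_group_free:
  assumes "abelian_group R"
  shows "abelian_group (fmod sm R (free R I))"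
proof -
  interpret abelian_group R by fact
  show ?thesis
  proof (rule abelian_groupI)
    show "\<exists>y\<in>carrier (fmod sm R (free R I)). y \<oplus>\<^bsub>fmod sm R (free R I)\<^esub> x = \<zero>\<^bsub>fmod sm R (free R I)\<^esub>"
      if "x \<in> carrier (fmod sm R (free R I))" for x
      by (rule bexI[of _ "\<lambda>i. \<ominus>\<^bsub>R\<^esub> x i"]) (use that in \<open>auto simp: free_def l_neg\<close>)
  qed (auto simp: free_def a_ac)
qed

lemma minus_free:
  assumes "abelian_group R" "x \<in> free R I"
  shows "\<ominus>\<^bsub>fmod sm R (free R I)\<^esub> x = (\<lambda>i. \<ominus>\<^bsub>R\<^esub> x i)"
proof -
  interpret R: abelian_group R by fact
  interpret abelian_group "fmod sm R (free R I)" by (rule abelian_group_free[OF assms(1)])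
  show ?thesis
    by (rule minus_equality) (use assms(2) in \<open>auto simp: free_def R.l_neg\<close>)
qed

lemma finsum_free:
  assumes "abelian_group R" "finite J" "\<And>j. j \<in> J \<Longrightarrow> f j \<in> free R I"
  shows "finsum (fmod sm R (free R I)) f J = (\<lambda>i. finsum R (\<lambda>j. f j i) J)"
proof
  fix i
  have "addm (fmod sm R (free R I)) R (\<lambda>x. x i)"
    by (rule addmI) (auto simp: free_def)
  from addm_finsum[OF abelian_group_free[OF assms(1)] assms(1) this assms(2)]
  show "finsum (fmod sm R (free R I)) f J i = finsum R (\<lambda>j. f j i) J" using assms(3) by auto
qed

lemma free_gen:
  assumes "abelian_group R" "finite I" "x \<in> free R I"
  shows "x \<in> acl (fmod sm R (free R I)) {elm R i r | i r. i \<in> I \<and> r \<in> carrier R}"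
proof -
  interpret R: abelian_group R by fact
  interpret abelian_group "fmod sm R (free R I)" by (rule abelian_group_free[OF assms(1)])
  have "x = finsum (fmod sm R (free R I)) (\<lambda>i. elm R i (x i)) I"
  proof -
    have "finsum R (\<lambda>j. elm R j (x j) i) I = x i" for i
    proof (cases "i \<in> I")
      case True
      then show ?thesis
        using R.add.finprod_singleton[of i I x] assms by (auto simp: elm_def free_def)
    next
      case False
      have "finsum R (\<lambda>j. elm R j (x j) i) I = finsum R (\<lambda>j. \<zero>\<^bsub>R\<^esub>) I"
        by (rule R.finsum_cong') (use False in \<open>auto simp: elm_def\<close>)
      then show ?thesis using False assms(3) by (simp add: free_def R.finsum_zero)
    qed
    then show ?thesis
      by (subst finsum_free[OF assms(1,2)]) (use assms(3) in \<open>auto simp: elm_def free_def\<close>)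
  qed
  also have "\<dots> \<in> acl (fmod sm R (free R I)) {elm R i r | i r. i \<in> I \<and> r \<in> carrier R}"
    by (rule add_closed_finsum[OF add_closed_acl])
      (use assms(3) in \<open>auto simp: elm_def free_def intro!: acl_base\<close>)
  finally show ?thesis .
qed

context gr_ring
begin

lemma left_module_free: "left_module R (lmod R (free R I))"
  by (intro left_module.intro left_module_axioms.intro abelian_group_free ring_axioms abelian_group_axioms)
    (auto simp: free_def l_distr r_distr m_assoc)

lemma shift_pr_elm: "shift_pr pr \<delta> j (elm R i r) = elm R i (pr (j - \<delta> i) r)"
  by (auto simp: shift_pr_def elm_def)

lemma elm_free [simp]: "i \<in> I \<Longrightarrow> r \<in> carrier R \<Longrightarrow> elm R i r \<in> free R I"
  by (auto simp: elm_def free_def)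

lemma gmod_free:
  assumes "finite I"
  shows "gmod R pr (lmod R (free R I)) (shift_pr pr \<delta>)"
proof -
  let ?F = "lmod R (free R I)"
  interpret F: left_module R ?F by (rule left_module_free)
  have S: "addm ?F ?F (shift_pr pr \<delta> j)" for j
    by (rule addmI) (auto simp: shift_pr_def free_def q_add)
  have "grading ?F (shift_pr pr \<delta>)"
  proof (intro grading.intro grading_axioms.intro S F.M.abelian_group_axioms)
    show "shift_pr pr \<delta> i (shift_pr pr \<delta> j x) = (if i = j then shift_pr pr \<delta> j x else \<zero>\<^bsub>?F\<^esub>)"
      if "x \<in> carrier ?F" for x i j
      using that by (auto simp: shift_pr_def free_def q_orth)
  next
    let ?S = "{y \<in> carrier ?F. \<exists>j. shift_pr pr \<delta> j y = y}"
    have A: "add_closed ?F (acl ?F ?S)" by (rule F.M.add_closed_acl) auto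
    have e: "elm R i r \<in> acl ?F ?S" if "i \<in> I" "r \<in> carrier R" for i r
    proof (rule addm_acl[OF abelian_group_axioms F.M.abelian_group_axioms _ _ _ A q_gen[OF that(2)]])
      show "addm R ?F (elm R i)"
        by (rule addmI) (use that in \<open>auto simp: elm_def free_def\<close>)
      fix r assume r: "r \<in> {y \<in> carrier R. \<exists>j. pr j y = y}"
      then obtain j where j: "pr j r = r" by auto
      have "shift_pr pr \<delta> (j + \<delta> i) (elm R i r) = elm R i r" using j by (simp add: shift_pr_elm)
      then show "elm R i r \<in> acl ?F ?S" using r that by (intro acl_base) auto
    qed auto
    show "x \<in> acl ?F ?S" if "x \<in> carrier ?F" for x
      by (rule acl_least[OF A _ free_gen[OF abelian_group_axioms assms]])
        (use that e in auto)
  qed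
  moreover have "shift_pr pr \<delta> n (a \<odot>\<^bsub>?F\<^esub> y) = pr (n - e) a \<odot>\<^bsub>?F\<^esub> y"
    if "a \<in> carrier R" "y \<in> carrier ?F" "shift_pr pr \<delta> e y = y" for a y e n
  proof
    fix i
    \<comment> \<open>A vector of module degree \<open>e\<close> has coordinates that are
      homogeneous of the shifted degrees, to which \<open>pr_mult\<close> applies
      separately.\<close>
    have "pr (e - \<delta> i) (y i) = y i" using fun_cong[OF that(3), of i] by (simp add: shift_pr_def)
    from pr_mult[OF _ _ this, of a "n - \<delta> i"]
    show "shift_pr pr \<delta> n (a \<odot>\<^bsub>?F\<^esub> y) i = (pr (n - e) a \<odot>\<^bsub>?F\<^esub> y) i"
      using that by (auto simp: shift_pr_def free_def)
  qed
  ultimately show ?thesis using F.left_module_axioms by (auto simp: gmod_def)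
qed

lemma flift_elm:
  assumes "left_module R M" "finite I" "\<And>i. i \<in> I \<Longrightarrow> y i \<in> carrier M" "i \<in> I" "r \<in> carrier R"
  shows "flift M y I (elm R i r) = r \<odot>\<^bsub>M\<^esub> y i"
proof -
  interpret M: left_module R M by fact
  have "flift M y I (elm R i r) = (\<Oplus>\<^bsub>M\<^esub>j\<in>I. if i = j then r \<odot>\<^bsub>M\<^esub> y j else \<zero>\<^bsub>M\<^esub>)"
    unfolding flift_def by (rule M.M.finsum_cong') (use assms in \<open>auto simp: elm_def\<close>)
  also have "\<dots> = r \<odot>\<^bsub>M\<^esub> y i" by (rule M.M.add.finprod_singleton) (use assms in auto)
  finally show ?thesis .
qed

lemma flift_addm:
  assumes "left_module R M" "finite I" "\<And>i. i \<in> I \<Longrightarrow> y i \<in> carrier M"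
  shows "addm (lmod R (free R I)) M (flift M y I)"
proof -
  interpret M: left_module R M by fact
  show ?thesis unfolding flift_def
    by (intro addm_finsumf M.M.abelian_group_axioms assms(2) addmI)
      (use assms(3) in \<open>auto simp: free_def M.smult_l_distr\<close>)
qed

lemma flift_ghom:
  assumes M: "gmod R pr M q" and I: "finite I" "\<And>i. i \<in> I \<Longrightarrow> y i \<in> carrier M" "\<And>i. i \<in> I \<Longrightarrow> q (\<epsilon> i) (y i) = y i"
  shows "ghom R (lmod R (free R I)) (shift_pr pr \<epsilon>) M q (flift M y I)"
proof -
  interpret M: left_module R M by (rule gmodD[OF M])
  interpret gM: grading M q by (rule gmodD[OF M])
  interpret F: left_module R "lmod R (free R I)" by (rule left_module_free)
  interpret gF: grading "lmod R (free R I)" "shift_pr pr \<epsilon>" by (rule gmodD[OF gmod_free[OF I(1)]])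
  note A = flift_addm[OF gmodD(1)[OF M] I(1,2)] and E = flift_elm[OF gmodD(1)[OF M] I(1,2)]
  note ab = F.M.abelian_group_axioms M.M.abelian_group_axioms
  show ?thesis
  proof (rule ghomI[OF A])
    fix a x assume x: "a \<in> carrier R" "x \<in> carrier (lmod R (free R I))"
    show "flift M y I (a \<odot>\<^bsub>lmod R (free R I)\<^esub> x) = a \<odot>\<^bsub>M\<^esub> flift M y I x"
      using addm_finsum[OF ab(2) ab(2) M.smult_addm[OF x(1)] I(1), of "\<lambda>i. x i \<odot>\<^bsub>M\<^esub> y i"] x I(2)
      by (auto simp: flift_def free_def M.smult_assoc1[symmetric] intro!: M.M.finsum_cong')
  next
    fix j x assume x: "x \<in> carrier (lmod R (free R I))"
    show "flift M y I (shift_pr pr \<epsilon> j x) = q j (flift M y I x)"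
    proof (rule addm_eq_on_acl[OF ab addm_comp[OF gF.q_addm A] addm_comp[OF A gM.q_addm] _ _
          free_gen[OF abelian_group_axioms I(1)]])
      fix x assume "x \<in> {elm R i r |i r. i \<in> I \<and> r \<in> carrier R}"
      then obtain i r where ir: "x = elm R i r" "i \<in> I" "r \<in> carrier R" by auto
      then show "flift M y I (shift_pr pr \<epsilon> j x) = q j (flift M y I x)"
        by (simp add: shift_pr_elm E gmodD(4)[OF M _ I(2) I(3)])
    qed (use x in auto)
  qed
qed

lemma lhom_eq_free:
  assumes "left_module R M" "f \<in> left_module_hom R (lmod R (free R I)) M" "g \<in> left_module_hom R (lmod R (free R I)) M"
    "finite I" "\<And>i. i \<in> I \<Longrightarrow> f (elm R i \<one>) = g (elm R i \<one>)" "x \<in> free R I"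
  shows "f x = g x"
proof (rule addm_eq_on_acl[OF abelian_group_free[OF abelian_group_axioms] _ lhomD(1)[OF assms(2)] lhomD(1)[OF assms(3)]
        _ _ free_gen[OF abelian_group_axioms assms(4,6)]])
  show "abelian_group M" using assms(1) by (simp add: left_module_def)
  fix x assume "x \<in> {elm R i r |i r. i \<in> I \<and> r \<in> carrier R}"
  then obtain i r where ir: "x = elm R i r" "i \<in> I" "r \<in> carrier R" by auto
  have "x = r \<odot>\<^bsub>lmod R (free R I)\<^esub> elm R i \<one>" using ir by (auto simp: elm_def)
  then show "f x = g x" using ir assms(5) by (simp only: lhomD(2)[OF assms(2)] lhomD(2)[OF assms(3)] fmod_simps(1) elm_free one_closed)
qed auto

end

section \<open>Finite projective dimension\<close>

text \<open>Only the existence of a finite ambient index set is recorded, so that \<open>X\<close>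
  can be placed inside any \<open>free R I\<close> that contains it. Closure under negation comes
  from the scalar minus one.\<close>

definition gsub :: "('r, 'c) ring_scheme \<Rightarrow> (int \<Rightarrow> 'r \<Rightarrow> 'r) \<Rightarrow> (nat \<Rightarrow> 'r) set \<Rightarrow> (nat \<Rightarrow> int) \<Rightarrow> bool"
  where "gsub R pr X \<delta> \<longleftrightarrow> (\<exists>I. finite I \<and> X \<subseteq> free R I) \<and> (\<lambda>i. \<zero>\<^bsub>R\<^esub>) \<in> X \<and>
    (\<forall>x\<in>X. \<forall>y\<in>X. (\<lambda>i. x i \<oplus>\<^bsub>R\<^esub> y i) \<in> X) \<and> (\<forall>a\<in>carrier R. \<forall>x\<in>X. (\<lambda>i. a \<otimes>\<^bsub>R\<^esub> x i) \<in> X) \<and>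
    (\<forall>j. \<forall>x\<in>X. shift_pr pr \<delta> j x \<in> X)"

definition pres :: "('r, 'c) ring_scheme \<Rightarrow> (int \<Rightarrow> 'r \<Rightarrow> 'r) \<Rightarrow> nat set \<Rightarrow> (nat \<Rightarrow> int) \<Rightarrow> ('r, 'm) module \<Rightarrow>
    (int \<Rightarrow> 'm \<Rightarrow> 'm) \<Rightarrow> ((nat \<Rightarrow> 'r) \<Rightarrow> 'm) \<Rightarrow> bool"
  where "pres R pr I \<epsilon> M q \<pi> \<longleftrightarrow> finite I \<and> ghom R (lmod R (free R I)) (shift_pr pr \<epsilon>) M q \<pi> \<and> \<pi> ` free R I = carrier M"

definition kern :: "('r, 'c) ring_scheme \<Rightarrow> nat set \<Rightarrow> ('r, 'm) module \<Rightarrow> ((nat \<Rightarrow> 'r) \<Rightarrow> 'm) \<Rightarrow> (nat \<Rightarrow> 'r) set"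
  where "kern R I M \<pi> = {u \<in> free R I. \<pi> u = \<zero>\<^bsub>M\<^esub>}"

text \<open>A direct summand of a graded free module of finite rank. In this form projectivity
  involves no test modules, hence no choice of their type.\<close>

definition fgp :: "('r, 'c) ring_scheme \<Rightarrow> (int \<Rightarrow> 'r \<Rightarrow> 'r) \<Rightarrow> ('r, 'm) module \<Rightarrow> (int \<Rightarrow> 'm \<Rightarrow> 'm) \<Rightarrow> bool"
  where "fgp R pr M q \<longleftrightarrow> (\<exists>I \<epsilon> \<pi> s. pres R pr I \<epsilon> M q \<pi> \<and>
    ghom R M q (lmod R (free R I)) (shift_pr pr \<epsilon>) s \<and> (\<forall>x\<in>carrier M. \<pi> (s x) = x))"

text \<open>
  \<open>fp R pr n X \<delta>\<close> says that \<open>X\<close>, a submodule of a free module with generators in degrees \<open>\<delta>\<close>, has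
  a resolution of length \<open>n\<close> by finitely generated projectives. All syzygies are submodules of free
  modules with index sets in \<open>nat\<close>, so a recursion on \<open>n\<close> stays within one type.
\<close>

primrec fp :: "('r, 'c) ring_scheme \<Rightarrow> (int \<Rightarrow> 'r \<Rightarrow> 'r) \<Rightarrow> nat \<Rightarrow> (nat \<Rightarrow> 'r) set \<Rightarrow> (nat \<Rightarrow> int) \<Rightarrow> bool"
  where
    "fp R pr 0 X \<delta> \<longleftrightarrow> gsub R pr X \<delta> \<and> fgp R pr (lmod R X) (shift_pr pr \<delta>)"
  | "fp R pr (Suc n) X \<delta> \<longleftrightarrow> gsub R pr X \<delta> \<and>
      (\<exists>I \<epsilon> \<pi>. pres R pr I \<epsilon> (lmod R X) (shift_pr pr \<delta>) \<pi> \<and> fp R pr n (kern R I (lmod R X) \<pi>) \<epsilon>)"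

text \<open>The counterpart of \<open>fp\<close> for modules of any element type, such as
  \<open>A\<close> itself. The number is the length for the first syzygy, so
  \<open>haspres R pr n\<close> corresponds to resolutions of length \<open>Suc n\<close>.\<close>

definition haspres :: "('r, 'c) ring_scheme \<Rightarrow> (int \<Rightarrow> 'r \<Rightarrow> 'r) \<Rightarrow> nat \<Rightarrow> ('r, 'm) module \<Rightarrow> (int \<Rightarrow> 'm \<Rightarrow> 'm) \<Rightarrow> bool"
  where "haspres R pr n M q \<longleftrightarrow> (\<exists>I \<epsilon> \<pi>. pres R pr I \<epsilon> M q \<pi> \<and> fp R pr n (kern R I M \<pi>) \<epsilon>)"

lemma (in abelian_group) diff_zero: "x \<in> carrier G \<Longrightarrow> x \<ominus> \<zero> = x"
  by (simp add: a_minus_def)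

lemma fp_Suc: "fp R pr (Suc n) X \<delta> \<longleftrightarrow> gsub R pr X \<delta> \<and> haspres R pr n (lmod R X) (shift_pr pr \<delta>)"
  by (simp add: haspres_def)

lemma gsubD:
  assumes "gsub R pr X \<delta>"
  shows "\<exists>I. finite I \<and> X \<subseteq> free R I" "(\<lambda>i. \<zero>\<^bsub>R\<^esub>) \<in> X" "\<And>x y. x \<in> X \<Longrightarrow> y \<in> X \<Longrightarrow> (\<lambda>i. x i \<oplus>\<^bsub>R\<^esub> y i) \<in> X"
    "\<And>a x. a \<in> carrier R \<Longrightarrow> x \<in> X \<Longrightarrow> (\<lambda>i. a \<otimes>\<^bsub>R\<^esub> x i) \<in> X" "\<And>j x. x \<in> X \<Longrightarrow> shift_pr pr \<delta> j x \<in> X"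
    "\<And>x i. x \<in> X \<Longrightarrow> x i \<in> carrier R"
  using assms by (auto simp: gsub_def free_def)

lemma gsubI:
  assumes "finite I" "X \<subseteq> free R I" "(\<lambda>i. \<zero>\<^bsub>R\<^esub>) \<in> X" "\<And>x y. x \<in> X \<Longrightarrow> y \<in> X \<Longrightarrow> (\<lambda>i. x i \<oplus>\<^bsub>R\<^esub> y i) \<in> X"
    "\<And>a x. a \<in> carrier R \<Longrightarrow> x \<in> X \<Longrightarrow> (\<lambda>i. a \<otimes>\<^bsub>R\<^esub> x i) \<in> X" "\<And>j x. x \<in> X \<Longrightarrow> shift_pr pr \<delta> j x \<in> X"
  shows "gsub R pr X \<delta>"
  using assms by (auto simp: gsub_def)

lemma fp_gsub: "fp R pr n X \<delta> \<Longrightarrow> gsub R pr X \<delta>"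
  by (cases n) auto

lemma presD:
  assumes "pres R pr I \<epsilon> M q \<pi>"
  shows "finite I" "ghom R (lmod R (free R I)) (shift_pr pr \<epsilon>) M q \<pi>" "\<pi> ` free R I = carrier M"
    "\<pi> ` carrier (lmod R (free R I)) = carrier M"
  using assms by (auto simp: pres_def)

lemma kern_carrier: "kern R I M \<pi> = {u \<in> carrier (lmod R (free R I)). \<pi> u = \<zero>\<^bsub>M\<^esub>}"
  by (simp add: kern_def)

section \<open>Direct sums of free modules over index sets joined by
  \<open>sum_encode\<close>\<close>

definition inL :: "('r, 'c) ring_scheme \<Rightarrow> (nat \<Rightarrow> 'r) \<Rightarrow> nat \<Rightarrow> 'r"
  where "inL R x = (\<lambda>n. case sum_decode n of Inl i \<Rightarrow> x i | Inr i \<Rightarrow> \<zero>\<^bsub>R\<^esub>)"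
definition inR :: "('r, 'c) ring_scheme \<Rightarrow> (nat \<Rightarrow> 'r) \<Rightarrow> nat \<Rightarrow> 'r"
  where "inR R x = (\<lambda>n. case sum_decode n of Inl i \<Rightarrow> \<zero>\<^bsub>R\<^esub> | Inr i \<Rightarrow> x i)"
definition prL :: "(nat \<Rightarrow> 'r) \<Rightarrow> nat \<Rightarrow> 'r"
  where "prL u = (\<lambda>i. u (sum_encode (Inl i)))"
definition prR :: "(nat \<Rightarrow> 'r) \<Rightarrow> nat \<Rightarrow> 'r"
  where "prR u = (\<lambda>i. u (sum_encode (Inr i)))"
definition isum :: "nat set \<Rightarrow> nat set \<Rightarrow> nat set"
  where "isum I J = sum_encode ` (I <+> J)"
definition dsum :: "(nat \<Rightarrow> int) \<Rightarrow> (nat \<Rightarrow> int) \<Rightarrow> nat \<Rightarrow> int"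
  where "dsum \<delta> \<epsilon> = (\<lambda>n. case sum_decode n of Inl i \<Rightarrow> \<delta> i | Inr i \<Rightarrow> \<epsilon> i)"

lemma isum_iff: "n \<in> isum I J \<longleftrightarrow> (case sum_decode n of Inl i \<Rightarrow> i \<in> I | Inr i \<Rightarrow> i \<in> J)"
proof -
  have "n \<in> isum I J \<longleftrightarrow> sum_decode n \<in> I <+> J"
    unfolding isum_def by (metis image_iff sum_decode_inverse sum_encode_inverse)
  then show ?thesis by (auto split: sum.split)
qed

lemma finite_isum: "finite I \<Longrightarrow> finite J \<Longrightarrow> finite (isum I J)"
  by (simp add: isum_def)

section \<open>Presentations, split kernels and transport along isomorphisms\<close>

context gr_ring
begin

lemma gsub_gsubm:
  assumes "gsub R pr X \<delta>" "X \<subseteq> free R I"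
  shows "gsubm R (lmod R (free R I)) (shift_pr pr \<delta>) X"
proof (rule gsubmI[OF add_closedI])
  note D = gsubD[OF assms(1)]
  show "\<ominus>\<^bsub>lmod R (free R I)\<^esub> x \<in> X" if "x \<in> X" for x
  proof -
    have "(\<lambda>i. (\<ominus> \<one>) \<otimes> x i) \<in> X" using D(4) that by simp
    moreover have "(\<lambda>i. (\<ominus> \<one>) \<otimes> x i) = (\<lambda>i. \<ominus> x i)"
      using D(6)[OF that] by (simp add: l_minus)
    ultimately show ?thesis by (simp only: minus_free[OF abelian_group_axioms subsetD[OF assms(2) that]])
  qed
qed (simp_all add: assms(2) gsubD(2-5)[OF assms(1)])

lemma gsubm_gsub:
  assumes "gsubm R (lmod R X) (shift_pr pr \<delta>) Y" "finite I" "X \<subseteq> free R I"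
  shows "gsub R pr Y \<delta>"
  using gsubmD[OF assms(1)] add_closedD[OF gsubmD(1)[OF assms(1)]] assms(2,3)
  by (intro gsubI[of I]) auto

lemma gsub_gmod: "gsub R pr X \<delta> \<Longrightarrow> gmod R pr (lmod R X) (shift_pr pr \<delta>)"
  using gsubD(1)[of R pr X \<delta>] gmod_sub[OF gmod_free gsub_gsubm] by (metis fmod_simps(5))

lemma gsub_free: "finite I \<Longrightarrow> gsub R pr (free R I) \<delta>"
  using gsubm_gsub[OF gsubm_carrier[OF gmod_free]] by auto

lemma gsub_kern:
  assumes "pres R pr I \<epsilon> M q \<pi>" "gmod R pr M q"
  shows "gsub R pr (kern R I M \<pi>) \<epsilon>"
  unfolding kern_carrier
  by (rule gsubm_gsub[OF gsubm_kernel[OF gmod_free[OF presD(1)[OF assms(1)]] assms(2) presD(2)[OF assms(1)]]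
      presD(1)[OF assms(1)]]) simp

lemma gsub_vimage:
  assumes "gsub R pr X \<delta>" "gmod R pr N q" "ghom R (lmod R X) (shift_pr pr \<delta>) N q f" "gsubm R N q L"
  shows "gsub R pr {x \<in> X. f x \<in> L} \<delta>"
  using gsubm_gsub[OF gsubm_vimage[OF gsub_gmod[OF assms(1)] assms(2-4)]] gsubD(1)[OF assms(1)] by auto

lemma gsub_kernel:
  assumes "gsub R pr X \<delta>" "gmod R pr N q" "ghom R (lmod R X) (shift_pr pr \<delta>) N q f"
  shows "gsub R pr {x \<in> X. f x = \<zero>\<^bsub>N\<^esub>} \<delta>"
  using gsub_vimage[OF assms gsubm_zero[OF assms(2)]] by simp

lemma fgpI:
  assumes "finite I" "ghom R (lmod R (free R I)) (shift_pr pr \<epsilon>) M q \<pi>"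
    "ghom R M q (lmod R (free R I)) (shift_pr pr \<epsilon>) s" "\<And>x. x \<in> carrier M \<Longrightarrow> \<pi> (s x) = x"
  shows "fgp R pr M q"
proof -
  have "carrier M \<subseteq> \<pi> ` free R I"
  proof
    fix x assume "x \<in> carrier M"
    then show "x \<in> \<pi> ` free R I" using assms(4)[of x] ghomD(3)[OF assms(3), of x] by (metis fmod_simps(1) imageI)
  qed
  then have "pres R pr I \<epsilon> M q \<pi>" using assms(1,2) ghomD(3)[OF assms(2)] by (auto simp: pres_def)
  then show ?thesis using assms(3,4) unfolding fgp_def by blast
qed

text \<open>The map \<open>u \<ominus> s (\<pi> u)\<close> retracts the free module onto the kernel
  of \<open>\<pi>\<close>, so the kernel of a split presentation is projective.\<close>

lemma fp_kern_split:
  assumes "gmod R pr M q" "pres R pr I \<epsilon> M q \<pi>"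
    "ghom R M q (lmod R (free R I)) (shift_pr pr \<epsilon>) s" "\<And>x. x \<in> carrier M \<Longrightarrow> \<pi> (s x) = x"
  shows "fp R pr 0 (kern R I M \<pi>) \<epsilon>"
proof -
  let ?F = "lmod R (free R I)" and ?K = "kern R I M \<pi>"
  note I = presD(1)[OF assms(2)] and \<pi> = ghomD[OF presD(2)[OF assms(2)]] and s = ghomD[OF assms(3)]
  interpret M: left_module R M by (rule gmodD[OF assms(1)])
  interpret F: left_module R ?F by (rule left_module_free)
  have G: "ghom R ?F (shift_pr pr \<epsilon>) ?F (shift_pr pr \<epsilon>) (\<lambda>u. u \<ominus>\<^bsub>?F\<^esub> s (\<pi> u))"
    by (rule ghom_minus[OF gmod_free[OF I] ghom_id ghom_comp[OF presD(2)[OF assms(2)] assms(3)]])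
  have K: "\<pi> (u \<ominus>\<^bsub>?F\<^esub> s (\<pi> u)) = \<zero>\<^bsub>M\<^esub>" if "u \<in> carrier ?F" for u
    using addm_diff[OF F.M.abelian_group_axioms M.M.abelian_group_axioms \<pi>(2) that, of "s (\<pi> u)"]
      assms(4)[OF \<pi>(3)[OF that]] s(3) \<pi>(3) that by (simp add: M.M.r_neg a_minus_def)
  have s0: "s \<zero>\<^bsub>M\<^esub> = \<zero>\<^bsub>?F\<^esub>"
    by (rule addm_zero[OF M.M.abelian_group_axioms F.M.abelian_group_axioms s(2)])
  have "fgp R pr (?F\<lparr>carrier := ?K\<rparr>) (shift_pr pr \<epsilon>)"
  proof (rule fgpI[OF I])
    show "ghom R ?F (shift_pr pr \<epsilon>) (?F\<lparr>carrier := ?K\<rparr>) (shift_pr pr \<epsilon>) (\<lambda>u. u \<ominus>\<^bsub>?F\<^esub> s (\<pi> u))"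
      using K ghomD(3)[OF G] by (intro ghom_into[OF G]) (auto simp: kern_carrier)
    show "ghom R (?F\<lparr>carrier := ?K\<rparr>) (shift_pr pr \<epsilon>) ?F (shift_pr pr \<epsilon>) (\<lambda>u. u)"
      by (rule ghom_restrict_left[OF ghom_id]) (auto simp: kern_carrier)
    fix x assume "x \<in> carrier (?F\<lparr>carrier := ?K\<rparr>)"
    then have "x \<in> carrier ?F" "\<pi> x = \<zero>\<^bsub>M\<^esub>" by (auto simp: kern_carrier)
    then show "x \<ominus>\<^bsub>?F\<^esub> s (\<pi> x) = x" by (simp only: s0 F.M.diff_zero)
  qed
  then show ?thesis using gsub_kern[OF assms(2,1)] by simp
qed

lemma fgp_haspres:
  assumes "gmod R pr M q" "fgp R pr M q"
  shows "haspres R pr 0 M q"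
  using assms(2) fp_kern_split[OF assms(1)] unfolding fgp_def haspres_def by blast

text \<open>A split presentation has projective kernel, which turns length 0 into length 1; for
  larger lengths the same presentations serve. Bounds of different origin can then be raised to a
  common one.\<close>

lemma fp_mono_Suc: "fp R pr n X \<delta> \<Longrightarrow> fp R pr (Suc n) X \<delta>"
proof (induction n arbitrary: X \<delta>)
  case 0
  then show ?case using fgp_haspres[OF gsub_gmod] by (simp only: fp_Suc fp.simps(1))
next
  case (Suc n)
  then show ?case unfolding fp_Suc[of R pr n] fp_Suc[of R pr "Suc n"] haspres_def by blast
qed

lemma fp_mono: "m \<le> n \<Longrightarrow> fp R pr m X \<delta> \<Longrightarrow> fp R pr n X \<delta>"
  by (induction rule: dec_induct) (auto intro: fp_mono_Suc simp del: fp.simps)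

lemma fp_haspres: "fp R pr n X \<delta> \<Longrightarrow> haspres R pr n (lmod R X) (shift_pr pr \<delta>)"
  using fp_mono_Suc by (simp only: fp_Suc)

lemma ghom_bij_inverse:
  assumes "gmod R pr M q" "gmod R pr N q'" "ghom R M q N q' h" "h ` carrier M = carrier N"
    "\<And>x. x \<in> carrier M \<Longrightarrow> h x = \<zero>\<^bsub>N\<^esub> \<Longrightarrow> x = \<zero>\<^bsub>M\<^esub>"
  shows "\<exists>k. ghom R N q' M q k \<and> (\<forall>x\<in>carrier M. k (h x) = x) \<and> (\<forall>y\<in>carrier N. h (k y) = y)"
proof -
  have "\<exists>k. ghom R N q' M q k \<and> (\<forall>x\<in>carrier M. k (h x) = x)"
    by (rule ghom_factor[OF assms(1,2,1,3,4) ghom_id]) (rule assms(5))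
  then obtain k where "ghom R N q' M q k \<and> (\<forall>x\<in>carrier M. k (h x) = x)" ..
  then have k: "ghom R N q' M q k" "\<And>x. x \<in> carrier M \<Longrightarrow> k (h x) = x" by simp_all
  have "h (k y) = y" if "y \<in> carrier N" for y
  proof -
    from that obtain x where x: "x \<in> carrier M" "y = h x" unfolding assms(4)[symmetric] by (rule imageE)
    then show ?thesis by (simp only: k(2)[OF x(1)])
  qed
  then show ?thesis by (intro exI[of _ k] conjI ballI k)
qed

lemma haspres_iso:
  assumes "gmod R pr M q" "gmod R pr N q'" "ghom R M q N q' h" "h ` carrier M = carrier N"
    "\<And>x. x \<in> carrier M \<Longrightarrow> h x = \<zero>\<^bsub>N\<^esub> \<Longrightarrow> x = \<zero>\<^bsub>M\<^esub>" "haspres R pr n M q"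
  shows "haspres R pr n N q'"
proof -
  obtain I \<epsilon> \<pi> where P: "pres R pr I \<epsilon> M q \<pi>" "fp R pr n (kern R I M \<pi>) \<epsilon>"
    using assms(6) unfolding haspres_def by blast
  note h = ghomD[OF assms(3)] and \<pi> = ghomD[OF presD(2)[OF P(1)]]
  have "h \<zero>\<^bsub>M\<^esub> = \<zero>\<^bsub>N\<^esub>" by (rule addm_zero[OF gmodD(3)[OF assms(1)] gmodD(3)[OF assms(2)] h(2)])
  then have "kern R I N (\<lambda>u. h (\<pi> u)) = kern R I M \<pi>"
    using assms(5) \<pi>(3) by (auto simp: kern_def)
  moreover have "(\<lambda>u. h (\<pi> u)) ` free R I = h ` \<pi> ` free R I" by (rule image_image[symmetric])
  then have "pres R pr I \<epsilon> N q' (\<lambda>u. h (\<pi> u))"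
    using presD[OF P(1)] assms(4) ghom_comp[OF presD(2)[OF P(1)] assms(3)] by (simp add: pres_def)
  ultimately show ?thesis using P(2) unfolding haspres_def by metis
qed

text \<open>Length 0 needs the inverse isomorphism to transport the splitting. For positive length a
  presentation is composed with \<open>h\<close>, which is injective, so the kernel does not
  change.\<close>

lemma fp_iso:
  assumes "fp R pr n X \<delta>" "gsub R pr Y \<delta>'" "ghom R (lmod R X) (shift_pr pr \<delta>) (lmod R Y) (shift_pr pr \<delta>') h"
    "h ` X = Y" "\<And>x. x \<in> X \<Longrightarrow> h x = (\<lambda>i. \<zero>) \<Longrightarrow> x = (\<lambda>i. \<zero>)"
  shows "fp R pr n Y \<delta>'"
proof (cases n)
  case 0
  note X = gsub_gmod[OF fp_gsub[OF assms(1)]] and Y = gsub_gmod[OF assms(2)]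
  have "\<exists>k. ghom R (lmod R Y) (shift_pr pr \<delta>') (lmod R X) (shift_pr pr \<delta>) k \<and>
      (\<forall>x\<in>carrier (lmod R X). k (h x) = x) \<and> (\<forall>y\<in>carrier (lmod R Y). h (k y) = y)"
    by (rule ghom_bij_inverse[OF X Y assms(3)]) (simp_all add: assms(4,5))
  then obtain k where k: "ghom R (lmod R Y) (shift_pr pr \<delta>') (lmod R X) (shift_pr pr \<delta>) k" "\<forall>y\<in>Y. h (k y) = y"
    unfolding fmod_simps(1) by blast
  obtain I \<epsilon> \<pi> s where P: "pres R pr I \<epsilon> (lmod R X) (shift_pr pr \<delta>) \<pi>"
    "ghom R (lmod R X) (shift_pr pr \<delta>) (lmod R (free R I)) (shift_pr pr \<epsilon>) s" "\<forall>x\<in>X. \<pi> (s x) = x"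
    using assms(1) 0 by (auto simp: fgp_def)
  have "fgp R pr (lmod R Y) (shift_pr pr \<delta>')"
    by (rule fgpI[OF presD(1)[OF P(1)] ghom_comp[OF presD(2)[OF P(1)] assms(3)] ghom_comp[OF k(1) P(2)]])
      (use ghomD(3)[OF k(1)] k(2) P(3) in auto)
  then show ?thesis using 0 assms(2) by simp
next
  case (Suc m)
  note X = gsub_gmod[OF fp_gsub[OF assms(1)]] and Y = gsub_gmod[OF assms(2)]
  show ?thesis
    using haspres_iso[OF X Y assms(3), of m] assms(1,2,4,5) unfolding Suc fp_Suc by auto
qed

lemma free_lift:
  assumes "gmod R pr M q" "gmod R pr N q'" "ghom R M q N q' f" "f ` carrier M = carrier N" "finite I"
    "ghom R (lmod R (free R I)) (shift_pr pr \<epsilon>) N q' \<pi>"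
  shows "\<exists>g. ghom R (lmod R (free R I)) (shift_pr pr \<epsilon>) M q g \<and> (\<forall>u\<in>free R I. f (g u) = \<pi> u)"
proof -
  note f = ghomD[OF assms(3)] and \<pi> = ghomD[OF assms(6)]
  interpret gM: grading M q by (rule gmodD[OF assms(1)])
  have "\<exists>y\<in>carrier M. q (\<epsilon> i) y = y \<and> f y = \<pi> (elm R i \<one>)" if "i \<in> I" for i
  proof -
    have e: "elm R i \<one> \<in> carrier (lmod R (free R I))" using that by simp
    then obtain y where y: "y \<in> carrier M" "f y = \<pi> (elm R i \<one>)" using assms(4) \<pi>(3) by (metis imageE)
    \<comment> \<open>An arbitrary preimage \<open>y\<close> need not be homogeneous. Its component
      of degree \<open>\<epsilon> i\<close> is a preimage as well, because the image of the basis
      element is homogeneous of that degree.\<close>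
    have "f (q (\<epsilon> i) y) = \<pi> (elm R i \<one>)"
      using y f(6)[OF y(1), of "\<epsilon> i"] \<pi>(6)[OF e, of "\<epsilon> i"] by (simp add: shift_pr_elm pr_one)
    then show ?thesis using y by (intro bexI[of _ "q (\<epsilon> i) y"]) (auto simp: gM.q_orth)
  qed
  then obtain y where y: "\<And>i. i \<in> I \<Longrightarrow> y i \<in> carrier M" "\<And>i. i \<in> I \<Longrightarrow> q (\<epsilon> i) (y i) = y i"
    "\<And>i. i \<in> I \<Longrightarrow> f (y i) = \<pi> (elm R i \<one>)" by metis
  interpret M: left_module R M by (rule gmodD[OF assms(1)])
  let ?g = "flift M y I"
  have g: "ghom R (lmod R (free R I)) (shift_pr pr \<epsilon>) M q ?g" by (rule flift_ghom[OF assms(1,5) y(1,2)])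
  have "f (?g u) = \<pi> u" if "u \<in> free R I" for u
    by (rule lhom_eq_free[OF gmodD(1)[OF assms(2)] ghomD(1)[OF ghom_comp[OF g assms(3)]] \<pi>(1) assms(5) _ that])
      (simp add: flift_elm[OF gmodD(1)[OF assms(1)] assms(5) y(1)] y)
  with g show ?thesis by auto
qed

lemma ghom_inL: "ghom R (lmod R (free R I)) (shift_pr pr \<delta>) (lmod R (free R (isum I J))) (shift_pr pr (dsum \<delta> \<epsilon>)) (inL R)"
  by (rule ghomI; (rule addmI)?)
    (auto simp: inL_def free_def isum_iff dsum_def shift_pr_def fun_eq_iff split: sum.split)

lemma ghom_inR: "ghom R (lmod R (free R J)) (shift_pr pr \<epsilon>) (lmod R (free R (isum I J))) (shift_pr pr (dsum \<delta> \<epsilon>)) (inR R)"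
  by (rule ghomI; (rule addmI)?)
    (auto simp: inR_def free_def isum_iff dsum_def shift_pr_def fun_eq_iff split: sum.split)

lemma ghom_prL: "ghom R (lmod R (free R (isum I J))) (shift_pr pr (dsum \<delta> \<epsilon>)) (lmod R (free R I)) (shift_pr pr \<delta>) prL"
  by (rule ghomI; (rule addmI)?)
    (auto simp: prL_def free_def isum_iff dsum_def shift_pr_def fun_eq_iff split: sum.split)

lemma ghom_prR: "ghom R (lmod R (free R (isum I J))) (shift_pr pr (dsum \<delta> \<epsilon>)) (lmod R (free R J)) (shift_pr pr \<epsilon>) prR"
  by (rule ghomI; (rule addmI)?)
    (auto simp: prR_def free_def isum_iff dsum_def shift_pr_def fun_eq_iff split: sum.split)

lemma pr_in [simp]:
  "prL (inL R x) = x" "prR (inR R x) = x" "prL (inR R x) = (\<lambda>i. \<zero>)" "prR (inL R x) = (\<lambda>i. \<zero>)"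
  by (auto simp: prL_def inL_def prR_def inR_def)

lemma inL_prL: "prR u = (\<lambda>i. \<zero>) \<Longrightarrow> inL R (prL u) = u"
  by (force simp: prL_def inL_def prR_def fun_eq_iff split: sum.split dest: arg_cong[of _ _ sum_encode])

end

section \<open>Extensions and sums: the horseshoe lemma and its consequences\<close>

context gr_ring
begin

lemma inL_zeroD:
  assumes "inL R x = (\<lambda>i. \<zero>)"
  shows "x = (\<lambda>i. \<zero>)"
proof -
  have "x = prL (inL R x)" by simp
  also have "\<dots> = (\<lambda>i. \<zero>)" unfolding assms by (simp add: prL_def)
  finally show ?thesis .
qed

text \<open>The cover of \<open>M\<close> joins the cover of the kernel of \<open>f\<close> with a
  lift \<open>g\<close> of the cover of \<open>N\<close>. The last two conclusions make the new
  kernel an extension of the kernel of \<open>\<pi>2\<close> by the kernel of \<open>\<pi>1\<close>,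
  with \<open>prR\<close> and \<open>inL R\<close> as the maps.\<close>

lemma horseshoe:
  assumes M: "gmod R pr M q" and N: "gmod R pr N q'" and f: "ghom R M q N q' f" "f ` carrier M = carrier N"
    and P1: "pres R pr I1 \<epsilon>1 (M\<lparr>carrier := {x \<in> carrier M. f x = \<zero>\<^bsub>N\<^esub>}\<rparr>) q \<pi>1"
    and P2: "pres R pr I2 \<epsilon>2 N q' \<pi>2"
    and g: "ghom R (lmod R (free R I2)) (shift_pr pr \<epsilon>2) M q g" "\<And>u. u \<in> free R I2 \<Longrightarrow> f (g u) = \<pi>2 u"
  defines "\<pi> \<equiv> \<lambda>u. \<pi>1 (prL u) \<oplus>\<^bsub>M\<^esub> g (prR u)" and "I \<equiv> isum I1 I2" and "\<epsilon> \<equiv> dsum \<epsilon>1 \<epsilon>2"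
  shows "pres R pr I \<epsilon> M q \<pi>"
    and "prR ` kern R I M \<pi> = kern R I2 N \<pi>2"
    and "inL R ` kern R I1 (M\<lparr>carrier := {x \<in> carrier M. f x = \<zero>\<^bsub>N\<^esub>}\<rparr>) \<pi>1 =
      {u \<in> kern R I M \<pi>. prR u = (\<lambda>i. \<zero>)}"
proof -
  let ?M1 = "{x \<in> carrier M. f x = \<zero>\<^bsub>N\<^esub>}"
  interpret M: left_module R M by (rule gmodD[OF M])
  interpret N: left_module R N by (rule gmodD[OF N])
  note fD = ghomD[OF f(1)] and gD = ghomD[OF g(1), simplified]
  note L = ghomD[OF ghom_prL, simplified] and R = ghomD[OF ghom_prR, simplified]
  have p1: "ghom R (lmod R (free R I1)) (shift_pr pr \<epsilon>1) M q \<pi>1"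
    by (rule ghom_extend_codomain[OF presD(2)[OF P1]]) auto
  note p1D = ghomD[OF p1, simplified] and p2D = ghomD[OF presD(2)[OF P2], simplified]
  have im1: "\<pi>1 ` free R I1 = ?M1" using presD(3)[OF P1] by simp
  have f0: "f (\<pi>1 u) = \<zero>\<^bsub>N\<^esub>" if "u \<in> free R I1" for u using im1 that by blast
  have \<pi>: "ghom R (lmod R (free R I)) (shift_pr pr \<epsilon>) M q \<pi>"
    unfolding \<pi>_def I_def \<epsilon>_def
    by (rule ghom_plus[OF M ghom_comp[OF ghom_prL p1] ghom_comp[OF ghom_prR g(1)]])
  have f\<pi>: "f (\<pi> u) = \<pi>2 (prR u)" if "u \<in> free R I" for u
    using that unfolding \<pi>_def I_def by (simp add: fD(4) L(3) R(3) p1D(3) gD(3) f0 g(2) p2D(3))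
  have g0: "g (\<lambda>i. \<zero>) = \<zero>\<^bsub>M\<^esub>"
    using addm_zero[OF abelian_group_free[OF abelian_group_axioms] M.M.abelian_group_axioms gD(2)] by simp
  let ?u = "\<lambda>u v i. inL R u i \<oplus> inR R v i"
  have uF: "?u u v \<in> free R I" if "u \<in> free R I1" "v \<in> free R I2" for u v
    using that ghomD(3)[OF ghom_inL, of u I1] ghomD(3)[OF ghom_inR, of v I2] unfolding I_def by (simp add: free_def)
  have pu: "prL (?u u v) = u" "prR (?u u v) = v" if "u \<in> free R I1" "v \<in> free R I2" for u v
    using that by (auto simp: prL_def prR_def inL_def inR_def free_def)
  have \<pi>u: "\<pi> (?u u v) = \<pi>1 u \<oplus>\<^bsub>M\<^esub> g v" if "u \<in> free R I1" "v \<in> free R I2" for u v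
    unfolding \<pi>_def by (simp only: pu[OF that])
  have ex1: "\<exists>u\<in>free R I1. \<pi>1 u = x" if "x \<in> carrier M" "f x = \<zero>\<^bsub>N\<^esub>" for x
    using im1 that by (metis (mono_tags, lifting) imageE mem_Collect_eq)
  have surj: "x \<in> \<pi> ` free R I" if x: "x \<in> carrier M" for x
  proof -
    have "f x \<in> \<pi>2 ` free R I2" using presD(3)[OF P2] fD(3)[OF x] by simp
    then obtain v where v: "v \<in> free R I2" "f x = \<pi>2 v" by (rule imageE)
    \<comment> \<open>Subtracting a lift of \<open>f x\<close> moves \<open>x\<close> into the
      kernel of \<open>f\<close>, which \<open>\<pi>1\<close> covers.\<close>
    have "f (x \<ominus>\<^bsub>M\<^esub> g v) = \<zero>\<^bsub>N\<^esub>"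
      using addm_diff[OF M.M.abelian_group_axioms N.M.abelian_group_axioms fD(2) x gD(3)[OF v(1)]] v g(2) p2D(3)
      by (simp add: N.M.r_neg a_minus_def)
    then obtain u where u: "u \<in> free R I1" "\<pi>1 u = x \<ominus>\<^bsub>M\<^esub> g v" using ex1 x gD(3)[OF v(1)] by (metis M.M.minus_closed)
    have "\<pi> (?u u v) = x" using \<pi>u[OF u(1) v(1)] u(2) x gD(3)[OF v(1)]
      by (simp add: a_minus_def M.M.a_assoc M.M.l_neg)
    then show ?thesis using uF[OF u(1) v(1)] by (metis imageI)
  qed
  show "pres R pr I \<epsilon> M q \<pi>"
    using presD(1)[OF P1] presD(1)[OF P2] finite_isum \<pi> surj ghomD(3)[OF \<pi>] by (auto simp: pres_def I_def)
  show "prR ` kern R I M \<pi> = kern R I2 N \<pi>2"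
  proof (intro equalityI subsetI)
    fix v assume "v \<in> prR ` kern R I M \<pi>"
    then obtain w where w: "w \<in> free R I" "\<pi> w = \<zero>\<^bsub>M\<^esub>" "v = prR w" by (auto simp: kern_def)
    have "\<pi>2 v = \<zero>\<^bsub>N\<^esub>"
      using f\<pi>[OF w(1)] w(2,3) addm_zero[OF M.M.abelian_group_axioms N.M.abelian_group_axioms fD(2)] by simp
    then show "v \<in> kern R I2 N \<pi>2" using w R(3) by (simp add: kern_def I_def)
  next
    fix v assume "v \<in> kern R I2 N \<pi>2"
    then have v: "v \<in> free R I2" "f (g v) = \<zero>\<^bsub>N\<^esub>" by (auto simp: kern_def g(2))
    \<comment> \<open>For \<open>v\<close> in the kernel of \<open>\<pi>2\<close> the lift
      \<open>g v\<close> is in the kernel of \<open>f\<close>, so a first component that cancels it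
      exists.\<close>
    have "f (\<ominus>\<^bsub>M\<^esub> g v) = \<zero>\<^bsub>N\<^esub>"
      using addm_minus[OF M.M.abelian_group_axioms N.M.abelian_group_axioms fD(2) gD(3)[OF v(1)]] v(2) by simp
    then obtain u where u: "u \<in> free R I1" "\<pi>1 u = \<ominus>\<^bsub>M\<^esub> g v"
      using ex1 gD(3)[OF v(1)] by (metis M.M.a_inv_closed)
    have "\<pi> (?u u v) = \<zero>\<^bsub>M\<^esub>" using \<pi>u[OF u(1) v(1)] u(2) gD(3)[OF v(1)] by (simp add: M.M.l_neg)
    then have "?u u v \<in> kern R I M \<pi>" using uF[OF u(1) v(1)] by (simp add: kern_def)
    then show "v \<in> prR ` kern R I M \<pi>" using pu(2)[OF u(1) v(1)] by (metis imageI)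
  qed
  show "inL R ` kern R I1 (M\<lparr>carrier := ?M1\<rparr>) \<pi>1 = {u \<in> kern R I M \<pi>. prR u = (\<lambda>i. \<zero>)}"
  proof (intro equalityI subsetI)
    fix w assume "w \<in> inL R ` kern R I1 (M\<lparr>carrier := ?M1\<rparr>) \<pi>1"
    then obtain u where u: "u \<in> free R I1" "\<pi>1 u = \<zero>\<^bsub>M\<^esub>" "w = inL R u" by (auto simp: kern_def)
    have "w \<in> free R I" using ghomD(3)[OF ghom_inL, of u I1] u by (simp add: I_def)
    moreover have "\<pi> w = \<zero>\<^bsub>M\<^esub>" using u g0 by (simp add: \<pi>_def)
    ultimately show "w \<in> {u \<in> kern R I M \<pi>. prR u = (\<lambda>i. \<zero>)}" using u by (simp add: kern_def)
  next
    fix w assume "w \<in> {u \<in> kern R I M \<pi>. prR u = (\<lambda>i. \<zero>)}"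
    then have w: "w \<in> free R I" "\<pi> w = \<zero>\<^bsub>M\<^esub>" "prR w = (\<lambda>i. \<zero>)" by (auto simp: kern_def)
    have l: "prL w \<in> free R I1" using L(3) w(1) by (simp add: I_def)
    have "\<pi>1 (prL w) = \<zero>\<^bsub>M\<^esub>" using w(2,3) g0 p1D(3)[OF l] by (simp add: \<pi>_def)
    then have "prL w \<in> kern R I1 (M\<lparr>carrier := ?M1\<rparr>) \<pi>1" using l by (simp add: kern_def)
    then show "w \<in> inL R ` kern R I1 (M\<lparr>carrier := ?M1\<rparr>) \<pi>1" by (rule rev_image_eqI) (rule inL_prL[OF w(3), symmetric])
  qed
qed

text \<open>Closure under extensions at one fixed length, isolated because the step from
  \<open>n\<close> to \<open>Suc n\<close> applies it to the syzygies produced by the horseshoe. It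
  speaks of submodules of free modules since a quantifier cannot range over element types.\<close>

definition ext_closed :: "nat \<Rightarrow> bool"
  where "ext_closed n \<longleftrightarrow> (\<forall>X Z \<delta> \<delta>' f. gsub R pr X \<delta> \<and> ghom R (lmod R X) (shift_pr pr \<delta>) (lmod R Z) (shift_pr pr \<delta>') f \<and>
    f ` X = Z \<and> fp R pr n Z \<delta>' \<and> fp R pr n {x \<in> X. f x = (\<lambda>i. \<zero>)} \<delta> \<longrightarrow> fp R pr n X \<delta>)"

text \<open>\<open>M\<close> and \<open>N\<close> may have any element types, but the kernels of the
  covers in the horseshoe are submodules of free modules, to which \<open>ext_closed n\<close>
  applies.\<close>

lemma haspres_ext_step:
  assumes n: "ext_closed n"
    and M: "gmod R pr M q" and N: "gmod R pr N q'" and f: "ghom R M q N q' f" "f ` carrier M = carrier N"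
    and 1: "haspres R pr n (M\<lparr>carrier := {x \<in> carrier M. f x = \<zero>\<^bsub>N\<^esub>}\<rparr>) q" and 2: "haspres R pr n N q'"
  shows "haspres R pr n M q"
proof -
  let ?M1 = "M\<lparr>carrier := {x \<in> carrier M. f x = \<zero>\<^bsub>N\<^esub>}\<rparr>"
  have M1: "gmod R pr ?M1 q" by (rule gmod_sub[OF M gsubm_kernel[OF M N f(1)]])
  obtain I1 \<epsilon>1 \<pi>1 where P1: "pres R pr I1 \<epsilon>1 ?M1 q \<pi>1" "fp R pr n (kern R I1 ?M1 \<pi>1) \<epsilon>1"
    using 1 unfolding haspres_def by blast
  obtain I2 \<epsilon>2 \<pi>2 where P2: "pres R pr I2 \<epsilon>2 N q' \<pi>2" "fp R pr n (kern R I2 N \<pi>2) \<epsilon>2"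
    using 2 unfolding haspres_def by blast
  obtain g where g: "ghom R (lmod R (free R I2)) (shift_pr pr \<epsilon>2) M q g" "\<And>u. u \<in> free R I2 \<Longrightarrow> f (g u) = \<pi>2 u"
    using free_lift[OF M N f presD(1,2)[OF P2(1)]] by metis
  define \<pi> where "\<pi> = (\<lambda>u. \<pi>1 (prL u) \<oplus>\<^bsub>M\<^esub> g (prR u))"
  define I where "I = isum I1 I2"
  define \<epsilon> where "\<epsilon> = dsum \<epsilon>1 \<epsilon>2"
  note H = horseshoe[OF M N f P1(1) P2(1) g, folded \<pi>_def I_def \<epsilon>_def]
  let ?K = "kern R I M \<pi>"
  have K: "gsub R pr ?K \<epsilon>" by (rule gsub_kern[OF H(1) M])
  have h: "ghom R (lmod R ?K) (shift_pr pr \<epsilon>) (lmod R (kern R I2 N \<pi>2)) (shift_pr pr \<epsilon>2) prR"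
    using ghom_restrict[OF ghom_prR[of I1 I2 \<epsilon>1 \<epsilon>2], of ?K "kern R I2 N \<pi>2"] H(2)
    by (auto simp: I_def \<epsilon>_def kern_def)
  have K1: "gsub R pr {u \<in> ?K. prR u = (\<lambda>i. \<zero>)} \<epsilon>"
    using gsub_kernel[OF K gsub_gmod[OF fp_gsub[OF P2(2)]] h] by simp
  have "fp R pr n {u \<in> ?K. prR u = (\<lambda>i. \<zero>)} \<epsilon>"
  proof (rule fp_iso[OF P1(2) K1])
    show "ghom R (lmod R (kern R I1 ?M1 \<pi>1)) (shift_pr pr \<epsilon>1) (lmod R {u \<in> ?K. prR u = (\<lambda>i. \<zero>)}) (shift_pr pr \<epsilon>) (inL R)"
      using ghom_restrict[OF ghom_inL[of I1 \<epsilon>1 I2 \<epsilon>2], of "kern R I1 ?M1 \<pi>1" "{u \<in> ?K. prR u = (\<lambda>i. \<zero>)}"] H(3)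
      by (auto simp: I_def \<epsilon>_def kern_def)
    show "x = (\<lambda>i. \<zero>)" if "inL R x = (\<lambda>i. \<zero>)" for x
      using that by (rule inL_zeroD)
  qed (rule H(3))
  then have "fp R pr n ?K \<epsilon>"
    using n K h H(2) P2(2) unfolding ext_closed_def by blast
  then show ?thesis using H(1) unfolding haspres_def by blast
qed

lemma ext_closed: "ext_closed n"
proof (induction n)
  case 0
  show ?case unfolding ext_closed_def
  proof (intro allI impI, elim conjE)
    fix X Z \<delta> \<delta>' f
    assume X: "gsub R pr X \<delta>" and f: "ghom R (lmod R X) (shift_pr pr \<delta>) (lmod R Z) (shift_pr pr \<delta>') f" "f ` X = Z"
      and Z: "fp R pr 0 Z \<delta>'" and X1: "fp R pr 0 {x \<in> X. f x = (\<lambda>i. \<zero>)} \<delta>"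
    let ?M = "lmod R X" and ?N = "lmod R Z" and ?M1 = "lmod R {x \<in> X. f x = (\<lambda>i. \<zero>)}"
    note M = gsub_gmod[OF X] and N = gsub_gmod[OF fp_gsub[OF Z]] and M1 = gsub_gmod[OF fp_gsub[OF X1]]
    interpret M: left_module R ?M by (rule gmodD[OF M])
    interpret N: left_module R ?N by (rule gmodD[OF N])
    obtain I1 \<epsilon>1 \<pi>1 s1 where P1: "pres R pr I1 \<epsilon>1 ?M1 (shift_pr pr \<delta>) \<pi>1"
      "ghom R ?M1 (shift_pr pr \<delta>) (lmod R (free R I1)) (shift_pr pr \<epsilon>1) s1" "\<And>x. x \<in> X \<Longrightarrow> f x = (\<lambda>i. \<zero>) \<Longrightarrow> \<pi>1 (s1 x) = x"
      using X1 by (auto simp: fgp_def)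
    obtain I2 \<epsilon>2 \<pi>2 s2 where P2: "pres R pr I2 \<epsilon>2 ?N (shift_pr pr \<delta>') \<pi>2"
      "ghom R ?N (shift_pr pr \<delta>') (lmod R (free R I2)) (shift_pr pr \<epsilon>2) s2" "\<And>x. x \<in> Z \<Longrightarrow> \<pi>2 (s2 x) = x"
      using Z by (auto simp: fgp_def)
    obtain g where g: "ghom R (lmod R (free R I2)) (shift_pr pr \<epsilon>2) ?M (shift_pr pr \<delta>) g" "\<And>u. u \<in> free R I2 \<Longrightarrow> f (g u) = \<pi>2 u"
      using free_lift[OF M N f(1) _ presD(1,2)[OF P2(1)]] f(2) by (metis fmod_simps(1))
    define \<pi> where "\<pi> = (\<lambda>u. \<pi>1 (prL u) \<oplus>\<^bsub>?M\<^esub> g (prR u))"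
    have H: "pres R pr (isum I1 I2) (dsum \<epsilon>1 \<epsilon>2) ?M (shift_pr pr \<delta>) \<pi>"
    proof -
      have f2: "f ` carrier ?M = carrier ?N" using f(2) by simp
      have P: "pres R pr I1 \<epsilon>1 (?M\<lparr>carrier := {x \<in> carrier ?M. f x = \<zero>\<^bsub>?N\<^esub>}\<rparr>) (shift_pr pr \<delta>) \<pi>1"
        using P1(1) by simp
      show ?thesis unfolding \<pi>_def by (rule horseshoe(1)[OF M N f(1) f2 P P2(1) g(1)]) (rule g(2))
    qed
    \<comment> \<open>\<open>g\<close> after \<open>s2\<close> is a section of \<open>f\<close>. The
      remainder \<open>r x\<close> projects \<open>x\<close> to the kernel of \<open>f\<close>,
      where the splitting \<open>s1\<close> is available.\<close>
    define r where "r x = x \<ominus>\<^bsub>?M\<^esub> g (s2 (f x))" for x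
    note s2f = ghom_comp[OF f(1) P2(2)]
    note fD = ghomD[OF f(1)] and gD = ghomD[OF g(1)] and s2D = ghomD[OF P2(2)]
    have r0: "ghom R ?M (shift_pr pr \<delta>) ?M (shift_pr pr \<delta>) r"
      unfolding r_def by (rule ghom_minus[OF M ghom_id ghom_comp[OF s2f g(1)]])
    have gx: "g (s2 (f x)) \<in> carrier ?M" if "x \<in> carrier ?M" for x
      by (rule gD(3)[OF s2D(3)[OF fD(3)[OF that]]])
    have fr: "f (r x) = (\<lambda>i. \<zero>)" if "x \<in> carrier ?M" for x
    proof -
      have "f (g (s2 (f x))) = f x"
        using g(2) P2(3) s2D(3)[OF fD(3)[OF that]] fD(3)[OF that] by simp
      then have "f (r x) = f x \<ominus>\<^bsub>?N\<^esub> f x"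
        unfolding r_def using addm_diff[OF gmodD(3)[OF M] gmodD(3)[OF N] fD(2) that gx[OF that]] by simp
      also have "\<dots> = \<zero>\<^bsub>?N\<^esub>" using fD(3)[OF that] unfolding a_minus_def by (rule N.M.r_neg)
      finally show ?thesis by simp
    qed
    have rM: "r x \<in> carrier ?M" if "x \<in> carrier ?M" for x by (rule ghomD(3)[OF r0 that])
    have r: "ghom R ?M (shift_pr pr \<delta>) ?M1 (shift_pr pr \<delta>) r"
      using ghom_into[OF r0, of "{x \<in> X. f x = (\<lambda>i. \<zero>)}"] fr rM by simp
    let ?F = "lmod R (free R (isum I1 I2))" and ?\<epsilon> = "shift_pr pr (dsum \<epsilon>1 \<epsilon>2)"
    \<comment> \<open>An extension of projectives is projective: the splitting of
      \<open>\<pi>\<close> combines \<open>s1\<close> on the kernel part \<open>r x\<close> with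
      \<open>s2\<close> on the quotient part \<open>f x\<close>.\<close>
    define s where "s x = inL R (s1 (r x)) \<oplus>\<^bsub>?F\<^esub> inR R (s2 (f x))" for x
    have s: "ghom R ?M (shift_pr pr \<delta>) ?F ?\<epsilon> s" unfolding s_def
      by (rule ghom_plus[OF gmod_free ghom_comp[OF ghom_comp[OF r P1(2)] ghom_inL] ghom_comp[OF s2f ghom_inR]])
        (rule presD(1)[OF H])
    have "\<pi> (s x) = x" if x: "x \<in> carrier ?M" for x
    proof -
      have c: "s1 (r x) \<in> free R I1" "s2 (f x) \<in> free R I2"
        using ghomD(3)[OF P1(2), of "r x"] s2D(3)[OF fD(3)[OF x]] rM[OF x] fr[OF x] by simp_all
      have "prL (s x) = s1 (r x)" "prR (s x) = s2 (f x)"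
        using c by (auto simp: s_def prL_def prR_def inL_def inR_def free_def)
      then have "\<pi> (s x) = r x \<oplus>\<^bsub>?M\<^esub> g (s2 (f x))"
        using P1(3)[of "r x"] rM[OF x] fr[OF x] by (simp add: \<pi>_def)
      also have "\<dots> = x"
        unfolding r_def a_minus_def using x gx[OF x]
        by (simp only: M.M.a_assoc M.M.a_inv_closed M.M.l_neg M.M.r_zero)
      finally show ?thesis .
    qed
    with s have "fgp R pr ?M (shift_pr pr \<delta>)" by (intro fgpI[OF presD(1,2)[OF H]])
    then show "fp R pr 0 X \<delta>" using X by simp
  qed
next
  case (Suc n)
  show ?case unfolding ext_closed_def
  proof (intro allI impI, elim conjE)
    fix X Z \<delta> \<delta>' f
    assume X: "gsub R pr X \<delta>" and f: "ghom R (lmod R X) (shift_pr pr \<delta>) (lmod R Z) (shift_pr pr \<delta>') f" "f ` X = Z"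
      and Z: "fp R pr (Suc n) Z \<delta>'" and X1: "fp R pr (Suc n) {x \<in> X. f x = (\<lambda>i. \<zero>)} \<delta>"
    have "haspres R pr n (lmod R X) (shift_pr pr \<delta>)"
      by (rule haspres_ext_step[OF Suc gsub_gmod[OF X] gsub_gmod[OF fp_gsub[OF Z]] f(1)])
        (use f(2) Z X1 in \<open>simp_all add: fp_Suc del: fp.simps\<close>)
    then show "fp R pr (Suc n) X \<delta>" using X by (simp only: fp_Suc)
  qed
qed

lemmas haspres_ext = haspres_ext_step[OF ext_closed]

lemma fp_ext:
  assumes "gsub R pr X \<delta>" "ghom R (lmod R X) (shift_pr pr \<delta>) (lmod R Z) (shift_pr pr \<delta>') f" "f ` X = Z"
    "fp R pr n Z \<delta>'" "fp R pr n {x \<in> X. f x = (\<lambda>i. \<zero>)} \<delta>"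
  shows "fp R pr n X \<delta>"
  using ext_closed[of n] assms unfolding ext_closed_def by blast

text \<open>\<open>X\<close> and \<open>Y\<close> are covered by free modules. The kernel of the
  induced map from their direct sum to the sum of \<open>X\<close> and \<open>Y\<close> maps onto
  \<open>X \<inter> Y\<close> through the first component, and what this kills is the direct sum of
  the two kernels. Two uses of \<open>fp_ext\<close> bound the kernel by \<open>n\<close>, hence the
  sum by \<open>Suc n\<close>.\<close>

lemma fp_sum:
  assumes X: "fp R pr n X \<delta>" and Y: "fp R pr n Y \<delta>" and XY: "fp R pr n (X \<inter> Y) \<delta>"
  shows "fp R pr (Suc n) {(\<lambda>i. x i \<oplus> y i) | x y. x \<in> X \<and> y \<in> Y} \<delta>"
proof -
  let ?S = "{(\<lambda>i. x i \<oplus> y i) | x y. x \<in> X \<and> y \<in> Y}"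
  note XD = gsubD[OF fp_gsub[OF X]] and YD = gsubD[OF fp_gsub[OF Y]]
  obtain J1 J2 where J: "finite J1" "X \<subseteq> free R J1" "finite J2" "Y \<subseteq> free R J2" using XD(1) YD(1) by metis
  have S: "gsub R pr ?S \<delta>"
  proof (rule gsubI[of "J1 \<union> J2"])
    show "?S \<subseteq> free R (J1 \<union> J2)" using J by (auto simp: free_def subset_iff)
    show "(\<lambda>i. \<zero>) \<in> ?S" using XD(2) YD(2) by force
    show "(\<lambda>i. x i \<oplus> y i) \<in> ?S" if xy: "x \<in> ?S" "y \<in> ?S" for x y
    proof -
      from xy obtain a b c d where x: "x = (\<lambda>i. a i \<oplus> b i)" "a \<in> X" "b \<in> Y" "y = (\<lambda>i. c i \<oplus> d i)" "c \<in> X" "d \<in> Y" by auto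
      have "(\<lambda>i. x i \<oplus> y i) = (\<lambda>i. (a i \<oplus> c i) \<oplus> (b i \<oplus> d i))"
        using x XD(6) YD(6) by (simp add: a_ac)
      then show ?thesis using XD(3)[OF x(2,5)] YD(3)[OF x(3,6)] by auto
    qed
    show "(\<lambda>i. a \<otimes> x i) \<in> ?S" if a: "a \<in> carrier R" "x \<in> ?S" for a x
    proof -
      from a obtain b c where x: "x = (\<lambda>i. b i \<oplus> c i)" "b \<in> X" "c \<in> Y" by auto
      have "(\<lambda>i. a \<otimes> x i) = (\<lambda>i. a \<otimes> b i \<oplus> a \<otimes> c i)" using x XD(6) YD(6) a by (simp add: r_distr)
      then show ?thesis using XD(4)[OF a(1) x(2)] YD(4)[OF a(1) x(3)] by auto
    qed
    show "shift_pr pr \<delta> j x \<in> ?S" if a: "x \<in> ?S" for j x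
    proof -
      from a obtain b c where x: "x = (\<lambda>i. b i \<oplus> c i)" "b \<in> X" "c \<in> Y" by auto
      have "shift_pr pr \<delta> j x = (\<lambda>i. shift_pr pr \<delta> j b i \<oplus> shift_pr pr \<delta> j c i)"
        using x XD(6) YD(6) by (simp add: shift_pr_def q_add)
      then show ?thesis using XD(5)[OF x(2)] YD(5)[OF x(3)] by auto
    qed
  qed (use J in auto)
  let ?M = "lmod R ?S" and ?q = "shift_pr pr \<delta>"
  have XS: "X \<subseteq> ?S"
  proof
    fix x assume x: "x \<in> X"
    then have "x = (\<lambda>i. x i \<oplus> \<zero>)" using XD(6) by simp
    then show "x \<in> ?S" using x YD(2) by (intro CollectI exI[of _ x] exI[of _ "\<lambda>i. \<zero>"] conjI)
  qed
  have YS: "Y \<subseteq> ?S"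
  proof
    fix y assume y: "y \<in> Y"
    then have "y = (\<lambda>i. \<zero> \<oplus> y i)" using YD(6) by simp
    then show "y \<in> ?S" using y XD(2) by (intro CollectI exI[of _ y] exI[of _ "\<lambda>i. \<zero>"] conjI)
  qed
  obtain I1 \<epsilon>1 \<pi>1 where P1: "pres R pr I1 \<epsilon>1 (lmod R X) ?q \<pi>1" "fp R pr n (kern R I1 (lmod R X) \<pi>1) \<epsilon>1"
    using fp_haspres[OF X] unfolding haspres_def by blast
  obtain I2 \<epsilon>2 \<pi>2 where P2: "pres R pr I2 \<epsilon>2 (lmod R Y) ?q \<pi>2" "fp R pr n (kern R I2 (lmod R Y) \<pi>2) \<epsilon>2"
    using fp_haspres[OF Y] unfolding haspres_def by blast
  define I where "I = isum I1 I2"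
  define \<epsilon> where "\<epsilon> = dsum \<epsilon>1 \<epsilon>2"
  let ?F = "lmod R (free R I)" and ?qF = "shift_pr pr \<epsilon>"
  have finI: "finite I" using presD(1)[OF P1(1)] presD(1)[OF P2(1)] by (simp add: I_def finite_isum)
  define p1 where "p1 u = \<pi>1 (prL u)" for u
  define p2 where "p2 u = \<pi>2 (prR u)" for u
  have p1X: "ghom R ?F ?qF (lmod R X) ?q p1"
    unfolding p1_def I_def \<epsilon>_def by (rule ghom_comp[OF ghom_prL presD(2)[OF P1(1)]])
  have p1: "ghom R ?F ?qF ?M ?q p1"
    using ghom_extend_codomain[of R ?F ?qF X ?M ?q p1] p1X XS by simp
  have p2Y: "ghom R ?F ?qF (lmod R Y) ?q p2"
    unfolding p2_def I_def \<epsilon>_def by (rule ghom_comp[OF ghom_prR presD(2)[OF P2(1)]])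
  have p2: "ghom R ?F ?qF ?M ?q p2"
    using ghom_extend_codomain[of R ?F ?qF Y ?M ?q p2] p2Y YS by simp
  define \<pi> where "\<pi> u = p1 u \<oplus>\<^bsub>?M\<^esub> p2 u" for u
  have \<pi>: "ghom R ?F ?qF ?M ?q \<pi>" unfolding \<pi>_def by (rule ghom_plus[OF gsub_gmod[OF S] p1 p2])
  note p1D = ghomD[OF p1X, simplified] and p2D = ghomD[OF p2Y, simplified]
  let ?u = "\<lambda>u v i. inL R u i \<oplus> inR R v i"
  have uF: "?u u v \<in> free R I" if "u \<in> free R I1" "v \<in> free R I2" for u v
    using that ghomD(3)[OF ghom_inL, of u I1] ghomD(3)[OF ghom_inR, of v I2] unfolding I_def by (simp add: free_def)
  have pu: "p1 (?u u v) = \<pi>1 u" "p2 (?u u v) = \<pi>2 v" if "u \<in> free R I1" "v \<in> free R I2" for u v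
  proof -
    have "prL (?u u v) = u" "prR (?u u v) = v"
      using that by (auto simp: prL_def prR_def inL_def inR_def free_def)
    then show "p1 (?u u v) = \<pi>1 u" "p2 (?u u v) = \<pi>2 v" by (simp_all only: p1_def p2_def)
  qed
  have ex: "\<exists>w\<in>free R I. p1 w = x \<and> p2 w = y" if "x \<in> X" "y \<in> Y" for x y
  proof -
    have "x \<in> \<pi>1 ` free R I1" "y \<in> \<pi>2 ` free R I2" using that presD(3)[OF P1(1)] presD(3)[OF P2(1)] by simp_all
    then obtain u v where "u \<in> free R I1" "x = \<pi>1 u" "v \<in> free R I2" "y = \<pi>2 v" by blast
    then show ?thesis using uF pu by metis
  qed
  have "\<pi> ` free R I = ?S"
  proof (intro equalityI subsetI)
    fix s assume "s \<in> ?S"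
    then obtain x y where "s = (\<lambda>i. x i \<oplus> y i)" "x \<in> X" "y \<in> Y" by blast
    moreover then obtain w where "w \<in> free R I" "p1 w = x" "p2 w = y" using ex by blast
    ultimately show "s \<in> \<pi> ` free R I" by (intro image_eqI[of _ _ w]) (auto simp: \<pi>_def)
  qed (use ghomD(3)[OF \<pi>] in auto)
  then have P: "pres R pr I \<epsilon> ?M ?q \<pi>" using finI \<pi> by (simp add: pres_def)
  let ?K = "kern R I ?M \<pi>"
  have K: "gsub R pr ?K \<epsilon>" by (rule gsub_kern[OF P gsub_gmod[OF S]])
  \<comment> \<open>A pair in the kernel has opposite components, so the first one lies in
    \<open>Y\<close> as well as in \<open>X\<close>.\<close>
  have Kneg: "p1 u = (\<lambda>i. \<ominus> p2 u i)" if "u \<in> ?K" for u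
  proof
    fix i
    have u: "u \<in> free R I" "p1 u i \<oplus> p2 u i = \<zero>"
      using that by (auto simp: kern_def \<pi>_def dest: fun_cong)
    then show "p1 u i = \<ominus> p2 u i"
      using XD(6)[OF p1D(3)[OF u(1)]] YD(6)[OF p2D(3)[OF u(1)]] by (simp add: minus_equality)
  qed
  have YN: "(\<lambda>i. \<ominus> y i) \<in> Y" if "y \<in> Y" for y
    using YD(4)[of "\<ominus> \<one>" y] that YD(6)[OF that] by (simp add: l_minus)
  have KI: "p1 u \<in> X \<inter> Y" if "u \<in> ?K" for u
  proof
    have u: "u \<in> free R I" using that by (simp add: kern_def)
    show "p1 u \<in> X" using p1D(3)[OF u] .
    show "p1 u \<in> Y" unfolding Kneg[OF that] by (rule YN[OF p2D(3)[OF u]])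
  qed
  let ?Z = "{x \<in> ?K. p1 x = (\<lambda>i. \<zero>)}"
  have h: "ghom R (lmod R ?K) ?qF (lmod R (X \<inter> Y)) ?q p1"
    using ghom_restrict[OF p1X, of ?K "X \<inter> Y"] KI by (auto simp: kern_def)
  have Z: "gsub R pr ?Z \<epsilon>" using gsub_kernel[OF K gsub_gmod[OF fp_gsub[OF XY]] h] by simp
  have Zeq: "?Z = {u \<in> free R I. p1 u = (\<lambda>i. \<zero>) \<and> p2 u = (\<lambda>i. \<zero>)}"
  proof -
    have "p2 u = (\<lambda>i. \<zero>)" if "u \<in> ?K" "p1 u = (\<lambda>i. \<zero>)" for u
    proof
      fix i
      have "\<pi> u i = \<zero>" using that(1) by (auto simp: kern_def)
      then show "p2 u i = \<zero>"
        using that YD(6)[OF p2D(3), of u i] by (simp add: \<pi>_def kern_def)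
    qed
    then show ?thesis by (auto simp: kern_def \<pi>_def)
  qed
  \<comment> \<open>\<open>?Z\<close> is the direct sum of the kernels of \<open>\<pi>1\<close> and
    \<open>\<pi>2\<close>, treated as an extension of the second by the first.\<close>
  have Z2: "fp R pr n ?Z \<epsilon>"
  proof (rule fp_ext[OF Z _ _ P2(2)])
    have sub: "?Z \<subseteq> free R I" by (auto simp: Zeq)
    have into: "prR u \<in> kern R I2 (lmod R Y) \<pi>2" if "u \<in> ?Z" for u
      using that ghomD(3)[OF ghom_prR, of u I1 I2] unfolding Zeq by (simp add: kern_def p2_def I_def)
    show "ghom R (lmod R ?Z) ?qF (lmod R (kern R I2 (lmod R Y) \<pi>2)) (shift_pr pr \<epsilon>2) prR"
      using ghom_restrict[OF ghom_prR[of I1 I2 \<epsilon>1 \<epsilon>2], of ?Z "kern R I2 (lmod R Y) \<pi>2"] into sub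
      by (simp add: I_def \<epsilon>_def subset_iff)
    have z1: "\<pi>1 (\<lambda>i. \<zero>) = (\<lambda>i. \<zero>)"
      using addm_zero[OF abelian_group_free[OF abelian_group_axioms] gmodD(3)[OF gsub_gmod[OF fp_gsub[OF X]]] ghomD(2)[OF presD(2)[OF P1(1)]]] by simp
    have z2: "\<pi>2 (\<lambda>i. \<zero>) = (\<lambda>i. \<zero>)"
      using addm_zero[OF abelian_group_free[OF abelian_group_axioms] gmodD(3)[OF gsub_gmod[OF fp_gsub[OF Y]]] ghomD(2)[OF presD(2)[OF P2(1)]]] by simp
    show "prR ` ?Z = kern R I2 (lmod R Y) \<pi>2"
    proof (intro equalityI subsetI)
      fix v assume "v \<in> kern R I2 (lmod R Y) \<pi>2"
      then have v: "v \<in> free R I2" "\<pi>2 v = (\<lambda>i. \<zero>)" by (auto simp: kern_def)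
      have "inR R v \<in> ?Z" unfolding Zeq
        using v z1 ghomD(3)[OF ghom_inR, of v I2 I1] by (simp add: p1_def p2_def I_def)
      then show "v \<in> prR ` ?Z" by (intro image_eqI[of _ _ "inR R v"]) auto
    qed (use into in auto)
    let ?W = "{x \<in> ?Z. prR x = (\<lambda>i. \<zero>)}"
    show "fp R pr n ?W \<epsilon>"
    proof (rule fp_iso[OF P1(2)])
      show "gsub R pr ?W \<epsilon>"
        using gsub_kernel[OF Z gsub_gmod[OF fp_gsub[OF P2(2)]]] \<open>ghom R (lmod R ?Z) ?qF _ _ prR\<close> by simp
      have inW: "inL R x \<in> ?W" if "x \<in> kern R I1 (lmod R X) \<pi>1" for x
        unfolding Zeq using that z2 ghomD(3)[OF ghom_inL, of x I1 I2] by (simp add: p1_def p2_def I_def kern_def)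
      then show "ghom R (lmod R (kern R I1 (lmod R X) \<pi>1)) (shift_pr pr \<epsilon>1) (lmod R ?W) ?qF (inL R)"
        using ghom_restrict[OF ghom_inL[of I1 \<epsilon>1 I2 \<epsilon>2], of "kern R I1 (lmod R X) \<pi>1" ?W]
        by (simp add: I_def \<epsilon>_def kern_def)
      show "inL R ` kern R I1 (lmod R X) \<pi>1 = ?W"
      proof (intro equalityI subsetI)
        fix w assume w: "w \<in> ?W"
        then have "prL w \<in> kern R I1 (lmod R X) \<pi>1"
          using ghomD(3)[OF ghom_prL, of w I1 I2] unfolding Zeq by (simp add: kern_def p1_def I_def)
        moreover have "w = inL R (prL w)" using w inL_prL by simp
        ultimately show "w \<in> inL R ` kern R I1 (lmod R X) \<pi>1" by (intro image_eqI[of w "inL R" "prL w"])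
      qed (use inW in blast)
      show "x = (\<lambda>i. \<zero>)" if "inL R x = (\<lambda>i. \<zero>)" for x
        using that by (rule inL_zeroD)
    qed
  qed
  have "p1 ` ?K = X \<inter> Y"
  proof (intro equalityI subsetI)
    fix z assume z: "z \<in> X \<inter> Y"
    \<comment> \<open>For \<open>z\<close> in the intersection, the pair of \<open>z\<close> and its
      negative is hit by some \<open>w\<close>, which then lies in the kernel.\<close>
    obtain w where w: "w \<in> free R I" "p1 w = z" "p2 w = (\<lambda>i. \<ominus> z i)" using ex[of z "\<lambda>i. \<ominus> z i"] z YN by auto
    then have "w \<in> ?K" using z XD(6) by (auto simp: kern_def \<pi>_def r_neg)
    then show "z \<in> p1 ` ?K" using w(2) by blast
  qed (use KI in blast)
  from fp_ext[OF K h this XY Z2] have "haspres R pr n ?M ?q" using P unfolding haspres_def by blast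
  then show ?thesis using S by (simp only: fp_Suc)
qed

end

section \<open>Finite resolutions\<close>

lemma a_kernel_eq: "a_kernel M N f = {x \<in> carrier M. f x = \<zero>\<^bsub>N\<^esub>}"
  by (simp add: a_kernel_def kernel_def)

lemma submodule_iff:
  assumes "abelian_group M"
  shows "submodule H R M \<longleftrightarrow> add_closed M H \<and> (\<forall>a\<in>carrier R. \<forall>x\<in>H. a \<odot>\<^bsub>M\<^esub> x \<in> H)"
  using add_closed_iff_subgroup[OF assms] by (auto simp: submodule_def submodule_axioms_def)

definition gres :: "('r, 'c) ring_scheme \<Rightarrow> (int \<Rightarrow> 'r \<Rightarrow> 'r) \<Rightarrow> ('r, 'm) module \<Rightarrow> (int \<Rightarrow> 'm \<Rightarrow> 'm) \<Rightarrow> nat \<Rightarrow>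
    (nat \<Rightarrow> ('r, 'p) module) \<Rightarrow> (nat \<Rightarrow> int \<Rightarrow> 'p \<Rightarrow> 'p) \<Rightarrow> (nat \<Rightarrow> 'p \<Rightarrow> 'p) \<Rightarrow> ('p \<Rightarrow> 'm) \<Rightarrow> bool"
  where "gres R pr M q n P Q d \<epsilon> \<longleftrightarrow> finite_resolution R M n P d \<epsilon> \<and>
    (\<forall>i\<le>n. gmod R pr (P i) (Q i) \<and> fgp R pr (P i) (Q i)) \<and>
    (\<forall>i<n. ghom R (P (Suc i)) (Q (Suc i)) (P i) (Q i) (d i)) \<and> ghom R (P 0) (Q 0) M q \<epsilon>"

context gr_ring
begin

lemma fp_free: "finite I \<Longrightarrow> fp R pr 0 (free R I) \<delta>"
  using fgpI[OF _ ghom_id ghom_id] gsub_free by simp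

lemma haspres_zero:
  assumes "gmod R pr M q"
  shows "haspres R pr 0 (M\<lparr>carrier := {\<zero>\<^bsub>M\<^esub>}\<rparr>) q"
proof -
  let ?Z = "M\<lparr>carrier := {\<zero>\<^bsub>M\<^esub>}\<rparr>"
  have Z: "gmod R pr ?Z q" by (rule gmod_sub[OF assms gsubm_zero[OF assms]])
  interpret Z: left_module R ?Z by (rule gmodD[OF Z])
  have "ghom R (lmod R (free R {})) (shift_pr pr (\<lambda>_. 0)) ?Z q (flift ?Z (\<lambda>_. \<zero>\<^bsub>M\<^esub>) {})"
    by (rule flift_ghom[OF Z]) auto
  then have g: "ghom R (lmod R (free R {})) (shift_pr pr (\<lambda>_. 0)) ?Z q (\<lambda>_. \<zero>\<^bsub>M\<^esub>)"
    unfolding flift_def Z.M.finsum_empty by simp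
  have ne: "(\<lambda>_. \<zero>) \<in> free R {}" by (simp add: free_def)
  have "pres R pr {} (\<lambda>_. 0) ?Z q (\<lambda>_. \<zero>\<^bsub>M\<^esub>)"
    using g ne by (auto simp: pres_def)
  moreover have "kern R {} ?Z (\<lambda>_. \<zero>\<^bsub>M\<^esub>) = free R {}" by (simp add: kern_def)
  ultimately show ?thesis using fp_free[of "{}" "\<lambda>_. 0"] unfolding haspres_def by (metis finite.emptyI)
qed

text \<open>A split cover \<open>\<pi>\<close> of \<open>P\<close> by a free module is followed by
  \<open>\<epsilon>\<close>. The kernel of the composite is an extension of the kernel of
  \<open>\<epsilon>\<close> by the kernel of \<open>\<pi>\<close>, and the latter is projective by
  \<open>fp_kern_split\<close>. Replacing a projective by a free module thus alters the syzygy only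
  by a projective.\<close>

lemma haspres_quotient:
  assumes P: "gmod R pr P p" "fgp R pr P p" and M: "gmod R pr M q"
    and \<epsilon>: "ghom R P p M q \<epsilon>" "\<epsilon> ` carrier P = carrier M"
    and K: "haspres R pr m (P\<lparr>carrier := {x \<in> carrier P. \<epsilon> x = \<zero>\<^bsub>M\<^esub>}\<rparr>) p"
  shows "haspres R pr (Suc m) M q"
proof -
  let ?K = "{x \<in> carrier P. \<epsilon> x = \<zero>\<^bsub>M\<^esub>}"
  obtain I \<delta> \<pi> s where \<pi>: "pres R pr I \<delta> P p \<pi>" "ghom R P p (lmod R (free R I)) (shift_pr pr \<delta>) s" "\<forall>x\<in>carrier P. \<pi> (s x) = x"
    using P(2) unfolding fgp_def by blast
  note \<pi>D = ghomD[OF presD(2)[OF \<pi>(1)], simplified] and \<epsilon>D = ghomD[OF \<epsilon>(1)]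
  have c: "pres R pr I \<delta> M q (\<lambda>u. \<epsilon> (\<pi> u))"
    using presD[OF \<pi>(1)] \<epsilon>(2) ghom_comp[OF presD(2)[OF \<pi>(1)] \<epsilon>(1)] by (simp add: pres_def image_image[symmetric])
  let ?Y = "kern R I M (\<lambda>u. \<epsilon> (\<pi> u))"
  have Y: "gsub R pr ?Y \<delta>" by (rule gsub_kern[OF c M])
  have PK: "gmod R pr (P\<lparr>carrier := ?K\<rparr>) p" by (rule gmod_sub[OF P(1) gsubm_kernel[OF P(1) M \<epsilon>(1)]])
  have \<epsilon>0: "\<epsilon> \<zero>\<^bsub>P\<^esub> = \<zero>\<^bsub>M\<^esub>" by (rule addm_zero[OF gmodD(3)[OF P(1)] gmodD(3)[OF M] \<epsilon>D(2)])
  have into: "\<pi> u \<in> ?K" if "u \<in> ?Y" for u using that \<pi>D(3) by (simp add: kern_def)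
  have g: "ghom R (lmod R ?Y) (shift_pr pr \<delta>) (P\<lparr>carrier := ?K\<rparr>) p \<pi>"
    using ghom_restrict[OF presD(2)[OF \<pi>(1)], of ?Y ?K] into by (simp add: kern_def)
  have "haspres R pr m (lmod R ?Y) (shift_pr pr \<delta>)"
  proof (rule haspres_ext[OF gsub_gmod[OF Y] PK g _ _ K])
    show "\<pi> ` carrier (lmod R ?Y) = carrier (P\<lparr>carrier := ?K\<rparr>)"
    proof (intro equalityI subsetI)
      fix x assume "x \<in> carrier (P\<lparr>carrier := ?K\<rparr>)"
      then have x: "x \<in> carrier P" "\<epsilon> x = \<zero>\<^bsub>M\<^esub>" by simp_all
      then have "s x \<in> ?Y" "\<pi> (s x) = x" using \<pi>(3) ghomD(3)[OF \<pi>(2) x(1)] by (simp_all add: kern_def)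
      then show "x \<in> \<pi> ` carrier (lmod R ?Y)" by (intro image_eqI[of x \<pi> "s x"]) simp_all
    qed (use into in auto)
    have "{x \<in> ?Y. \<pi> x = \<zero>\<^bsub>P\<^esub>} = kern R I P \<pi>" using \<epsilon>0 by (auto simp: kern_def)
    moreover have "fp R pr m (kern R I P \<pi>) \<delta>"
      by (rule fp_mono[OF _ fp_kern_split[OF P(1) \<pi>(1,2)]]) (use \<pi>(3) in auto)
    ultimately show "haspres R pr m ((lmod R ?Y)\<lparr>carrier := {x \<in> carrier (lmod R ?Y). \<pi> x = \<zero>\<^bsub>P\<lparr>carrier := ?K\<rparr>\<^esub>}\<rparr>) (shift_pr pr \<delta>)"
      using fp_haspres by simp
  qed
  then have "fp R pr (Suc m) ?Y \<delta>" using Y by (simp only: fp_Suc)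
  then show ?thesis using c unfolding haspres_def by blast
qed

text \<open>Descending induction, starting from the zero module behind the last term. The submodule
  \<open>inc i\<close> of \<open>P i\<close> is a quotient of \<open>P (Suc i)\<close> whose kernel
  is \<open>inc (Suc i)\<close> by exactness, so \<open>haspres_quotient\<close> applies at each
  place and costs one unit of length.\<close>

lemma gres_haspres:
  assumes M: "gmod R pr M q" and res: "gres R pr M q n P Q d \<epsilon>"
  shows "\<exists>m. haspres R pr m M q"
proof -
  define inc where "inc i = (if i < n then d i ` carrier (P (Suc i)) else {\<zero>\<^bsub>P i\<^esub>})" for i
  have P: "gmod R pr (P i) (Q i)" "fgp R pr (P i) (Q i)" if "i \<le> n" for i using res that by (auto simp: gres_def)
  have d: "ghom R (P (Suc i)) (Q (Suc i)) (P i) (Q i) (d i)" if "i < n" for i using res that by (auto simp: gres_def)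
  have \<epsilon>: "ghom R (P 0) (Q 0) M q \<epsilon>" using res by (auto simp: gres_def)
  have ex: "\<epsilon> ` carrier (P 0) = carrier M" "{x \<in> carrier (P 0). \<epsilon> x = \<zero>\<^bsub>M\<^esub>} = inc 0"
    "\<And>i. i < n \<Longrightarrow> {x \<in> carrier (P (Suc i)). d i x = \<zero>\<^bsub>P i\<^esub>} = inc (Suc i)"
    using res by (auto simp: gres_def finite_resolution_def Let_def a_kernel_eq inc_def)
  have "\<exists>m. haspres R pr m ((P i)\<lparr>carrier := inc i\<rparr>) (Q i)" if "i \<le> n" for i
    using that
  proof (induction rule: inc_induct)
    case base
    then show ?case using haspres_zero[OF P(1)[of n]] by (auto simp: inc_def)
  next
    case (step i)
    then obtain m where m: "haspres R pr m ((P (Suc i))\<lparr>carrier := inc (Suc i)\<rparr>) (Q (Suc i))" by blast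
    have i: "i \<le> n" "Suc i \<le> n" using step by simp_all
    have inc: "inc i = d i ` carrier (P (Suc i))" using step by (simp add: inc_def)
    have N: "gmod R pr ((P i)\<lparr>carrier := inc i\<rparr>) (Q i)"
      unfolding inc by (rule gmod_sub[OF P(1)[OF i(1)] gsubm_image[OF P(1)[OF i(2)] P(1)[OF i(1)] d]]) (rule step)
    have g: "ghom R (P (Suc i)) (Q (Suc i)) ((P i)\<lparr>carrier := inc i\<rparr>) (Q i) (d i)"
      by (rule ghom_into[OF d]) (use inc step in auto)
    have "haspres R pr (Suc m) ((P i)\<lparr>carrier := inc i\<rparr>) (Q i)"
      by (rule haspres_quotient[OF P[OF i(2)] N g]) (use inc m ex(3) step in auto)
    then show ?case by blast
  qed
  then obtain m where "haspres R pr m ((P 0)\<lparr>carrier := inc 0\<rparr>) (Q 0)" by blast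
  then have "haspres R pr (Suc m) M q"
    by (intro haspres_quotient[OF P M \<epsilon> ex(1)]) (use ex(2) in auto)
  then show ?thesis by blast
qed

text \<open>The free cover takes position 0 and the resolution of its kernel moves up by one, which
  \<open>case_nat\<close> expresses. The augmentation \<open>e\<close> of the old resolution becomes
  the first differential.\<close>

lemma gres_prepend:
  assumes T: "gmod R pr T q" and \<pi>: "pres R pr I \<delta> T q \<pi>"
    and res: "gres R pr (lmod R (kern R I T \<pi>)) (shift_pr pr \<delta>) n P Q d e"
  shows "gres R pr T q (Suc n) (case_nat (lmod R (free R I)) P) (case_nat (shift_pr pr \<delta>) Q) (case_nat e d) \<pi>"
proof -
  let ?F = "lmod R (free R I)" and ?K = "kern R I T \<pi>"
  have KF: "?K \<subseteq> free R I" by (auto simp: kern_def)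
  have e: "ghom R (P 0) (Q 0) (lmod R ?K) (shift_pr pr \<delta>) e" using res by (simp add: gres_def)
  have e': "ghom R (P 0) (Q 0) ?F (shift_pr pr \<delta>) e"
    using ghom_extend_codomain[of R "P 0" "Q 0" ?K ?F "shift_pr pr \<delta>" e] e KF by simp
  have F: "gmod R pr ?F (shift_pr pr \<delta>)" "fgp R pr ?F (shift_pr pr \<delta>)"
    using gmod_free[OF presD(1)[OF \<pi>]] fp_free[OF presD(1)[OF \<pi>]] by simp_all
  have P: "gmod R pr (P i) (Q i)" "fgp R pr (P i) (Q i)" if "i \<le> n" for i using res that by (auto simp: gres_def)
  have d: "ghom R (P (Suc i)) (Q (Suc i)) (P i) (Q i) (d i)" if "i < n" for i using res that by (auto simp: gres_def)
  have r: "e ` carrier (P 0) = ?K" "a_kernel (P 0) (lmod R ?K) e = (if 0 < n then d 0 ` carrier (P 1) else {\<zero>\<^bsub>P 0\<^esub>})"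
    "\<And>i. i < n \<Longrightarrow> a_kernel (P (Suc i)) (P i) (d i) =
      (if Suc i < n then d (Suc i) ` carrier (P (Suc (Suc i))) else {\<zero>\<^bsub>P (Suc i)\<^esub>})"
    using res by (auto simp: gres_def finite_resolution_def Let_def)
  have "finite_resolution R T (Suc n) (case_nat ?F P) (case_nat e d) \<pi>"
    unfolding finite_resolution_def Let_def
  proof (intro conjI allI impI)
    show "left_module R (case i of 0 \<Rightarrow> ?F | Suc x \<Rightarrow> P x)" if "i \<le> Suc n" for i
      using that gmodD(1)[OF F(1)] gmodD(1)[OF P(1)] by (cases i) auto
    show "(case i of 0 \<Rightarrow> e | Suc x \<Rightarrow> d x) \<in> left_module_hom R (case Suc i of 0 \<Rightarrow> ?F | Suc x \<Rightarrow> P x) (case i of 0 \<Rightarrow> ?F | Suc x \<Rightarrow> P x)"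
      if "i < Suc n" for i
      using that ghomD(1)[OF e'] ghomD(1)[OF d] by (cases i) auto
    show "a_kernel (case Suc i of 0 \<Rightarrow> ?F | Suc x \<Rightarrow> P x) (case i of 0 \<Rightarrow> ?F | Suc x \<Rightarrow> P x) (case i of 0 \<Rightarrow> e | Suc x \<Rightarrow> d x) =
         (if Suc i < Suc n then (case Suc i of 0 \<Rightarrow> e | Suc x \<Rightarrow> d x) ` carrier (case Suc (Suc i) of 0 \<Rightarrow> ?F | Suc x \<Rightarrow> P x)
          else {\<zero>\<^bsub>case Suc i of 0 \<Rightarrow> ?F | Suc x \<Rightarrow> P x\<^esub>})" if "i < Suc n" for i
      using that r(2) r(3) by (cases i) (auto simp: a_kernel_eq)
    show "\<pi> \<in> left_module_hom R (case 0 of 0 \<Rightarrow> ?F | Suc x \<Rightarrow> P x) T" using ghomD(1)[OF presD(2)[OF \<pi>]] by simp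
    show "\<pi> ` carrier (case 0 of 0 \<Rightarrow> ?F | Suc x \<Rightarrow> P x) = carrier T" using presD(3)[OF \<pi>] by simp
    show "a_kernel (case 0 of 0 \<Rightarrow> ?F | Suc x \<Rightarrow> P x) T \<pi> =
      (if 0 < Suc n then (case 0 of 0 \<Rightarrow> e | Suc x \<Rightarrow> d x) ` carrier (case Suc 0 of 0 \<Rightarrow> ?F | Suc x \<Rightarrow> P x)
       else {\<zero>\<^bsub>case 0 of 0 \<Rightarrow> ?F | Suc x \<Rightarrow> P x\<^esub>})"
      using r(1) by (simp add: a_kernel_eq kern_def)
  qed
  moreover have "gmod R pr (case i of 0 \<Rightarrow> ?F | Suc x \<Rightarrow> P x) (case i of 0 \<Rightarrow> shift_pr pr \<delta> | Suc x \<Rightarrow> Q x) \<and>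
      fgp R pr (case i of 0 \<Rightarrow> ?F | Suc x \<Rightarrow> P x) (case i of 0 \<Rightarrow> shift_pr pr \<delta> | Suc x \<Rightarrow> Q x)" if "i \<le> Suc n" for i
    using that F P by (cases i) auto
  moreover have "ghom R (case Suc i of 0 \<Rightarrow> ?F | Suc x \<Rightarrow> P x) (case Suc i of 0 \<Rightarrow> shift_pr pr \<delta> | Suc x \<Rightarrow> Q x)
     (case i of 0 \<Rightarrow> ?F | Suc x \<Rightarrow> P x) (case i of 0 \<Rightarrow> shift_pr pr \<delta> | Suc x \<Rightarrow> Q x) (case i of 0 \<Rightarrow> e | Suc x \<Rightarrow> d x)"
    if "i < Suc n" for i
    using that e' d by (cases i) auto
  ultimately show ?thesis using presD(2)[OF \<pi>] unfolding gres_def by simp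
qed

text \<open>The recursion that defines \<open>fp\<close> is unrolled, one free cover at a time; at
  length 0 the projective \<open>X\<close> is its own resolution.\<close>

lemma fp_gres:
  assumes "fp R pr n X \<delta>"
  shows "\<exists>P Q d e. gres R pr (lmod R X) (shift_pr pr \<delta>) n (P :: nat \<Rightarrow> ('r, nat \<Rightarrow> 'r) module) Q d e"
  using assms
proof (induction n arbitrary: X \<delta>)
  case 0
  let ?M = "lmod R X"
  have M: "gmod R pr ?M (shift_pr pr \<delta>)" "fgp R pr ?M (shift_pr pr \<delta>)" using 0 gsub_gmod by auto
  have "gres R pr ?M (shift_pr pr \<delta>) 0 (\<lambda>_. ?M) (\<lambda>_. shift_pr pr \<delta>) (\<lambda>_ x. x) (\<lambda>x. x)"
    using M gmodD(1)[OF M(1)] ghom_id[of R ?M "shift_pr pr \<delta>"] ghomD(1)[OF ghom_id[of R ?M]] gsubD(2)[OF fp_gsub[OF 0]]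
    by (auto simp: gres_def finite_resolution_def a_kernel_eq)
  then show ?case by blast
next
  case (Suc n)
  then obtain I \<epsilon> \<pi> where P: "pres R pr I \<epsilon> (lmod R X) (shift_pr pr \<delta>) \<pi>" "fp R pr n (kern R I (lmod R X) \<pi>) \<epsilon>" by auto
  obtain P' and Q d e where "gres R pr (lmod R (kern R I (lmod R X) \<pi>)) (shift_pr pr \<epsilon>) n (P' :: nat \<Rightarrow> ('r, nat \<Rightarrow> 'r) module) Q d e"
    using Suc.IH[OF P(2)] by blast
  from gres_prepend[OF gsub_gmod[OF fp_gsub[OF Suc.prems]] P(1) this] show ?case by blast
qed

lemma haspres_gres:
  assumes "gmod R pr T q" "haspres R pr n T q"
  shows "\<exists>P Q d e. gres R pr T q (Suc n) (P :: nat \<Rightarrow> ('r, nat \<Rightarrow> 'r) module) Q d e"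
proof -
  obtain I \<epsilon> \<pi> where P: "pres R pr I \<epsilon> T q \<pi>" "fp R pr n (kern R I T \<pi>) \<epsilon>" using assms(2) unfolding haspres_def by blast
  obtain P' and Q d e where "gres R pr (lmod R (kern R I T \<pi>)) (shift_pr pr \<epsilon>) n (P' :: nat \<Rightarrow> ('r, nat \<Rightarrow> 'r) module) Q d e"
    using fp_gres[OF P(2)] by blast
  from gres_prepend[OF assms(1) P(1) this] show ?thesis by blast
qed

section \<open>Splittings compared with finite generation and lifting properties\<close>

lemma flift_lhom:
  assumes M: "left_module R M" and I: "finite I" "\<And>i. i \<in> I \<Longrightarrow> y i \<in> carrier M"
  shows "flift M y I \<in> left_module_hom R (lmod R (free R I)) M"
proof (rule lhomI[OF flift_addm[OF M I]])
  interpret M: left_module R M by fact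
  fix a x assume x: "a \<in> carrier R" "x \<in> carrier (lmod R (free R I))"
  show "flift M y I (a \<odot>\<^bsub>lmod R (free R I)\<^esub> x) = a \<odot>\<^bsub>M\<^esub> flift M y I x"
    using addm_finsum[OF M.M.abelian_group_axioms M.M.abelian_group_axioms M.smult_addm[OF x(1)] I(1), of "\<lambda>i. x i \<odot>\<^bsub>M\<^esub> y i"] x I(2)
    by (auto simp: flift_def free_def M.smult_assoc1[symmetric] intro!: M.M.finsum_cong')
qed

lemma gsubm_submodule:
  assumes "gmod R pr M q" "gsubm R M q H"
  shows "submodule H R M"
  unfolding submodule_iff[OF gmodD(3)[OF assms(1)]] using gsubmD(1,2)[OF assms(2)] by simp

lemma fgp_finitely_generated:
  assumes "gmod R pr M q" "fgp R pr M q"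
  shows "finitely_generated R M"
proof -
  obtain I \<epsilon> \<pi> where P: "pres R pr I \<epsilon> M q \<pi>" using assms(2) unfolding fgp_def by blast
  note \<pi> = ghomD[OF presD(2)[OF P], simplified]
  let ?S = "(\<lambda>i. \<pi> (elm R i \<one>)) ` I"
  have S: "?S \<subseteq> carrier M" using \<pi>(3) by auto
  have "x \<in> H" if x: "x \<in> carrier M" and H: "submodule H R M" "?S \<subseteq> H" for x H
  proof -
    obtain u where u: "u \<in> free R I" "x = \<pi> u" using presD(3)[OF P] x by blast
    have HD: "add_closed M H" "\<And>a x. a \<in> carrier R \<Longrightarrow> x \<in> H \<Longrightarrow> a \<odot>\<^bsub>M\<^esub> x \<in> H"
      using H(1) submodule_iff[OF gmodD(3)[OF assms(1)]] by auto
    have "\<pi> u \<in> H"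
    proof (rule addm_acl[OF abelian_group_free[OF abelian_group_axioms] gmodD(3)[OF assms(1)] \<pi>(2) _ _ HD(1)
          free_gen[OF abelian_group_axioms presD(1)[OF P] u(1)]])
      fix x assume "x \<in> {elm R i r |i r. i \<in> I \<and> r \<in> carrier R}"
      then obtain i r where ir: "x = elm R i r" "i \<in> I" "r \<in> carrier R" by auto
      have "elm R i r = (\<lambda>j. r \<otimes> elm R i \<one> j)" using ir by (auto simp: elm_def)
      then have "\<pi> x = r \<odot>\<^bsub>M\<^esub> \<pi> (elm R i \<one>)" using \<pi>(5)[of r "elm R i \<one>"] ir by simp
      then show "\<pi> x \<in> H" using HD(2) H(2) ir by auto
    qed auto
    then show ?thesis using u by simp
  qed
  moreover have "submodule (carrier M) R M" by (rule gsubm_submodule[OF assms(1) gsubm_carrier[OF assms(1)]])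
  ultimately have "(\<lambda>H. submodule H R M) hull ?S = carrier M"
    using S by (intro hull_unique) auto
  then show ?thesis using S presD(1)[OF P] unfolding finitely_generated_def by (metis finite_imageI)
qed

text \<open>Generators in the sense of \<open>finitely_generated\<close> need not be homogeneous.
  They are replaced by their homogeneous components, finitely many in total, and the pairs in
  \<open>?T\<close> are renumbered by natural numbers to serve as an index set.\<close>

lemma finitely_generated_pres:
  assumes M: "gmod R pr M q" and fg: "finitely_generated R M"
  shows "\<exists>I \<epsilon> \<pi>. pres R pr I \<epsilon> M q \<pi>"
proof -
  interpret M: left_module R M by (rule gmodD[OF M])
  interpret gM: grading M q by (rule gmodD[OF M])
  obtain S where S: "finite S" "S \<subseteq> carrier M" "(\<lambda>H. submodule H R M) hull S = carrier M"
    using fg unfolding finitely_generated_def by blast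
  have "\<exists>J. finite J \<and> x = (\<Oplus>\<^bsub>M\<^esub>j\<in>J. q j x)" if "x \<in> S" for x
    using gM.finite_decomposition[of x] S(2) that by blast
  then obtain J where J: "\<And>x. x \<in> S \<Longrightarrow> finite (J x)" "\<And>x. x \<in> S \<Longrightarrow> x = (\<Oplus>\<^bsub>M\<^esub>j\<in>J x. q j x)" by metis
  let ?T = "SIGMA x:S. J x"
  have T: "finite ?T" using S(1) J(1) by auto
  obtain t where t: "bij_betw t {0..<card ?T} ?T" using ex_bij_betw_nat_finite[OF T] by blast
  define I where "I = {0..<card ?T}"
  define y where "y i = q (snd (t i)) (fst (t i))" for i
  define \<epsilon> where "\<epsilon> i = snd (t i)" for i
  have tI: "t i \<in> ?T" if "i \<in> I" for i using bij_betwE[OF t] that by (simp add: I_def)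
  have tS: "fst (t i) \<in> carrier M" if "i \<in> I" for i using tI[OF that] S(2) by auto
  have y: "\<And>i. i \<in> I \<Longrightarrow> y i \<in> carrier M" "\<And>i. i \<in> I \<Longrightarrow> q (\<epsilon> i) (y i) = y i"
    using tS by (simp_all add: y_def \<epsilon>_def gM.q_orth)
  let ?\<pi> = "flift M y I"
  have I: "finite I" by (simp add: I_def)
  have g: "ghom R (lmod R (free R I)) (shift_pr pr \<epsilon>) M q ?\<pi>" by (rule flift_ghom[OF M I y])
  let ?H = "?\<pi> ` free R I"
  have H: "gsubm R M q ?H" using gsubm_image[OF gmod_free[OF I] M g] by simp
  have "S \<subseteq> ?H"
  proof
    fix x assume x: "x \<in> S"
    have "q j x \<in> ?H" if "j \<in> J x" for j
    proof -
      have "(x, j) \<in> t ` I" using t x that by (simp add: bij_betw_def I_def)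
      then obtain i where i: "i \<in> I" "t i = (x, j)" by (metis imageE)
      have "?\<pi> (elm R i \<one>) = y i" using flift_elm[OF gmodD(1)[OF M] I y(1) i(1)] y(1)[OF i(1)] by simp
      then have "q j x = ?\<pi> (elm R i \<one>)" using i by (simp add: y_def)
      then show ?thesis using i by auto
    qed
    from M.M.add_closed_finsum[OF gsubmD(1)[OF H] this]
    show "x \<in> ?H" by (subst J(2)[OF x])
  qed
  then have "carrier M \<subseteq> ?H" using hull_minimal[of S ?H "\<lambda>H. submodule H R M"] gsubm_submodule[OF M H] S(3) by simp
  then have "?H = carrier M" using gsubmD(4)[OF H] by blast
  then have "pres R pr I \<epsilon> M q ?\<pi>" using I g by (simp add: pres_def)
  then show ?thesis by blast
qed

text \<open>The lift passes through the free module, where the images of the basis can be prescribed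
  freely, and \<open>s\<close> carries it back to \<open>P\<close>. Test modules of any type
  \<open>'u\<close> are therefore allowed.\<close>

lemma fgp_projective:
  assumes P: "gmod R pr P p" "fgp R pr P p"
  shows "projective_wrt TYPE('u) R P"
  unfolding projective_wrt_def
proof (intro allI impI, elim conjE)
  fix M N :: "('r, 'u) module" and g f
  assume M: "left_module R M" and N: "left_module R N" and g: "g \<in> left_module_hom R M N" "g ` carrier M = carrier N"
    and f: "f \<in> left_module_hom R P N"
  obtain I \<epsilon> \<pi> s where \<pi>: "pres R pr I \<epsilon> P p \<pi>" "ghom R P p (lmod R (free R I)) (shift_pr pr \<epsilon>) s" "\<forall>x\<in>carrier P. \<pi> (s x) = x"
    using P(2) unfolding fgp_def by blast
  note \<pi>D = ghomD[OF presD(2)[OF \<pi>(1)], simplified] and sD = ghomD[OF \<pi>(2), simplified]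
  note I = presD(1)[OF \<pi>(1)]
  have "\<exists>y\<in>carrier M. g y = f (\<pi> (elm R i \<one>))" if "i \<in> I" for i
  proof -
    have "f (\<pi> (elm R i \<one>)) \<in> g ` carrier M"
      unfolding g(2) using that \<pi>D(3) addm_closed[OF lhomD(1)[OF f]] by simp
    then show ?thesis by (metis imageE)
  qed
  then obtain y where y: "\<And>i. i \<in> I \<Longrightarrow> y i \<in> carrier M" "\<And>i. i \<in> I \<Longrightarrow> g (y i) = f (\<pi> (elm R i \<one>))" by metis
  let ?h = "flift M y I"
  have h: "?h \<in> left_module_hom R (lmod R (free R I)) M" by (rule flift_lhom[OF M I y(1)])
  interpret M: left_module R M by fact
  have comp: "(\<lambda>x. k (l x)) \<in> left_module_hom R A C" if "l \<in> left_module_hom R A B" "k \<in> left_module_hom R B C"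
    for k l and A :: "('r, 'x) module" and B :: "('r, 'y) module" and C :: "('r, 'z) module"
    using that addm_comp[OF lhomD(1)[OF that(1)] lhomD(1)[OF that(2)]] addm_closed[OF lhomD(1)[OF that(1)]]
    by (intro lhomI) (auto simp: lhomD(2))
  have eq: "g (?h u) = f (\<pi> u)" if "u \<in> free R I" for u
    by (rule lhom_eq_free[OF N comp[OF h g(1)] comp[OF \<pi>D(1) f] I _ that])
      (simp add: flift_elm[OF M I y(1)] y)
  have "(\<lambda>x. ?h (s x)) \<in> left_module_hom R P M" by (rule comp[OF sD(1) h])
  moreover have "\<forall>x\<in>carrier P. g (?h (s x)) = f x" using eq sD(3) \<pi>(3) by auto
  ultimately show "\<exists>h\<in>left_module_hom R P M. \<forall>x\<in>carrier P. g (h x) = f x" by (intro bexI[of _ "\<lambda>x. ?h (s x)"])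
qed

lemma projective_fgp:
  assumes P: "gmod R pr P p" "finitely_generated R P"
    and lift: "\<And>I \<epsilon> \<pi>. pres R pr I \<epsilon> P p \<pi> \<Longrightarrow>
      \<exists>s. ghom R P p (lmod R (free R I)) (shift_pr pr \<epsilon>) s \<and> (\<forall>x\<in>carrier P. \<pi> (s x) = x)"
  shows "fgp R pr P p"
  using finitely_generated_pres[OF P] lift unfolding fgp_def by blast

end

text \<open>Ring degrees are natural numbers in \<open>G\<close> but integers in \<open>pr\<close>,
  to match the integer degrees of modules; the projections to negative degrees vanish.\<close>

locale nat_gr_ring = gr_ring R pr for R (structure) and pr :: "int \<Rightarrow> 'r \<Rightarrow> 'r" and G :: "nat \<Rightarrow> 'r set" +
  assumes G_eq: "G n = {r \<in> carrier R. pr (int n) r = r}"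
    and pr_neg: "j < 0 \<Longrightarrow> r \<in> carrier R \<Longrightarrow> pr j r = \<zero>"
begin

text \<open>Both sides of the shift identity in \<open>gmod\<close> are additive in
  \<open>a\<close>, so \<open>a\<close> may be homogeneous. By \<open>smult_degree\<close> both
  sides are then the product itself if \<open>n\<close> is the sum of the two degrees, and zero
  otherwise.\<close>

lemma graded_module_gmod:
  assumes "graded_module R G M H"
  shows "\<exists>q. gmod R pr M q \<and> H = (\<lambda>j. {x \<in> carrier M. q j x = x})"
proof -
  interpret M: graded_module R G M H by fact
  obtain q where q: "grading M q" "\<And>j. H j = {x \<in> carrier M. q j x = x}"
    using internal_direct_sum_grading[OF M.M.abelian_group_axioms M.direct_sum] by blast
  interpret gM: grading M q by fact
  have "q n (a \<odot>\<^bsub>M\<^esub> y) = pr (n - e) a \<odot>\<^bsub>M\<^esub> y" if a: "a \<in> carrier R" and y: "y \<in> carrier M" "q e y = y" for a y e n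
  proof (rule addm_eq_on_acl[OF abelian_group_axioms M.M.abelian_group_axioms
        addm_comp[OF M.smult_addm_left[OF y(1)] gM.q_addm] addm_comp[OF q_addm M.smult_addm_left[OF y(1)]] _ _ q_gen[OF a]])
    fix a assume "a \<in> {y \<in> carrier R. \<exists>i. pr i y = y}"
    then obtain j where j: "a \<in> carrier R" "pr j a = a" by auto
    show "q n (a \<odot>\<^bsub>M\<^esub> y) = pr (n - e) a \<odot>\<^bsub>M\<^esub> y"
    proof (cases "j < 0")
      case True
      then have "a = \<zero>" using pr_neg j by metis
      then show ?thesis using y by simp
    next
      case False
      then have "a \<in> G (nat j)" "y \<in> H e" using j y by (simp_all add: G_eq q(2))
      from M.smult_degree[OF this] have "a \<odot>\<^bsub>M\<^esub> y \<in> H (j + e)" using False by simp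
      then have 1: "q (j + e) (a \<odot>\<^bsub>M\<^esub> y) = a \<odot>\<^bsub>M\<^esub> y" by (simp add: q(2))
      show ?thesis
      proof (cases "n = j + e")
        case True
        then show ?thesis using 1 j by simp
      next
        case False
        then have "n - e \<noteq> j" by simp
        then show ?thesis using False gM.q_other[OF _ 1 False] q_other[OF j] j y by simp
      qed
    qed
  qed auto
  then have "gmod R pr M q" using q(1) M.left_module_axioms by (simp add: gmod_def)
  then show ?thesis using q(2) by blast
qed

lemma gmod_graded_module:
  assumes "gmod R pr M q"
  shows "graded_module R G M (\<lambda>j. {x \<in> carrier M. q j x = x})"
proof -
  interpret M: left_module R M by (rule gmodD[OF assms])
  interpret gM: grading M q by (rule gmodD[OF assms])
  show ?thesis
  proof (intro graded_module.intro graded_module_axioms.intro M.left_module_axioms gM.internal_direct_sum)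
    fix a m x j assume "a \<in> G m" "x \<in> {x \<in> carrier M. q j x = x}"
    then have a: "a \<in> carrier R" "pr (int m) a = a" and x: "x \<in> carrier M" "q j x = x" by (auto simp: G_eq)
    show "a \<odot>\<^bsub>M\<^esub> x \<in> {x \<in> carrier M. q (int m + j) x = x}"
      using gmodD(4)[OF assms a(1) x, of "int m + j"] a x by simp
  qed
qed

lemma ghom_graded_hom:
  assumes "ghom R M q N q' f"
  shows "f \<in> graded_hom R M (\<lambda>j. {x \<in> carrier M. q j x = x}) N (\<lambda>j. {x \<in> carrier N. q' j x = x})"
  using ghomD[OF assms] unfolding graded_hom_def by (auto simp: image_subset_iff) (metis)

text \<open>Commuting with the projections is additive in the element, and on homogeneous elements
  it amounts to preservation of degrees.\<close>

lemma graded_hom_ghom: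
  assumes M: "gmod R pr M q" and N: "gmod R pr N q'"
    and f: "f \<in> graded_hom R M (\<lambda>j. {x \<in> carrier M. q j x = x}) N (\<lambda>j. {x \<in> carrier N. q' j x = x})"
  shows "ghom R M q N q' f"
proof -
  have fh: "f \<in> left_module_hom R M N" using f by (simp add: graded_hom_def)
  note fD = lhomD[OF fh]
  interpret gM: grading M q by (rule gmodD[OF M])
  interpret gN: grading N q' by (rule gmodD[OF N])
  show ?thesis
  proof (rule ghomI[OF fD])
    fix j x assume x: "x \<in> carrier M"
    show "f (q j x) = q' j (f x)"
    proof (rule addm_eq_on_acl[OF gM.abelian_group_axioms gN.abelian_group_axioms addm_comp[OF gM.q_addm fD(1)]
          addm_comp[OF fD(1) gN.q_addm] _ _ gM.q_gen[OF x]])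
      fix y assume "y \<in> {y \<in> carrier M. \<exists>i. q i y = y}"
      then obtain i where y: "y \<in> carrier M" "q i y = y" by auto
      have "f y \<in> {x \<in> carrier N. q' i x = x}" using f y unfolding graded_hom_def by blast
      then have fy: "f y \<in> carrier N" "q' i (f y) = f y" by auto
      have "f \<zero>\<^bsub>M\<^esub> = \<zero>\<^bsub>N\<^esub>" by (rule addm_zero[OF gM.abelian_group_axioms gN.abelian_group_axioms fD(1)])
      then show "f (q j y) = q' j (f y)"
        using y fy gM.q_other[OF y] gN.q_other[OF fy] by (cases "j = i") auto
    qed auto
  qed
qed

lemma fgp_graded_projective:
  assumes P: "gmod R pr P p" "fgp R pr P p"
  shows "graded_projective_wrt TYPE('u) R G P (\<lambda>j. {x \<in> carrier P. p j x = x})"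
  unfolding graded_projective_wrt_def
proof (intro allI impI, elim conjE)
  fix M N :: "('r, 'u) module" and H L g f
  assume MH: "graded_module R G M H" and NL: "graded_module R G N L" and g: "g \<in> graded_hom R M H N L" "g ` carrier M = carrier N"
    and f: "f \<in> graded_hom R P (\<lambda>j. {x \<in> carrier P. p j x = x}) N L"
  obtain q where M: "gmod R pr M q" "H = (\<lambda>j. {x \<in> carrier M. q j x = x})" using graded_module_gmod[OF MH] by blast
  obtain q' where N: "gmod R pr N q'" "L = (\<lambda>j. {x \<in> carrier N. q' j x = x})" using graded_module_gmod[OF NL] by blast
  have g': "ghom R M q N q' g" by (rule graded_hom_ghom[OF M(1) N(1)]) (use g M N in simp)
  have f': "ghom R P p N q' f" by (rule graded_hom_ghom[OF P(1) N(1)]) (use f N in simp)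
  obtain I \<epsilon> \<pi> s where \<pi>: "pres R pr I \<epsilon> P p \<pi>" "ghom R P p (lmod R (free R I)) (shift_pr pr \<epsilon>) s" "\<forall>x\<in>carrier P. \<pi> (s x) = x"
    using P(2) unfolding fgp_def by blast
  obtain h where h: "ghom R (lmod R (free R I)) (shift_pr pr \<epsilon>) M q h" "\<forall>u\<in>free R I. g (h u) = f (\<pi> u)"
    using free_lift[OF M(1) N(1) g' g(2) presD(1)[OF \<pi>(1)] ghom_comp[OF presD(2)[OF \<pi>(1)] f']] by blast
  have "(\<lambda>x. h (s x)) \<in> graded_hom R P (\<lambda>j. {x \<in> carrier P. p j x = x}) M H"
    unfolding M(2) by (rule ghom_graded_hom[OF ghom_comp[OF \<pi>(2) h(1)]])
  moreover have "\<forall>x\<in>carrier P. g (h (s x)) = f x" using h(2) ghomD(3)[OF \<pi>(2)] \<pi>(3) by auto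
  ultimately show "\<exists>h\<in>graded_hom R P (\<lambda>j. {x \<in> carrier P. p j x = x}) M H. \<forall>x\<in>carrier P. g (h x) = f x"
    by (intro bexI[of _ "\<lambda>x. h (s x)"])
qed

end

section \<open>Linear functionals over a field\<close>

definition fnl :: "('k, 'c) ring_scheme \<Rightarrow> ('k, 'v) module \<Rightarrow> ('v \<Rightarrow> 'k) \<Rightarrow> bool"
  where "fnl K V \<phi> \<longleftrightarrow> addm V K \<phi> \<and> (\<forall>c\<in>carrier K. \<forall>x\<in>carrier V. \<phi> (c \<odot>\<^bsub>V\<^esub> x) = c \<otimes>\<^bsub>K\<^esub> \<phi> x)"

definition sbsp :: "('k, 'c) ring_scheme \<Rightarrow> ('k, 'v) module \<Rightarrow> 'v set \<Rightarrow> bool"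
  where "sbsp K V H \<longleftrightarrow> add_closed V H \<and> (\<forall>c\<in>carrier K. \<forall>x\<in>H. c \<odot>\<^bsub>V\<^esub> x \<in> H)"

lemma sbspD:
  assumes "sbsp K V H"
  shows "add_closed V H" "\<And>c x. c \<in> carrier K \<Longrightarrow> x \<in> H \<Longrightarrow> c \<odot>\<^bsub>V\<^esub> x \<in> H" "\<And>x. x \<in> H \<Longrightarrow> x \<in> carrier V"
    "\<zero>\<^bsub>V\<^esub> \<in> H" "\<And>x y. x \<in> H \<Longrightarrow> y \<in> H \<Longrightarrow> x \<oplus>\<^bsub>V\<^esub> y \<in> H" "\<And>x. x \<in> H \<Longrightarrow> \<ominus>\<^bsub>V\<^esub> x \<in> H"
    "\<And>x y. x \<in> H \<Longrightarrow> y \<in> H \<Longrightarrow> x \<ominus>\<^bsub>V\<^esub> y \<in> H"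
  using assms add_closedD[of V H] by (auto simp: sbsp_def)

lemma sbspI:
  assumes "add_closed V H" "\<And>c x. c \<in> carrier K \<Longrightarrow> x \<in> H \<Longrightarrow> c \<odot>\<^bsub>V\<^esub> x \<in> H"
  shows "sbsp K V H"
  using assms by (auto simp: sbsp_def)

lemma sbsp_add_line:
  assumes "module K V" "sbsp K V H" "x \<in> carrier V"
  shows "sbsp K V {a \<odot>\<^bsub>V\<^esub> x \<oplus>\<^bsub>V\<^esub> h | a h. a \<in> carrier K \<and> h \<in> H}" (is "sbsp K V ?L")
    and "H \<subseteq> {a \<odot>\<^bsub>V\<^esub> x \<oplus>\<^bsub>V\<^esub> h | a h. a \<in> carrier K \<and> h \<in> H}" (is "H \<subseteq> _")
    and "x \<in> {a \<odot>\<^bsub>V\<^esub> x \<oplus>\<^bsub>V\<^esub> h | a h. a \<in> carrier K \<and> h \<in> H}" (is "x \<in> _")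
proof -
  interpret module K V by fact
  note H = sbspD[OF assms(2)]
  show "H \<subseteq> ?L"
  proof
    fix h assume h: "h \<in> H"
    then have "h = \<zero>\<^bsub>K\<^esub> \<odot>\<^bsub>V\<^esub> x \<oplus>\<^bsub>V\<^esub> h" using H(3) assms(3) by simp
    then show "h \<in> ?L" using h R.zero_closed by blast
  qed
  have "x = \<one>\<^bsub>K\<^esub> \<odot>\<^bsub>V\<^esub> x \<oplus>\<^bsub>V\<^esub> \<zero>\<^bsub>V\<^esub>" using assms(3) by simp
  then show "x \<in> ?L" using H(4) R.one_closed by blast
  show "sbsp K V ?L"
  proof (rule sbspI[OF add_closedI])
    show "?L \<subseteq> carrier V" using H(3) assms(3) by auto
    show "\<zero>\<^bsub>V\<^esub> \<in> ?L" using \<open>H \<subseteq> ?L\<close> H(4) by blast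
    show "y \<oplus>\<^bsub>V\<^esub> z \<in> ?L" if yz: "y \<in> ?L" "z \<in> ?L" for y z
    proof -
      from yz obtain a h b k where y: "y = a \<odot>\<^bsub>V\<^esub> x \<oplus>\<^bsub>V\<^esub> h" "a \<in> carrier K" "h \<in> H"
        and z: "z = b \<odot>\<^bsub>V\<^esub> x \<oplus>\<^bsub>V\<^esub> k" "b \<in> carrier K" "k \<in> H" by auto
      have "y \<oplus>\<^bsub>V\<^esub> z = (a \<oplus>\<^bsub>K\<^esub> b) \<odot>\<^bsub>V\<^esub> x \<oplus>\<^bsub>V\<^esub> (h \<oplus>\<^bsub>V\<^esub> k)"
        using y z H(3) assms(3) by (simp add: smult_l_distr M.a_ac)
      then show ?thesis using y z H(5) R.a_closed by blast
    qed
    show "c \<odot>\<^bsub>V\<^esub> y \<in> ?L" if c: "c \<in> carrier K" and y: "y \<in> ?L" for c y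
    proof -
      from y obtain a h where y: "y = a \<odot>\<^bsub>V\<^esub> x \<oplus>\<^bsub>V\<^esub> h" "a \<in> carrier K" "h \<in> H" by auto
      have "c \<odot>\<^bsub>V\<^esub> y = (c \<otimes>\<^bsub>K\<^esub> a) \<odot>\<^bsub>V\<^esub> x \<oplus>\<^bsub>V\<^esub> c \<odot>\<^bsub>V\<^esub> h"
        using y c H(3) assms(3) by (simp add: smult_r_distr smult_assoc1)
      then show ?thesis using y c H(2) R.m_closed by blast
    qed
    show "\<ominus>\<^bsub>V\<^esub> y \<in> ?L" if y: "y \<in> ?L" for y
    proof -
      from y obtain a h where y: "y = a \<odot>\<^bsub>V\<^esub> x \<oplus>\<^bsub>V\<^esub> h" "a \<in> carrier K" "h \<in> H" by auto
      have "\<ominus>\<^bsub>V\<^esub> y = (\<ominus>\<^bsub>K\<^esub> a) \<odot>\<^bsub>V\<^esub> x \<oplus>\<^bsub>V\<^esub> (\<ominus>\<^bsub>V\<^esub> h)"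
        using y H(3) assms(3) by (simp add: smult_l_minus M.minus_add)
      then show ?thesis using y H(6) R.a_inv_closed by blast
    qed
  qed
qed

text \<open>Zorn's lemma gives a subspace \<open>H\<close> maximal among those that contain
  \<open>W\<close> but not \<open>w\<close>. Maximality makes \<open>H\<close> complementary to the
  line spanned by \<open>w\<close>, and the functional reads off the coefficient of
  \<open>w\<close>.\<close>

lemma functional_exists:
  assumes K: "field K" and V: "module K V" and W: "sbsp K V W" and w: "w \<in> carrier V" "w \<notin> W"
  shows "\<exists>\<phi>. fnl K V \<phi> \<and> (\<forall>x\<in>W. \<phi> x = \<zero>\<^bsub>K\<^esub>) \<and> \<phi> w = \<one>\<^bsub>K\<^esub>"
proof -
  interpret K: field K by fact
  interpret module K V by fact
  define F where "F = {H. sbsp K V H \<and> W \<subseteq> H \<and> w \<notin> H}"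
  have "\<exists>H\<in>F. \<forall>X\<in>F. H \<subseteq> X \<longrightarrow> X = H"
  proof (rule subset_Zorn_nonempty)
    show "F \<noteq> {}" using W w by (auto simp: F_def)
    fix \<C> assume ne: "\<C> \<noteq> {}" and ch: "subset.chain F \<C>"
    have sub: "H \<in> F" if "H \<in> \<C>" for H using ch that by (auto simp: subset.chain_def)
    have subs: "sbsp K V H" if "H \<in> \<C>" for H using sub[OF that] by (simp add: F_def)
    have two: "\<exists>H\<in>\<C>. x \<in> H \<and> y \<in> H" if "x \<in> \<Union>\<C>" "y \<in> \<Union>\<C>" for x y
    proof -
      from that obtain X Y where XY: "X \<in> \<C>" "Y \<in> \<C>" "x \<in> X" "y \<in> Y" by blast
      then have "X \<subseteq> Y \<or> Y \<subseteq> X" using ch by (auto simp: subset_chain_def)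
      then show ?thesis using XY by blast
    qed
    have "sbsp K V (\<Union>\<C>)"
    proof (rule sbspI[OF add_closedI])
      show "\<Union>\<C> \<subseteq> carrier V" using sub sbspD(3) by (fastforce simp: F_def)
      show "\<zero>\<^bsub>V\<^esub> \<in> \<Union>\<C>" using ne sub sbspD(4) by (fastforce simp: F_def)
      show "x \<oplus>\<^bsub>V\<^esub> y \<in> \<Union>\<C>" if xy: "x \<in> \<Union>\<C>" "y \<in> \<Union>\<C>" for x y
      proof -
        obtain H where "H \<in> \<C>" "x \<in> H" "y \<in> H" using two[OF xy] by blast
        then show ?thesis using sbspD(5)[OF subs] by blast
      qed
      show "\<ominus>\<^bsub>V\<^esub> x \<in> \<Union>\<C>" if "x \<in> \<Union>\<C>" for x
        using that sbspD(6)[OF subs] by blast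
      show "c \<odot>\<^bsub>V\<^esub> x \<in> \<Union>\<C>" if "c \<in> carrier K" "x \<in> \<Union>\<C>" for c x
        using that sbspD(2)[OF subs] by blast
    qed
    then show "\<Union>\<C> \<in> F" using ne sub by (fastforce simp: F_def)
  qed
  then obtain H where HF: "H \<in> F" and "\<forall>X\<in>F. H \<subseteq> X \<longrightarrow> X = H" by blast
  then have max: "\<And>X. X \<in> F \<Longrightarrow> H \<subseteq> X \<Longrightarrow> X = H" by simp
  from HF have H: "sbsp K V H" "W \<subseteq> H" "w \<notin> H" by (simp_all add: F_def)
  note HD = sbspD[OF H(1)]
  have ex: "\<exists>c\<in>carrier K. x \<ominus>\<^bsub>V\<^esub> c \<odot>\<^bsub>V\<^esub> w \<in> H" if x: "x \<in> carrier V" for x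
  proof (cases "x \<in> H")
    case True
    then show ?thesis using x w by (intro bexI[of _ "\<zero>\<^bsub>K\<^esub>"]) (simp_all add: M.diff_zero)
  next
    case False
    \<comment> \<open>By maximality, adjoining \<open>x\<close> to \<open>H\<close> captures
      \<open>w\<close>. The coefficient of \<open>x\<close> in \<open>w\<close> is nonzero, and
      inverting it expresses \<open>x\<close> through \<open>w\<close> modulo
      \<open>H\<close>.\<close>
    let ?L = "{a \<odot>\<^bsub>V\<^esub> x \<oplus>\<^bsub>V\<^esub> h | a h. a \<in> carrier K \<and> h \<in> H}"
    note L = sbsp_add_line[OF V H(1) x]
    have "?L \<notin> F" using max[of ?L] L False by blast
    then have "w \<in> ?L" using L(1,2) H(2) unfolding F_def by blast
    then obtain a h where a: "w = a \<odot>\<^bsub>V\<^esub> x \<oplus>\<^bsub>V\<^esub> h" "a \<in> carrier K" "h \<in> H" by auto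
    have a0: "a \<noteq> \<zero>\<^bsub>K\<^esub>"
    proof
      assume "a = \<zero>\<^bsub>K\<^esub>"
      then have "w = h" using a x HD(3) by simp
      then show False using a H(3) by simp
    qed
    define b where "b = inv\<^bsub>K\<^esub> a"
    have b: "b \<in> carrier K" "b \<otimes>\<^bsub>K\<^esub> a = \<one>\<^bsub>K\<^esub>"
      using a(2) a0 K.field_Units by (auto simp: b_def)
    have h: "h \<in> carrier V" using HD(3) a(3) .
    have "b \<odot>\<^bsub>V\<^esub> w = x \<oplus>\<^bsub>V\<^esub> b \<odot>\<^bsub>V\<^esub> h"
      using a b x h by (simp add: smult_r_distr smult_assoc1[symmetric])
    then have "x \<ominus>\<^bsub>V\<^esub> b \<odot>\<^bsub>V\<^esub> w = \<ominus>\<^bsub>V\<^esub> (b \<odot>\<^bsub>V\<^esub> h)"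
      using x h b by (simp add: a_minus_def M.minus_add M.a_assoc[symmetric] M.r_neg)
    then have "x \<ominus>\<^bsub>V\<^esub> b \<odot>\<^bsub>V\<^esub> w \<in> H" using HD(6)[OF HD(2)[OF b(1) a(3)]] by simp
    then show ?thesis using b(1) by blast
  qed
  \<comment> \<open>Two different coefficients would put a nonzero multiple of \<open>w\<close> into
    \<open>H\<close>, and so \<open>w\<close> itself.\<close>
  have uniq: "c = c'" if c: "c \<in> carrier K" "c' \<in> carrier K" "x \<ominus>\<^bsub>V\<^esub> c \<odot>\<^bsub>V\<^esub> w \<in> H" "x \<ominus>\<^bsub>V\<^esub> c' \<odot>\<^bsub>V\<^esub> w \<in> H" "x \<in> carrier V" for x c c'
  proof (rule ccontr)
    assume ne: "c \<noteq> c'"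
    have "(x \<ominus>\<^bsub>V\<^esub> c \<odot>\<^bsub>V\<^esub> w) \<ominus>\<^bsub>V\<^esub> (x \<ominus>\<^bsub>V\<^esub> c' \<odot>\<^bsub>V\<^esub> w) = (c' \<ominus>\<^bsub>K\<^esub> c) \<odot>\<^bsub>V\<^esub> w"
    proof -
      have "(x \<ominus>\<^bsub>V\<^esub> c \<odot>\<^bsub>V\<^esub> w) \<ominus>\<^bsub>V\<^esub> (x \<ominus>\<^bsub>V\<^esub> c' \<odot>\<^bsub>V\<^esub> w) =
          (x \<oplus>\<^bsub>V\<^esub> \<ominus>\<^bsub>V\<^esub> x) \<oplus>\<^bsub>V\<^esub> (c' \<odot>\<^bsub>V\<^esub> w \<oplus>\<^bsub>V\<^esub> \<ominus>\<^bsub>V\<^esub> (c \<odot>\<^bsub>V\<^esub> w))"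
        using c w by (simp add: a_minus_def M.minus_add M.a_ac)
      also have "\<dots> = (c' \<ominus>\<^bsub>K\<^esub> c) \<odot>\<^bsub>V\<^esub> w"
        using c w by (simp add: a_minus_def M.r_neg smult_l_distr smult_l_minus)
      finally show ?thesis .
    qed
    then have d: "(c' \<ominus>\<^bsub>K\<^esub> c) \<odot>\<^bsub>V\<^esub> w \<in> H" using HD(7)[OF c(3,4)] by simp
    have d0: "c' \<ominus>\<^bsub>K\<^esub> c \<noteq> \<zero>\<^bsub>K\<^esub>" using ne K.diff_zero_eq[of c' c] c(1,2) by blast
    have dc: "c' \<ominus>\<^bsub>K\<^esub> c \<in> carrier K" using c by simp
    have "inv\<^bsub>K\<^esub> (c' \<ominus>\<^bsub>K\<^esub> c) \<odot>\<^bsub>V\<^esub> ((c' \<ominus>\<^bsub>K\<^esub> c) \<odot>\<^bsub>V\<^esub> w) \<in> H"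
      by (rule HD(2)[OF _ d]) (use d0 dc K.field_Units in auto)
    moreover have "inv\<^bsub>K\<^esub> (c' \<ominus>\<^bsub>K\<^esub> c) \<odot>\<^bsub>V\<^esub> ((c' \<ominus>\<^bsub>K\<^esub> c) \<odot>\<^bsub>V\<^esub> w) = w"
      using d0 dc w K.field_Units by (subst smult_assoc1[symmetric]) auto
    ultimately show False using H(3) by simp
  qed
  define \<phi> where "\<phi> x = (SOME c. c \<in> carrier K \<and> x \<ominus>\<^bsub>V\<^esub> c \<odot>\<^bsub>V\<^esub> w \<in> H)" for x
  have \<phi>: "\<phi> x \<in> carrier K" "x \<ominus>\<^bsub>V\<^esub> \<phi> x \<odot>\<^bsub>V\<^esub> w \<in> H" if "x \<in> carrier V" for x
    using someI_ex[of "\<lambda>c. c \<in> carrier K \<and> x \<ominus>\<^bsub>V\<^esub> c \<odot>\<^bsub>V\<^esub> w \<in> H"] ex[OF that] unfolding \<phi>_def by blast+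
  have \<phi>I: "\<phi> x = c" if "x \<in> carrier V" "c \<in> carrier K" "x \<ominus>\<^bsub>V\<^esub> c \<odot>\<^bsub>V\<^esub> w \<in> H" for x c
    using uniq[OF \<phi>(1)[OF that(1)] that(2) \<phi>(2)[OF that(1)] that(3,1)] .
  have "fnl K V \<phi>"
    unfolding fnl_def
  proof (intro conjI ballI addmI)
    fix x y assume x: "x \<in> carrier V" "y \<in> carrier V"
    show "\<phi> (x \<oplus>\<^bsub>V\<^esub> y) = \<phi> x \<oplus>\<^bsub>K\<^esub> \<phi> y"
    proof (rule \<phi>I)
      have "(x \<oplus>\<^bsub>V\<^esub> y) \<ominus>\<^bsub>V\<^esub> (\<phi> x \<oplus>\<^bsub>K\<^esub> \<phi> y) \<odot>\<^bsub>V\<^esub> w = (x \<ominus>\<^bsub>V\<^esub> \<phi> x \<odot>\<^bsub>V\<^esub> w) \<oplus>\<^bsub>V\<^esub> (y \<ominus>\<^bsub>V\<^esub> \<phi> y \<odot>\<^bsub>V\<^esub> w)"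
        using x \<phi>(1) w by (simp add: a_minus_def smult_l_distr M.minus_add M.a_ac)
      then show "(x \<oplus>\<^bsub>V\<^esub> y) \<ominus>\<^bsub>V\<^esub> (\<phi> x \<oplus>\<^bsub>K\<^esub> \<phi> y) \<odot>\<^bsub>V\<^esub> w \<in> H" using HD(5)[OF \<phi>(2)[OF x(1)] \<phi>(2)[OF x(2)]] by simp
    qed (use x \<phi>(1) in auto)
  next
    fix c x assume x: "c \<in> carrier K" "x \<in> carrier V"
    show "\<phi> (c \<odot>\<^bsub>V\<^esub> x) = c \<otimes>\<^bsub>K\<^esub> \<phi> x"
    proof (rule \<phi>I)
      have "c \<odot>\<^bsub>V\<^esub> x \<ominus>\<^bsub>V\<^esub> (c \<otimes>\<^bsub>K\<^esub> \<phi> x) \<odot>\<^bsub>V\<^esub> w = c \<odot>\<^bsub>V\<^esub> (x \<ominus>\<^bsub>V\<^esub> \<phi> x \<odot>\<^bsub>V\<^esub> w)"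
        using x \<phi>(1) w by (simp add: a_minus_def smult_r_distr smult_assoc1 smult_r_minus)
      then show "c \<odot>\<^bsub>V\<^esub> x \<ominus>\<^bsub>V\<^esub> (c \<otimes>\<^bsub>K\<^esub> \<phi> x) \<odot>\<^bsub>V\<^esub> w \<in> H" using HD(2)[OF x(1) \<phi>(2)[OF x(2)]] by simp
    qed (use x \<phi>(1) in auto)
  qed (use \<phi>(1) in auto)
  moreover have "\<phi> x = \<zero>\<^bsub>K\<^esub>" if "x \<in> W" for x
  proof -
    have x: "x \<in> H" "x \<in> carrier V" using that H(2) HD(3) by auto
    show ?thesis by (rule \<phi>I) (use x w in \<open>simp_all add: M.diff_zero\<close>)
  qed
  moreover have "\<phi> w = \<one>\<^bsub>K\<^esub>" by (rule \<phi>I) (use w HD(4) in \<open>simp_all add: a_minus_def M.r_neg\<close>)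
  ultimately show ?thesis by blast
qed

section \<open>Kernels of tensor products of linear maps\<close>

text \<open>
  An element of the span of the \<open>v \<otimes> n\<close> is written along a flag of subspaces of \<open>W\<close>. A functional
  that vanishes on the smaller steps of the flag isolates the leading left factor.
\<close>

primrec flag :: "('k, 'c) ring_scheme \<Rightarrow> ('k, 'w) module \<Rightarrow> 'w set \<Rightarrow> 'w list \<Rightarrow> 'w set"
  where
    "flag K W H [] = H"
  | "flag K W H (w # ws) = {a \<odot>\<^bsub>W\<^esub> w \<oplus>\<^bsub>W\<^esub> h | a h. a \<in> carrier K \<and> h \<in> flag K W H ws}"

primrec tflag :: "('v \<Rightarrow> 'w \<Rightarrow> 't) \<Rightarrow> 'v set \<Rightarrow> ('t, 'd) ring_scheme \<Rightarrow> 'w list \<Rightarrow> 't set"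
  where
    "tflag \<beta> V T [] = {\<zero>\<^bsub>T\<^esub>}"
  | "tflag \<beta> V T (w # ws) = {\<beta> v w \<oplus>\<^bsub>T\<^esub> y | v y. v \<in> V \<and> y \<in> tflag \<beta> V T ws}"

text \<open>The common core of two formulas. In \<open>tens_kernel\<close>, \<open>C\<close> is the
  kernel of the tensor product of two maps, \<open>M\<close> and \<open>N0\<close> are the kernels
  of the maps, and \<open>N\<close> is the whole right-hand free module. In \<open>tn_inter\<close>,
  \<open>C\<close> is the span of the tensors with left factor in \<open>X\<close>, \<open>M\<close>
  is \<open>X\<close>, \<open>N\<close> is \<open>Y\<close>, and \<open>N0\<close> is zero.
  \<open>G\<close> is the expected answer each time, and \<open>sep\<close> supplies the
  functionals.\<close>

lemma tensor_sep:
  assumes K: "field K" and V: "module K V" and W: "module K W" and T: "abelian_group T"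
    and \<beta>l: "\<And>w. w \<in> carrier W \<Longrightarrow> addm V T (\<lambda>v. \<beta> v w)" and \<beta>r: "\<And>v. v \<in> carrier V \<Longrightarrow> addm W T (\<beta> v)"
    and \<beta>K: "\<And>c v w. c \<in> carrier K \<Longrightarrow> v \<in> carrier V \<Longrightarrow> w \<in> carrier W \<Longrightarrow> \<beta> (c \<odot>\<^bsub>V\<^esub> v) w = \<beta> v (c \<odot>\<^bsub>W\<^esub> w)"
    and N: "sbsp K W N" and N0: "sbsp K W N0" "N0 \<subseteq> N" and C: "add_closed T C"
    and sep: "\<And>u w H. u \<in> carrier V \<Longrightarrow> u \<notin> M \<Longrightarrow> sbsp K W H \<Longrightarrow> N0 \<subseteq> H \<Longrightarrow> H \<subseteq> N \<Longrightarrow> w \<in> N \<Longrightarrow> w \<notin> H \<Longrightarrow>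
      \<exists>\<Lambda>. addm T K \<Lambda> \<and> \<Lambda> (\<beta> u w) \<noteq> \<zero>\<^bsub>K\<^esub> \<and> (\<forall>v\<in>carrier V. \<forall>h\<in>H. \<Lambda> (\<beta> v h) = \<zero>\<^bsub>K\<^esub>) \<and> (\<forall>c\<in>C. \<Lambda> c = \<zero>\<^bsub>K\<^esub>)"
    and G: "add_closed T G" "G \<subseteq> C" "\<And>v n. v \<in> M \<Longrightarrow> n \<in> N \<Longrightarrow> \<beta> v n \<in> G" "\<And>v n. v \<in> carrier V \<Longrightarrow> n \<in> N0 \<Longrightarrow> \<beta> v n \<in> G"
    and x: "x \<in> acl T {\<beta> v n | v n. v \<in> carrier V \<and> n \<in> N}" "x \<in> C"
  shows "x \<in> G"
proof -
  interpret K: field K by fact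
  interpret V: module K V by fact
  interpret W: module K W by fact
  interpret T: abelian_group T by fact
  note ND = sbspD[OF N] and GD = add_closedD[OF G(1)] and CD = add_closedD[OF C]
  let ?F = "flag K W N0" and ?D = "tflag \<beta> (carrier V) T"
  have \<beta>c: "\<beta> v w \<in> carrier T" if "v \<in> carrier V" "w \<in> carrier W" for v w using addm_closed[OF \<beta>r] that .
  have F: "sbsp K W (?F ws) \<and> N0 \<subseteq> ?F ws \<and> ?F ws \<subseteq> N \<and> set ws \<subseteq> ?F ws" if "set ws \<subseteq> N" for ws
    using that
  proof (induction ws)
    case Nil
    then show ?case using N0 by simp
  next
    case (Cons w ws)
    then have IH: "sbsp K W (?F ws)" "N0 \<subseteq> ?F ws" "?F ws \<subseteq> N" "set ws \<subseteq> ?F ws" "w \<in> carrier W" "w \<in> N" using ND(3) by auto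
    note L = sbsp_add_line[OF W IH(1,5)]
    have "?F (w # ws) \<subseteq> N" using IH(3,6) ND(2,5) by auto
    then show ?case using L IH by auto
  qed
  have Dc: "?D ws \<subseteq> carrier T" if "set ws \<subseteq> N" for ws
    using that by (induction ws) (auto simp: \<beta>c ND(3))
  have Dadd: "y \<oplus>\<^bsub>T\<^esub> z \<in> ?D ws" if "set ws \<subseteq> N" "y \<in> ?D ws" "z \<in> ?D ws" for y z ws
    using that
  proof (induction ws arbitrary: y z)
    case (Cons w ws)
    then obtain u y' v z' where y: "y = \<beta> u w \<oplus>\<^bsub>T\<^esub> y'" "u \<in> carrier V" "y' \<in> ?D ws"
      and z: "z = \<beta> v w \<oplus>\<^bsub>T\<^esub> z'" "v \<in> carrier V" "z' \<in> ?D ws" by auto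
    have c: "w \<in> carrier W" "y' \<in> carrier T" "z' \<in> carrier T" using Cons.prems(1) ND(3) Dc[of ws] y z by auto
    have "y \<oplus>\<^bsub>T\<^esub> z = \<beta> (u \<oplus>\<^bsub>V\<^esub> v) w \<oplus>\<^bsub>T\<^esub> (y' \<oplus>\<^bsub>T\<^esub> z')"
      using y z c \<beta>c by (simp add: addm_add[OF \<beta>l] T.a_ac)
    moreover have "y' \<oplus>\<^bsub>T\<^esub> z' \<in> ?D ws" using Cons.IH[OF _ y(3) z(3)] Cons.prems(1) by simp
    ultimately show ?case using y(2) z(2) by auto
  qed simp
  have Dneg: "\<ominus>\<^bsub>T\<^esub> y \<in> ?D ws" if "set ws \<subseteq> N" "y \<in> ?D ws" for y ws
    using that
  proof (induction ws arbitrary: y)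
    case (Cons w ws)
    then obtain u y' where y: "y = \<beta> u w \<oplus>\<^bsub>T\<^esub> y'" "u \<in> carrier V" "y' \<in> ?D ws" by auto
    have c: "w \<in> carrier W" "y' \<in> carrier T" using Cons.prems(1) ND(3) Dc[of ws] y by auto
    have "\<ominus>\<^bsub>T\<^esub> y = \<beta> (\<ominus>\<^bsub>V\<^esub> u) w \<oplus>\<^bsub>T\<^esub> (\<ominus>\<^bsub>T\<^esub> y')"
      using y c \<beta>c by (simp add: addm_minus[OF V.abelian_group_axioms T \<beta>l] T.minus_add)
    moreover have "\<ominus>\<^bsub>T\<^esub> y' \<in> ?D ws" using Cons.IH[OF _ y(3)] Cons.prems(1) by simp
    ultimately show ?case using y(2) by auto
  qed simp
  have Dapp: "y \<oplus>\<^bsub>T\<^esub> z \<in> ?D (ws @ ws')" if "set ws \<subseteq> N" "set ws' \<subseteq> N" "y \<in> ?D ws" "z \<in> ?D ws'" for y z ws ws'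
    using that
  proof (induction ws arbitrary: y)
    case Nil
    then show ?case using Dc[of ws'] by auto
  next
    case (Cons w ws)
    then obtain u y' where y: "y = \<beta> u w \<oplus>\<^bsub>T\<^esub> y'" "u \<in> carrier V" "y' \<in> ?D ws" by auto
    have c: "w \<in> carrier W" "y' \<in> carrier T" "z \<in> carrier T" using Cons.prems ND(3) Dc[of ws] Dc[of ws'] y by auto
    have "y \<oplus>\<^bsub>T\<^esub> z = \<beta> u w \<oplus>\<^bsub>T\<^esub> (y' \<oplus>\<^bsub>T\<^esub> z)" using y c \<beta>c by (simp add: T.a_assoc)
    moreover have "y' \<oplus>\<^bsub>T\<^esub> z \<in> ?D (ws @ ws')" using Cons.IH[OF _ _ y(3)] Cons.prems by simp
    ultimately show ?case using y(2) by auto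
  qed
  \<comment> \<open>If \<open>n\<close> depends on the list modulo \<open>N0\<close>, its
    coefficients move to the left factor, and \<open>\<beta> u n\<close> becomes a tensor along the
    list plus a term with right factor in \<open>N0\<close>, which lies in \<open>G\<close>.\<close>
  have FD: "\<exists>y\<in>?D ws. \<exists>g\<in>G. \<beta> u n = y \<oplus>\<^bsub>T\<^esub> g" if "set ws \<subseteq> N" "n \<in> ?F ws" "u \<in> carrier V" for ws n u
    using that
  proof (induction ws arbitrary: n)
    case Nil
    then have "\<beta> u n \<in> G" using G(4) by simp
    then show ?case using GD(1) by auto
  next
    case (Cons w ws)
    then obtain a h where n: "n = a \<odot>\<^bsub>W\<^esub> w \<oplus>\<^bsub>W\<^esub> h" "a \<in> carrier K" "h \<in> ?F ws" by auto
    have ws: "set ws \<subseteq> N" and w: "w \<in> carrier W" using Cons.prems(1) ND(3) by auto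
    obtain y g where y: "y \<in> ?D ws" "g \<in> G" "\<beta> u h = y \<oplus>\<^bsub>T\<^esub> g" using Cons.IH[OF ws n(3) Cons.prems(3)] by blast
    have h: "h \<in> carrier W" using F[OF ws] n(3) ND(3) by blast
    have c: "y \<in> carrier T" "g \<in> carrier T" using Dc[OF ws] y GD(1) by auto
    have "\<beta> u n = \<beta> (a \<odot>\<^bsub>V\<^esub> u) w \<oplus>\<^bsub>T\<^esub> y \<oplus>\<^bsub>T\<^esub> g"
      using n w h Cons.prems(3) c y(3) \<beta>c by (simp add: addm_add[OF \<beta>r] \<beta>K T.a_assoc)
    moreover have "\<beta> (a \<odot>\<^bsub>V\<^esub> u) w \<oplus>\<^bsub>T\<^esub> y \<in> ?D (w # ws)" using n(2) Cons.prems(3) y(1) by auto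
    ultimately show ?case using y(2) by blast
  qed
  \<comment> \<open>Induction on the list of right factors. A leading \<open>w\<close> that depends
    on the later ones modulo \<open>N0\<close> is absorbed into them. Otherwise a functional that
    kills the rest of the flag isolates the leading term and forces its left factor into
    \<open>M\<close>; the term then lies in \<open>G\<close> and is subtracted.\<close>
  have main: "z \<in> G" if "set ws \<subseteq> N" "z \<in> ?D ws" "z \<in> C" for ws z
    using that
  proof (induction ws arbitrary: z)
    case Nil
    then show ?case using GD(2) by simp
  next
    case (Cons w ws)
    then obtain u y where z: "z = \<beta> u w \<oplus>\<^bsub>T\<^esub> y" "u \<in> carrier V" "y \<in> ?D ws" by auto
    have ws: "set ws \<subseteq> N" and w: "w \<in> N" "w \<in> carrier W" using Cons.prems(1) ND(3) by auto
    have yc: "y \<in> carrier T" using Dc[OF ws] z(3) by auto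
    note Fws = F[OF ws]
    show ?case
    proof (cases "w \<in> ?F ws")
      case True
      obtain y' g where y': "y' \<in> ?D ws" "g \<in> G" "\<beta> u w = y' \<oplus>\<^bsub>T\<^esub> g" using FD[OF ws True z(2)] by blast
      have c: "y' \<in> carrier T" "g \<in> carrier T" using Dc[OF ws] y' GD(1) by auto
      have z2: "z = (y' \<oplus>\<^bsub>T\<^esub> y) \<oplus>\<^bsub>T\<^esub> g" using z y' c yc by (simp add: T.a_ac)
      have "y' \<oplus>\<^bsub>T\<^esub> y = z \<ominus>\<^bsub>T\<^esub> g" using z2 c yc by (simp add: a_minus_def T.a_assoc T.r_neg)
      then have "y' \<oplus>\<^bsub>T\<^esub> y \<in> C" using CD(5)[OF Cons.prems(3)] y'(2) G(2) by auto
      then have "y' \<oplus>\<^bsub>T\<^esub> y \<in> G" using Cons.IH[OF ws Dadd[OF ws y'(1) z(3)]] by simp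
      then show ?thesis using z2 GD(3) y'(2) by simp
    next
      case False
      have uM: "u \<in> M"
      proof (rule ccontr)
        assume "u \<notin> M"
        then obtain \<Lambda> where \<Lambda>: "addm T K \<Lambda>" "\<Lambda> (\<beta> u w) \<noteq> \<zero>\<^bsub>K\<^esub>" "\<And>v h. v \<in> carrier V \<Longrightarrow> h \<in> ?F ws \<Longrightarrow> \<Lambda> (\<beta> v h) = \<zero>\<^bsub>K\<^esub>"
          "\<And>c. c \<in> C \<Longrightarrow> \<Lambda> c = \<zero>\<^bsub>K\<^esub>"
          using sep[OF z(2) _ _ _ _ w(1) False] Fws by metis
        \<comment> \<open>The flag space of \<open>ws\<close> must stay fixed while the induction
          shortens the list, hence the separate list \<open>vs\<close>.\<close>
        have "\<Lambda> y' = \<zero>\<^bsub>K\<^esub>" if "set vs \<subseteq> ?F ws" "y' \<in> ?D vs" for vs y'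
          using that
        proof (induction vs arbitrary: y')
          case Nil
          then show ?case using addm_zero[OF T K.abelian_group_axioms \<Lambda>(1)] by simp
        next
          case (Cons v vs)
          then obtain u' y'' where y: "y' = \<beta> u' v \<oplus>\<^bsub>T\<^esub> y''" "u' \<in> carrier V" "y'' \<in> ?D vs" by auto
          have "y'' \<in> carrier T" "v \<in> carrier W" using y(3) Dc[of vs] Cons.prems(1) Fws ND(3) by auto
          then show ?case using y Cons.IH[OF _ y(3)] Cons.prems(1) \<beta>c by (simp add: addm_add[OF \<Lambda>(1)] \<Lambda>(3))
        qed
        then have "\<Lambda> y = \<zero>\<^bsub>K\<^esub>" using Fws z(3) by blast
        then have "\<Lambda> z = \<Lambda> (\<beta> u w)"
          using z \<beta>c w yc addm_closed[OF \<Lambda>(1)] by (simp add: addm_add[OF \<Lambda>(1)])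
        then show False using \<Lambda>(2) \<Lambda>(4)[OF Cons.prems(3)] by simp
      qed
      have bG: "\<beta> u w \<in> G" by (rule G(3)[OF uM w(1)])
      have "y = z \<ominus>\<^bsub>T\<^esub> \<beta> u w"
        using z yc \<beta>c w by (simp add: a_minus_def T.a_comm[of "\<beta> u w" y] T.a_assoc T.r_neg)
      then have "y \<in> C" using CD(5)[OF Cons.prems(3)] bG G(2) by auto
      then have "y \<in> G" using Cons.IH[OF ws z(3)] by simp
      then show ?thesis using z bG GD(3) by simp
    qed
  qed
  have "\<exists>ws. set ws \<subseteq> N \<and> x \<in> ?D ws" using x(1)
  proof induction
    case acl_zero
    show ?case by (rule exI[of _ "[]"]) simp
  next
    case (acl_base x)
    then obtain v n where "x = \<beta> v n" "v \<in> carrier V" "n \<in> N" by auto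
    moreover then have "\<beta> v n = \<beta> v n \<oplus>\<^bsub>T\<^esub> \<zero>\<^bsub>T\<^esub>" using \<beta>c ND(3) by simp
    ultimately show ?case by (intro exI[of _ "[n]"]) auto
  next
    case (acl_add x y)
    then obtain ws ws' where "set ws \<subseteq> N" "x \<in> ?D ws" "set ws' \<subseteq> N" "y \<in> ?D ws'" by auto
    then show ?case using Dapp[of ws ws' x y] by (intro exI[of _ "ws @ ws'"]) simp
  next
    case (acl_minus x)
    then obtain ws where "set ws \<subseteq> N" "x \<in> ?D ws" by auto
    then show ?case using Dneg[of ws x] by (intro exI[of _ ws]) simp
  qed
  then obtain ws where "set ws \<subseteq> N" "x \<in> ?D ws" by auto
  then show ?thesis using main x(2) by simp
qed

section \<open>Tensor products of modules of finite projective dimension\<close>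

definition iprod :: "nat set \<Rightarrow> nat set \<Rightarrow> nat set"
  where "iprod I J = prod_encode ` (I \<times> J)"
definition dprod :: "(nat \<Rightarrow> int) \<Rightarrow> (nat \<Rightarrow> int) \<Rightarrow> nat \<Rightarrow> int"
  where "dprod \<delta> \<epsilon> n = \<delta> (fst (prod_decode n)) + \<epsilon> (snd (prod_decode n))"

lemma iprod_iff: "n \<in> iprod I J \<longleftrightarrow> fst (prod_decode n) \<in> I \<and> snd (prod_decode n) \<in> J"
proof -
  have "n \<in> iprod I J \<longleftrightarrow> prod_decode n \<in> I \<times> J"
    unfolding iprod_def by (metis image_iff prod_decode_inverse prod_encode_inverse)
  then show ?thesis by (cases "prod_decode n") auto
qed

lemma finite_iprod: "finite I \<Longrightarrow> finite J \<Longrightarrow> finite (iprod I J)"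
  by (simp add: iprod_def)

lemma addm_fmod_subset: "addm (fmod sm R X) T f \<Longrightarrow> Y \<subseteq> X \<Longrightarrow> addm (fmod sm' R Y) T f"
  by (simp add: addm_def subset_iff Pi_iff)

lemma add_closed_fmod:
  assumes "abelian_group R"
  shows "add_closed (fmod sm R (free R I)) X \<longleftrightarrow> add_closed (fmod sm' R (free R I)) X"
proof -
  have "\<ominus>\<^bsub>fmod sm R (free R I)\<^esub> x = \<ominus>\<^bsub>fmod sm' R (free R I)\<^esub> x" if "x \<in> free R I" for x
    by (simp only: minus_free[OF assms that])
  then show ?thesis unfolding add_closed_def by (auto simp: subset_iff)
qed

lemma add_closed_sum:
  assumes "abelian_group M" "add_closed M X" "add_closed M Y"
  shows "add_closed M {x \<oplus>\<^bsub>M\<^esub> y | x y. x \<in> X \<and> y \<in> Y}" (is "add_closed M ?S")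
    and "X \<subseteq> {x \<oplus>\<^bsub>M\<^esub> y | x y. x \<in> X \<and> y \<in> Y}" "Y \<subseteq> {x \<oplus>\<^bsub>M\<^esub> y | x y. x \<in> X \<and> y \<in> Y}"
proof -
  interpret abelian_group M by fact
  note X = add_closedD[OF assms(2)] and Y = add_closedD[OF assms(3)]
  show XS: "X \<subseteq> ?S"
  proof
    fix x assume "x \<in> X"
    then have "x = x \<oplus>\<^bsub>M\<^esub> \<zero>\<^bsub>M\<^esub>" "x \<in> X" using X(1) by simp_all
    then show "x \<in> ?S" using Y(2) by blast
  qed
  show "Y \<subseteq> ?S"
  proof
    fix x assume "x \<in> Y"
    then have "x = \<zero>\<^bsub>M\<^esub> \<oplus>\<^bsub>M\<^esub> x" "x \<in> Y" using Y(1) by simp_all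
    then show "x \<in> ?S" using X(2) by blast
  qed
  show "add_closed M ?S"
  proof (rule add_closedI)
    show "?S \<subseteq> carrier M" using X(1) Y(1) by auto
    show "\<zero>\<^bsub>M\<^esub> \<in> ?S" using XS X(2) by blast
    show "a \<oplus>\<^bsub>M\<^esub> b \<in> ?S" if ab: "a \<in> ?S" "b \<in> ?S" for a b
    proof -
      from ab obtain x y x' y' where e: "a = x \<oplus>\<^bsub>M\<^esub> y" "x \<in> X" "y \<in> Y" "b = x' \<oplus>\<^bsub>M\<^esub> y'" "x' \<in> X" "y' \<in> Y" by auto
      then have "a \<oplus>\<^bsub>M\<^esub> b = (x \<oplus>\<^bsub>M\<^esub> x') \<oplus>\<^bsub>M\<^esub> (y \<oplus>\<^bsub>M\<^esub> y')" using X(1) Y(1) by (simp add: a_ac)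
      then show ?thesis using X(3)[OF e(2,5)] Y(3)[OF e(3,6)] by blast
    qed
    show "\<ominus>\<^bsub>M\<^esub> a \<in> ?S" if a: "a \<in> ?S" for a
    proof -
      from a obtain x y where e: "a = x \<oplus>\<^bsub>M\<^esub> y" "x \<in> X" "y \<in> Y" by auto
      then have "\<ominus>\<^bsub>M\<^esub> a = (\<ominus>\<^bsub>M\<^esub> x) \<oplus>\<^bsub>M\<^esub> (\<ominus>\<^bsub>M\<^esub> y)" using X(1) Y(1) by (simp add: minus_add)
      then show ?thesis using X(4)[OF e(2)] Y(4)[OF e(3)] by blast
    qed
  qed
qed

context assoc_algebra
begin

lemma module_free: "module K (fmod (smult A) A (free A I))"
  by (intro moduleI abelian_group_free abelian_group_axioms R.cring_axioms)
    (auto simp: free_def smult_l_distr smult_r_distr smult_assoc1)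

lemma smult_one_mult: "c \<in> carrier K \<Longrightarrow> x \<in> carrier A \<Longrightarrow> (c \<odot>\<^bsub>A\<^esub> \<one>\<^bsub>A\<^esub>) \<otimes>\<^bsub>A\<^esub> x = c \<odot>\<^bsub>A\<^esub> x"
  by (simp add: smult_mult_left)

lemma smult_one_mult_free:
  "c \<in> carrier K \<Longrightarrow> x \<in> free A I \<Longrightarrow> (\<lambda>i. (c \<odot>\<^bsub>A\<^esub> \<one>\<^bsub>A\<^esub>) \<otimes>\<^bsub>A\<^esub> x i) = (\<lambda>i. c \<odot>\<^bsub>A\<^esub> x i)"
  by (auto simp: free_def smult_one_mult)

text \<open>\<open>K\<close> acts on a free module through the multiples of one, so that submodules
  over \<open>A\<close> are subspaces over \<open>K\<close> and functionals can be applied to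
  them.\<close>

lemma sbsp_freeI:
  assumes "add_closed (fmod sm A (free A I)) X"
    "\<And>c x. c \<in> carrier K \<Longrightarrow> x \<in> X \<Longrightarrow> (\<lambda>i. (c \<odot>\<^bsub>A\<^esub> \<one>\<^bsub>A\<^esub>) \<otimes>\<^bsub>A\<^esub> x i) \<in> X"
  shows "sbsp K (fmod (smult A) A (free A I)) X"
proof (rule sbspI)
  show "add_closed (fmod (smult A) A (free A I)) X"
    using assms(1) add_closed_fmod[OF abelian_group_axioms] by blast
  fix c x assume c: "c \<in> carrier K" "x \<in> X"
  then have x: "x \<in> free A I" using add_closedD(1)[OF assms(1)] by simp
  show "c \<odot>\<^bsub>fmod (smult A) A (free A I)\<^esub> x \<in> X"
    using assms(2)[OF c] smult_one_mult_free[OF c(1) x] by simp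
qed

end

text \<open>
  \<open>\<beta>_gen\<close> and \<open>\<beta>_fnl\<close> say that \<open>\<beta>\<close> makes \<open>U\<close> the tensor product of \<open>R\<close> and \<open>S\<close> over \<open>K\<close>.
\<close>

locale tensor_rings =
  K: field K + R: gr_ring R prR + S: gr_ring S prS + U: gr_ring U prU +
  RA: assoc_algebra K R + SA: assoc_algebra K S
  for K :: "('k, 'c) ring_scheme" and R :: "('k, 'r) module" and prR and S :: "('k, 's) module" and prS
    and U :: "('k, 'u) module" and prU +
  fixes \<beta> :: "'r \<Rightarrow> 's \<Rightarrow> 'u"
  assumes \<beta>_left: "s \<in> carrier S \<Longrightarrow> addm R U (\<lambda>r. \<beta> r s)"
    and \<beta>_right: "r \<in> carrier R \<Longrightarrow> addm S U (\<beta> r)"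
    and \<beta>_scalar: "c \<in> carrier K \<Longrightarrow> r \<in> carrier R \<Longrightarrow> s \<in> carrier S \<Longrightarrow> \<beta> (c \<odot>\<^bsub>R\<^esub> r) s = \<beta> r (c \<odot>\<^bsub>S\<^esub> s)"
    and \<beta>_mult: "r \<in> carrier R \<Longrightarrow> r' \<in> carrier R \<Longrightarrow> s \<in> carrier S \<Longrightarrow> s' \<in> carrier S \<Longrightarrow>
      \<beta> (r \<otimes>\<^bsub>R\<^esub> r') (s \<otimes>\<^bsub>S\<^esub> s') = \<beta> r s \<otimes>\<^bsub>U\<^esub> \<beta> r' s'"
    and \<beta>_gen: "x \<in> carrier U \<Longrightarrow> x \<in> acl U {\<beta> r s | r s. r \<in> carrier R \<and> s \<in> carrier S}"
    and \<beta>_fnl: "fnl K R \<psi> \<Longrightarrow> fnl K S \<phi> \<Longrightarrow>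
      \<exists>\<Lambda>. addm U K \<Lambda> \<and> (\<forall>r\<in>carrier R. \<forall>s\<in>carrier S. \<Lambda> (\<beta> r s) = \<psi> r \<otimes>\<^bsub>K\<^esub> \<phi> s)"
    and \<beta>_degree: "r \<in> carrier R \<Longrightarrow> s \<in> carrier S \<Longrightarrow> prR i r = r \<Longrightarrow> prS j s = s \<Longrightarrow> prU (i + j) (\<beta> r s) = \<beta> r s"
begin

section \<open>Tensor products of submodules of free modules\<close>

definition bE :: "(nat \<Rightarrow> 'r) \<Rightarrow> (nat \<Rightarrow> 's) \<Rightarrow> nat \<Rightarrow> 'u"
  where "bE x y n = \<beta> (x (fst (prod_decode n))) (y (snd (prod_decode n)))"

abbreviation "FU I \<equiv> lmod U (free U I)"

text \<open>The span of the pure tensors inside the free module on \<open>iprod I J\<close>. That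
  this is the tensor product of \<open>X\<close> and \<open>Y\<close> and not a proper quotient of
  it depends on \<open>K\<close> being a field and is verified in \<open>tens_tn\<close>.\<close>

definition tn :: "nat set \<Rightarrow> nat set \<Rightarrow> (nat \<Rightarrow> 'r) set \<Rightarrow> (nat \<Rightarrow> 's) set \<Rightarrow> (nat \<Rightarrow> 'u) set"
  where "tn I J X Y = acl (FU (iprod I J)) {bE x y | x y. x \<in> X \<and> y \<in> Y}"

lemma \<beta>_closed [simp]: "r \<in> carrier R \<Longrightarrow> s \<in> carrier S \<Longrightarrow> \<beta> r s \<in> carrier U"
  using addm_closed[OF \<beta>_right] .

lemma \<beta>_zero [simp]: "s \<in> carrier S \<Longrightarrow> \<beta> \<zero>\<^bsub>R\<^esub> s = \<zero>\<^bsub>U\<^esub>" "r \<in> carrier R \<Longrightarrow> \<beta> r \<zero>\<^bsub>S\<^esub> = \<zero>\<^bsub>U\<^esub>"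
  using addm_zero[OF R.abelian_group_axioms U.abelian_group_axioms \<beta>_left]
    addm_zero[OF S.abelian_group_axioms U.abelian_group_axioms \<beta>_right] by auto

lemma abelian_FU: "abelian_group (FU I)"
  by (rule abelian_group_free[OF U.abelian_group_axioms])

lemma bE_free: "x \<in> free R I \<Longrightarrow> y \<in> free S J \<Longrightarrow> bE x y \<in> free U (iprod I J)"
  by (auto simp: free_def bE_def iprod_iff)

lemma bE_elm:
  "r \<in> carrier R \<Longrightarrow> s \<in> carrier S \<Longrightarrow> bE (elm R i r) (elm S j s) = elm U (prod_encode (i, j)) (\<beta> r s)"
  by (auto simp: bE_def elm_def fun_eq_iff)

lemma bE_left: "y \<in> free S J \<Longrightarrow> addm (fmod sm R (free R I)) (FU (iprod I J)) (\<lambda>x. bE x y)"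
  by (rule addmI) (auto simp: bE_free, auto simp: bE_def free_def addm_add[OF \<beta>_left])

lemma bE_right: "x \<in> free R I \<Longrightarrow> addm (fmod sm S (free S J)) (FU (iprod I J)) (bE x)"
  by (rule addmI) (auto simp: bE_free, auto simp: bE_def free_def addm_add[OF \<beta>_right])

lemma bE_smult:
  "r \<in> carrier R \<Longrightarrow> s \<in> carrier S \<Longrightarrow> x \<in> free R I \<Longrightarrow> y \<in> free S J \<Longrightarrow>
    bE (\<lambda>i. r \<otimes>\<^bsub>R\<^esub> x i) (\<lambda>j. s \<otimes>\<^bsub>S\<^esub> y j) = (\<lambda>k. \<beta> r s \<otimes>\<^bsub>U\<^esub> bE x y k)"
  by (auto simp: bE_def free_def \<beta>_mult)

lemma bE_degree:
  assumes "x \<in> free R I" "y \<in> free S J" "shift_pr prR \<delta> i x = x" "shift_pr prS \<epsilon> j y = y"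
  shows "shift_pr prU (dprod \<delta> \<epsilon>) (i + j) (bE x y) = bE x y"
proof
  fix n
  let ?a = "fst (prod_decode n)" and ?b = "snd (prod_decode n)"
  have "prR (i - \<delta> ?a) (x ?a) = x ?a" "prS (j - \<epsilon> ?b) (y ?b) = y ?b"
    using fun_cong[OF assms(3), of ?a] fun_cong[OF assms(4), of ?b] by (simp_all add: shift_pr_def)
  then have "prU ((i - \<delta> ?a) + (j - \<epsilon> ?b)) (\<beta> (x ?a) (y ?b)) = \<beta> (x ?a) (y ?b)"
    using assms(1,2) by (intro \<beta>_degree) (auto simp: free_def)
  moreover have "(i - \<delta> ?a) + (j - \<epsilon> ?b) = i + j - dprod \<delta> \<epsilon> n" by (simp add: dprod_def)
  ultimately show "shift_pr prU (dprod \<delta> \<epsilon>) (i + j) (bE x y) n = bE x y n"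
    by (simp add: shift_pr_def bE_def)
qed

lemma bE_subset: "X \<subseteq> free R I \<Longrightarrow> Y \<subseteq> free S J \<Longrightarrow> {bE x y | x y. x \<in> X \<and> y \<in> Y} \<subseteq> free U (iprod I J)"
  using bE_free by blast

lemma add_closed_tn: "X \<subseteq> free R I \<Longrightarrow> Y \<subseteq> free S J \<Longrightarrow> add_closed (FU (iprod I J)) (tn I J X Y)"
  unfolding tn_def by (rule abelian_group.add_closed_acl[OF abelian_FU]) (use bE_subset in auto)

lemma tn_base: "x \<in> X \<Longrightarrow> y \<in> Y \<Longrightarrow> bE x y \<in> tn I J X Y"
  unfolding tn_def by (rule acl_base) blast

text \<open>A basis multiple with coefficient \<open>\<beta> r s\<close> is the tensor of two basis
  multiples, and such coefficients generate \<open>U\<close> additively.\<close>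

lemma tn_free:
  assumes "finite I" "finite J"
  shows "tn I J (free R I) (free S J) = free U (iprod I J)"
proof (intro equalityI subsetI)
  let ?T = "tn I J (free R I) (free S J)"
  have A: "add_closed (FU (iprod I J)) ?T" by (rule add_closed_tn) auto
  show "x \<in> free U (iprod I J)" if "x \<in> ?T" for x using add_closedD(1)[OF A that] by simp
  fix z assume z: "z \<in> free U (iprod I J)"
  have "elm U k u \<in> ?T" if k: "k \<in> iprod I J" and u: "u \<in> carrier U" for k u
  proof (rule addm_acl[OF U.abelian_group_axioms abelian_FU _ _ _ A \<beta>_gen[OF u]])
    show "addm U (FU (iprod I J)) (elm U k)"
      by (rule addmI) (use k in \<open>auto simp: elm_def free_def\<close>)
    fix b assume "b \<in> {\<beta> r s |r s. r \<in> carrier R \<and> s \<in> carrier S}"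
    then obtain r s where b: "b = \<beta> r s" "r \<in> carrier R" "s \<in> carrier S" by auto
    have "elm U k b = bE (elm R (fst (prod_decode k)) r) (elm S (snd (prod_decode k)) s)"
      using b by (simp add: bE_elm)
    also have "\<dots> \<in> ?T" using b k by (intro tn_base R.elm_free S.elm_free) (auto simp: iprod_iff)
    finally show "elm U k b \<in> ?T" .
  qed auto
  then show "z \<in> ?T"
    by (intro acl_least[OF A _ free_gen[OF U.abelian_group_axioms finite_iprod[OF assms] z]]) auto
qed

text \<open>Scalars in \<open>U\<close> are sums of values of \<open>\<beta>\<close>, which act on a
  pure tensor factor by factor. For the projections, first \<open>x\<close> and then
  \<open>y\<close> is reduced to a homogeneous vector, whose tensor is homogeneous.\<close>

lemma gsub_tn:
  assumes X: "gsub R prR X \<delta>" "X \<subseteq> free R I" and Y: "gsub S prS Y \<epsilon>" "Y \<subseteq> free S J" and fin: "finite I" "finite J"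
  shows "gsub U prU (tn I J X Y) (dprod \<delta> \<epsilon>)"
proof -
  let ?F = "FU (iprod I J)" and ?T = "tn I J X Y"
  interpret F: left_module U ?F by (rule U.left_module_free)
  interpret gF: grading ?F "shift_pr prU (dprod \<delta> \<epsilon>)" by (rule gmodD[OF U.gmod_free[OF finite_iprod[OF fin]]])
  interpret gX: grading "lmod R X" "shift_pr prR \<delta>" by (rule gmodD[OF R.gsub_gmod[OF X(1)]])
  interpret gY: grading "lmod S Y" "shift_pr prS \<epsilon>" by (rule gmodD[OF S.gsub_gmod[OF Y(1)]])
  note A = add_closed_tn[OF X(2) Y(2)] and AD = add_closedD[OF add_closed_tn[OF X(2) Y(2)]]
  have sub: "{bE x y |x y. x \<in> X \<and> y \<in> Y} \<subseteq> carrier ?F" using bE_subset[OF X(2) Y(2)] by simp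
  have gen: "z \<in> acl ?F {bE x y |x y. x \<in> X \<and> y \<in> Y}" if "z \<in> ?T" for z using that by (simp add: tn_def)
  have left: "addm (lmod R X) ?F (\<lambda>x. bE x y)" if "y \<in> Y" for y
    by (rule addm_fmod_subset[OF bE_left X(2)]) (use Y(2) that in blast)
  have right: "addm (lmod S Y) ?F (bE x)" if "x \<in> X" for x
    by (rule addm_fmod_subset[OF bE_right Y(2)]) (use X(2) that in blast)
  show ?thesis
  proof (rule gsubI[of "iprod I J"])
    show "(\<lambda>k. u \<otimes>\<^bsub>U\<^esub> z k) \<in> ?T" if u: "u \<in> carrier U" and z: "z \<in> ?T" for u z
    proof -
      have "u \<odot>\<^bsub>?F\<^esub> z \<in> ?T"
      proof (rule addm_acl[OF F.M.abelian_group_axioms F.M.abelian_group_axioms F.smult_addm[OF u] sub _ A gen[OF z]])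
        fix b assume b: "b \<in> {bE x y |x y. x \<in> X \<and> y \<in> Y}"
        then obtain x y where xy: "b = bE x y" "x \<in> X" "y \<in> Y" by auto
        show "u \<odot>\<^bsub>?F\<^esub> b \<in> ?T"
        proof (rule addm_acl[OF U.abelian_group_axioms F.M.abelian_group_axioms F.smult_addm_left _ _ A \<beta>_gen[OF u]])
          fix v assume "v \<in> {\<beta> r s |r s. r \<in> carrier R \<and> s \<in> carrier S}"
          then obtain r s where v: "v = \<beta> r s" "r \<in> carrier R" "s \<in> carrier S" by auto
          have "v \<odot>\<^bsub>?F\<^esub> b = bE (\<lambda>i. r \<otimes>\<^bsub>R\<^esub> x i) (\<lambda>j. s \<otimes>\<^bsub>S\<^esub> y j)"
            using v xy X(2) Y(2) by (simp add: bE_smult[of r s x I y J] subset_iff)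
          then show "v \<odot>\<^bsub>?F\<^esub> b \<in> ?T" using gsubD(4)[OF X(1)] gsubD(4)[OF Y(1)] v xy by (simp add: tn_base)
        qed (use b sub in auto)
      qed
      then show ?thesis by simp
    qed
    show "shift_pr prU (dprod \<delta> \<epsilon>) k z \<in> ?T" if z: "z \<in> ?T" for k z
    proof (rule addm_acl[OF F.M.abelian_group_axioms F.M.abelian_group_axioms gF.q_addm sub _ A gen[OF z]])
      fix b assume b: "b \<in> {bE x y |x y. x \<in> X \<and> y \<in> Y}"
      then obtain x y where xy: "b = bE x y" "x \<in> X" "y \<in> Y" by auto
      let ?p = "shift_pr prU (dprod \<delta> \<epsilon>) k"
      have "?p (bE x y) \<in> ?T"
      proof (rule addm_acl[OF gX.abelian_group_axioms F.M.abelian_group_axioms addm_comp[OF left[OF xy(3)] gF.q_addm] _ _ A gX.q_gen])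
        fix x assume "x \<in> {y \<in> carrier (lmod R X). \<exists>i. shift_pr prR \<delta> i y = y}"
        then obtain i where x: "x \<in> X" "shift_pr prR \<delta> i x = x" by auto
        show "?p (bE x y) \<in> ?T"
        proof (rule addm_acl[OF gY.abelian_group_axioms F.M.abelian_group_axioms addm_comp[OF right[OF x(1)] gF.q_addm] _ _ A gY.q_gen])
          fix y assume "y \<in> {y \<in> carrier (lmod S Y). \<exists>i. shift_pr prS \<epsilon> i y = y}"
          then obtain j where y: "y \<in> Y" "shift_pr prS \<epsilon> j y = y" by auto
          have d: "shift_pr prU (dprod \<delta> \<epsilon>) (i + j) (bE x y) = bE x y"
            using bE_degree[of x I y J] x y X(2) Y(2) by blast
          have c: "bE x y \<in> carrier ?F" using sub x(1) y(1) by blast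
          show "?p (bE x y) \<in> ?T"
          proof (cases "k = i + j")
            case True
            then show ?thesis using d tn_base[OF x(1) y(1)] by simp
          next
            case False
            then show ?thesis using gF.q_other[OF c d False] AD(2) by simp
          qed
        qed (use xy in auto)
      qed (use xy in auto)
      then show "?p b \<in> ?T" using xy by simp
    qed
  qed (use AD finite_iprod[OF fin] in auto)
qed

text \<open>A functional on a free module is the sum of its restrictions to the coordinates, so the
  product of two functionals is assembled from one application of \<open>\<beta>_fnl\<close> for
  each pair of coordinates.\<close>

lemma bE_fnl:
  assumes fin: "finite I" "finite J" and \<psi>: "fnl K (fmod (smult R) R (free R I)) \<psi>" and \<phi>: "fnl K (fmod (smult S) S (free S J)) \<phi>"
  shows "\<exists>\<Lambda>. addm (FU (iprod I J)) K \<Lambda> \<and> (\<forall>x\<in>free R I. \<forall>y\<in>free S J. \<Lambda> (bE x y) = \<psi> x \<otimes>\<^bsub>K\<^esub> \<phi> y)"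
proof -
  have \<psi>A: "addm (fmod (smult R) R (free R I)) K \<psi>" and \<phi>A: "addm (fmod (smult S) S (free S J)) K \<phi>"
    using \<psi> \<phi> by (auto simp: fnl_def)
  have \<psi>c: "\<psi> x \<in> carrier K" if "x \<in> free R I" for x using addm_closed[OF \<psi>A] that by simp
  have \<phi>c: "\<phi> y \<in> carrier K" if "y \<in> free S J" for y using addm_closed[OF \<phi>A] that by simp
  have fR: "fnl K R (\<lambda>r. \<psi> (elm R i r))" if "i \<in> I" for i
    unfolding fnl_def
  proof (intro conjI ballI)
    have "addm R (fmod (smult R) R (free R I)) (elm R i)"
      by (rule addmI) (use that in \<open>auto simp: elm_def free_def\<close>)
    from addm_comp[OF this \<psi>A] show "addm R K (\<lambda>r. \<psi> (elm R i r))" .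
    fix c r assume c: "c \<in> carrier K" "r \<in> carrier R"
    then have "elm R i (c \<odot>\<^bsub>R\<^esub> r) = c \<odot>\<^bsub>fmod (smult R) R (free R I)\<^esub> elm R i r" by (auto simp: elm_def)
    then show "\<psi> (elm R i (c \<odot>\<^bsub>R\<^esub> r)) = c \<otimes>\<^bsub>K\<^esub> \<psi> (elm R i r)"
      using \<psi> c that R.elm_free[OF that c(2)] unfolding fnl_def by (metis fmod_simps(1))
  qed
  have fS: "fnl K S (\<lambda>r. \<phi> (elm S i r))" if "i \<in> J" for i
    unfolding fnl_def
  proof (intro conjI ballI)
    have "addm S (fmod (smult S) S (free S J)) (elm S i)"
      by (rule addmI) (use that in \<open>auto simp: elm_def free_def\<close>)
    from addm_comp[OF this \<phi>A] show "addm S K (\<lambda>r. \<phi> (elm S i r))" .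
    fix c r assume c: "c \<in> carrier K" "r \<in> carrier S"
    then have "elm S i (c \<odot>\<^bsub>S\<^esub> r) = c \<odot>\<^bsub>fmod (smult S) S (free S J)\<^esub> elm S i r" by (auto simp: elm_def)
    then show "\<phi> (elm S i (c \<odot>\<^bsub>S\<^esub> r)) = c \<otimes>\<^bsub>K\<^esub> \<phi> (elm S i r)"
      using \<phi> c that S.elm_free[OF that c(2)] unfolding fnl_def by (metis fmod_simps(1))
  qed
  have "\<exists>L. addm U K L \<and> (\<forall>r\<in>carrier R. \<forall>s\<in>carrier S.
      L (\<beta> r s) = \<psi> (elm R (fst (prod_decode k)) r) \<otimes>\<^bsub>K\<^esub> \<phi> (elm S (snd (prod_decode k)) s))" if "k \<in> iprod I J" for k
    using \<beta>_fnl[OF fR fS] that by (simp add: iprod_iff)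
  then obtain L where L: "\<And>k. k \<in> iprod I J \<Longrightarrow> addm U K (L k)"
    "\<And>k r s. k \<in> iprod I J \<Longrightarrow> r \<in> carrier R \<Longrightarrow> s \<in> carrier S \<Longrightarrow>
      L k (\<beta> r s) = \<psi> (elm R (fst (prod_decode k)) r) \<otimes>\<^bsub>K\<^esub> \<phi> (elm S (snd (prod_decode k)) s)" by metis
  define \<Lambda> where "\<Lambda> z = (\<Oplus>\<^bsub>K\<^esub>k\<in>iprod I J. L k (z k))" for z
  have \<Lambda>: "addm (FU (iprod I J)) K \<Lambda>"
    unfolding \<Lambda>_def
  proof (intro addm_finsumf K.abelian_group_axioms finite_iprod fin)
    fix k assume k: "k \<in> iprod I J"
    have "addm (FU (iprod I J)) U (\<lambda>z. z k)" by (rule addmI) (auto simp: free_def)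
    from addm_comp[OF this L(1)[OF k]] show "addm (FU (iprod I J)) K (\<lambda>z. L k (z k))" .
  qed
  have elm: "\<Lambda> (bE (elm R i r) (elm S j s)) = \<psi> (elm R i r) \<otimes>\<^bsub>K\<^esub> \<phi> (elm S j s)"
    if "i \<in> I" "j \<in> J" "r \<in> carrier R" "s \<in> carrier S" for i j r s
  proof -
    let ?k = "prod_encode (i, j)"
    have k: "?k \<in> iprod I J" using that by (simp add: iprod_def)
    have "\<Lambda> (bE (elm R i r) (elm S j s)) = (\<Oplus>\<^bsub>K\<^esub>k\<in>iprod I J. if ?k = k then L k (\<beta> r s) else \<zero>\<^bsub>K\<^esub>)"
      unfolding \<Lambda>_def
    proof (rule K.finsum_cong')
      fix k assume "k \<in> iprod I J"
      then show "L k (bE (elm R i r) (elm S j s) k) = (if ?k = k then L k (\<beta> r s) else \<zero>\<^bsub>K\<^esub>)"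
        unfolding bE_elm[OF that(3,4)]
        using addm_zero[OF U.abelian_group_axioms K.abelian_group_axioms L(1)] by (auto simp: elm_def)
    qed (use that addm_closed[OF L(1)] in auto)
    also have "\<dots> = L ?k (\<beta> r s)"
      by (rule K.add.finprod_singleton) (use that k fin finite_iprod addm_closed[OF L(1)] in auto)
    also have "\<dots> = \<psi> (elm R i r) \<otimes>\<^bsub>K\<^esub> \<phi> (elm S j s)" using L(2)[OF k that(3,4)] by simp
    finally show ?thesis .
  qed
  have 1: "\<Lambda> (bE (elm R i r) y) = \<psi> (elm R i r) \<otimes>\<^bsub>K\<^esub> \<phi> y" if "i \<in> I" "r \<in> carrier R" "y \<in> free S J" for i r y
  proof (rule addm_eq_on_acl[OF abelian_group_free[OF S.abelian_group_axioms] K.abelian_group_axioms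
        addm_comp[OF bE_right \<Lambda>] _ _ _ free_gen[OF S.abelian_group_axioms fin(2) that(3)]])
    show "addm (fmod (smult S) S (free S J)) K (\<lambda>x. \<psi> (elm R i r) \<otimes>\<^bsub>K\<^esub> \<phi> x)"
      by (rule addmI) (use \<psi>c \<phi>c that addm_add[OF \<phi>A] in \<open>auto simp: K.r_distr\<close>)
  qed (use that elm in auto)
  have "\<Lambda> (bE x y) = \<psi> x \<otimes>\<^bsub>K\<^esub> \<phi> y" if "x \<in> free R I" "y \<in> free S J" for x y
  proof (rule addm_eq_on_acl[OF abelian_group_free[OF R.abelian_group_axioms] K.abelian_group_axioms
        addm_comp[OF bE_left \<Lambda>] _ _ _ free_gen[OF R.abelian_group_axioms fin(1) that(1)]])
    show "addm (fmod (smult R) R (free R I)) K (\<lambda>x. \<psi> x \<otimes>\<^bsub>K\<^esub> \<phi> y)"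
      by (rule addmI) (use \<psi>c \<phi>c that addm_add[OF \<psi>A] in \<open>auto simp: K.l_distr\<close>)
  qed (use that 1 in auto)
  then show ?thesis using \<Lambda> by blast
qed

lemma sbsp_gsub_left: "gsub R prR X \<delta> \<Longrightarrow> X \<subseteq> free R I \<Longrightarrow> sbsp K (fmod (smult R) R (free R I)) X"
  by (rule RA.sbsp_freeI[OF gsubmD(1)[OF R.gsub_gsubm]]) (auto simp: gsubD(4))

lemma sbsp_gsub_right: "gsub S prS X \<delta> \<Longrightarrow> X \<subseteq> free S I \<Longrightarrow> sbsp K (fmod (smult S) S (free S I)) X"
  by (rule SA.sbsp_freeI[OF gsubmD(1)[OF S.gsub_gsubm]]) (auto simp: gsubD(4))

lemma bE_scalar:
  "c \<in> carrier K \<Longrightarrow> x \<in> free R I \<Longrightarrow> y \<in> free S J \<Longrightarrow>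
    bE (\<lambda>i. c \<odot>\<^bsub>R\<^esub> x i) y = bE x (\<lambda>i. c \<odot>\<^bsub>S\<^esub> y i)"
  by (auto simp: bE_def free_def \<beta>_scalar)

text \<open>For the inclusion from left to right, membership in \<open>tn I J (free R I) Y\<close>
  gives the span that \<open>tensor_sep\<close> starts from, and the other membership gives
  \<open>C\<close>. The separating functional is a product: its left factor vanishes on
  \<open>X\<close>, which kills \<open>C\<close>, and its right factor vanishes on
  \<open>H\<close>.\<close>

lemma tn_inter:
  assumes X: "gsub R prR X \<delta>" "X \<subseteq> free R I" and Y: "gsub S prS Y \<epsilon>" "Y \<subseteq> free S J" and fin: "finite I" "finite J"
  shows "tn I J X (free S J) \<inter> tn I J (free R I) Y = tn I J X Y"
proof (intro equalityI subsetI)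
  let ?V = "fmod (smult R) R (free R I)" and ?W = "fmod (smult S) S (free S J)"
  note sX = sbsp_gsub_left[OF X] and sY = sbsp_gsub_right[OF Y]
  fix z assume z: "z \<in> tn I J X (free S J) \<inter> tn I J (free R I) Y"
  show "z \<in> tn I J X Y"
  proof (rule tensor_sep[OF K.field_axioms RA.module_free[of I] SA.module_free[of J] abelian_FU[of "iprod I J"], where \<beta> = bE and N = Y and M = X
        and ?N0.0 = "{\<zero>\<^bsub>?W\<^esub>}" and C = "tn I J X (free S J)"])
    show "add_closed (FU (iprod I J)) (tn I J X (free S J))" by (rule add_closed_tn[OF X(2)]) simp
    show "add_closed (FU (iprod I J)) (tn I J X Y)" by (rule add_closed_tn[OF X(2) Y(2)])
    show "tn I J X Y \<subseteq> tn I J X (free S J)" unfolding tn_def by (intro subsetI, erule acl_mono[rotated]) (use Y(2) in blast)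
    show "z \<in> acl (FU (iprod I J)) {bE v n |v n. v \<in> carrier ?V \<and> n \<in> Y}" using z by (simp add: tn_def)
    show "sbsp K ?W {\<zero>\<^bsub>?W\<^esub>}"
      by (rule sbspI[OF add_closed_zero[OF abelian_group_free[OF S.abelian_group_axioms]]]) auto
    show "bE v n \<in> tn I J X Y" if "v \<in> carrier ?V" "n \<in> {\<zero>\<^bsub>?W\<^esub>}" for v n
    proof -
      have "bE v n = \<zero>\<^bsub>FU (iprod I J)\<^esub>" using that by (auto simp: bE_def free_def)
      then show ?thesis using add_closedD(2)[OF add_closed_tn[OF X(2) Y(2)]] by simp
    qed
    fix u w H assume u: "u \<in> carrier ?V" "u \<notin> X" and H: "sbsp K ?W H" and w: "w \<in> Y" "w \<notin> H"
    obtain \<psi> where \<psi>: "fnl K ?V \<psi>" "\<forall>x\<in>X. \<psi> x = \<zero>\<^bsub>K\<^esub>" "\<psi> u = \<one>\<^bsub>K\<^esub>"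
      using functional_exists[OF K.field_axioms RA.module_free sX u] by blast
    have wc: "w \<in> carrier ?W" using w Y(2) by auto
    obtain \<phi> where \<phi>: "fnl K ?W \<phi>" "\<forall>x\<in>H. \<phi> x = \<zero>\<^bsub>K\<^esub>" "\<phi> w = \<one>\<^bsub>K\<^esub>"
      using functional_exists[OF K.field_axioms SA.module_free H wc w(2)] by blast
    obtain \<Lambda> where \<Lambda>: "addm (FU (iprod I J)) K \<Lambda>" "\<And>x y. x \<in> free R I \<Longrightarrow> y \<in> free S J \<Longrightarrow> \<Lambda> (bE x y) = \<psi> x \<otimes>\<^bsub>K\<^esub> \<phi> y"
      using bE_fnl[OF fin \<psi>(1) \<phi>(1)] by auto
    have \<psi>c: "\<psi> x \<in> carrier K" if "x \<in> free R I" for x using \<psi>(1) that addm_closed[of ?V K \<psi>] by (simp add: fnl_def)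
    have \<phi>c: "\<phi> x \<in> carrier K" if "x \<in> free S J" for x using \<phi>(1) that addm_closed[of ?W K \<phi>] by (simp add: fnl_def)
    show "\<exists>\<Lambda>. addm (FU (iprod I J)) K \<Lambda> \<and> \<Lambda> (bE u w) \<noteq> \<zero>\<^bsub>K\<^esub> \<and>
        (\<forall>v\<in>carrier ?V. \<forall>h\<in>H. \<Lambda> (bE v h) = \<zero>\<^bsub>K\<^esub>) \<and> (\<forall>c\<in>tn I J X (free S J). \<Lambda> c = \<zero>\<^bsub>K\<^esub>)"
    proof (intro exI conjI ballI)
      show "addm (FU (iprod I J)) K \<Lambda>" by fact
      show "\<Lambda> (bE u w) \<noteq> \<zero>\<^bsub>K\<^esub>" using \<Lambda>(2) u wc \<psi>(3) \<phi>(3) by simp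
      show "\<Lambda> (bE v h) = \<zero>\<^bsub>K\<^esub>" if "v \<in> carrier ?V" "h \<in> H" for v h
        using \<Lambda>(2)[of v h] that \<phi>(2) sbspD(3)[OF H that(2)] \<psi>c by simp
      fix c assume "c \<in> tn I J X (free S J)"
      then have "c \<in> acl (FU (iprod I J)) {bE x y |x y. x \<in> X \<and> y \<in> free S J}" by (simp add: tn_def)
      then show "\<Lambda> c = \<zero>\<^bsub>K\<^esub>"
        by (rule addm_eq_on_acl[OF abelian_FU K.abelian_group_axioms \<Lambda>(1) addm_const_zero[OF K.abelian_group_axioms], rotated 2])
          (use X(2) bE_free \<Lambda>(2) \<psi>(2) \<phi>c in auto)
    qed
  qed (use sY z bE_left bE_right bE_scalar tn_base sbspD(4)[OF sY] in auto)
next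
  fix z assume "z \<in> tn I J X Y"
  then show "z \<in> tn I J X (free S J) \<inter> tn I J (free R I) Y"
    unfolding tn_def by (intro IntI; elim acl_mono[rotated]) (use X(2) Y(2) in blast)+
qed

end

section \<open>Abstract tensor products of modules and their presentations\<close>

context tensor_rings
begin

text \<open>
  Separation by functionals expresses that \<open>t\<close> makes \<open>T\<close> the tensor product of \<open>M\<close> and \<open>N\<close> over \<open>K\<close>,
  not merely a quotient of it. The subgroups \<open>H\<close> are the \<open>K\<close>-subspaces of \<open>N\<close>.
\<close>

definition tens_sep :: "('r, 'm) module \<Rightarrow> ('s, 'n) module \<Rightarrow> ('u, 't) module \<Rightarrow> ('m \<Rightarrow> 'n \<Rightarrow> 't) \<Rightarrow> bool"
  where "tens_sep M N T t \<longleftrightarrow>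
    (\<forall>u\<in>carrier M. \<forall>H. \<forall>w\<in>carrier N. u \<noteq> \<zero>\<^bsub>M\<^esub> \<longrightarrow> add_closed N H \<longrightarrow>
      (\<forall>c\<in>carrier K. \<forall>h\<in>H. (c \<odot>\<^bsub>S\<^esub> \<one>\<^bsub>S\<^esub>) \<odot>\<^bsub>N\<^esub> h \<in> H) \<longrightarrow> w \<notin> H \<longrightarrow>
      (\<exists>\<Lambda>. addm T K \<Lambda> \<and> \<Lambda> (t u w) \<noteq> \<zero>\<^bsub>K\<^esub> \<and> (\<forall>v\<in>carrier M. \<forall>h\<in>H. \<Lambda> (t v h) = \<zero>\<^bsub>K\<^esub>)))"

definition tens :: "('r, 'm) module \<Rightarrow> (int \<Rightarrow> 'm \<Rightarrow> 'm) \<Rightarrow> ('s, 'n) module \<Rightarrow> (int \<Rightarrow> 'n \<Rightarrow> 'n) \<Rightarrow>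
    ('u, 't) module \<Rightarrow> (int \<Rightarrow> 't \<Rightarrow> 't) \<Rightarrow> ('m \<Rightarrow> 'n \<Rightarrow> 't) \<Rightarrow> bool"
  where "tens M qM N qN T qT t \<longleftrightarrow> gmod R prR M qM \<and> gmod S prS N qN \<and> gmod U prU T qT \<and>
    (\<forall>n\<in>carrier N. addm M T (\<lambda>m. t m n)) \<and> (\<forall>m\<in>carrier M. addm N T (t m)) \<and>
    (\<forall>r\<in>carrier R. \<forall>s\<in>carrier S. \<forall>m\<in>carrier M. \<forall>n\<in>carrier N.
      t (r \<odot>\<^bsub>M\<^esub> m) (s \<odot>\<^bsub>N\<^esub> n) = \<beta> r s \<odot>\<^bsub>T\<^esub> t m n) \<and>
    (\<forall>m\<in>carrier M. \<forall>n\<in>carrier N. \<forall>i j. qM i m = m \<longrightarrow> qN j n = n \<longrightarrow> qT (i + j) (t m n) = t m n) \<and>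
    carrier T \<subseteq> acl T {t m n | m n. m \<in> carrier M \<and> n \<in> carrier N} \<and>
    tens_sep M N T t"

lemma tensD:
  assumes "tens M qM N qN T qT t"
  shows "gmod R prR M qM" "gmod S prS N qN" "gmod U prU T qT"
    "\<And>n. n \<in> carrier N \<Longrightarrow> addm M T (\<lambda>m. t m n)" "\<And>m. m \<in> carrier M \<Longrightarrow> addm N T (t m)"
    "\<And>r s m n. r \<in> carrier R \<Longrightarrow> s \<in> carrier S \<Longrightarrow> m \<in> carrier M \<Longrightarrow> n \<in> carrier N \<Longrightarrow>
      t (r \<odot>\<^bsub>M\<^esub> m) (s \<odot>\<^bsub>N\<^esub> n) = \<beta> r s \<odot>\<^bsub>T\<^esub> t m n"
    "\<And>m n i j. m \<in> carrier M \<Longrightarrow> n \<in> carrier N \<Longrightarrow> qM i m = m \<Longrightarrow> qN j n = n \<Longrightarrow> qT (i + j) (t m n) = t m n"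
    "\<And>x. x \<in> carrier T \<Longrightarrow> x \<in> acl T {t m n | m n. m \<in> carrier M \<and> n \<in> carrier N}"
    "\<And>u H w. u \<in> carrier M \<Longrightarrow> u \<noteq> \<zero>\<^bsub>M\<^esub> \<Longrightarrow> add_closed N H \<Longrightarrow>
      (\<And>c h. c \<in> carrier K \<Longrightarrow> h \<in> H \<Longrightarrow> (c \<odot>\<^bsub>S\<^esub> \<one>\<^bsub>S\<^esub>) \<odot>\<^bsub>N\<^esub> h \<in> H) \<Longrightarrow> w \<in> carrier N \<Longrightarrow> w \<notin> H \<Longrightarrow>
      \<exists>\<Lambda>. addm T K \<Lambda> \<and> \<Lambda> (t u w) \<noteq> \<zero>\<^bsub>K\<^esub> \<and> (\<forall>v\<in>carrier M. \<forall>h\<in>H. \<Lambda> (t v h) = \<zero>\<^bsub>K\<^esub>)"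
proof -
  note a = assms[unfolded tens_def]
  show "gmod R prR M qM" "gmod S prS N qN" "gmod U prU T qT"
    "\<And>n. n \<in> carrier N \<Longrightarrow> addm M T (\<lambda>m. t m n)" "\<And>m. m \<in> carrier M \<Longrightarrow> addm N T (t m)"
    "\<And>r s m n. r \<in> carrier R \<Longrightarrow> s \<in> carrier S \<Longrightarrow> m \<in> carrier M \<Longrightarrow> n \<in> carrier N \<Longrightarrow>
      t (r \<odot>\<^bsub>M\<^esub> m) (s \<odot>\<^bsub>N\<^esub> n) = \<beta> r s \<odot>\<^bsub>T\<^esub> t m n"
    "\<And>m n i j. m \<in> carrier M \<Longrightarrow> n \<in> carrier N \<Longrightarrow> qM i m = m \<Longrightarrow> qN j n = n \<Longrightarrow> qT (i + j) (t m n) = t m n"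
    using a by simp_all
  show "x \<in> acl T {t m n | m n. m \<in> carrier M \<and> n \<in> carrier N}" if "x \<in> carrier T" for x
    by (rule subsetD[OF _ that]) (use a in simp)
  have s: "tens_sep M N T t" using a by simp
  fix u H w
  assume u: "u \<in> carrier M" "u \<noteq> \<zero>\<^bsub>M\<^esub>" "add_closed N H"
    and H: "\<And>c h. c \<in> carrier K \<Longrightarrow> h \<in> H \<Longrightarrow> (c \<odot>\<^bsub>S\<^esub> \<one>\<^bsub>S\<^esub>) \<odot>\<^bsub>N\<^esub> h \<in> H" and w: "w \<in> carrier N" "w \<notin> H"
  have "\<forall>c\<in>carrier K. \<forall>h\<in>H. (c \<odot>\<^bsub>S\<^esub> \<one>\<^bsub>S\<^esub>) \<odot>\<^bsub>N\<^esub> h \<in> H" using H by simp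
  with s u w show "\<exists>\<Lambda>. addm T K \<Lambda> \<and> \<Lambda> (t u w) \<noteq> \<zero>\<^bsub>K\<^esub> \<and> (\<forall>v\<in>carrier M. \<forall>h\<in>H. \<Lambda> (t v h) = \<zero>\<^bsub>K\<^esub>)"
    unfolding tens_sep_def by simp
qed

text \<open>Tensor products of syzygies re-enter the induction of \<open>fp_tn\<close> through this
  lemma. The separating functionals are found on the ambient free modules and then
  restricted.\<close>

lemma tens_tn:
  assumes X: "gsub R prR X \<delta>" "X \<subseteq> free R I" and Y: "gsub S prS Y \<epsilon>" "Y \<subseteq> free S J" and fin: "finite I" "finite J"
  shows "tens (lmod R X) (shift_pr prR \<delta>) (lmod S Y) (shift_pr prS \<epsilon>) (lmod U (tn I J X Y)) (shift_pr prU (dprod \<delta> \<epsilon>)) bE"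
proof -
  let ?T = "tn I J X Y" and ?F = "FU (iprod I J)"
  note A = add_closed_tn[OF X(2) Y(2)]
  have TF: "?T \<subseteq> free U (iprod I J)" using add_closedD(1)[OF A] by auto
  have XF: "x \<in> free R I" if "x \<in> X" for x using X(2) that by blast
  have YF: "x \<in> free S J" if "x \<in> Y" for x using Y(2) that by blast
  have into: "addm M (lmod U ?T) f" if "addm M ?F f" "\<And>x. x \<in> carrier M \<Longrightarrow> f x \<in> ?T" for f and M :: "('a, 'b) module"
    using that by (simp add: addm_def Pi_iff)
  have 1: "addm (lmod R X) (lmod U ?T) (\<lambda>x. bE x y)" if "y \<in> Y" for y
    by (rule into[OF addm_fmod_subset[OF bE_left X(2)]]) (use that YF tn_base in auto)
  have 2: "addm (lmod S Y) (lmod U ?T) (bE x)" if "x \<in> X" for x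
    by (rule into[OF addm_fmod_subset[OF bE_right Y(2)]]) (use that XF tn_base in auto)
  have 3: "bE (r \<odot>\<^bsub>lmod R X\<^esub> m) (s \<odot>\<^bsub>lmod S Y\<^esub> n) = \<beta> r s \<odot>\<^bsub>lmod U ?T\<^esub> bE m n"
    if "r \<in> carrier R" "s \<in> carrier S" "m \<in> X" "n \<in> Y" for r s m n
    using bE_smult[OF that(1,2) XF[OF that(3)] YF[OF that(4)]] by simp
  have 4: "shift_pr prU (dprod \<delta> \<epsilon>) (i + j) (bE m n) = bE m n"
    if "m \<in> X" "n \<in> Y" "shift_pr prR \<delta> i m = m" "shift_pr prS \<epsilon> j n = n" for m n i j
    by (rule bE_degree[OF XF[OF that(1)] YF[OF that(2)] that(3,4)])
  have 5: "x \<in> acl (lmod U ?T) {bE m n |m n. m \<in> carrier (lmod R X) \<and> n \<in> carrier (lmod S Y)}" if "x \<in> ?T" for x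
  proof -
    have "{bE m n |m n. m \<in> X \<and> n \<in> Y} \<subseteq> ?T" using tn_base by blast
    from acl_sub[OF abelian_FU A this that[unfolded tn_def]] show ?thesis by simp
  qed
  have 6: "\<exists>\<Lambda>. addm (lmod U ?T) K \<Lambda> \<and> \<Lambda> (bE u w) \<noteq> \<zero>\<^bsub>K\<^esub> \<and> (\<forall>v\<in>X. \<forall>h\<in>H. \<Lambda> (bE v h) = \<zero>\<^bsub>K\<^esub>)"
    if u: "u \<in> X" "u \<noteq> \<zero>\<^bsub>lmod R X\<^esub>" and H: "add_closed (lmod S Y) H" "\<forall>c\<in>carrier K. \<forall>h\<in>H. (c \<odot>\<^bsub>S\<^esub> \<one>\<^bsub>S\<^esub>) \<odot>\<^bsub>lmod S Y\<^esub> h \<in> H"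
      and w: "w \<in> Y" "w \<notin> H" for u H w
  proof -
    let ?V = "fmod (smult R) R (free R I)" and ?W = "fmod (smult S) S (free S J)"
    have HY: "H \<subseteq> Y" using add_closedD(1)[OF H(1)] by auto
    have "add_closed (lmod S (free S J)) H"
    proof (rule add_closedI)
      show "H \<subseteq> carrier (lmod S (free S J))" using HY Y(2) by auto
      show "\<zero>\<^bsub>lmod S (free S J)\<^esub> \<in> H" using add_closedD(2)[OF H(1)] by simp
      show "x \<oplus>\<^bsub>lmod S (free S J)\<^esub> y \<in> H" if "x \<in> H" "y \<in> H" for x y
        using add_closedD(3)[OF H(1) that] by simp
      show "\<ominus>\<^bsub>lmod S (free S J)\<^esub> x \<in> H" if "x \<in> H" for x
        using a_inv_sub[OF abelian_group_free[OF S.abelian_group_axioms] gsubmD(1)[OF S.gsub_gsubm[OF Y]], of x]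
          add_closedD(4)[OF H(1) that] that HY by auto
    qed
    then have sH: "sbsp K ?W H" by (rule SA.sbsp_freeI) (use H(2) in auto)
    have s0: "sbsp K ?V {\<zero>\<^bsub>?V\<^esub>}"
      by (rule sbspI[OF add_closed_zero[OF abelian_group_free[OF R.abelian_group_axioms]]]) auto
    have uc: "u \<in> carrier ?V" "u \<notin> {\<zero>\<^bsub>?V\<^esub>}" and wc: "w \<in> carrier ?W" using u XF w YF by auto
    obtain \<psi> where \<psi>: "fnl K ?V \<psi>" "\<psi> u = \<one>\<^bsub>K\<^esub>"
      using functional_exists[OF K.field_axioms RA.module_free s0 uc] by blast
    obtain \<phi> where \<phi>: "fnl K ?W \<phi>" "\<forall>x\<in>H. \<phi> x = \<zero>\<^bsub>K\<^esub>" "\<phi> w = \<one>\<^bsub>K\<^esub>"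
      using functional_exists[OF K.field_axioms SA.module_free sH wc w(2)] by blast
    obtain \<Lambda> where \<Lambda>: "addm ?F K \<Lambda>" "\<And>x y. x \<in> free R I \<Longrightarrow> y \<in> free S J \<Longrightarrow> \<Lambda> (bE x y) = \<psi> x \<otimes>\<^bsub>K\<^esub> \<phi> y"
      using bE_fnl[OF fin \<psi>(1) \<phi>(1)] by auto
    have \<psi>c: "\<psi> x \<in> carrier K" if "x \<in> free R I" for x using \<psi>(1) that addm_closed[of ?V K \<psi>] by (simp add: fnl_def)
    have "addm (lmod U ?T) K \<Lambda>" by (rule addm_fmod_subset[OF \<Lambda>(1) TF])
    moreover have "\<Lambda> (bE u w) \<noteq> \<zero>\<^bsub>K\<^esub>" using \<Lambda>(2) uc wc \<psi>(2) \<phi>(3) by simp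
    moreover have "\<forall>v\<in>X. \<forall>h\<in>H. \<Lambda> (bE v h) = \<zero>\<^bsub>K\<^esub>" using \<Lambda>(2) XF YF HY \<phi>(2) \<psi>c by auto
    ultimately show ?thesis by blast
  qed
  have "tens_sep (lmod R X) (lmod S Y) (lmod U ?T) bE"
    unfolding tens_sep_def fmod_simps(1) by (intro ballI allI impI) (rule 6)
  note 7 = this R.gsub_gmod[OF X(1)] S.gsub_gmod[OF Y(1)] U.gsub_gmod[OF gsub_tn[OF X Y fin]]
  show ?thesis unfolding tens_def
    by (intro conjI ballI allI impI subsetI 7; (rule 1 2 3 4 5); simp)
qed

text \<open>\<open>P\<close> is the tensor product of \<open>f\<close> and \<open>g\<close>. It is
  prescribed on the basis of the free module and then identified on pure tensors, by additivity in
  one factor at a time.\<close>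

lemma tens_lift:
  assumes t: "tens M qM N qN T qT t" and fin: "finite I" "finite J"
    and f: "ghom R (lmod R (free R I)) (shift_pr prR \<delta>) M qM f" and g: "ghom S (lmod S (free S J)) (shift_pr prS \<epsilon>) N qN g"
  shows "\<exists>P. ghom U (FU (iprod I J)) (shift_pr prU (dprod \<delta> \<epsilon>)) T qT P \<and>
    (\<forall>u\<in>free R I. \<forall>v\<in>free S J. P (bE u v) = t (f u) (g v))"
proof -
  note tD = tensD[OF t] and fD = ghomD[OF f, simplified] and gD = ghomD[OF g, simplified]
  define y where "y k = t (f (elm R (fst (prod_decode k)) \<one>\<^bsub>R\<^esub>)) (g (elm S (snd (prod_decode k)) \<one>\<^bsub>S\<^esub>))" for k
  let ?P = "flift T y (iprod I J)"
  note finIJ = finite_iprod[OF fin]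
  have fc: "f (elm R i \<one>\<^bsub>R\<^esub>) \<in> carrier M" "qM (\<delta> i) (f (elm R i \<one>\<^bsub>R\<^esub>)) = f (elm R i \<one>\<^bsub>R\<^esub>)" if "i \<in> I" for i
    using fD(3) fD(6)[of "elm R i \<one>\<^bsub>R\<^esub>" "\<delta> i"] that by (simp_all add: R.shift_pr_elm R.pr_one)
  have gc: "g (elm S i \<one>\<^bsub>S\<^esub>) \<in> carrier N" "qN (\<epsilon> i) (g (elm S i \<one>\<^bsub>S\<^esub>)) = g (elm S i \<one>\<^bsub>S\<^esub>)" if "i \<in> J" for i
    using gD(3) gD(6)[of "elm S i \<one>\<^bsub>S\<^esub>" "\<epsilon> i"] that by (simp_all add: S.shift_pr_elm S.pr_one)
  have tc: "t m n \<in> carrier T" if "m \<in> carrier M" "n \<in> carrier N" for m n using addm_closed[OF tD(5)] that .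
  have y: "y k \<in> carrier T" "qT (dprod \<delta> \<epsilon> k) (y k) = y k" if "k \<in> iprod I J" for k
    using that fc gc tc tD(7) by (auto simp: y_def iprod_iff dprod_def)
  have P: "ghom U (FU (iprod I J)) (shift_pr prU (dprod \<delta> \<epsilon>)) T qT ?P"
    by (rule U.flift_ghom[OF tD(3) finIJ y])
  note PA = ghomD(2)[OF P]
  have elm: "?P (bE (elm R i r) (elm S j s)) = t (f (elm R i r)) (g (elm S j s))"
    if "i \<in> I" "j \<in> J" "r \<in> carrier R" "s \<in> carrier S" for i j r s
  proof -
    have k: "prod_encode (i, j) \<in> iprod I J" using that by (simp add: iprod_def)
    have "elm R i r = (\<lambda>k. r \<otimes>\<^bsub>R\<^esub> elm R i \<one>\<^bsub>R\<^esub> k)" "elm S j s = (\<lambda>k. s \<otimes>\<^bsub>S\<^esub> elm S j \<one>\<^bsub>S\<^esub> k)"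
      using that by (auto simp: elm_def)
    then have e: "f (elm R i r) = r \<odot>\<^bsub>M\<^esub> f (elm R i \<one>\<^bsub>R\<^esub>)" "g (elm S j s) = s \<odot>\<^bsub>N\<^esub> g (elm S j \<one>\<^bsub>S\<^esub>)"
      using fD(5)[of r "elm R i \<one>\<^bsub>R\<^esub>"] gD(5)[of s "elm S j \<one>\<^bsub>S\<^esub>"] that by simp_all
    have "?P (bE (elm R i r) (elm S j s)) = \<beta> r s \<odot>\<^bsub>T\<^esub> y (prod_encode (i, j))"
      unfolding bE_elm[OF that(3,4)]
      by (rule U.flift_elm[OF gmodD(1)[OF tD(3)] finIJ y(1) k]) (use that in auto)
    also have "\<dots> = t (f (elm R i r)) (g (elm S j s))"
      unfolding e using tD(6)[OF that(3,4) fc(1)[OF that(1)] gc(1)[OF that(2)]] by (simp add: y_def)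
    finally show ?thesis .
  qed
  have 1: "?P (bE (elm R i r) v) = t (f (elm R i r)) (g v)" if "i \<in> I" "r \<in> carrier R" "v \<in> free S J" for i r v
  proof (rule addm_eq_on_acl[OF abelian_group_free[OF S.abelian_group_axioms] gmodD(3)[OF tD(3)]
        addm_comp[OF bE_right PA] addm_comp[OF gD(2) tD(5)] _ _ free_gen[OF S.abelian_group_axioms fin(2) that(3)]])
  qed (use that elm fD(3) in auto)
  have "?P (bE u v) = t (f u) (g v)" if "u \<in> free R I" "v \<in> free S J" for u v
  proof (rule addm_eq_on_acl[OF abelian_group_free[OF R.abelian_group_axioms] gmodD(3)[OF tD(3)]
        addm_comp[OF bE_left PA] addm_comp[OF fD(2) tD(4)] _ _ free_gen[OF R.abelian_group_axioms fin(1) that(1)]])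
  qed (use that 1 gD(3) in auto)
  then show ?thesis using P by blast
qed

lemma tens_surj:
  assumes t: "tens M qM N qN T qT t" and pM: "pres R prR I \<delta> M qM f" and pN: "pres S prS J \<epsilon> N qN g"
    and P': "ghom U (FU (iprod I J)) (shift_pr prU (dprod \<delta> \<epsilon>)) T qT P"
      "\<forall>u\<in>free R I. \<forall>v\<in>free S J. P (bE u v) = t (f u) (g v)"
  shows "pres U prU (iprod I J) (dprod \<delta> \<epsilon>) T qT P"
proof -
  note tD = tensD[OF t] and P = P'(1) P'(2)[rule_format]
  note finIJ = finite_iprod[OF presD(1)[OF pM] presD(1)[OF pN]]
  have A: "add_closed T (P ` free U (iprod I J))"
    using add_closed_image[OF abelian_FU gmodD(3)[OF tD(3)] ghomD(2)[OF P(1)] abelian_group.add_closed_carrier[OF abelian_FU]]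
    by simp
  have "x \<in> P ` free U (iprod I J)" if "x \<in> carrier T" for x
  proof (rule acl_least[OF A _ tD(8)[OF that]])
    show "{t m n |m n. m \<in> carrier M \<and> n \<in> carrier N} \<subseteq> P ` free U (iprod I J)"
    proof
      fix z assume "z \<in> {t m n |m n. m \<in> carrier M \<and> n \<in> carrier N}"
      then obtain m n where z: "z = t m n" "m \<in> f ` free R I" "n \<in> g ` free S J"
        using presD(3)[OF pM] presD(3)[OF pN] by auto
      then obtain u v where "u \<in> free R I" "m = f u" "v \<in> free S J" "n = g v" by blast
      then show "z \<in> P ` free U (iprod I J)" using P(2) z(1) bE_free by (intro image_eqI[of z P "bE u v"]) auto
    qed
  qed
  then show ?thesis using finIJ P(1) ghomD(3)[OF P(1)] by (auto simp: pres_def)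
qed

text \<open>That the kernel is no larger than the sum expresses exactness of tensor products over a
  field. If \<open>u\<close> is outside the kernel of \<open>f\<close>, then \<open>tens_sep\<close>
  applies to \<open>f u\<close>, to \<open>g w\<close> and to the image of \<open>H\<close> under
  \<open>g\<close>. The functional it gives is pulled back along \<open>P\<close> and so vanishes on
  the kernel of \<open>P\<close>.\<close>

lemma tens_kernel:
  assumes t: "tens M qM N qN T qT t" and pM: "pres R prR I \<delta> M qM f" and pN: "pres S prS J \<epsilon> N qN g"
    and P': "ghom U (FU (iprod I J)) (shift_pr prU (dprod \<delta> \<epsilon>)) T qT P"
      "\<forall>u\<in>free R I. \<forall>v\<in>free S J. P (bE u v) = t (f u) (g v)"
  shows "kern U (iprod I J) T P =
    {(\<lambda>k. x k \<oplus>\<^bsub>U\<^esub> y k) | x y. x \<in> tn I J (kern R I M f) (free S J) \<and> y \<in> tn I J (free R I) (kern S J N g)}"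
    (is "_ = ?G")
proof -
  note tD = tensD[OF t] and fD = ghomD[OF presD(2)[OF pM], simplified] and gD = ghomD[OF presD(2)[OF pN], simplified]
  note P = P'(1) P'(2)[rule_format]
  note fin = presD(1)[OF pM] presD(1)[OF pN]
  let ?F = "FU (iprod I J)" and ?V = "fmod (smult R) R (free R I)" and ?W = "fmod (smult S) S (free S J)"
  let ?M1 = "kern R I M f" and ?N1 = "kern S J N g"
  interpret T: abelian_group T by (rule gmodD[OF tD(3)])
  have M1: "?M1 \<subseteq> free R I" and N1: "?N1 \<subseteq> free S J" by (auto simp: kern_def)
  note A1 = add_closed_tn[OF M1 subset_refl, of J] and A2 = add_closed_tn[OF subset_refl N1, of I]
  note G = add_closed_sum[OF abelian_FU A1 A2]
  have Geq: "{x \<oplus>\<^bsub>?F\<^esub> y |x y. x \<in> tn I J ?M1 (free S J) \<and> y \<in> tn I J (free R I) ?N1} = ?G" by simp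
  note PA = ghomD(2)[OF P(1)]
  have C: "add_closed ?F (kern U (iprod I J) T P)"
    unfolding kern_carrier using add_closed_vimage[OF abelian_FU T.abelian_group_axioms PA add_closed_zero[OF T.abelian_group_axioms]]
    by simp
  have f0: "t m \<zero>\<^bsub>N\<^esub> = \<zero>\<^bsub>T\<^esub>" if "m \<in> carrier M" for m
    by (rule addm_zero[OF gmodD(3)[OF tD(2)] T.abelian_group_axioms tD(5)[OF that]])
  have g0: "t \<zero>\<^bsub>M\<^esub> n = \<zero>\<^bsub>T\<^esub>" if "n \<in> carrier N" for n
    by (rule addm_zero[OF gmodD(3)[OF tD(1)] T.abelian_group_axioms tD(4)[OF that]])
  have C1: "tn I J ?M1 (free S J) \<subseteq> kern U (iprod I J) T P"
    unfolding tn_def by (intro subsetI, erule acl_least[OF C, rotated]) (auto simp: kern_def bE_free P(2) g0 gD(3))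
  have C2: "tn I J (free R I) ?N1 \<subseteq> kern U (iprod I J) T P"
    unfolding tn_def by (intro subsetI, erule acl_least[OF C, rotated]) (auto simp: kern_def bE_free P(2) f0 fD(3))
  have GC: "?G \<subseteq> kern U (iprod I J) T P"
    using C1 C2 add_closedD(3)[OF C] by (auto simp: subset_iff)
  have sN1: "sbsp K ?W ?N1" by (rule sbsp_gsub_right[OF S.gsub_kern[OF pN tD(2)] N1])
  have "z \<in> ?G" if z: "z \<in> kern U (iprod I J) T P" for z
  proof (rule tensor_sep[OF K.field_axioms RA.module_free[of I] SA.module_free[of J] abelian_FU[of "iprod I J"],
        where \<beta> = bE and N = "free S J" and M = ?M1 and ?N0.0 = ?N1 and C = "kern U (iprod I J) T P"])
    show "add_closed ?F ?G" using G(1) Geq by simp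
    show "?G \<subseteq> kern U (iprod I J) T P" by (rule GC)
    show "add_closed ?F (kern U (iprod I J) T P)" by (rule C)
    have "z \<in> tn I J (free R I) (free S J)" using tn_free[OF fin] z by (simp add: kern_def)
    then show "z \<in> acl ?F {bE v n |v n. v \<in> carrier ?V \<and> n \<in> free S J}" by (simp add: tn_def)
    show "sbsp K ?W (free S J)"
      using sbsp_gsub_right[OF S.gsub_free[OF fin(2)], of J] by simp
    show "bE v n \<in> ?G" if "v \<in> ?M1" "n \<in> free S J" for v n using G(2) tn_base[OF that] Geq by blast
    show "bE v n \<in> ?G" if "v \<in> carrier ?V" "n \<in> ?N1" for v n using G(3) tn_base[of v "free R I" n ?N1 I J] that Geq by auto
    fix u w H assume u: "u \<in> carrier ?V" "u \<notin> ?M1" and H: "sbsp K ?W H" "?N1 \<subseteq> H" "H \<subseteq> free S J" and w: "w \<in> free S J" "w \<notin> H"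
    have fu: "f u \<in> carrier M" "f u \<noteq> \<zero>\<^bsub>M\<^esub>" using u fD(3) by (auto simp: kern_def)
    have gA: "addm ?W N g" by (rule addm_fmod_subset[OF gD(2) subset_refl])
    have gH: "add_closed N (g ` H)"
      by (rule add_closed_image[OF abelian_group_free[OF S.abelian_group_axioms] gmodD(3)[OF tD(2)] gA sbspD(1)[OF H(1)]])
    have gHK: "(c \<odot>\<^bsub>S\<^esub> \<one>\<^bsub>S\<^esub>) \<odot>\<^bsub>N\<^esub> h \<in> g ` H" if c: "c \<in> carrier K" and h: "h \<in> g ` H" for c h
    proof -
      from h obtain v where v: "v \<in> H" "h = g v" by blast
      have vc: "v \<in> free S J" using v H(3) by blast
      have "(c \<odot>\<^bsub>S\<^esub> \<one>\<^bsub>S\<^esub>) \<odot>\<^bsub>N\<^esub> h = g (\<lambda>i. (c \<odot>\<^bsub>S\<^esub> \<one>\<^bsub>S\<^esub>) \<otimes>\<^bsub>S\<^esub> v i)"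
        using gD(5)[of "c \<odot>\<^bsub>S\<^esub> \<one>\<^bsub>S\<^esub>" v] v(2) vc c by simp
      also have "\<dots> = g (c \<odot>\<^bsub>?W\<^esub> v)" using SA.smult_one_mult_free[OF c vc] by simp
      finally show ?thesis using sbspD(2)[OF H(1) c v(1)] by blast
    qed
    \<comment> \<open>\<open>H\<close> contains the kernel of \<open>g\<close>, so \<open>g\<close>
      cannot map a vector outside \<open>H\<close> into the image of \<open>H\<close>.\<close>
    have gw: "g w \<in> carrier N" "g w \<notin> g ` H"
    proof -
      show "g w \<in> carrier N" using gD(3) w(1) .
      show "g w \<notin> g ` H"
      proof
        assume "g w \<in> g ` H"
        then obtain h where h: "h \<in> H" "g w = g h" by blast
        have hc: "h \<in> carrier ?W" "w \<in> carrier ?W" using h H(3) w by auto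
        interpret W: abelian_group ?W by (rule abelian_group_free[OF S.abelian_group_axioms])
        interpret N: abelian_group N by (rule gmodD[OF tD(2)])
        have "g (w \<ominus>\<^bsub>?W\<^esub> h) = \<zero>\<^bsub>N\<^esub>"
          using addm_diff[OF W.abelian_group_axioms N.abelian_group_axioms gA hc(2,1)] h(2) addm_closed[OF gA hc(1)]
          by (simp add: a_minus_def N.r_neg)
        then have "w \<ominus>\<^bsub>?W\<^esub> h \<in> ?N1" using W.minus_closed[OF hc(2,1)] by (simp add: kern_def)
        then have "w \<ominus>\<^bsub>?W\<^esub> h \<in> H" using H(2) by blast
        then have "(w \<ominus>\<^bsub>?W\<^esub> h) \<oplus>\<^bsub>?W\<^esub> h \<in> H" using sbspD(5)[OF H(1)] h(1) by blast
        moreover have "(w \<ominus>\<^bsub>?W\<^esub> h) \<oplus>\<^bsub>?W\<^esub> h = w"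
          using hc unfolding a_minus_def by (simp only: W.a_assoc W.a_inv_closed W.l_neg W.r_zero)
        ultimately show False using w(2) by simp
      qed
    qed
    obtain \<Lambda> where \<Lambda>: "addm T K \<Lambda>" "\<Lambda> (t (f u) (g w)) \<noteq> \<zero>\<^bsub>K\<^esub>" "\<forall>v\<in>carrier M. \<forall>h\<in>g ` H. \<Lambda> (t v h) = \<zero>\<^bsub>K\<^esub>"
      using tD(9)[OF fu gH gHK gw] by blast
    show "\<exists>\<Lambda>. addm ?F K \<Lambda> \<and> \<Lambda> (bE u w) \<noteq> \<zero>\<^bsub>K\<^esub> \<and> (\<forall>v\<in>carrier ?V. \<forall>h\<in>H. \<Lambda> (bE v h) = \<zero>\<^bsub>K\<^esub>) \<and>
        (\<forall>c\<in>kern U (iprod I J) T P. \<Lambda> c = \<zero>\<^bsub>K\<^esub>)"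
    proof (intro exI[of _ "\<lambda>z. \<Lambda> (P z)"] conjI ballI)
      show "addm ?F K (\<lambda>z. \<Lambda> (P z))" by (rule addm_comp[OF PA \<Lambda>(1)])
      show "\<Lambda> (P (bE u w)) \<noteq> \<zero>\<^bsub>K\<^esub>" using P(2)[of u w] u(1) w(1) \<Lambda>(2) by simp
      show "\<Lambda> (P (bE v h)) = \<zero>\<^bsub>K\<^esub>" if "v \<in> carrier ?V" "h \<in> H" for v h
      proof -
        have "h \<in> free S J" using that H(3) by blast
        then show ?thesis using P(2)[of v h] that \<Lambda>(3) fD(3)[of v] by simp
      qed
      show "\<Lambda> (P c) = \<zero>\<^bsub>K\<^esub>" if "c \<in> kern U (iprod I J) T P" for c
        using that addm_zero[OF T.abelian_group_axioms K.abelian_group_axioms \<Lambda>(1)] by (simp add: kern_def)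
    qed
  qed (use sN1 N1 z bE_left bE_right bE_scalar in auto)
  then show ?thesis using GC by blast
qed

text \<open>The kernel is the sum of two submodules whose intersection is given by
  \<open>tn_inter\<close>; \<open>fp_sum\<close> turns the three bounds \<open>n\<close> into
  \<open>Suc n\<close>.\<close>

lemma tens_haspres:
  assumes t: "tens M qM N qN T qT t" and pM: "pres R prR I \<delta> M qM f" and pN: "pres S prS J \<epsilon> N qN g"
    and "fp U prU n (tn I J (kern R I M f) (free S J)) (dprod \<delta> \<epsilon>)"
    and "fp U prU n (tn I J (free R I) (kern S J N g)) (dprod \<delta> \<epsilon>)"
    and "fp U prU n (tn I J (kern R I M f) (kern S J N g)) (dprod \<delta> \<epsilon>)"
  shows "haspres U prU (Suc n) T qT"
proof -
  note tD = tensD[OF t] and fin = presD(1)[OF pM] presD(1)[OF pN]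
  obtain P where P: "ghom U (FU (iprod I J)) (shift_pr prU (dprod \<delta> \<epsilon>)) T qT P"
    "\<forall>u\<in>free R I. \<forall>v\<in>free S J. P (bE u v) = t (f u) (g v)"
    using tens_lift[OF t fin presD(2)[OF pM] presD(2)[OF pN]] by blast
  have "tn I J (kern R I M f) (free S J) \<inter> tn I J (free R I) (kern S J N g) = tn I J (kern R I M f) (kern S J N g)"
    by (rule tn_inter[OF R.gsub_kern[OF pM tD(1)] _ S.gsub_kern[OF pN tD(2)] _ fin]) (auto simp: kern_def)
  then have "fp U prU (Suc n) (kern U (iprod I J) T P) (dprod \<delta> \<epsilon>)"
    unfolding tens_kernel[OF t pM pN P] using U.fp_sum[OF assms(4,5)] assms(6) by simp
  then show ?thesis using tens_surj[OF t pM pN P] unfolding haspres_def by blast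
qed

text \<open>\<open>tens\<close> offers no universal property from which a splitting of
  \<open>T\<close> could be defined on pure tensors. Instead the tensor product \<open>E\<close> of
  the idempotents \<open>s \<circ> f\<close> and \<open>r \<circ> g\<close> is formed on the free
  module; the kernel formula shows that it kills the kernel of \<open>P\<close>, hence it factors
  through \<open>T\<close>.\<close>

lemma tens_fgp:
  assumes t: "tens M qM N qN T qT t" and M: "fgp R prR M qM" and N: "fgp S prS N qN"
  shows "fgp U prU T qT"
proof -
  note tD = tensD[OF t]
  obtain I \<delta> f s where pM: "pres R prR I \<delta> M qM f" and s: "ghom R M qM (lmod R (free R I)) (shift_pr prR \<delta>) s"
    "\<forall>x\<in>carrier M. f (s x) = x" using M unfolding fgp_def by blast
  obtain J \<epsilon> g r where pN: "pres S prS J \<epsilon> N qN g" and r: "ghom S N qN (lmod S (free S J)) (shift_pr prS \<epsilon>) r"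
    "\<forall>x\<in>carrier N. g (r x) = x" using N unfolding fgp_def by blast
  note fin = presD(1)[OF pM] presD(1)[OF pN]
  note fD = ghomD[OF presD(2)[OF pM], simplified] and gD = ghomD[OF presD(2)[OF pN], simplified]
  note sD = ghomD[OF s(1), simplified] and rD = ghomD[OF r(1), simplified]
  let ?F = "FU (iprod I J)" and ?q = "shift_pr prU (dprod \<delta> \<epsilon>)"
  have F: "gmod U prU ?F ?q" by (rule U.gmod_free[OF finite_iprod[OF fin]])
  obtain P where P': "ghom U ?F ?q T qT P" "\<forall>u\<in>free R I. \<forall>v\<in>free S J. P (bE u v) = t (f u) (g v)"
    using tens_lift[OF t fin presD(2)[OF pM] presD(2)[OF pN]] by blast
  note P = P'(1) P'(2)[rule_format]
  have tF: "tens (lmod R (free R I)) (shift_pr prR \<delta>) (lmod S (free S J)) (shift_pr prS \<epsilon>) ?F ?q bE"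
    using tens_tn[OF R.gsub_free[OF fin(1)] subset_refl S.gsub_free[OF fin(2)] subset_refl fin] tn_free[OF fin] by simp
  obtain E where E: "ghom U ?F ?q ?F ?q E" "\<And>u v. u \<in> free R I \<Longrightarrow> v \<in> free S J \<Longrightarrow> E (bE u v) = bE (s (f u)) (r (g v))"
    using tens_lift[OF tF fin ghom_comp[OF presD(2)[OF pM] s(1)] ghom_comp[OF presD(2)[OF pN] r(1)]] by auto
  note pT = tens_surj[OF t pM pN P']
  have z0: "s \<zero>\<^bsub>M\<^esub> = (\<lambda>i. \<zero>\<^bsub>R\<^esub>)" "r \<zero>\<^bsub>N\<^esub> = (\<lambda>i. \<zero>\<^bsub>S\<^esub>)"
    using addm_zero[OF gmodD(3)[OF tD(1)] abelian_group_free[OF R.abelian_group_axioms] sD(2)]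
      addm_zero[OF gmodD(3)[OF tD(2)] abelian_group_free[OF S.abelian_group_axioms] rD(2)] by simp_all
  have b0: "\<And>v. v \<in> free S J \<Longrightarrow> bE (\<lambda>i. \<zero>\<^bsub>R\<^esub>) v = (\<lambda>i. \<zero>\<^bsub>U\<^esub>)"
    "\<And>u. u \<in> free R I \<Longrightarrow> bE u (\<lambda>i. \<zero>\<^bsub>S\<^esub>) = (\<lambda>i. \<zero>\<^bsub>U\<^esub>)"
    by (auto simp: bE_def free_def)
  have KE: "E z = \<zero>\<^bsub>?F\<^esub>" if z: "z \<in> kern U (iprod I J) T P" for z
  proof -
    note EA = ghomD(2)[OF E(1)]
    have C: "add_closed ?F {x \<in> carrier ?F. E x \<in> {\<zero>\<^bsub>?F\<^esub>}}"
      by (rule add_closed_vimage[OF abelian_FU abelian_FU EA add_closed_zero[OF abelian_FU]])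
    obtain x y where xy: "z = x \<oplus>\<^bsub>?F\<^esub> y" "x \<in> tn I J (kern R I M f) (free S J)" "y \<in> tn I J (free R I) (kern S J N g)"
      using z unfolding tens_kernel[OF t pM pN P'] by auto
    have "x \<in> {x \<in> carrier ?F. E x \<in> {\<zero>\<^bsub>?F\<^esub>}}"
      by (rule acl_least[OF C _ xy(2)[unfolded tn_def]])
        (auto simp: kern_def bE_free E(2) z0 b0 rD(3) gD(3))
    moreover have "y \<in> {x \<in> carrier ?F. E x \<in> {\<zero>\<^bsub>?F\<^esub>}}"
      by (rule acl_least[OF C _ xy(3)[unfolded tn_def]])
        (auto simp: kern_def bE_free E(2) z0 b0 sD(3) fD(3))
    ultimately have "z \<in> {x \<in> carrier ?F. E x \<in> {\<zero>\<^bsub>?F\<^esub>}}" using add_closedD(3)[OF C] xy(1) by blast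
    then show ?thesis by simp
  qed
  \<comment> \<open>\<open>f\<close> after \<open>s\<close> and \<open>g\<close> after
    \<open>r\<close> are identities, so \<open>P\<close> is unchanged by \<open>E\<close>. Once
    \<open>E\<close> is written as \<open>h\<close> after \<open>P\<close>, this makes
    \<open>h\<close> a section of \<open>P\<close>.\<close>
  have PE: "P (E z) = P z" if "z \<in> free U (iprod I J)" for z
  proof (rule addm_eq_on_acl[OF abelian_FU gmodD(3)[OF tD(3)] addm_comp[OF ghomD(2)[OF E(1)] ghomD(2)[OF P(1)]] ghomD(2)[OF P(1)]])
    show "z \<in> acl ?F {bE u v |u v. u \<in> free R I \<and> v \<in> free S J}" using tn_free[OF fin] that by (simp add: tn_def)
    fix b assume "b \<in> {bE u v |u v. u \<in> free R I \<and> v \<in> free S J}"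
    then obtain u v where b: "b = bE u v" "u \<in> free R I" "v \<in> free S J" by auto
    then show "P (E b) = P b" using P(2) E(2) fD(3) gD(3) sD(3) rD(3) s(2) r(2) by simp
  qed (use bE_free in auto)
  have "\<exists>h. ghom U T qT ?F ?q h \<and> (\<forall>x\<in>carrier ?F. h (P x) = E x)"
    by (rule ghom_factor[OF F tD(3) F P(1) presD(4)[OF pT] E(1)]) (use KE in \<open>simp add: kern_def\<close>)
  then obtain h where h: "ghom U T qT ?F ?q h" "\<forall>x\<in>carrier ?F. h (P x) = E x" by blast
  show ?thesis
  proof (rule U.fgpI[OF presD(1,2)[OF pT] h(1)])
    fix x assume "x \<in> carrier T"
    then have "x \<in> P ` free U (iprod I J)" using presD(3)[OF pT] by simp
    then obtain z where "z \<in> free U (iprod I J)" "x = P z" by blast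
    then show "P (h x) = x" using h(2) PE by simp
  qed
qed

text \<open>Induction on the sum of the lengths. The three tensor products that
  \<open>tens_haspres\<close> asks for have a first syzygy in at least one factor, and a free factor
  counts with length 0.\<close>

theorem fp_tn:
  assumes "fp R prR a X \<delta>" "X \<subseteq> free R I" "fp S prS b Y \<epsilon>" "Y \<subseteq> free S J" "finite I" "finite J"
  shows "\<exists>n. fp U prU n (tn I J X Y) (dprod \<delta> \<epsilon>)"
  using assms
proof (induction "a + b" arbitrary: a b X Y \<delta> \<epsilon> I J rule: less_induct)
  case less
  note X = fp_gsub[OF less.prems(1)] less.prems(2) and Y = fp_gsub[OF less.prems(3)] less.prems(4) and fin = less.prems(5,6)
  note t = tens_tn[OF X Y fin]
  note gT = gsub_tn[OF X Y fin]
  show ?case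
  proof (cases "a = 0 \<and> b = 0")
    case True
    then have "fp U prU 0 (tn I J X Y) (dprod \<delta> \<epsilon>)" using tens_fgp[OF t] less.prems(1,3) gT by simp
    then show ?thesis by blast
  next
    case False
    \<comment> \<open>Truncated subtraction is intended: a module of length 0 has a presentation
      whose kernel again has length 0. Since \<open>a\<close> and \<open>b\<close> are not both 0,
      the sum of the lengths drops in all three calls.\<close>
    have "haspres R prR (a - 1) (lmod R X) (shift_pr prR \<delta>)"
      using less.prems(1) R.fgp_haspres[OF R.gsub_gmod[OF X(1)]] by (cases a) (auto simp: haspres_def)
    then obtain I' \<delta>' f where pM: "pres R prR I' \<delta>' (lmod R X) (shift_pr prR \<delta>) f"
      and M1: "fp R prR (a - 1) (kern R I' (lmod R X) f) \<delta>'" unfolding haspres_def by blast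
    have "haspres S prS (b - 1) (lmod S Y) (shift_pr prS \<epsilon>)"
      using less.prems(3) S.fgp_haspres[OF S.gsub_gmod[OF Y(1)]] by (cases b) (auto simp: haspres_def)
    then obtain J' \<epsilon>' g where pN: "pres S prS J' \<epsilon>' (lmod S Y) (shift_pr prS \<epsilon>) g"
      and N1: "fp S prS (b - 1) (kern S J' (lmod S Y) g) \<epsilon>'" unfolding haspres_def by blast
    let ?M1 = "kern R I' (lmod R X) f" and ?N1 = "kern S J' (lmod S Y) g"
    note fin' = presD(1)[OF pM] presD(1)[OF pN]
    have sub: "?M1 \<subseteq> free R I'" "?N1 \<subseteq> free S J'" by (auto simp: kern_def)
    have lt: "(a - 1) + 0 < a + b" "0 + (b - 1) < a + b" "(a - 1) + (b - 1) < a + b" using False by auto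
    obtain n1 where n1: "fp U prU n1 (tn I' J' ?M1 (free S J')) (dprod \<delta>' \<epsilon>')"
      using less.hyps[OF lt(1) M1 sub(1) S.fp_free[OF fin'(2), of \<epsilon>'] subset_refl fin'] by blast
    obtain n2 where n2: "fp U prU n2 (tn I' J' (free R I') ?N1) (dprod \<delta>' \<epsilon>')"
      using less.hyps[OF lt(2) R.fp_free[OF fin'(1), of \<delta>'] subset_refl N1 sub(2) fin'] by blast
    obtain n3 where n3: "fp U prU n3 (tn I' J' ?M1 ?N1) (dprod \<delta>' \<epsilon>')"
      using less.hyps[OF lt(3) M1 sub(1) N1 sub(2) fin'] by blast
    define n where "n = max n1 (max n2 n3)"
    have "haspres U prU (Suc n) (lmod U (tn I J X Y)) (shift_pr prU (dprod \<delta> \<epsilon>))"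
      by (rule tens_haspres[OF t pM pN U.fp_mono[OF _ n1] U.fp_mono[OF _ n2] U.fp_mono[OF _ n3]]) (auto simp: n_def)
    then have "fp U prU (Suc (Suc n)) (tn I J X Y) (dprod \<delta> \<epsilon>)" using gT by (simp only: fp_Suc)
    then show ?thesis by blast
  qed
qed

text \<open>One more application of \<open>tens_haspres\<close>, outside the induction of
  \<open>fp_tn\<close>: here \<open>M\<close>, \<open>N\<close> and \<open>T\<close> may have any
  element types, and their syzygies are submodules of free modules.\<close>

theorem haspres_tens:
  assumes t: "tens M qM N qN T qT t" and M: "haspres R prR a M qM" and N: "haspres S prS b N qN"
  shows "\<exists>n. haspres U prU n T qT"
proof -
  obtain I \<delta> f where pM: "pres R prR I \<delta> M qM f" and M1: "fp R prR a (kern R I M f) \<delta>" using M unfolding haspres_def by blast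
  obtain J \<epsilon> g where pN: "pres S prS J \<epsilon> N qN g" and N1: "fp S prS b (kern S J N g) \<epsilon>" using N unfolding haspres_def by blast
  note fin = presD(1)[OF pM] presD(1)[OF pN]
  have sub: "kern R I M f \<subseteq> free R I" "kern S J N g \<subseteq> free S J" by (auto simp: kern_def)
  obtain n1 where n1: "fp U prU n1 (tn I J (kern R I M f) (free S J)) (dprod \<delta> \<epsilon>)"
    using fp_tn[OF M1 sub(1) S.fp_free[OF fin(2), of \<epsilon>] subset_refl fin] by blast
  obtain n2 where n2: "fp U prU n2 (tn I J (free R I) (kern S J N g)) (dprod \<delta> \<epsilon>)"
    using fp_tn[OF R.fp_free[OF fin(1), of \<delta>] subset_refl N1 sub(2) fin] by blast
  obtain n3 where n3: "fp U prU n3 (tn I J (kern R I M f) (kern S J N g)) (dprod \<delta> \<epsilon>)"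
    using fp_tn[OF M1 sub(1) N1 sub(2) fin] by blast
  define n where "n = max n1 (max n2 n3)"
  have "haspres U prU (Suc n) T qT"
    by (rule tens_haspres[OF t pM pN U.fp_mono[OF _ n1] U.fp_mono[OF _ n2] U.fp_mono[OF _ n3]]) (auto simp: n_def)
  then show ?thesis by blast
qed

end

section \<open>The tensor product of two algebras\<close>

lemma malg_simps:
  "carrier (monoid_algebra K G) = {f. range f \<subseteq> carrier K \<and> finite {x. f x \<noteq> \<zero>\<^bsub>K\<^esub>} \<and> {x. f x \<noteq> \<zero>\<^bsub>K\<^esub>} \<subseteq> carrier G}"
  "mult (monoid_algebra K G) = (\<lambda>f g z. \<Oplus>\<^bsub>K\<^esub> p \<in> {(x, y). f x \<noteq> \<zero>\<^bsub>K\<^esub> \<and> g y \<noteq> \<zero>\<^bsub>K\<^esub> \<and> x \<otimes>\<^bsub>G\<^esub> y = z}.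
       f (fst p) \<otimes>\<^bsub>K\<^esub> g (snd p))"
  "one (monoid_algebra K G) = basis_elem K \<one>\<^bsub>G\<^esub>" "zero (monoid_algebra K G) = (\<lambda>x. \<zero>\<^bsub>K\<^esub>)"
  "add (monoid_algebra K G) = (\<lambda>f g x. f x \<oplus>\<^bsub>K\<^esub> g x)" "smult (monoid_algebra K G) = (\<lambda>c f x. c \<otimes>\<^bsub>K\<^esub> f x)"
  by (simp_all add: monoid_algebra_def basis_elem_def)

definition lin_ext :: "('k, 'c) ring_scheme \<Rightarrow> ('k, 'z) module \<Rightarrow> ('x \<Rightarrow> 'z) \<Rightarrow> ('x \<Rightarrow> 'k) \<Rightarrow> 'z"
  where "lin_ext K Z g f = (\<Oplus>\<^bsub>Z\<^esub>p \<in> {p. f p \<noteq> \<zero>\<^bsub>K\<^esub>}. f p \<odot>\<^bsub>Z\<^esub> g p)"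

section \<open>The algebra of a monoid over a commutative ring\<close>

locale cring_monoid = K: cring K + G: monoid G for K (structure) and G (structure)
begin

abbreviation "F \<equiv> monoid_algebra K G"
abbreviation "e x \<equiv> basis_elem K x"

lemma F_D:
  assumes "f \<in> carrier F"
  shows "f x \<in> carrier K" "finite {x. f x \<noteq> \<zero>\<^bsub>K\<^esub>}" "f x \<noteq> \<zero>\<^bsub>K\<^esub> \<Longrightarrow> x \<in> carrier G"
  using assms by (auto simp: malg_simps)

lemma F_I:
  assumes "\<And>x. f x \<in> carrier K" "finite X" "X \<subseteq> carrier G" "\<And>x. x \<notin> X \<Longrightarrow> f x = \<zero>\<^bsub>K\<^esub>"
  shows "f \<in> carrier F"
proof -
  have "{x. f x \<noteq> \<zero>\<^bsub>K\<^esub>} \<subseteq> X" using assms(4) by auto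
  then show ?thesis using assms(1-3) finite_subset by (auto simp: malg_simps)
qed

lemma F_supp:
  assumes "f \<in> carrier F"
  obtains X where "finite X" "X \<subseteq> carrier G" "\<And>x. x \<notin> X \<Longrightarrow> f x = \<zero>\<^bsub>K\<^esub>"
  using assms by (intro that[of "{x. f x \<noteq> \<zero>\<^bsub>K\<^esub>}"]) (auto simp: malg_simps)

lemma F_add: "f \<in> carrier F \<Longrightarrow> g \<in> carrier F \<Longrightarrow> (\<lambda>x. f x \<oplus>\<^bsub>K\<^esub> g x) \<in> carrier F"
  by (rule F_I[of _ "{x. f x \<noteq> \<zero>\<^bsub>K\<^esub>} \<union> {x. g x \<noteq> \<zero>\<^bsub>K\<^esub>}"]) (auto simp: F_D)

lemma F_smult: "c \<in> carrier K \<Longrightarrow> f \<in> carrier F \<Longrightarrow> (\<lambda>x. c \<otimes>\<^bsub>K\<^esub> f x) \<in> carrier F"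
  by (rule F_I[of _ "{x. f x \<noteq> \<zero>\<^bsub>K\<^esub>}"]) (auto simp: F_D)

lemma F_module: "module K F"
proof (intro moduleI abelian_groupI K.cring_axioms)
  show "\<exists>y\<in>carrier F. y \<oplus>\<^bsub>F\<^esub> x = \<zero>\<^bsub>F\<^esub>" if "x \<in> carrier F" for x
  proof (rule bexI)
    show "(\<lambda>z. (\<ominus>\<^bsub>K\<^esub> \<one>\<^bsub>K\<^esub>) \<otimes>\<^bsub>K\<^esub> x z) \<in> carrier F" using F_smult that by simp
    show "(\<lambda>z. (\<ominus>\<^bsub>K\<^esub> \<one>\<^bsub>K\<^esub>) \<otimes>\<^bsub>K\<^esub> x z) \<oplus>\<^bsub>F\<^esub> x = \<zero>\<^bsub>F\<^esub>"
      using F_D(1)[OF that] by (simp add: malg_simps K.l_minus K.l_neg)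
  qed
  show "\<zero>\<^bsub>F\<^esub> \<in> carrier F" by (simp add: malg_simps)
qed (use F_add F_smult F_D(1) in \<open>auto simp: malg_simps(4-6) K.l_distr K.r_distr K.a_ac K.m_assoc\<close>)

interpretation F: module K F by (rule F_module)

lemma e_closed [simp]: "x \<in> carrier G \<Longrightarrow> e x \<in> carrier F"
  by (rule F_I[of _ "{x}"]) (auto simp: basis_elem_def)

lemma F_finsum_apply:
  assumes "finite I" "\<And>i. i \<in> I \<Longrightarrow> f i \<in> carrier F"
  shows "finsum F f I x = (\<Oplus>\<^bsub>K\<^esub>i\<in>I. f i x)"
  using addm_finsum[OF F.abelian_group_axioms K.abelian_group_axioms _ assms, of "\<lambda>f. f x"] F_D(1)
  by (auto simp: addm_def malg_simps(5))

lemma F_gen: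
  assumes f: "f \<in> carrier F"
  shows "f \<in> acl F {c \<odot>\<^bsub>F\<^esub> e x | c x. c \<in> carrier K \<and> x \<in> carrier G}"
proof -
  let ?I = "{x. f x \<noteq> \<zero>\<^bsub>K\<^esub>}" and ?S = "{c \<odot>\<^bsub>F\<^esub> e x | c x. c \<in> carrier K \<and> x \<in> carrier G}"
  have c: "f x \<odot>\<^bsub>F\<^esub> e x \<in> carrier F" if "x \<in> ?I" for x using F_D[OF f] that by (intro F.smult_closed e_closed) auto
  have "f = finsum F (\<lambda>x. f x \<odot>\<^bsub>F\<^esub> e x) ?I"
  proof
    fix z
    have "finsum F (\<lambda>x. f x \<odot>\<^bsub>F\<^esub> e x) ?I z = (\<Oplus>\<^bsub>K\<^esub>x\<in>?I. (f x \<odot>\<^bsub>F\<^esub> e x) z)"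
      by (rule F_finsum_apply[OF F_D(2)[OF f] c])
    also have "\<dots> = (\<Oplus>\<^bsub>K\<^esub>x\<in>?I. if z = x then f x else \<zero>\<^bsub>K\<^esub>)"
      by (rule K.finsum_cong') (use F_D(1)[OF f] in \<open>auto simp: malg_simps basis_elem_def\<close>)
    also have "\<dots> = f z"
    proof (cases "z \<in> ?I")
      case True
      then show ?thesis using F_D[OF f] by (intro K.add.finprod_singleton) auto
    next
      case False
      then have "(\<Oplus>\<^bsub>K\<^esub>x\<in>?I. if z = x then f x else \<zero>\<^bsub>K\<^esub>) = (\<Oplus>\<^bsub>K\<^esub>x\<in>?I. \<zero>\<^bsub>K\<^esub>)" by (intro K.finsum_cong') auto
      then show ?thesis using False by (simp add: K.finsum_zero)
    qed
    finally show "f z = finsum F (\<lambda>x. f x \<odot>\<^bsub>F\<^esub> e x) ?I z" by simp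
  qed
  also have "\<dots> \<in> acl F ?S"
  proof (rule F.add_closed_finsum[OF F.add_closed_acl])
    show "?S \<subseteq> carrier F" by auto
    show "f x \<odot>\<^bsub>F\<^esub> e x \<in> acl F ?S" if "x \<in> ?I" for x
      using F_D(1)[OF f] F_D(3)[OF f, of x] that by (intro acl_base) blast
  qed
  finally show ?thesis .
qed

lemma lin_ext_over:
  assumes Z: "module K Z" and g: "\<And>x. x \<in> carrier G \<Longrightarrow> g x \<in> carrier Z"
    and f: "f \<in> carrier F" and X: "finite X" "X \<subseteq> carrier G" "\<And>x. x \<notin> X \<Longrightarrow> f x = \<zero>\<^bsub>K\<^esub>"
  shows "lin_ext K Z g f = (\<Oplus>\<^bsub>Z\<^esub>x\<in>X. f x \<odot>\<^bsub>Z\<^esub> g x)"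
proof -
  interpret Z: module K Z by fact
  show ?thesis unfolding lin_ext_def
    by (rule Z.add.finprod_mono_neutral_cong_left) (use X g F_D(1)[OF f] in \<open>auto simp: subset_iff\<close>)
qed

lemma lin_ext_addm:
  assumes Z: "module K Z" and g: "\<And>x. x \<in> carrier G \<Longrightarrow> g x \<in> carrier Z"
  shows "addm F Z (lin_ext K Z g)"
proof (rule addmI)
  interpret Z: module K Z by fact
  fix f assume f: "f \<in> carrier F"
  show "lin_ext K Z g f \<in> carrier Z"
    unfolding lin_ext_def by (rule Z.finsum_closed) (use F_D[OF f] g in auto)
  fix h assume h: "h \<in> carrier F"
  obtain X where X: "finite X" "X \<subseteq> carrier G" "\<And>x. x \<notin> X \<Longrightarrow> f x = \<zero>\<^bsub>K\<^esub>" using F_supp[OF f] by blast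
  obtain Y where Y: "finite Y" "Y \<subseteq> carrier G" "\<And>x. x \<notin> Y \<Longrightarrow> h x = \<zero>\<^bsub>K\<^esub>" using F_supp[OF h] by blast
  have c: "finite (X \<union> Y)" "X \<union> Y \<subseteq> carrier G" using X Y by auto
  note O = lin_ext_over[OF Z g _ c]
  have "lin_ext K Z g (f \<oplus>\<^bsub>F\<^esub> h) = (\<Oplus>\<^bsub>Z\<^esub>x\<in>X \<union> Y. (f \<oplus>\<^bsub>F\<^esub> h) x \<odot>\<^bsub>Z\<^esub> g x)"
    by (rule O) (use f h X Y F_add in \<open>auto simp: malg_simps(5)\<close>)
  also have "\<dots> = (\<Oplus>\<^bsub>Z\<^esub>x\<in>X \<union> Y. f x \<odot>\<^bsub>Z\<^esub> g x \<oplus>\<^bsub>Z\<^esub> h x \<odot>\<^bsub>Z\<^esub> g x)"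
    by (rule Z.finsum_cong') (use c g F_D(1)[OF f] F_D(1)[OF h] in \<open>auto simp: malg_simps(5) Z.smult_l_distr subset_iff\<close>)
  also have "\<dots> = (\<Oplus>\<^bsub>Z\<^esub>x\<in>X \<union> Y. f x \<odot>\<^bsub>Z\<^esub> g x) \<oplus>\<^bsub>Z\<^esub> (\<Oplus>\<^bsub>Z\<^esub>x\<in>X \<union> Y. h x \<odot>\<^bsub>Z\<^esub> g x)"
    by (rule Z.finsum_addf) (use c g F_D(1)[OF f] F_D(1)[OF h] in \<open>auto simp: subset_iff\<close>)
  also have "\<dots> = lin_ext K Z g f \<oplus>\<^bsub>Z\<^esub> lin_ext K Z g h"
    using O[OF _ f] O[OF _ h] g X(3) Y(3) by simp
  finally show "lin_ext K Z g (f \<oplus>\<^bsub>F\<^esub> h) = lin_ext K Z g f \<oplus>\<^bsub>Z\<^esub> lin_ext K Z g h" .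
qed

lemma lin_ext_smult:
  assumes Z: "module K Z" and g: "\<And>x. x \<in> carrier G \<Longrightarrow> g x \<in> carrier Z" and c: "c \<in> carrier K" and f: "f \<in> carrier F"
  shows "lin_ext K Z g (c \<odot>\<^bsub>F\<^esub> f) = c \<odot>\<^bsub>Z\<^esub> lin_ext K Z g f"
proof -
  interpret Z: module K Z by fact
  obtain X where X: "finite X" "X \<subseteq> carrier G" "\<And>x. x \<notin> X \<Longrightarrow> f x = \<zero>\<^bsub>K\<^esub>" using F_supp[OF f] by blast
  have "lin_ext K Z g (c \<odot>\<^bsub>F\<^esub> f) = (\<Oplus>\<^bsub>Z\<^esub>x\<in>X. (c \<odot>\<^bsub>F\<^esub> f) x \<odot>\<^bsub>Z\<^esub> g x)"
    by (rule lin_ext_over[OF Z g _ X(1,2)]) (use c f X(3) F_smult in \<open>auto simp: malg_simps(6)\<close>)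
  also have "\<dots> = (\<Oplus>\<^bsub>Z\<^esub>x\<in>X. c \<odot>\<^bsub>Z\<^esub> (f x \<odot>\<^bsub>Z\<^esub> g x))"
    by (rule Z.finsum_cong') (use X(2) c g F_D(1)[OF f] in \<open>auto simp: malg_simps(6) Z.smult_assoc1 subset_iff\<close>)
  also have "\<dots> = c \<odot>\<^bsub>Z\<^esub> (\<Oplus>\<^bsub>Z\<^esub>x\<in>X. f x \<odot>\<^bsub>Z\<^esub> g x)"
    by (rule Z.finsum_smult_ldistr[symmetric]) (use X c g F_D(1)[OF f] in auto)
  also have "\<dots> = c \<odot>\<^bsub>Z\<^esub> lin_ext K Z g f" using lin_ext_over[OF Z g f X] by simp
  finally show ?thesis .
qed

lemma lin_ext_basis:
  assumes Z: "module K Z" and g: "\<And>x. x \<in> carrier G \<Longrightarrow> g x \<in> carrier Z" and x: "x \<in> carrier G"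
  shows "lin_ext K Z g (e x) = g x"
proof -
  interpret Z: module K Z by fact
  have "lin_ext K Z g (e x) = (\<Oplus>\<^bsub>Z\<^esub>y\<in>{x}. e x y \<odot>\<^bsub>Z\<^esub> g y)"
    by (rule lin_ext_over[OF Z g e_closed[OF x]]) (use x in \<open>auto simp: basis_elem_def\<close>)
  also have "\<dots> = g x" using g[OF x] by (subst Z.finsum_insert) (auto simp: basis_elem_def)
  finally show ?thesis .
qed

text \<open>The definition sums over the pairs in the exact supports with a prescribed product. A
  fixed rectangle \<open>X \<times> Y\<close> with an indicator makes the convolutions of different
  functions comparable term by term.\<close>

lemma conv_over:
  assumes f: "f \<in> carrier F" and g: "g \<in> carrier F"
    and X: "finite X" "\<And>x. x \<notin> X \<Longrightarrow> f x = \<zero>\<^bsub>K\<^esub>" and Y: "finite Y" "\<And>x. x \<notin> Y \<Longrightarrow> g x = \<zero>\<^bsub>K\<^esub>"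
  shows "(f \<otimes>\<^bsub>F\<^esub> g) z = (\<Oplus>\<^bsub>K\<^esub>p\<in>X \<times> Y. if fst p \<otimes>\<^bsub>G\<^esub> snd p = z then f (fst p) \<otimes>\<^bsub>K\<^esub> g (snd p) else \<zero>\<^bsub>K\<^esub>)"
  unfolding malg_simps(2)
  by (rule K.add.finprod_mono_neutral_cong_left) (use X Y F_D(1)[OF f] F_D(1)[OF g] in \<open>auto split: if_splits\<close>)

lemma conv_closed:
  assumes f: "f \<in> carrier F" and g: "g \<in> carrier F"
  shows "f \<otimes>\<^bsub>F\<^esub> g \<in> carrier F"
proof -
  obtain X where X: "finite X" "X \<subseteq> carrier G" "\<And>x. x \<notin> X \<Longrightarrow> f x = \<zero>\<^bsub>K\<^esub>" using F_supp[OF f] by blast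
  obtain Y where Y: "finite Y" "Y \<subseteq> carrier G" "\<And>x. x \<notin> Y \<Longrightarrow> g x = \<zero>\<^bsub>K\<^esub>" using F_supp[OF g] by blast
  have O: "(f \<otimes>\<^bsub>F\<^esub> g) z = (\<Oplus>\<^bsub>K\<^esub>p\<in>X \<times> Y. if fst p \<otimes>\<^bsub>G\<^esub> snd p = z then f (fst p) \<otimes>\<^bsub>K\<^esub> g (snd p) else \<zero>\<^bsub>K\<^esub>)" for z
    by (rule conv_over[OF f g X(1) _ Y(1)]) (use X(3) Y(3) in auto)
  show ?thesis
  proof (rule F_I[of _ "(\<lambda>p. fst p \<otimes>\<^bsub>G\<^esub> snd p) ` (X \<times> Y)"])
    show "(f \<otimes>\<^bsub>F\<^esub> g) z \<in> carrier K" for z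
      unfolding O by (rule K.finsum_closed) (use F_D(1)[OF f] F_D(1)[OF g] in auto)
    show "(f \<otimes>\<^bsub>F\<^esub> g) z = \<zero>\<^bsub>K\<^esub>" if "z \<notin> (\<lambda>p. fst p \<otimes>\<^bsub>G\<^esub> snd p) ` (X \<times> Y)" for z
    proof -
      have "(f \<otimes>\<^bsub>F\<^esub> g) z = (\<Oplus>\<^bsub>K\<^esub>p\<in>X \<times> Y. \<zero>\<^bsub>K\<^esub>)"
        unfolding O by (rule K.finsum_cong') (use that in auto)
      then show ?thesis by (simp add: K.finsum_zero)
    qed
  qed (use X(1,2) Y(1,2) in \<open>auto simp: subset_iff\<close>)
qed

lemma conv_left: "g \<in> carrier F \<Longrightarrow> addm F F (\<lambda>f. f \<otimes>\<^bsub>F\<^esub> g)"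
proof (rule addmI)
  fix f h assume g: "g \<in> carrier F" and f: "f \<in> carrier F" and h: "h \<in> carrier F"
  obtain X where X: "finite X" "X \<subseteq> carrier G" "\<And>x. x \<notin> X \<Longrightarrow> f x = \<zero>\<^bsub>K\<^esub>" using F_supp[OF f] by blast
  obtain Y where Y: "finite Y" "Y \<subseteq> carrier G" "\<And>x. x \<notin> Y \<Longrightarrow> h x = \<zero>\<^bsub>K\<^esub>" using F_supp[OF h] by blast
  obtain W where W: "finite W" "W \<subseteq> carrier G" "\<And>x. x \<notin> W \<Longrightarrow> g x = \<zero>\<^bsub>K\<^esub>" using F_supp[OF g] by blast
  have XY: "finite (X \<union> Y)" using X Y by auto
  show "(f \<oplus>\<^bsub>F\<^esub> h) \<otimes>\<^bsub>F\<^esub> g = f \<otimes>\<^bsub>F\<^esub> g \<oplus>\<^bsub>F\<^esub> h \<otimes>\<^bsub>F\<^esub> g"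
  proof
    fix z
    let ?t = "\<lambda>f p. if fst p \<otimes>\<^bsub>G\<^esub> snd p = z then f (fst p) \<otimes>\<^bsub>K\<^esub> g (snd p) else \<zero>\<^bsub>K\<^esub>"
    have c: "?t f p \<in> carrier K" "?t h p \<in> carrier K" for p using F_D(1)[OF f] F_D(1)[OF h] F_D(1)[OF g] by auto
    have "((f \<oplus>\<^bsub>F\<^esub> h) \<otimes>\<^bsub>F\<^esub> g) z = (\<Oplus>\<^bsub>K\<^esub>p\<in>(X \<union> Y) \<times> W. ?t (f \<oplus>\<^bsub>F\<^esub> h) p)"
      by (rule conv_over[OF F.a_closed[OF f h] g XY _ W(1,3)]) (use X Y in \<open>auto simp: malg_simps(5)\<close>)
    also have "\<dots> = (\<Oplus>\<^bsub>K\<^esub>p\<in>(X \<union> Y) \<times> W. ?t f p \<oplus>\<^bsub>K\<^esub> ?t h p)"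
      by (rule K.finsum_cong') (use F_D(1)[OF f] F_D(1)[OF h] F_D(1)[OF g] in \<open>auto simp: malg_simps(5) K.l_distr\<close>)
    also have "\<dots> = (\<Oplus>\<^bsub>K\<^esub>p\<in>(X \<union> Y) \<times> W. ?t f p) \<oplus>\<^bsub>K\<^esub> (\<Oplus>\<^bsub>K\<^esub>p\<in>(X \<union> Y) \<times> W. ?t h p)"
      by (rule K.finsum_addf) (use c in auto)
    also have "(\<Oplus>\<^bsub>K\<^esub>p\<in>(X \<union> Y) \<times> W. ?t f p) = (f \<otimes>\<^bsub>F\<^esub> g) z"
      by (rule conv_over[OF f g XY _ W(1,3), symmetric]) (use X in auto)
    also have "(\<Oplus>\<^bsub>K\<^esub>p\<in>(X \<union> Y) \<times> W. ?t h p) = (h \<otimes>\<^bsub>F\<^esub> g) z"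
      by (rule conv_over[OF h g XY _ W(1,3), symmetric]) (use Y in auto)
    finally show "((f \<oplus>\<^bsub>F\<^esub> h) \<otimes>\<^bsub>F\<^esub> g) z = (f \<otimes>\<^bsub>F\<^esub> g \<oplus>\<^bsub>F\<^esub> h \<otimes>\<^bsub>F\<^esub> g) z" by (simp add: malg_simps(5))
  qed
qed (rule conv_closed)

lemma conv_right: "g \<in> carrier F \<Longrightarrow> addm F F (\<lambda>f. g \<otimes>\<^bsub>F\<^esub> f)"
proof (rule addmI)
  fix f h assume g: "g \<in> carrier F" and f: "f \<in> carrier F" and h: "h \<in> carrier F"
  obtain X where X: "finite X" "X \<subseteq> carrier G" "\<And>x. x \<notin> X \<Longrightarrow> f x = \<zero>\<^bsub>K\<^esub>" using F_supp[OF f] by blast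
  obtain Y where Y: "finite Y" "Y \<subseteq> carrier G" "\<And>x. x \<notin> Y \<Longrightarrow> h x = \<zero>\<^bsub>K\<^esub>" using F_supp[OF h] by blast
  obtain W where W: "finite W" "W \<subseteq> carrier G" "\<And>x. x \<notin> W \<Longrightarrow> g x = \<zero>\<^bsub>K\<^esub>" using F_supp[OF g] by blast
  have XY: "finite (X \<union> Y)" using X Y by auto
  show "g \<otimes>\<^bsub>F\<^esub> (f \<oplus>\<^bsub>F\<^esub> h) = g \<otimes>\<^bsub>F\<^esub> f \<oplus>\<^bsub>F\<^esub> g \<otimes>\<^bsub>F\<^esub> h"
  proof
    fix z
    let ?t = "\<lambda>f p. if fst p \<otimes>\<^bsub>G\<^esub> snd p = z then g (fst p) \<otimes>\<^bsub>K\<^esub> f (snd p) else \<zero>\<^bsub>K\<^esub>"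
    have c: "?t f p \<in> carrier K" "?t h p \<in> carrier K" for p using F_D(1)[OF f] F_D(1)[OF h] F_D(1)[OF g] by auto
    have "(g \<otimes>\<^bsub>F\<^esub> (f \<oplus>\<^bsub>F\<^esub> h)) z = (\<Oplus>\<^bsub>K\<^esub>p\<in>W \<times> (X \<union> Y). ?t (f \<oplus>\<^bsub>F\<^esub> h) p)"
      by (rule conv_over[OF g F.a_closed[OF f h] W(1,3) XY]) (use X Y in \<open>auto simp: malg_simps(5)\<close>)
    also have "\<dots> = (\<Oplus>\<^bsub>K\<^esub>p\<in>W \<times> (X \<union> Y). ?t f p \<oplus>\<^bsub>K\<^esub> ?t h p)"
      by (rule K.finsum_cong') (use F_D(1)[OF f] F_D(1)[OF h] F_D(1)[OF g] in \<open>auto simp: malg_simps(5) K.r_distr\<close>)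
    also have "\<dots> = (\<Oplus>\<^bsub>K\<^esub>p\<in>W \<times> (X \<union> Y). ?t f p) \<oplus>\<^bsub>K\<^esub> (\<Oplus>\<^bsub>K\<^esub>p\<in>W \<times> (X \<union> Y). ?t h p)"
      by (rule K.finsum_addf) (use c in auto)
    also have "(\<Oplus>\<^bsub>K\<^esub>p\<in>W \<times> (X \<union> Y). ?t f p) = (g \<otimes>\<^bsub>F\<^esub> f) z"
      by (rule conv_over[OF g f W(1,3) XY, symmetric]) (use X in auto)
    also have "(\<Oplus>\<^bsub>K\<^esub>p\<in>W \<times> (X \<union> Y). ?t h p) = (g \<otimes>\<^bsub>F\<^esub> h) z"
      by (rule conv_over[OF g h W(1,3) XY, symmetric]) (use Y in auto)
    finally show "(g \<otimes>\<^bsub>F\<^esub> (f \<oplus>\<^bsub>F\<^esub> h)) z = (g \<otimes>\<^bsub>F\<^esub> f \<oplus>\<^bsub>F\<^esub> g \<otimes>\<^bsub>F\<^esub> h) z" by (simp add: malg_simps(5))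
  qed
qed (rule conv_closed)

lemma conv_basis:
  assumes c: "c \<in> carrier K" "d \<in> carrier K" and x: "x \<in> carrier G" "y \<in> carrier G"
  shows "(c \<odot>\<^bsub>F\<^esub> e x) \<otimes>\<^bsub>F\<^esub> (d \<odot>\<^bsub>F\<^esub> e y) = (c \<otimes>\<^bsub>K\<^esub> d) \<odot>\<^bsub>F\<^esub> e (x \<otimes>\<^bsub>G\<^esub> y)"
proof
  fix z
  have "((c \<odot>\<^bsub>F\<^esub> e x) \<otimes>\<^bsub>F\<^esub> (d \<odot>\<^bsub>F\<^esub> e y)) z =
      (\<Oplus>\<^bsub>K\<^esub>p\<in>{x} \<times> {y}. if fst p \<otimes>\<^bsub>G\<^esub> snd p = z then (c \<odot>\<^bsub>F\<^esub> e x) (fst p) \<otimes>\<^bsub>K\<^esub> (d \<odot>\<^bsub>F\<^esub> e y) (snd p) else \<zero>\<^bsub>K\<^esub>)"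
    by (rule conv_over[OF F.smult_closed[OF c(1) e_closed[OF x(1)]] F.smult_closed[OF c(2) e_closed[OF x(2)]]])
      (use c in \<open>auto simp: malg_simps(6) basis_elem_def\<close>)
  also have "\<dots> = ((c \<otimes>\<^bsub>K\<^esub> d) \<odot>\<^bsub>F\<^esub> e (x \<otimes>\<^bsub>G\<^esub> y)) z"
    using c by (auto simp: malg_simps(6) basis_elem_def)
  finally show "((c \<odot>\<^bsub>F\<^esub> e x) \<otimes>\<^bsub>F\<^esub> (d \<odot>\<^bsub>F\<^esub> e y)) z = ((c \<otimes>\<^bsub>K\<^esub> d) \<odot>\<^bsub>F\<^esub> e (x \<otimes>\<^bsub>G\<^esub> y)) z" .
qed

text \<open>The generators carry a coefficient because \<open>acl\<close> closes under addition and
  negation, not under scalars.\<close>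

lemma F_eqI:
  assumes "addm F Z f" "addm F Z g" "abelian_group Z"
    "\<And>c x. c \<in> carrier K \<Longrightarrow> x \<in> carrier G \<Longrightarrow> f (c \<odot>\<^bsub>F\<^esub> e x) = g (c \<odot>\<^bsub>F\<^esub> e x)" "u \<in> carrier F"
  shows "f u = g u"
  by (rule addm_eq_on_acl[OF F.abelian_group_axioms assms(3,1,2) _ _ F_gen[OF assms(5)]])
    (use assms(4) in auto)

lemma F_assoc_algebra: "assoc_algebra K F"
proof -
  note aF = F.abelian_group_axioms
  have cl: "c \<odot>\<^bsub>F\<^esub> e x \<in> carrier F" if "c \<in> carrier K" "x \<in> carrier G" for c x using that by simp
  \<comment> \<open>One variable at a time is reduced to a multiple of a basis element, until only
    associativity in the monoid and in \<open>K\<close> remains.\<close>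
  have assoc: "(f \<otimes>\<^bsub>F\<^esub> g) \<otimes>\<^bsub>F\<^esub> h = f \<otimes>\<^bsub>F\<^esub> (g \<otimes>\<^bsub>F\<^esub> h)" if "f \<in> carrier F" "g \<in> carrier F" "h \<in> carrier F" for f g h
  proof (rule F_eqI[OF addm_comp[OF conv_left conv_left] conv_left aF _ that(1)])
    fix c x assume c: "c \<in> carrier K" "x \<in> carrier G"
    note cx = cl[OF c]
    show "((c \<odot>\<^bsub>F\<^esub> e x) \<otimes>\<^bsub>F\<^esub> g) \<otimes>\<^bsub>F\<^esub> h = (c \<odot>\<^bsub>F\<^esub> e x) \<otimes>\<^bsub>F\<^esub> (g \<otimes>\<^bsub>F\<^esub> h)"
    proof (rule F_eqI[OF addm_comp[OF conv_right conv_left] addm_comp[OF conv_left conv_right] aF _ that(2)])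
      fix d y assume d: "d \<in> carrier K" "y \<in> carrier G"
      show "((c \<odot>\<^bsub>F\<^esub> e x) \<otimes>\<^bsub>F\<^esub> (d \<odot>\<^bsub>F\<^esub> e y)) \<otimes>\<^bsub>F\<^esub> h = (c \<odot>\<^bsub>F\<^esub> e x) \<otimes>\<^bsub>F\<^esub> ((d \<odot>\<^bsub>F\<^esub> e y) \<otimes>\<^bsub>F\<^esub> h)"
        by (rule F_eqI[OF conv_right addm_comp[OF conv_right conv_right] aF _ that(3)])
          (use c d cl conv_closed in \<open>auto simp: conv_basis K.m_assoc G.m_assoc\<close>)
    qed (use that cx in auto)
  qed (use that conv_closed in auto)
  have one: "\<one>\<^bsub>F\<^esub> \<otimes>\<^bsub>F\<^esub> f = f" "f \<otimes>\<^bsub>F\<^esub> \<one>\<^bsub>F\<^esub> = f" if "f \<in> carrier F" for f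
  proof -
    have o: "\<one>\<^bsub>F\<^esub> = \<one>\<^bsub>K\<^esub> \<odot>\<^bsub>F\<^esub> e \<one>\<^bsub>G\<^esub>" by (auto simp: malg_simps basis_elem_def)
    have oc: "\<one>\<^bsub>F\<^esub> \<in> carrier F" unfolding o by simp
    show "\<one>\<^bsub>F\<^esub> \<otimes>\<^bsub>F\<^esub> f = f"
      by (rule F_eqI[OF conv_right addm_id aF _ that]) (use oc in \<open>auto simp: o conv_basis simp del: F.smult_one\<close>)
    show "f \<otimes>\<^bsub>F\<^esub> \<one>\<^bsub>F\<^esub> = f"
      by (rule F_eqI[OF conv_left addm_id aF _ that]) (use oc in \<open>auto simp: o conv_basis simp del: F.smult_one\<close>)
  qed
  have "\<one>\<^bsub>F\<^esub> \<in> carrier F" by (simp add: malg_simps(3))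
  then have r: "ring F"
    using addm_add[OF conv_left] addm_add[OF conv_right] assoc one conv_closed
    by (intro ringI aF monoidI) auto
  have sm: "addm F F (\<lambda>f. c \<odot>\<^bsub>F\<^esub> f)" if "c \<in> carrier K" for c
    by (rule addmI) (use that in \<open>auto simp: F.smult_r_distr\<close>)
  have l: "(c \<odot>\<^bsub>F\<^esub> f) \<otimes>\<^bsub>F\<^esub> g = c \<odot>\<^bsub>F\<^esub> (f \<otimes>\<^bsub>F\<^esub> g)" if "c \<in> carrier K" "f \<in> carrier F" "g \<in> carrier F" for c f g
  proof (rule F_eqI[OF addm_comp[OF sm conv_left] addm_comp[OF conv_left sm] aF _ that(2)])
    fix d x assume d: "d \<in> carrier K" "x \<in> carrier G"
    show "(c \<odot>\<^bsub>F\<^esub> (d \<odot>\<^bsub>F\<^esub> e x)) \<otimes>\<^bsub>F\<^esub> g = c \<odot>\<^bsub>F\<^esub> ((d \<odot>\<^bsub>F\<^esub> e x) \<otimes>\<^bsub>F\<^esub> g)"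
      by (rule F_eqI[OF conv_right addm_comp[OF conv_right sm] aF _ that(3)])
        (use that d in \<open>auto simp: F.smult_assoc1[symmetric] conv_basis K.m_assoc\<close>)
  qed (use that in auto)
  have rr: "f \<otimes>\<^bsub>F\<^esub> (c \<odot>\<^bsub>F\<^esub> g) = c \<odot>\<^bsub>F\<^esub> (f \<otimes>\<^bsub>F\<^esub> g)" if "c \<in> carrier K" "f \<in> carrier F" "g \<in> carrier F" for c f g
  proof (rule F_eqI[OF conv_left addm_comp[OF conv_left sm] aF _ that(2)])
    fix d x assume d: "d \<in> carrier K" "x \<in> carrier G"
    show "(d \<odot>\<^bsub>F\<^esub> e x) \<otimes>\<^bsub>F\<^esub> (c \<odot>\<^bsub>F\<^esub> g) = c \<odot>\<^bsub>F\<^esub> ((d \<odot>\<^bsub>F\<^esub> e x) \<otimes>\<^bsub>F\<^esub> g)"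
      by (rule F_eqI[OF addm_comp[OF sm conv_right] addm_comp[OF conv_right sm] aF _ that(3)])
        (use that d in \<open>auto simp: F.smult_assoc1[symmetric] conv_basis K.m_ac\<close>)
  qed (use that in auto)
  show ?thesis by (intro assoc_algebra.intro assoc_algebra_axioms.intro F_module r l rr)
qed

end

section \<open>Subspaces and their hulls\<close>

lemma sbsp_iff_submodule:
  assumes "module K M"
  shows "submodule H K M \<longleftrightarrow> sbsp K M H"
proof -
  interpret module K M by fact
  show ?thesis by (simp add: submodule_iff[OF M.abelian_group_axioms] sbsp_def)
qed

lemma sbsp_carrier: "module K M \<Longrightarrow> sbsp K M (carrier M)"
  using module.carrier_is_submodule sbsp_iff_submodule by blast

lemma sbsp_hull:
  assumes "module K M" "S \<subseteq> carrier M"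
  shows "sbsp K M ((\<lambda>H. submodule H K M) hull S)"
proof -
  interpret module K M by fact
  have "\<forall>H\<in>{H. sbsp K M H \<and> S \<subseteq> H}. sbsp K M H" "carrier M \<in> {H. sbsp K M H \<and> S \<subseteq> H}"
    using assms sbsp_carrier by auto
  \<comment> \<open>Having \<open>carrier M\<close> in the family keeps the intersection inside the
    carrier.\<close>
  moreover have "sbsp K M (\<Inter>C)" if C: "\<forall>H\<in>C. sbsp K M H" "carrier M \<in> C" for C
  proof (rule sbspI[OF add_closedI])
    show "\<Inter>C \<subseteq> carrier M" using C(2) by blast
    have D: "sbsp K M H" if "H \<in> C" for H using C(1) that by blast
    show "\<zero>\<^bsub>M\<^esub> \<in> \<Inter>C" using sbspD(4)[OF D] by simp
    show "x \<oplus>\<^bsub>M\<^esub> y \<in> \<Inter>C" if "x \<in> \<Inter>C" "y \<in> \<Inter>C" for x y using sbspD(5)[OF D] that by simp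
    show "\<ominus>\<^bsub>M\<^esub> x \<in> \<Inter>C" if "x \<in> \<Inter>C" for x using sbspD(6)[OF D] that by simp
    show "c \<odot>\<^bsub>M\<^esub> x \<in> \<Inter>C" if "c \<in> carrier K" "x \<in> \<Inter>C" for c x using sbspD(2)[OF D] that by simp
  qed
  ultimately show ?thesis unfolding hull_def sbsp_iff_submodule[OF assms(1)] by blast
qed

lemma hull_sbsp_least:
  assumes "module K M" "S \<subseteq> H" "sbsp K M H"
  shows "(\<lambda>H. submodule H K M) hull S \<subseteq> H"
  using assms sbsp_iff_submodule[OF assms(1)] by (intro hull_minimal) auto

lemma sbsp_vimage:
  assumes M: "module K M" and N: "module K N" and f: "addm M N f"
    "\<forall>c\<in>carrier K. \<forall>x\<in>carrier M. f (c \<odot>\<^bsub>M\<^esub> x) = c \<odot>\<^bsub>N\<^esub> f x" and H: "sbsp K N H"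
  shows "sbsp K M {x \<in> carrier M. f x \<in> H}"
proof -
  interpret M: module K M by fact
  interpret N: module K N by fact
  show ?thesis
    by (rule sbspI[OF add_closed_vimage[OF M.abelian_group_axioms N.abelian_group_axioms f(1) sbspD(1)[OF H]]])
      (auto simp: f(2) sbspD(2)[OF H])
qed

lemma sbsp_zero:
  assumes "module K M"
  shows "sbsp K M {\<zero>\<^bsub>M\<^esub>}"
proof -
  interpret M: module K M by fact
  show ?thesis by (rule sbspI[OF add_closed_zero[OF M.abelian_group_axioms]]) auto
qed

section \<open>The quotient by the bilinearity relations\<close>

locale tensor_pair = A: assoc_algebra K A + B: assoc_algebra K B
  for K :: "('k, 'c) ring_scheme" and A :: "('k, 'a) module" and B :: "('k, 'b) module"
begin

sublocale C: cring_monoid K "A \<times>\<times> B"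
  by (intro cring_monoid.intro A.R.cring_axioms DirProd_monoid A.monoid_axioms B.monoid_axioms)

abbreviation "FAB \<equiv> monoid_algebra K (A \<times>\<times> B)"

sublocale F: assoc_algebra K FAB by (rule C.F_assoc_algebra)

abbreviation "ee a b \<equiv> basis_elem K (a, b)"
abbreviation "tk \<equiv> tensor_kernel K A B"
abbreviation "TAB \<equiv> tensor_product K A B"
abbreviation "pt \<equiv> pure_tensor K A B"
abbreviation "cl f \<equiv> tk +>\<^bsub>FAB\<^esub> f"

lemma ee_mult: "a \<in> carrier A \<Longrightarrow> b \<in> carrier B \<Longrightarrow> a' \<in> carrier A \<Longrightarrow> b' \<in> carrier B \<Longrightarrow>
    ee a b \<otimes>\<^bsub>FAB\<^esub> ee a' b' = ee (a \<otimes>\<^bsub>A\<^esub> a') (b \<otimes>\<^bsub>B\<^esub> b')"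
  using C.conv_basis[of "\<one>\<^bsub>K\<^esub>" "\<one>\<^bsub>K\<^esub>" "(a, b)" "(a', b')"] by simp

lemma relators_subset: "bilinear_relators K A B \<subseteq> carrier FAB"
  unfolding bilinear_relators_def Let_def by auto

lemma tk_sbsp: "sbsp K FAB tk"
  unfolding tensor_kernel_def by (rule sbsp_hull[OF C.F_module relators_subset])

lemma relators_tk: "bilinear_relators K A B \<subseteq> tk"
  unfolding tensor_kernel_def by (rule hull_subset)

lemma tk_least: "bilinear_relators K A B \<subseteq> H \<Longrightarrow> sbsp K FAB H \<Longrightarrow> tk \<subseteq> H"
  unfolding tensor_kernel_def by (rule hull_sbsp_least[OF C.F_module])

lemma relatorI:
  "a \<in> carrier A \<Longrightarrow> a' \<in> carrier A \<Longrightarrow> b \<in> carrier B \<Longrightarrow>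
    ee (a \<oplus>\<^bsub>A\<^esub> a') b \<ominus>\<^bsub>FAB\<^esub> (ee a b \<oplus>\<^bsub>FAB\<^esub> ee a' b) \<in> bilinear_relators K A B"
  "a \<in> carrier A \<Longrightarrow> b \<in> carrier B \<Longrightarrow> b' \<in> carrier B \<Longrightarrow>
    ee a (b \<oplus>\<^bsub>B\<^esub> b') \<ominus>\<^bsub>FAB\<^esub> (ee a b \<oplus>\<^bsub>FAB\<^esub> ee a b') \<in> bilinear_relators K A B"
  "c \<in> carrier K \<Longrightarrow> a \<in> carrier A \<Longrightarrow> b \<in> carrier B \<Longrightarrow>
    ee (c \<odot>\<^bsub>A\<^esub> a) b \<ominus>\<^bsub>FAB\<^esub> c \<odot>\<^bsub>FAB\<^esub> ee a b \<in> bilinear_relators K A B"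
  "c \<in> carrier K \<Longrightarrow> a \<in> carrier A \<Longrightarrow> b \<in> carrier B \<Longrightarrow>
    ee a (c \<odot>\<^bsub>B\<^esub> b) \<ominus>\<^bsub>FAB\<^esub> c \<odot>\<^bsub>FAB\<^esub> ee a b \<in> bilinear_relators K A B"
  unfolding bilinear_relators_def Let_def by blast+

lemma relatorE:
  assumes "x \<in> bilinear_relators K A B"
  obtains a a' b where "a \<in> carrier A" "a' \<in> carrier A" "b \<in> carrier B"
      "x = ee (a \<oplus>\<^bsub>A\<^esub> a') b \<ominus>\<^bsub>FAB\<^esub> (ee a b \<oplus>\<^bsub>FAB\<^esub> ee a' b)"
  | a b b' where "a \<in> carrier A" "b \<in> carrier B" "b' \<in> carrier B"
      "x = ee a (b \<oplus>\<^bsub>B\<^esub> b') \<ominus>\<^bsub>FAB\<^esub> (ee a b \<oplus>\<^bsub>FAB\<^esub> ee a b')"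
  | c a b where "c \<in> carrier K" "a \<in> carrier A" "b \<in> carrier B"
      "x = ee (c \<odot>\<^bsub>A\<^esub> a) b \<ominus>\<^bsub>FAB\<^esub> c \<odot>\<^bsub>FAB\<^esub> ee a b"
  | c a b where "c \<in> carrier K" "a \<in> carrier A" "b \<in> carrier B"
      "x = ee a (c \<odot>\<^bsub>B\<^esub> b) \<ominus>\<^bsub>FAB\<^esub> c \<odot>\<^bsub>FAB\<^esub> ee a b"
  using assms unfolding bilinear_relators_def Let_def
  apply (elim UnE CollectE exE conjE)
  apply (rule that(1); assumption)
  apply (rule that(2); assumption)
  apply (rule that(3); assumption)
  apply (rule that(4); assumption)
  done

lemma F_diff_left: "x \<in> carrier FAB \<Longrightarrow> y \<in> carrier FAB \<Longrightarrow> z \<in> carrier FAB \<Longrightarrow>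
    z \<otimes>\<^bsub>FAB\<^esub> (x \<ominus>\<^bsub>FAB\<^esub> y) = z \<otimes>\<^bsub>FAB\<^esub> x \<ominus>\<^bsub>FAB\<^esub> z \<otimes>\<^bsub>FAB\<^esub> y"
  by (rule addm_diff[OF F.abelian_group_axioms F.abelian_group_axioms C.conv_right])

lemma F_diff_right: "x \<in> carrier FAB \<Longrightarrow> y \<in> carrier FAB \<Longrightarrow> z \<in> carrier FAB \<Longrightarrow>
    (x \<ominus>\<^bsub>FAB\<^esub> y) \<otimes>\<^bsub>FAB\<^esub> z = x \<otimes>\<^bsub>FAB\<^esub> z \<ominus>\<^bsub>FAB\<^esub> y \<otimes>\<^bsub>FAB\<^esub> z"
  by (rule addm_diff[OF F.abelian_group_axioms F.abelian_group_axioms C.conv_left])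

text \<open>Multiplication by a basis element turns a relator into the relator with multiplied
  entries. For this reason the span of the relators, defined only as a submodule, is a two-sided
  ideal.\<close>

lemma relator_mult:
  assumes p: "p \<in> carrier A" "q \<in> carrier B" and x: "x \<in> bilinear_relators K A B"
  shows "ee p q \<otimes>\<^bsub>FAB\<^esub> x \<in> bilinear_relators K A B" "x \<otimes>\<^bsub>FAB\<^esub> ee p q \<in> bilinear_relators K A B"
  by (insert x, erule_tac [!] relatorE)
    (simp_all add: p F_diff_left F_diff_right F.r_distr F.l_distr ee_mult A.r_distr B.r_distr A.l_distr B.l_distr
      F.smult_mult_left F.smult_mult_right A.smult_mult_left A.smult_mult_right B.smult_mult_left B.smult_mult_right relatorI)

lemma ideal: "ideal tk FAB"
proof -
  note I = sbspD[OF tk_sbsp]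
  have sm: "sbsp K FAB {x \<in> carrier FAB. f x \<in> tk}"
    if "addm FAB FAB f" "\<forall>c\<in>carrier K. \<forall>x\<in>carrier FAB. f (c \<odot>\<^bsub>FAB\<^esub> x) = c \<odot>\<^bsub>FAB\<^esub> f x" for f
    by (rule sbsp_vimage[OF C.F_module C.F_module that tk_sbsp])
  have l: "f \<otimes>\<^bsub>FAB\<^esub> r \<in> tk" and r: "r \<otimes>\<^bsub>FAB\<^esub> f \<in> tk" if f: "f \<in> carrier FAB" and r: "r \<in> tk" for f r
  proof -
    have r': "r \<in> carrier FAB" using I(3) r .
    have 1: "ee p q \<otimes>\<^bsub>FAB\<^esub> r \<in> tk \<and> r \<otimes>\<^bsub>FAB\<^esub> ee p q \<in> tk" if "p \<in> carrier A" "q \<in> carrier B" for p q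
    proof -
      have "tk \<subseteq> {x \<in> carrier FAB. ee p q \<otimes>\<^bsub>FAB\<^esub> x \<in> tk}"
        by (rule tk_least[OF _ sm[OF C.conv_right]])
          (use relators_subset relators_tk relator_mult(1)[OF that] that F.smult_mult_right in auto)
      moreover have "tk \<subseteq> {x \<in> carrier FAB. x \<otimes>\<^bsub>FAB\<^esub> ee p q \<in> tk}"
        by (rule tk_least[OF _ sm[OF C.conv_left]])
          (use relators_subset relators_tk relator_mult(2)[OF that] that F.smult_mult_left in auto)
      ultimately show ?thesis using r by blast
    qed
    have 2: "x \<otimes>\<^bsub>FAB\<^esub> r \<in> tk \<and> r \<otimes>\<^bsub>FAB\<^esub> x \<in> tk"
      if x: "x \<in> {c \<odot>\<^bsub>FAB\<^esub> basis_elem K x |c x. c \<in> carrier K \<and> x \<in> carrier (A \<times>\<times> B)}" for x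
    proof -
      from x obtain c p q where "x = c \<odot>\<^bsub>FAB\<^esub> ee p q" "c \<in> carrier K" "p \<in> carrier A" "q \<in> carrier B" by auto
      then show ?thesis using 1[of p q] r' I(2) by (simp add: F.smult_mult_left F.smult_mult_right)
    qed
    have S: "{c \<odot>\<^bsub>FAB\<^esub> basis_elem K x |c x. c \<in> carrier K \<and> x \<in> carrier (A \<times>\<times> B)} \<subseteq> carrier FAB" by auto
    show "f \<otimes>\<^bsub>FAB\<^esub> r \<in> tk"
      by (rule addm_acl[OF F.abelian_group_axioms F.abelian_group_axioms C.conv_left[OF r'] S _ I(1) C.F_gen[OF f]])
        (use 2 in blast)
    show "r \<otimes>\<^bsub>FAB\<^esub> f \<in> tk"
      by (rule addm_acl[OF F.abelian_group_axioms F.abelian_group_axioms C.conv_right[OF r'] S _ I(1) C.F_gen[OF f]])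
        (use 2 in blast)
  qed
  show ?thesis
    by (rule idealI[OF F.ring_axioms]) (use I(1) add_closed_iff_subgroup[OF F.abelian_group_axioms] l r in auto)
qed

sublocale I: ideal tk FAB by (rule ideal)

lemma T_simps:
  "carrier TAB = a_rcosets\<^bsub>FAB\<^esub> tk" "mult TAB = rcoset_mult FAB tk" "one TAB = cl \<one>\<^bsub>FAB\<^esub>"
  "zero TAB = tk" "add TAB = set_add FAB" "smult TAB = (\<lambda>c X. \<Union>f\<in>X. cl (c \<odot>\<^bsub>FAB\<^esub> f))"
  by (simp_all add: tensor_product_def Let_def ring.defs FactRing_def)

lemma T_E:
  assumes "X \<in> carrier TAB"
  obtains f where "f \<in> carrier FAB" "X = cl f"
  using assms by (auto simp: T_simps A_RCOSETS_def' RCOSETS_def a_r_coset_def)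

lemma cl_closed [simp]: "f \<in> carrier FAB \<Longrightarrow> cl f \<in> carrier TAB"
  unfolding T_simps by (rule F.a_rcosetsI[OF I.a_subset])

lemma cl_add: "f \<in> carrier FAB \<Longrightarrow> g \<in> carrier FAB \<Longrightarrow> cl f \<oplus>\<^bsub>TAB\<^esub> cl g = cl (f \<oplus>\<^bsub>FAB\<^esub> g)"
  unfolding T_simps by (rule I.a_rcos_sum)

lemma cl_mult: "f \<in> carrier FAB \<Longrightarrow> g \<in> carrier FAB \<Longrightarrow> cl f \<otimes>\<^bsub>TAB\<^esub> cl g = cl (f \<otimes>\<^bsub>FAB\<^esub> g)"
  unfolding T_simps by (rule I.rcoset_mult_add)

lemma cl_eqI:
  assumes "f \<in> carrier FAB" "g \<in> carrier FAB" "f \<ominus>\<^bsub>FAB\<^esub> g \<in> tk"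
  shows "cl f = cl g"
proof -
  have "f \<in> cl g" using I.a_rcos_module[of g f] assms F.ring_axioms by (simp add: a_minus_def)
  from I.a_repr_independence'[OF this assms(2)] show ?thesis by simp
qed

lemma cl_mem:
  assumes "f \<in> cl g" "g \<in> carrier FAB"
  shows "f \<in> carrier FAB" "f \<ominus>\<^bsub>FAB\<^esub> g \<in> tk"
proof -
  show f: "f \<in> carrier FAB" using assms I.a_elemrcos_carrier by blast
  show "f \<ominus>\<^bsub>FAB\<^esub> g \<in> tk" using I.a_rcos_module[of g f] assms f F.ring_axioms by (simp add: a_minus_def)
qed

lemma cl_self: "f \<in> carrier FAB \<Longrightarrow> f \<in> cl f"
  by (rule I.a_rcos_self)

text \<open>The scalar action on classes is defined as a union over all representatives; each of
  them contributes the same class.\<close>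

lemma cl_smult:
  assumes "c \<in> carrier K" "f \<in> carrier FAB"
  shows "c \<odot>\<^bsub>TAB\<^esub> cl f = cl (c \<odot>\<^bsub>FAB\<^esub> f)"
proof -
  have "cl (c \<odot>\<^bsub>FAB\<^esub> g) = cl (c \<odot>\<^bsub>FAB\<^esub> f)" if "g \<in> cl f" for g
  proof (rule cl_eqI)
    note g = cl_mem[OF that assms(2)]
    have "c \<odot>\<^bsub>FAB\<^esub> g \<ominus>\<^bsub>FAB\<^esub> c \<odot>\<^bsub>FAB\<^esub> f = c \<odot>\<^bsub>FAB\<^esub> (g \<ominus>\<^bsub>FAB\<^esub> f)"
      using assms g by (simp add: a_minus_def F.smult_r_distr F.smult_r_minus)
    then show "c \<odot>\<^bsub>FAB\<^esub> g \<ominus>\<^bsub>FAB\<^esub> c \<odot>\<^bsub>FAB\<^esub> f \<in> tk" using sbspD(2)[OF tk_sbsp assms(1) g(2)] by simp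
  qed (use assms cl_mem[OF that assms(2)] in auto)
  then show ?thesis using cl_self[OF assms(2)] unfolding T_simps by blast
qed

lemma cl_zero: "\<zero>\<^bsub>TAB\<^esub> = cl \<zero>\<^bsub>FAB\<^esub>"
  unfolding T_simps using I.a_subset F.abelian_group_axioms abelian_group.a_coset_add_zero by metis

lemma cl_one: "\<one>\<^bsub>TAB\<^esub> = cl \<one>\<^bsub>FAB\<^esub>"
  by (simp add: T_simps)

lemma T_assoc_algebra: "assoc_algebra K TAB"
proof -
  have ab: "abelian_group TAB"
  proof (rule abelian_groupI)
    show "\<exists>Y\<in>carrier TAB. Y \<oplus>\<^bsub>TAB\<^esub> X = \<zero>\<^bsub>TAB\<^esub>" if "X \<in> carrier TAB" for X
      using that
    proof (rule T_E)
      fix f assume f: "f \<in> carrier FAB" "X = cl f"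
      show ?thesis by (rule bexI[of _ "cl (\<ominus>\<^bsub>FAB\<^esub> f)"]) (use f in \<open>simp_all add: cl_add cl_zero F.l_neg\<close>)
    qed
  qed (auto elim!: T_E simp: cl_add cl_zero F.a_ac)
  have r: "ring TAB"
    by (intro ringI ab monoidI)
      (auto elim!: T_E simp: cl_add cl_mult cl_one F.m_assoc F.l_distr F.r_distr)
  have "module K TAB"
    by (intro moduleI ab A.R.cring_axioms)
      (auto elim!: T_E simp: cl_add cl_smult F.smult_l_distr F.smult_r_distr F.smult_assoc1)
  then show ?thesis
    by (intro assoc_algebra.intro assoc_algebra_axioms.intro r)
      (auto elim!: T_E simp: cl_smult cl_mult F.smult_mult_left F.smult_mult_right)
qed

sublocale T: assoc_algebra K TAB by (rule T_assoc_algebra)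

lemma cl_addm: "addm FAB TAB (\<lambda>f. cl f)"
  by (rule addmI) (auto simp: cl_add)

lemma pt_eq: "pt a b = cl (ee a b)"
  by (simp add: pure_tensor_def)

lemma pt_closed [simp]: "a \<in> carrier A \<Longrightarrow> b \<in> carrier B \<Longrightarrow> pt a b \<in> carrier TAB"
  by (simp add: pt_eq)

lemma pt_mult: "a \<in> carrier A \<Longrightarrow> b \<in> carrier B \<Longrightarrow> a' \<in> carrier A \<Longrightarrow> b' \<in> carrier B \<Longrightarrow>
    pt a b \<otimes>\<^bsub>TAB\<^esub> pt a' b' = pt (a \<otimes>\<^bsub>A\<^esub> a') (b \<otimes>\<^bsub>B\<^esub> b')"
  by (simp add: pt_eq cl_mult ee_mult)

lemma pt_one: "\<one>\<^bsub>TAB\<^esub> = pt \<one>\<^bsub>A\<^esub> \<one>\<^bsub>B\<^esub>"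
  by (simp add: pt_eq cl_one malg_simps)

lemma pt_left: "b \<in> carrier B \<Longrightarrow> addm A TAB (\<lambda>a. pt a b)"
proof (rule addmI)
  fix x y assume b: "b \<in> carrier B" and x: "x \<in> carrier A" "y \<in> carrier A"
  have "cl (ee (x \<oplus>\<^bsub>A\<^esub> y) b) = cl (ee x b \<oplus>\<^bsub>FAB\<^esub> ee y b)"
    by (rule cl_eqI) (use b x relatorI(1) relators_tk in auto)
  then show "pt (x \<oplus>\<^bsub>A\<^esub> y) b = pt x b \<oplus>\<^bsub>TAB\<^esub> pt y b" using b x by (simp add: pt_eq cl_add)
qed simp

lemma pt_right: "a \<in> carrier A \<Longrightarrow> addm B TAB (pt a)"
proof (rule addmI)
  fix x y assume a: "a \<in> carrier A" and x: "x \<in> carrier B" "y \<in> carrier B"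
  have "cl (ee a (x \<oplus>\<^bsub>B\<^esub> y)) = cl (ee a x \<oplus>\<^bsub>FAB\<^esub> ee a y)"
    by (rule cl_eqI) (use a x relatorI(2) relators_tk in auto)
  then show "pt a (x \<oplus>\<^bsub>B\<^esub> y) = pt a x \<oplus>\<^bsub>TAB\<^esub> pt a y" using a x by (simp add: pt_eq cl_add)
qed simp

lemma pt_smult:
  assumes "c \<in> carrier K" "a \<in> carrier A" "b \<in> carrier B"
  shows "pt (c \<odot>\<^bsub>A\<^esub> a) b = c \<odot>\<^bsub>TAB\<^esub> pt a b" "pt a (c \<odot>\<^bsub>B\<^esub> b) = c \<odot>\<^bsub>TAB\<^esub> pt a b"
proof -
  have "cl (ee (c \<odot>\<^bsub>A\<^esub> a) b) = cl (c \<odot>\<^bsub>FAB\<^esub> ee a b)"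
    by (rule cl_eqI) (use assms relatorI(3) relators_tk in auto)
  then show "pt (c \<odot>\<^bsub>A\<^esub> a) b = c \<odot>\<^bsub>TAB\<^esub> pt a b" using assms by (simp add: pt_eq cl_smult)
  have "cl (ee a (c \<odot>\<^bsub>B\<^esub> b)) = cl (c \<odot>\<^bsub>FAB\<^esub> ee a b)"
    by (rule cl_eqI) (use assms relatorI(4) relators_tk in auto)
  then show "pt a (c \<odot>\<^bsub>B\<^esub> b) = c \<odot>\<^bsub>TAB\<^esub> pt a b" using assms by (simp add: pt_eq cl_smult)
qed

lemma pt_gen:
  assumes "X \<in> carrier TAB"
  shows "X \<in> acl TAB {pt a b | a b. a \<in> carrier A \<and> b \<in> carrier B}"
proof -
  obtain f where f: "f \<in> carrier FAB" "X = cl f" using T_E[OF assms] .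
  have S: "{pt a b | a b. a \<in> carrier A \<and> b \<in> carrier B} \<subseteq> carrier TAB" by auto
  have "cl f \<in> acl TAB {pt a b | a b. a \<in> carrier A \<and> b \<in> carrier B}"
  proof (rule addm_acl[OF F.abelian_group_axioms T.abelian_group_axioms cl_addm _ _ T.add_closed_acl[OF S] C.F_gen[OF f(1)]])
    fix x assume "x \<in> {c \<odot>\<^bsub>FAB\<^esub> basis_elem K x |c x. c \<in> carrier K \<and> x \<in> carrier (A \<times>\<times> B)}"
    then obtain c a b where x: "x = c \<odot>\<^bsub>FAB\<^esub> ee a b" "c \<in> carrier K" "a \<in> carrier A" "b \<in> carrier B" by auto
    then have "cl x = pt (c \<odot>\<^bsub>A\<^esub> a) b" by (simp add: pt_smult) (simp add: pt_eq cl_smult)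
    then show "cl x \<in> acl TAB {pt a b | a b. a \<in> carrier A \<and> b \<in> carrier B}" using x by (intro acl_base) blast
  qed auto
  then show ?thesis using f by simp
qed

lemma T_eqI:
  assumes "abelian_group Z" "addm TAB Z f" "addm TAB Z g" "X \<in> carrier TAB"
    "\<And>a b. a \<in> carrier A \<Longrightarrow> b \<in> carrier B \<Longrightarrow> f (pt a b) = g (pt a b)"
  shows "f X = g X"
  by (rule addm_eq_on_acl[OF T.abelian_group_axioms assms(1-3) _ _ pt_gen[OF assms(4)]]) (use assms(5) in auto)

lemma T_inI:
  assumes "abelian_group Z" "addm TAB Z f" "add_closed Z H" "X \<in> carrier TAB"
    "\<And>a b. a \<in> carrier A \<Longrightarrow> b \<in> carrier B \<Longrightarrow> f (pt a b) \<in> H"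
  shows "f X \<in> H"
  by (rule addm_acl[OF T.abelian_group_axioms assms(1,2) _ _ assms(3) pt_gen[OF assms(4)]]) (use assms(5) in auto)

text \<open>The form with \<open>the_elem\<close> of the image of a class is that of the action in
  \<open>regular_bimodule\<close>, which thereby becomes an instance in
  \<open>regular_smult\<close>.\<close>

definition tlift :: "('k, 'z) module \<Rightarrow> ('a \<Rightarrow> 'b \<Rightarrow> 'z) \<Rightarrow> ('a \<times> 'b \<Rightarrow> 'k) set \<Rightarrow> 'z"
  where "tlift Z g X = the_elem (lin_ext K Z (\<lambda>p. g (fst p) (snd p)) ` X)"

definition bilin :: "('k, 'z) module \<Rightarrow> ('a \<Rightarrow> 'b \<Rightarrow> 'z) \<Rightarrow> bool"
  where "bilin Z g \<longleftrightarrow> (\<forall>b\<in>carrier B. addm A Z (\<lambda>a. g a b)) \<and> (\<forall>a\<in>carrier A. addm B Z (g a)) \<and>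
    (\<forall>c\<in>carrier K. \<forall>a\<in>carrier A. \<forall>b\<in>carrier B.
      g (c \<odot>\<^bsub>A\<^esub> a) b = c \<odot>\<^bsub>Z\<^esub> g a b \<and> g a (c \<odot>\<^bsub>B\<^esub> b) = c \<odot>\<^bsub>Z\<^esub> g a b)"

text \<open>The universal property: the linear extension of a bilinear map vanishes on the relators,
  hence on their span, and so is constant on each class.\<close>

lemma tlift:
  assumes Z: "module K Z" and g: "bilin Z g"
  shows "addm TAB Z (tlift Z g)"
    and "\<And>c X. c \<in> carrier K \<Longrightarrow> X \<in> carrier TAB \<Longrightarrow> tlift Z g (c \<odot>\<^bsub>TAB\<^esub> X) = c \<odot>\<^bsub>Z\<^esub> tlift Z g X"
    and "\<And>a b. a \<in> carrier A \<Longrightarrow> b \<in> carrier B \<Longrightarrow> tlift Z g (pt a b) = g a b"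
proof -
  interpret Z: module K Z by fact
  have gD: "\<And>b. b \<in> carrier B \<Longrightarrow> addm A Z (\<lambda>a. g a b)" "\<And>a. a \<in> carrier A \<Longrightarrow> addm B Z (g a)"
    "\<And>c a b. c \<in> carrier K \<Longrightarrow> a \<in> carrier A \<Longrightarrow> b \<in> carrier B \<Longrightarrow> g (c \<odot>\<^bsub>A\<^esub> a) b = c \<odot>\<^bsub>Z\<^esub> g a b"
    "\<And>c a b. c \<in> carrier K \<Longrightarrow> a \<in> carrier A \<Longrightarrow> b \<in> carrier B \<Longrightarrow> g a (c \<odot>\<^bsub>B\<^esub> b) = c \<odot>\<^bsub>Z\<^esub> g a b"
    using g by (auto simp: bilin_def)
  have gc: "g a b \<in> carrier Z" if "a \<in> carrier A" "b \<in> carrier B" for a b using addm_closed[OF gD(2)] that .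
  let ?g = "\<lambda>p. g (fst p) (snd p)"
  have gc': "?g p \<in> carrier Z" if "p \<in> carrier (A \<times>\<times> B)" for p using that gc by auto
  let ?E = "lin_ext K Z ?g"
  have E: "addm FAB Z ?E" "\<And>c f. c \<in> carrier K \<Longrightarrow> f \<in> carrier FAB \<Longrightarrow> ?E (c \<odot>\<^bsub>FAB\<^esub> f) = c \<odot>\<^bsub>Z\<^esub> ?E f"
    by (rule C.lin_ext_addm[OF Z], erule gc', rule C.lin_ext_smult[OF Z], erule gc')
  have Eb: "?E (ee a b) = g a b" if "a \<in> carrier A" "b \<in> carrier B" for a b
  proof -
    have "?E (ee a b) = ?g (a, b)" by (rule C.lin_ext_basis[OF Z], erule gc') (use that in simp)
    then show ?thesis by simp
  qed
  note Ea = addm_add[OF E(1)] and Ed = addm_diff[OF F.abelian_group_axioms Z.abelian_group_axioms E(1)]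
  have zz: "z \<ominus>\<^bsub>Z\<^esub> z = \<zero>\<^bsub>Z\<^esub>" if "z \<in> carrier Z" for z using that by (simp add: a_minus_def Z.r_neg)
  have "sbsp K FAB {f \<in> carrier FAB. ?E f \<in> {\<zero>\<^bsub>Z\<^esub>}}"
    by (rule sbsp_vimage[OF C.F_module Z E(1) _ sbsp_zero[OF Z]]) (use E(2) in auto)
  moreover have "?E x = \<zero>\<^bsub>Z\<^esub>" if "x \<in> bilinear_relators K A B" for x
    using that
    by (rule relatorE) (simp_all add: Ed Ea Eb E(2) gD(3,4) addm_add[OF gD(1)] addm_add[OF gD(2)] zz gc)
  ultimately have tk0: "tk \<subseteq> {f \<in> carrier FAB. ?E f \<in> {\<zero>\<^bsub>Z\<^esub>}}"
    by (intro tk_least) (use relators_subset in auto)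
  have cl: "tlift Z g (cl f) = ?E f" if f: "f \<in> carrier FAB" for f
  proof -
    have "?E h = ?E f" if h: "h \<in> cl f" for h
    proof -
      note h = cl_mem[OF h f]
      have "?E h \<ominus>\<^bsub>Z\<^esub> ?E f = \<zero>\<^bsub>Z\<^esub>" using Ed[OF h(1) f] tk0 h(2) by auto
      then show ?thesis using Z.diff_zero_eq addm_closed[OF E(1)] h(1) f by blast
    qed
    then have "?E ` cl f = {?E f}" using cl_self[OF f] by blast
    then show ?thesis by (simp add: tlift_def)
  qed
  show "addm TAB Z (tlift Z g)"
    by (rule addmI) (auto elim!: T_E simp: cl cl_add Ea addm_closed[OF E(1)])
  show "tlift Z g (c \<odot>\<^bsub>TAB\<^esub> X) = c \<odot>\<^bsub>Z\<^esub> tlift Z g X" if "c \<in> carrier K" "X \<in> carrier TAB" for c X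
    using that(2) by (rule T_E) (use that(1) in \<open>simp add: cl cl_smult E(2)\<close>)
  show "tlift Z g (pt a b) = g a b" if "a \<in> carrier A" "b \<in> carrier B" for a b
    using that by (simp add: pt_eq cl Eb)
qed

end

section \<open>Gradings of tensor products\<close>

text \<open>\<open>opposite\<close>, \<open>regular_bimodule\<close> and \<open>self_module\<close>
  preserve these three fields, and negation, \<open>addm\<close>, \<open>acl\<close> and
  \<open>grading\<close> depend on nothing else.\<close>

definition same_add :: "('m, 'c) ring_scheme \<Rightarrow> ('m, 'd) ring_scheme \<Rightarrow> bool"
  where "same_add N M \<longleftrightarrow> carrier N = carrier M \<and> add N = add M \<and> zero N = zero M"

lemma same_add:
  assumes "same_add N M"
  shows "carrier N = carrier M" "add N = add M" "zero N = zero M" "a_inv N x = a_inv M x"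
    "add_closed N H \<longleftrightarrow> add_closed M H" "addm N L f = addm M L f" "addm L N g = addm L M g"
proof -
  show c: "carrier N = carrier M" "add N = add M" "zero N = zero M" using assms by (auto simp: same_add_def)
  show i: "a_inv N x = a_inv M x" for x by (simp add: a_inv_def m_inv_def c)
  show "add_closed N H \<longleftrightarrow> add_closed M H" by (simp only: add_closed_def c i)
  show "addm N L f = addm M L f" "addm L N g = addm L M g" by (simp_all only: addm_def c)
qed

lemma same_add_abelian_group:
  assumes "same_add N M" "abelian_group M"
  shows "abelian_group N"
proof -
  interpret abelian_group M by fact
  show ?thesis
    by (rule abelian_groupI; simp only: same_add[OF assms(1)])
      (auto simp: a_ac intro!: bexI[of _ "\<ominus>\<^bsub>M\<^esub> _"] l_neg)
qed

lemma acl_cong: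
  assumes "same_add N M" "x \<in> acl M S"
  shows "x \<in> acl N S"
  using assms(2)
proof induction
  case acl_zero
  show ?case using acl.acl_zero[of N S] by (simp only: same_add[OF assms(1)])
next
  case (acl_add x y)
  show ?case using acl.acl_add[OF acl_add.IH] by (simp only: same_add[OF assms(1)])
next
  case (acl_minus x)
  show ?case using acl.acl_minus[OF acl_minus.IH] by (simp only: same_add[OF assms(1)])
qed (rule acl.acl_base)

lemma grading_cong:
  assumes "same_add N M" "grading M q"
  shows "grading N q"
proof -
  interpret grading M q by fact
  note e = same_add[OF assms(1)]
  show ?thesis
    by (intro grading.intro grading_axioms.intro same_add_abelian_group[OF assms(1)] abelian_group_axioms; simp only: e)
      (use q_addm q_orth acl_cong[OF assms(1) q_gen] in auto)
qed

lemma opposite_simps [simp]: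
  "carrier (opposite A) = carrier A" "add (opposite A) = add A" "zero (opposite A) = zero A"
  "one (opposite A) = one A" "smult (opposite A) = smult A" "mult (opposite A) = (\<lambda>x y. y \<otimes>\<^bsub>A\<^esub> x)"
  by (simp_all add: opposite_def)

lemma same_add_opposite: "same_add (opposite A) A"
  by (simp add: same_add_def)

lemma assoc_algebra_opposite:
  assumes "assoc_algebra K A"
  shows "assoc_algebra K (opposite A)"
proof -
  interpret assoc_algebra K A by fact
  have ab: "abelian_group (opposite A)"
    by (rule same_add_abelian_group[OF same_add_opposite abelian_group_axioms])
  have "ring (opposite A)"
    by (intro ringI ab monoidI) (auto simp: l_distr r_distr m_assoc)
  moreover have "module K (opposite A)"
    by (intro moduleI ab R.cring_axioms) (auto simp: smult_l_distr smult_r_distr smult_assoc1)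
  ultimately show ?thesis
    by (intro assoc_algebra.intro assoc_algebra_axioms.intro) (auto simp: smult_mult_left smult_mult_right)
qed

lemma sbsp_opposite: "sbsp K (opposite A) H \<longleftrightarrow> sbsp K A H"
  by (simp add: sbsp_def same_add(5)[OF same_add_opposite])

section \<open>Graded algebras\<close>

lemma graded_algebraI:
  assumes "assoc_algebra K A" "grading A q" "\<And>n. G n = {x \<in> carrier A. q n x = x}"
    "\<And>n. sbsp K A (G n)" "\<one>\<^bsub>A\<^esub> \<in> G 0" "\<And>x y m n. x \<in> G m \<Longrightarrow> y \<in> G n \<Longrightarrow> x \<otimes>\<^bsub>A\<^esub> y \<in> G (m + n)"
  shows "graded_algebra K A G"
proof -
  interpret assoc_algebra K A by fact
  have "G = (\<lambda>n. {x \<in> carrier A. q n x = x})" using assms(3) by auto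
  then have "internal_direct_sum A G" using grading.internal_direct_sum[OF assms(2)] by simp
  moreover have "module K A" by (rule module_axioms)
  ultimately show ?thesis
    by (intro graded_algebra.intro graded_algebra_axioms.intro assoc_algebra_axioms)
      (auto simp: sbsp_iff_submodule assms(4-6))
qed

lemma graded_algebraD:
  assumes "graded_algebra K A G"
  shows "assoc_algebra K A" "\<exists>q. grading A q \<and> (\<forall>n. G n = {x \<in> carrier A. q n x = x})"
    "\<And>n. sbsp K A (G n)" "\<one>\<^bsub>A\<^esub> \<in> G 0" "\<And>x y m n. x \<in> G m \<Longrightarrow> y \<in> G n \<Longrightarrow> x \<otimes>\<^bsub>A\<^esub> y \<in> G (m + n)"
proof -
  interpret graded_algebra K A G by fact
  show "assoc_algebra K A" by (rule assoc_algebra_axioms)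
  show "\<exists>q. grading A q \<and> (\<forall>n. G n = {x \<in> carrier A. q n x = x})"
    using internal_direct_sum_grading[OF abelian_group_axioms direct_sum] by metis
  show "sbsp K A (G n)" for n using subspaces sbsp_iff_submodule[OF module_axioms] by blast
qed (rule graded_algebra.one_degree[OF assms], rule graded_algebra.mult_degree[OF assms])

lemma graded_algebra_opposite:
  assumes "graded_algebra K A G"
  shows "graded_algebra K (opposite A) G"
proof -
  note D = graded_algebraD[OF assms]
  obtain q where q: "grading A q" "\<forall>n. G n = {x \<in> carrier A. q n x = x}" using D(2) by blast
  show ?thesis
  proof (rule graded_algebraI[OF assoc_algebra_opposite[OF D(1)] grading_cong[OF same_add_opposite q(1)]])
    show "x \<otimes>\<^bsub>opposite A\<^esub> y \<in> G (m + n)" if "x \<in> G m" "y \<in> G n" for x y m n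
      using D(5)[OF that(2,1)] by (simp add: add.commute)
    show "sbsp K (opposite A) (G n)" for n unfolding sbsp_opposite by (rule D(3))
  qed (use q(2) D(4) in auto)
qed

lemma graded_algebra_nat_gr_ring:
  fixes K :: "('k, 'c) ring_scheme" and A :: "('k, 'a) module"
  assumes "graded_algebra K A G"
  shows "\<exists>pr. nat_gr_ring A pr G"
proof -
  interpret graded_algebra K A G by fact
  note D = graded_algebraD[OF assms]
  obtain q where q: "grading A q" "\<And>n. G n = {x \<in> carrier A. q n x = x}" using D(2) by blast
  interpret g: grading A q by fact
  \<comment> \<open>Integer indices are wanted because modules are graded by integers; negative
    degrees are filled with zero.\<close>
  define pr where "pr j x = (if j < 0 then \<zero>\<^bsub>A\<^esub> else q (nat j) x)" for j :: int and x
  have G: "G n = {r \<in> carrier A. pr (int n) r = r}" for n by (simp add: q(2) pr_def)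
  have addm: "addm A A (pr j)" for j
    by (rule addmI) (auto simp: pr_def g.q_add)
  have "grading A pr"
  proof (intro grading.intro grading_axioms.intro abelian_group_axioms addm)
    show "pr i (pr j x) = (if i = j then pr j x else \<zero>\<^bsub>A\<^esub>)" if "x \<in> carrier A" for x i j
      using that by (auto simp: pr_def g.q_orth)
    show "x \<in> acl A {y \<in> carrier A. \<exists>i. pr i y = y}" if "x \<in> carrier A" for x
    proof (rule acl_mono[OF _ g.q_gen[OF that]])
      have "pr (int i) y = q i y" for i y by (simp add: pr_def)
      then show "{y \<in> carrier A. \<exists>i. q i y = y} \<subseteq> {y \<in> carrier A. \<exists>i. pr i y = y}" by auto metis
    qed
  qed
  then interpret p: grading A pr .
  have neg: "x = \<zero>\<^bsub>A\<^esub>" if "pr j x = x" "j < 0" for j x using that by (simp add: pr_def)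
  have mult: "pr n (x \<otimes>\<^bsub>A\<^esub> y) = pr (n - e) x \<otimes>\<^bsub>A\<^esub> y" if x: "x \<in> carrier A" and y: "y \<in> carrier A" "pr e y = y" for x y e n
  proof -
    have my: "addm A A (\<lambda>x. x \<otimes>\<^bsub>A\<^esub> y)" by (rule addmI) (use y in \<open>auto simp: l_distr\<close>)
    show ?thesis
    proof (rule addm_eq_on_acl[OF abelian_group_axioms abelian_group_axioms addm_comp[OF my addm] addm_comp[OF addm my] _ _ p.q_gen[OF x]])
      fix x assume "x \<in> {y \<in> carrier A. \<exists>i. pr i y = y}"
      then obtain i where x: "x \<in> carrier A" "pr i x = x" by auto
      show "pr n (x \<otimes>\<^bsub>A\<^esub> y) = pr (n - e) x \<otimes>\<^bsub>A\<^esub> y"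
      proof (cases "i < 0 \<or> e < 0")
        case True
        then have "x = \<zero>\<^bsub>A\<^esub> \<or> y = \<zero>\<^bsub>A\<^esub>" using neg x(2) y(2) by blast
        then show ?thesis using x y p.q_closed p.q_zero by auto
      next
        case False
        then have "x \<in> G (nat i)" "y \<in> G (nat e)" using x y by (simp_all add: G)
        from D(5)[OF this] have xy: "pr (i + e) (x \<otimes>\<^bsub>A\<^esub> y) = x \<otimes>\<^bsub>A\<^esub> y" using False by (simp add: G nat_add_distrib)
        have xyc: "x \<otimes>\<^bsub>A\<^esub> y \<in> carrier A" using x y by simp
        show ?thesis
        proof (cases "n = i + e")
          case True
          then show ?thesis using xy x by simp
        next
          case False
          then have "n - e \<noteq> i" by simp
          then show ?thesis using p.q_other[OF xyc xy False] p.q_other[OF x] y by simp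
        qed
      qed
    qed auto
  qed
  have one: "pr 0 \<one>\<^bsub>A\<^esub> = \<one>\<^bsub>A\<^esub>" using D(4) by (simp add: G)
  have "nat_gr_ring A pr G"
    by (intro nat_gr_ring.intro nat_gr_ring_axioms.intro gr_ring.intro gr_ring_axioms.intro ring_axioms p.grading_axioms mult one G)
      (simp_all add: pr_def)
  then show ?thesis by blast
qed

context tensor_pair
begin

lemma sbsp_total_grading: "sbsp K TAB (total_grading K A G B H n)"
  if "\<And>n. sbsp K A (G n)" "\<And>n. sbsp K B (H n)"
  unfolding total_grading_def
  by (rule sbsp_hull[OF T.module_axioms]) (use sbspD(3)[OF that(1)] sbspD(3)[OF that(2)] in auto)

lemma pt_total_grading: "a \<in> G i \<Longrightarrow> b \<in> H j \<Longrightarrow> pt a b \<in> total_grading K A G B H (i + j)"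
  unfolding total_grading_def by (rule hull_inc) blast

lemma total_grading_least:
  assumes "\<And>a b i j. a \<in> G i \<Longrightarrow> b \<in> H j \<Longrightarrow> i + j = n \<Longrightarrow> pt a b \<in> V" "sbsp K TAB V" "x \<in> total_grading K A G B H n"
  shows "x \<in> V"
proof -
  have "{pt a b |a b i j. a \<in> G i \<and> b \<in> H j \<and> i + j = n} \<subseteq> V" using assms(1) by blast
  from subsetD[OF hull_sbsp_least[OF T.module_axioms this assms(2)]] assms(3) show ?thesis
    by (simp add: total_grading_def)
qed

text \<open>The projection to degree \<open>n\<close> is the sum of the maps
  \<open>qA i \<otimes> qB (n - i)\<close> over \<open>i \<le> n\<close>, a finite sum because
  degrees are natural numbers. It is obtained by \<open>tlift\<close>, so its summands have to be
  bilinear over \<open>K\<close>, not merely additive in each argument.\<close>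

lemma graded_algebra_tensor:
  assumes GA: "graded_algebra K A G" and HB: "graded_algebra K B H"
  shows "graded_algebra K TAB (total_grading K A G B H)"
proof -
  let ?G = "total_grading K A G B H"
  note DA = graded_algebraD[OF GA] and DB = graded_algebraD[OF HB]
  obtain qA where qA: "grading A qA" "\<And>n. G n = {x \<in> carrier A. qA n x = x}" using DA(2) by blast
  obtain qB where qB: "grading B qB" "\<And>n. H n = {x \<in> carrier B. qB n x = x}" using DB(2) by blast
  interpret gA: grading A qA by fact
  interpret gB: grading B qB by fact
  \<comment> \<open>\<open>grading\<close> provides additive projections; linearity over
    \<open>K\<close> follows because the components are subspaces.\<close>
  have lin: "q i (c \<odot>\<^bsub>M\<^esub> x) = c \<odot>\<^bsub>M\<^esub> q i x"
    if M: "assoc_algebra K M" and q: "grading M q" "\<And>n. L n = {x \<in> carrier M. q n x = x}" "\<And>n. sbsp K M (L n)"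
      and c: "c \<in> carrier K" and x: "x \<in> carrier M"
    for M :: "('k, 'm) module" and q and L :: "nat \<Rightarrow> 'm set" and c x i
  proof -
    interpret M: assoc_algebra K M by fact
    interpret g: grading M q by fact
    have sm: "addm M M (\<lambda>x. c \<odot>\<^bsub>M\<^esub> x)" by (rule addmI) (use c in \<open>auto simp: M.smult_r_distr\<close>)
    show ?thesis
    proof (rule addm_eq_on_acl[OF M.abelian_group_axioms M.abelian_group_axioms addm_comp[OF sm g.q_addm] addm_comp[OF g.q_addm sm] _ _ g.q_gen[OF x]])
      fix x assume "x \<in> {y \<in> carrier M. \<exists>i. q i y = y}"
      then obtain j where x: "x \<in> carrier M" "q j x = x" by auto
      then have "c \<odot>\<^bsub>M\<^esub> x \<in> L j" using sbspD(2)[OF q(3) c] by (simp add: q(2))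
      then have cx: "c \<odot>\<^bsub>M\<^esub> x \<in> carrier M" "q j (c \<odot>\<^bsub>M\<^esub> x) = c \<odot>\<^bsub>M\<^esub> x" by (simp_all add: q(2))
      show "q i (c \<odot>\<^bsub>M\<^esub> x) = c \<odot>\<^bsub>M\<^esub> q i x"
        using g.q_other[OF cx, of i] g.q_other[OF x, of i] cx(2) x(2) c by (cases "i = j") auto
    qed auto
  qed
  note linA = lin[OF DA(1) qA DA(3)] and linB = lin[OF DB(1) qB DB(3)]
  define h where "h n a b = (\<Oplus>\<^bsub>TAB\<^esub>i\<in>{..n}. pt (qA i a) (qB (n - i) b))" for n a b
  have bil: "bilin TAB (h n)" for n
    unfolding bilin_def
  proof (intro conjI ballI)
    show "addm A TAB (\<lambda>a. h n a b)" if "b \<in> carrier B" for b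
      unfolding h_def
      by (intro addm_finsumf T.abelian_group_axioms addm_comp[OF gA.q_addm pt_left]) (use that in auto)
    show "addm B TAB (h n a)" if "a \<in> carrier A" for a
      unfolding h_def
      by (intro addm_finsumf T.abelian_group_axioms addm_comp[OF gB.q_addm pt_right]) (use that in auto)
    fix c a b assume c: "c \<in> carrier K" "a \<in> carrier A" "b \<in> carrier B"
    have s: "c \<odot>\<^bsub>TAB\<^esub> h n a b = (\<Oplus>\<^bsub>TAB\<^esub>i\<in>{..n}. c \<odot>\<^bsub>TAB\<^esub> pt (qA i a) (qB (n - i) b))"
      unfolding h_def by (rule T.finsum_smult_ldistr) (use c in auto)
    show "h n (c \<odot>\<^bsub>A\<^esub> a) b = c \<odot>\<^bsub>TAB\<^esub> h n a b"
      unfolding s unfolding h_def by (rule T.finsum_cong') (use c in \<open>auto simp: linA pt_smult\<close>)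
    show "h n a (c \<odot>\<^bsub>B\<^esub> b) = c \<odot>\<^bsub>TAB\<^esub> h n a b"
      unfolding s unfolding h_def by (rule T.finsum_cong') (use c in \<open>auto simp: linB pt_smult\<close>)
  qed
  define Q where "Q n = tlift TAB (h n)" for n
  note Q = tlift[OF T.module_axioms bil, folded Q_def]
  have Qpt: "Q n (pt a b) = (if n = i + j then pt a b else \<zero>\<^bsub>TAB\<^esub>)" if a: "a \<in> G i" and b: "b \<in> H j" for n a b i j
  proof -
    have a': "a \<in> carrier A" "qA i a = a" and b': "b \<in> carrier B" "qB j b = b" using a b qA(2) qB(2) by auto
    have z: "\<And>y. y \<in> carrier B \<Longrightarrow> pt \<zero>\<^bsub>A\<^esub> y = \<zero>\<^bsub>TAB\<^esub>" "\<And>x. x \<in> carrier A \<Longrightarrow> pt x \<zero>\<^bsub>B\<^esub> = \<zero>\<^bsub>TAB\<^esub>"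
      using addm_zero[OF A.abelian_group_axioms T.abelian_group_axioms pt_left]
        addm_zero[OF B.abelian_group_axioms T.abelian_group_axioms pt_right] by auto
    have "Q n (pt a b) = (\<Oplus>\<^bsub>TAB\<^esub>k\<in>{..n}. pt (qA k a) (qB (n - k) b))" using Q(3) a' b' by (simp add: h_def)
    also have "\<dots> = (\<Oplus>\<^bsub>TAB\<^esub>k\<in>{..n}. if i = k then (if n = i + j then pt a b else \<zero>\<^bsub>TAB\<^esub>) else \<zero>\<^bsub>TAB\<^esub>)"
    proof (rule T.finsum_cong')
      fix k assume k: "k \<in> {..n}"
      show "pt (qA k a) (qB (n - k) b) = (if i = k then (if n = i + j then pt a b else \<zero>\<^bsub>TAB\<^esub>) else \<zero>\<^bsub>TAB\<^esub>)"
      proof (cases "i = k")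
        case True
        show ?thesis
        proof (cases "n = i + j")
          case False
          \<comment> \<open>\<open>k \<le> n\<close> keeps this subtraction exact.\<close>
          then have "n - k \<noteq> j" using True k by auto
          then show ?thesis using True False gB.q_other[OF b'] a' b' z by simp
        qed (use True a' b' in auto)
      next
        case False
        then show ?thesis using gA.q_other[OF a'] b' z by simp
      qed
    qed (use a' b' in auto)
    also have "\<dots> = (if n = i + j then pt a b else \<zero>\<^bsub>TAB\<^esub>)"
    proof (cases "i \<le> n")
      case True
      then show ?thesis using a' b' by (subst T.add.finprod_singleton) auto
    next
      case False
      then have "(\<Oplus>\<^bsub>TAB\<^esub>k\<in>{..n}. if i = k then (if n = i + j then pt a b else \<zero>\<^bsub>TAB\<^esub>) else \<zero>\<^bsub>TAB\<^esub>) = (\<Oplus>\<^bsub>TAB\<^esub>k\<in>{..n}. \<zero>\<^bsub>TAB\<^esub>)"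
        by (intro T.finsum_cong') auto
      then show ?thesis using False by (simp add: T.finsum_zero)
    qed
    finally show ?thesis .
  qed
  define S where "S = {pt a b |a b. \<exists>i j. a \<in> G i \<and> b \<in> H j}"
  have Gc: "a \<in> carrier A" if "a \<in> G i" for a i using that qA(2) by simp
  have Hc: "a \<in> carrier B" if "a \<in> H i" for a i using that qB(2) by simp
  have Sc: "S \<subseteq> carrier TAB" using Gc Hc by (auto simp: S_def)
  \<comment> \<open>Homogeneous pure tensors generate: the left factor and then the right factor is
    replaced by homogeneous elements.\<close>
  have Sgen: "x \<in> acl TAB S" if x: "x \<in> carrier TAB" for x
  proof (rule T_inI[OF T.abelian_group_axioms addm_id T.add_closed_acl[OF Sc] x])
    fix a b assume a: "a \<in> carrier A" and b: "b \<in> carrier B"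
    show "pt a b \<in> acl TAB S"
    proof (rule addm_acl[OF A.abelian_group_axioms T.abelian_group_axioms pt_left[OF b] _ _ T.add_closed_acl[OF Sc] gA.q_gen[OF a]])
      fix a assume "a \<in> {y \<in> carrier A. \<exists>i. qA i y = y}"
      then obtain i where a: "a \<in> G i" using qA(2) by auto
      show "pt a b \<in> acl TAB S"
      proof (rule addm_acl[OF B.abelian_group_axioms T.abelian_group_axioms pt_right[OF Gc[OF a]] _ _ T.add_closed_acl[OF Sc] gB.q_gen[OF b]])
        fix b assume "b \<in> {y \<in> carrier B. \<exists>i. qB i y = y}"
        then obtain j where "b \<in> H j" using qB(2) by auto
        then show "pt a b \<in> acl TAB S" using a by (intro acl_base) (auto simp: S_def)
      qed auto
    qed auto
  qed
  have gr: "grading TAB Q"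
  proof (intro grading.intro grading_axioms.intro T.abelian_group_axioms Q(1))
    show "Q m (Q n x) = (if m = n then Q n x else \<zero>\<^bsub>TAB\<^esub>)" if x: "x \<in> carrier TAB" for x m n
    proof (rule addm_eq_on_acl[OF T.abelian_group_axioms T.abelian_group_axioms addm_comp[OF Q(1) Q(1)] _ Sc _ Sgen[OF x]])
      show "addm TAB TAB (\<lambda>x. if m = n then Q n x else \<zero>\<^bsub>TAB\<^esub>)"
        using Q(1) addm_const_zero[OF T.abelian_group_axioms] by (cases "m = n") auto
      fix s assume "s \<in> S"
      then obtain a b i j where s: "s = pt a b" "a \<in> G i" "b \<in> H j" by (auto simp: S_def)
      have "Q k \<zero>\<^bsub>TAB\<^esub> = \<zero>\<^bsub>TAB\<^esub>" for k by (rule addm_zero[OF T.abelian_group_axioms T.abelian_group_axioms Q(1)])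
      then show "Q m (Q n s) = (if m = n then Q n s else \<zero>\<^bsub>TAB\<^esub>)" using s by (simp add: Qpt)
    qed
    show "x \<in> acl TAB {y \<in> carrier TAB. \<exists>i. Q i y = y}" if x: "x \<in> carrier TAB" for x
    proof (rule acl_mono[OF _ Sgen[OF x]])
      show "S \<subseteq> {y \<in> carrier TAB. \<exists>i. Q i y = y}"
        using Sc Qpt by (auto simp: S_def)
    qed
  qed
  note sG = sbsp_total_grading[of G H, OF DA(3) DB(3)]
  have Gn: "?G n = {x \<in> carrier TAB. Q n x = x}" for n
  proof (intro equalityI subsetI)
    fix x assume x: "x \<in> ?G n"
    show "x \<in> {x \<in> carrier TAB. Q n x = x}"
    proof (rule total_grading_least[OF _ _ x])
      show "sbsp K TAB {x \<in> carrier TAB. Q n x = x}"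
        by (rule sbspI[OF grading.add_closed_component[OF gr]]) (auto simp: Q(2))
    qed (use Qpt Gc Hc in auto)
  next
    fix x assume "x \<in> {x \<in> carrier TAB. Q n x = x}"
    then have x: "x \<in> carrier TAB" "Q n x = x" by auto
    \<comment> \<open>\<open>x\<close> is a sum of homogeneous pure tensors, of which
      \<open>Q n\<close> keeps exactly those of degree \<open>n\<close>.\<close>
    have "Q n x \<in> ?G n"
    proof (rule addm_acl[OF T.abelian_group_axioms T.abelian_group_axioms Q(1) Sc _ sbspD(1)[OF sG] Sgen[OF x(1)]])
      fix s assume "s \<in> S"
      then obtain a b i j where s: "s = pt a b" "a \<in> G i" "b \<in> H j" by (auto simp: S_def)
      then show "Q n s \<in> ?G n" using pt_total_grading[of a G i b H j] sbspD(4)[OF sG[of n]] by (simp add: Qpt)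
    qed
    then show "x \<in> ?G n" using x by simp
  qed
  show ?thesis
  proof (rule graded_algebraI[OF T_assoc_algebra gr Gn sG])
    show "\<one>\<^bsub>TAB\<^esub> \<in> ?G 0" using pt_total_grading[of _ G 0 _ H 0, OF DA(4) DB(4)] by (simp add: pt_one)
    fix x y m n assume x: "x \<in> ?G m" and y: "y \<in> ?G n"
    note c = sbspD(3)[OF sG]
    have ml: "addm TAB TAB (\<lambda>x. x \<otimes>\<^bsub>TAB\<^esub> y)" if "y \<in> carrier TAB" for y
      by (rule addmI) (use that in \<open>auto simp: T.l_distr\<close>)
    have mr: "addm TAB TAB (\<lambda>y. x \<otimes>\<^bsub>TAB\<^esub> y)" if "x \<in> carrier TAB" for x
      by (rule addmI) (use that in \<open>auto simp: T.r_distr\<close>)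
    have "x \<in> {x \<in> carrier TAB. x \<otimes>\<^bsub>TAB\<^esub> y \<in> ?G (m + n)}"
    proof (rule total_grading_least[OF _ sbsp_vimage[OF T.module_axioms T.module_axioms ml[OF c[OF y]] _ sG] x])
      fix a b i j assume a: "a \<in> G i" "b \<in> H j" "i + j = m"
      have pc: "pt a b \<in> carrier TAB" using a Gc Hc by simp
      have "y \<in> {y \<in> carrier TAB. pt a b \<otimes>\<^bsub>TAB\<^esub> y \<in> ?G (m + n)}"
      proof (rule total_grading_least[OF _ sbsp_vimage[OF T.module_axioms T.module_axioms mr[OF pc] _ sG] y])
        fix a' b' k l assume b: "a' \<in> G k" "b' \<in> H l" "k + l = n"
        have "pt (a \<otimes>\<^bsub>A\<^esub> a') (b \<otimes>\<^bsub>B\<^esub> b') \<in> ?G ((i + k) + (j + l))"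
          by (rule pt_total_grading[of _ G "i + k" _ H "j + l", OF DA(5)[OF a(1) b(1)] DB(5)[OF a(2) b(2)]])
        moreover have "(i + k) + (j + l) = m + n" using a b by simp
        ultimately show "pt a' b' \<in> {y \<in> carrier TAB. pt a b \<otimes>\<^bsub>TAB\<^esub> y \<in> ?G (m + n)}"
          using a b Gc Hc by (simp add: pt_mult)
      qed (use pc T.smult_mult_right in auto)
      then show "pt a b \<in> {x \<in> carrier TAB. x \<otimes>\<^bsub>TAB\<^esub> y \<in> ?G (m + n)}" using pc by simp
    qed (use c[OF y] T.smult_mult_left in auto)
    then show "x \<otimes>\<^bsub>TAB\<^esub> y \<in> ?G (m + n)" by simp
  qed
qed

end

section \<open>The regular bimodule\<close>

lemma regular_simps:
  "carrier (regular_bimodule K A) = carrier A" "add (regular_bimodule K A) = add A" "zero (regular_bimodule K A) = zero A"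
  "same_add (regular_bimodule K A) A"
  by (simp_all add: regular_bimodule_def same_add_def)

locale env = assoc_algebra K A for K :: "('k, 'c) ring_scheme" and A :: "('k, 'a) module"
begin

sublocale E: tensor_pair K A "opposite A"
  by (intro tensor_pair.intro assoc_algebra_axioms assoc_algebra_opposite)

abbreviation "EA \<equiv> enveloping K A"
abbreviation "RB \<equiv> regular_bimodule K A"

lemma EA_eq: "EA = tensor_product K A (opposite A)"
  by (simp add: enveloping_def)

lemma regular_smult: "X \<odot>\<^bsub>RB\<^esub> x = E.tlift A (\<lambda>a b. a \<otimes>\<^bsub>A\<^esub> x \<otimes>\<^bsub>A\<^esub> b) X"
  by (simp add: regular_bimodule_def E.tlift_def lin_ext_def)

lemma regular_bilin: "x \<in> carrier A \<Longrightarrow> E.bilin A (\<lambda>a b. a \<otimes>\<^bsub>A\<^esub> x \<otimes>\<^bsub>A\<^esub> b)"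
  unfolding E.bilin_def
  by (intro conjI ballI addmI) (auto simp: l_distr r_distr smult_mult_left smult_mult_right)

lemma regular_addm: "x \<in> carrier A \<Longrightarrow> addm EA A (\<lambda>X. X \<odot>\<^bsub>RB\<^esub> x)"
  unfolding regular_smult EA_eq by (rule E.tlift(1)[OF module_axioms regular_bilin])

lemma regular_scalar: "x \<in> carrier A \<Longrightarrow> c \<in> carrier K \<Longrightarrow> X \<in> carrier EA \<Longrightarrow> (c \<odot>\<^bsub>EA\<^esub> X) \<odot>\<^bsub>RB\<^esub> x = c \<odot>\<^bsub>A\<^esub> (X \<odot>\<^bsub>RB\<^esub> x)"
  unfolding regular_smult EA_eq by (rule E.tlift(2)[OF module_axioms regular_bilin])

lemma regular_pt: "x \<in> carrier A \<Longrightarrow> a \<in> carrier A \<Longrightarrow> b \<in> carrier A \<Longrightarrow> E.pt a b \<odot>\<^bsub>RB\<^esub> x = a \<otimes>\<^bsub>A\<^esub> x \<otimes>\<^bsub>A\<^esub> b"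
  unfolding regular_smult by (rule E.tlift(3)[OF module_axioms regular_bilin]) auto

lemma EA_eqI:
  assumes "abelian_group Z" "addm EA Z f" "addm EA Z g" "X \<in> carrier EA"
    "\<And>a b. a \<in> carrier A \<Longrightarrow> b \<in> carrier A \<Longrightarrow> f (E.pt a b) = g (E.pt a b)"
  shows "f X = g X"
  using E.T_eqI[OF assms(1), of f g X] assms(2-5) by (simp add: EA_eq)

lemma regular_closed: "X \<in> carrier EA \<Longrightarrow> x \<in> carrier A \<Longrightarrow> X \<odot>\<^bsub>RB\<^esub> x \<in> carrier A"
  using addm_closed[OF regular_addm] .

lemma regular_addm_right: "X \<in> carrier EA \<Longrightarrow> addm A A (\<lambda>x. X \<odot>\<^bsub>RB\<^esub> x)"
proof (rule addmI)
  fix x y assume X: "X \<in> carrier EA" and x: "x \<in> carrier A" "y \<in> carrier A"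
  show "X \<odot>\<^bsub>RB\<^esub> (x \<oplus>\<^bsub>A\<^esub> y) = X \<odot>\<^bsub>RB\<^esub> x \<oplus>\<^bsub>A\<^esub> X \<odot>\<^bsub>RB\<^esub> y"
    by (rule EA_eqI[OF abelian_group_axioms regular_addm addm_plus[OF abelian_group_axioms regular_addm regular_addm] X])
      (use x in \<open>auto simp: regular_pt l_distr r_distr\<close>)
qed (rule regular_closed)

lemma EA_assoc_algebra: "assoc_algebra K EA"
  unfolding EA_eq by (rule E.T_assoc_algebra)

lemma EA_pt:
  "a \<in> carrier A \<Longrightarrow> b \<in> carrier A \<Longrightarrow> E.pt a b \<in> carrier EA"
  "a \<in> carrier A \<Longrightarrow> b \<in> carrier A \<Longrightarrow> a' \<in> carrier A \<Longrightarrow> b' \<in> carrier A \<Longrightarrow>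
    E.pt a b \<otimes>\<^bsub>EA\<^esub> E.pt a' b' = E.pt (a \<otimes>\<^bsub>A\<^esub> a') (b' \<otimes>\<^bsub>A\<^esub> b)"
  "\<one>\<^bsub>EA\<^esub> = E.pt \<one>\<^bsub>A\<^esub> \<one>\<^bsub>A\<^esub>"
  unfolding EA_eq by (simp_all add: E.pt_mult E.pt_one)

text \<open>Associativity of the action is additive in both scalars, so pure tensors suffice. There
  the reversed product in the opposite factor matches successive multiplication on the
  right.\<close>

lemma regular_left_module: "left_module EA RB"
proof -
  interpret U: assoc_algebra K EA by (rule EA_assoc_algebra)
  note ab = abelian_group_axioms
  have mult: "(X \<otimes>\<^bsub>EA\<^esub> Y) \<odot>\<^bsub>RB\<^esub> x = X \<odot>\<^bsub>RB\<^esub> (Y \<odot>\<^bsub>RB\<^esub> x)" if X: "X \<in> carrier EA" and Y: "Y \<in> carrier EA" and x: "x \<in> carrier A" for X Y x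
  proof -
    have ml: "addm EA EA (\<lambda>X. X \<otimes>\<^bsub>EA\<^esub> Y)" if "Y \<in> carrier EA" for Y
      by (rule addmI) (use that in \<open>auto simp: U.l_distr\<close>)
    have mr: "addm EA EA (\<lambda>Y. X \<otimes>\<^bsub>EA\<^esub> Y)" if "X \<in> carrier EA" for X
      by (rule addmI) (use that in \<open>auto simp: U.r_distr\<close>)
    show ?thesis
    proof (rule EA_eqI[OF ab addm_comp[OF ml[OF Y] regular_addm[OF x]] regular_addm[OF regular_closed[OF Y x]] X])
      fix a b assume a: "a \<in> carrier A" "b \<in> carrier A"
      note p = EA_pt(1)[OF a]
      show "(E.pt a b \<otimes>\<^bsub>EA\<^esub> Y) \<odot>\<^bsub>RB\<^esub> x = E.pt a b \<odot>\<^bsub>RB\<^esub> (Y \<odot>\<^bsub>RB\<^esub> x)"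
        by (rule EA_eqI[OF ab addm_comp[OF mr[OF p] regular_addm[OF x]] addm_comp[OF regular_addm[OF x] regular_addm_right[OF p]] Y])
          (use a x in \<open>simp add: EA_pt regular_pt m_assoc\<close>)
    qed
  qed
  show ?thesis
  proof (intro left_module.intro left_module_axioms.intro U.ring_axioms)
    show "abelian_group RB" by (rule same_add_abelian_group[OF regular_simps(4) ab])
  qed (auto simp: regular_simps regular_closed addm_add[OF regular_addm] addm_add[OF regular_addm_right] mult EA_pt(3) regular_pt)
qed

end

section \<open>Smoothness in terms of presentations\<close>

text \<open>The grading concentrated in degree 0, through which ungraded modules enter the graded
  theory. Zero remains homogeneous of every degree, hence the two cases in
  \<open>triv_eqD\<close>.\<close>

definition triv :: "('m, 'c) ring_scheme \<Rightarrow> int \<Rightarrow> 'm \<Rightarrow> 'm"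
  where "triv M n x = (if n = 0 then x else \<zero>\<^bsub>M\<^esub>)"

lemma grading_triv:
  assumes "abelian_group M"
  shows "grading M (triv M)"
proof -
  interpret abelian_group M by fact
  show ?thesis
  proof (intro grading.intro grading_axioms.intro assms)
    show "addm M M (triv M i)" for i by (rule addmI) (auto simp: triv_def)
    show "x \<in> acl M {y \<in> carrier M. \<exists>i. triv M i y = y}" if "x \<in> carrier M" for x
      using that by (intro acl_base) (auto simp: triv_def intro!: exI[of _ 0])
  qed (auto simp: triv_def)
qed

lemma triv_eqD: "triv M n x = x \<Longrightarrow> n = 0 \<or> x = \<zero>\<^bsub>M\<^esub>"
  by (auto simp: triv_def split: if_splits)

lemma gr_ring_triv:
  assumes "ring R"
  shows "gr_ring R (triv R)"
proof -
  interpret ring R by fact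
  show ?thesis
    by (intro gr_ring.intro gr_ring_axioms.intro assms grading_triv abelian_group_axioms)
      (auto dest!: triv_eqD simp: triv_def)
qed

lemma gmod_triv:
  assumes "left_module R M"
  shows "gmod R (triv R) M (triv M)"
proof -
  interpret left_module R M by fact
  show ?thesis unfolding gmod_def
    using assms grading_triv[OF M.abelian_group_axioms] by (auto dest!: triv_eqD simp: triv_def)
qed

lemma ghom_triv:
  assumes "left_module R M" "left_module R N" "f \<in> left_module_hom R M N"
  shows "ghom R M (triv M) N (triv N) f"
proof -
  interpret M: left_module R M by fact
  interpret N: left_module R N by fact
  show ?thesis using lhomD[OF assms(3)] addm_zero[OF M.M.abelian_group_axioms N.M.abelian_group_axioms lhomD(1)[OF assms(3)]]
    by (intro ghomI) (auto simp: triv_def)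
qed

text \<open>The test type \<open>nat \<Rightarrow> 'r\<close> is the element type of both
  \<open>P\<close> and \<open>lmod R (free R I)\<close>. The lifting property therefore applies to
  the identity of \<open>P\<close> and a free presentation of \<open>P\<close>, and splits
  it.\<close>

lemma fgp_triv:
  fixes P :: "('r, nat \<Rightarrow> 'r) module"
  assumes "left_module R P" "finitely_generated R P" "projective_wrt TYPE(nat \<Rightarrow> 'r) R P"
  shows "fgp R (triv R) P (triv P)"
proof -
  interpret P: left_module R P by fact
  interpret g: gr_ring R "triv R" by (rule gr_ring_triv) unfold_locales
  show ?thesis
  proof (rule g.projective_fgp[OF gmod_triv[OF assms(1)] assms(2)])
    fix I \<epsilon> \<pi> assume \<pi>: "pres R (triv R) I \<epsilon> P (triv P) \<pi>"
    let ?F = "lmod R (free R I)" and ?p = "shift_pr (triv R) \<epsilon>"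
    note I = presD(1)[OF \<pi>] and \<pi>D = ghomD[OF presD(2)[OF \<pi>]]
    have id: "(\<lambda>x. x) \<in> left_module_hom R P P" by (rule lhomI) (auto simp: addm_id)
    obtain s where s: "s \<in> left_module_hom R P ?F" "\<forall>x\<in>carrier P. \<pi> (s x) = x"
      using assms(3)[unfolded projective_wrt_def, rule_format, of ?F P \<pi> "\<lambda>x. x"]
        g.left_module_free[of I] assms(1) \<pi>D(1) presD(4)[OF \<pi>] id by blast
    note sD = lhomD[OF s(1)]
    interpret gF: grading ?F ?p by (rule gmodD[OF g.gmod_free[OF I]])
    have sc: "s x \<in> carrier ?F" if "x \<in> carrier P" for x using addm_closed[OF sD(1) that] .
    have z: "s \<zero>\<^bsub>P\<^esub> = \<zero>\<^bsub>?F\<^esub>" by (rule addm_zero[OF P.M.abelian_group_axioms gF.abelian_group_axioms sD(1)])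
    \<comment> \<open>The lifting property gives a splitting \<open>s\<close> that ignores degrees,
      while basis elements of the presentation may have nonzero degree. Those map to zero in
      \<open>P\<close>, so \<open>s\<close> followed by the projection to degree 0 is still a
      splitting, and it is graded.\<close>
    have "ghom R P (triv P) ?F ?p (\<lambda>x. ?p 0 (s x))"
    proof (rule ghomI[OF addm_comp[OF sD(1) gF.q_addm]])
      show "?p 0 (s (a \<odot>\<^bsub>P\<^esub> x)) = a \<odot>\<^bsub>?F\<^esub> ?p 0 (s x)" if "a \<in> carrier R" "x \<in> carrier P" for a x
        using sD(2)[OF that] that(1) sc[OF that(2)] by (auto simp: shift_pr_def triv_def fun_eq_iff)
      show "?p 0 (s (triv P j x)) = ?p j (?p 0 (s x))" if "x \<in> carrier P" for j x
        using gF.q_orth[OF sc[OF that], of j 0] z gF.q_zero[of 0] by (simp add: triv_def del: fmod_simps)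
    qed
    moreover have "\<pi> (?p 0 (s x)) = x" if "x \<in> carrier P" for x
      using \<pi>D(6)[OF sc[OF that], of 0] s(2) that by (simp add: triv_def)
    ultimately show "\<exists>s. ghom R P (triv P) ?F ?p s \<and> (\<forall>x\<in>carrier P. \<pi> (s x) = x)" by blast
  qed
qed

lemma resolution_haspres:
  fixes P :: "nat \<Rightarrow> ('r, nat \<Rightarrow> 'r) module"
  assumes M: "left_module R M" and res: "finite_resolution R M n P d \<epsilon>"
    and P: "\<And>i. i \<le> n \<Longrightarrow> finitely_generated R (P i) \<and> projective_wrt TYPE(nat \<Rightarrow> 'r) R (P i)"
  shows "\<exists>m. haspres R (triv R) m M (triv M)"
proof -
  interpret M: left_module R M by fact
  interpret g: gr_ring R "triv R" by (rule gr_ring_triv) unfold_locales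
  have lm: "left_module R (P i)" if "i \<le> n" for i using res that by (auto simp: finite_resolution_def Let_def)
  have "gres R (triv R) M (triv M) n P (\<lambda>i. triv (P i)) d \<epsilon>"
    unfolding gres_def
  proof (intro conjI allI impI res)
    show "gmod R (triv R) (P i) (triv (P i))" "fgp R (triv R) (P i) (triv (P i))" if "i \<le> n" for i
      using gmod_triv fgp_triv lm P that by blast+
    show "ghom R (P (Suc i)) (triv (P (Suc i))) (P i) (triv (P i)) (d i)" if "i < n" for i
      by (rule ghom_triv) (use lm that res in \<open>auto simp: finite_resolution_def Let_def\<close>)
    show "ghom R (P 0) (triv (P 0)) M (triv M) \<epsilon>"
      by (rule ghom_triv) (use lm M res in \<open>auto simp: finite_resolution_def Let_def\<close>)
  qed
  then show ?thesis by (rule g.gres_haspres[OF gmod_triv[OF M]])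
qed

text \<open>Each family \<open>Q i\<close> of subsets is traded for projections \<open>p i\<close>.
  The graded lifting property, applied to the identity of \<open>P i\<close> and a free
  presentation, then yields the splitting that \<open>gres\<close> asks for.\<close>

lemma (in nat_gr_ring) graded_resolution_haspres:
  fixes P :: "nat \<Rightarrow> ('r, nat \<Rightarrow> 'r) module"
  assumes M: "gmod R pr M q" and res: "finite_resolution R M n P d \<epsilon>"
    and d: "\<And>i. i < n \<Longrightarrow> d i \<in> graded_hom R (P (Suc i)) (Q (Suc i)) (P i) (Q i)"
    and \<epsilon>: "\<epsilon> \<in> graded_hom R (P 0) (Q 0) M (\<lambda>j. {x \<in> carrier M. q j x = x})"
    and P: "\<And>i. i \<le> n \<Longrightarrow> graded_module R G (P i) (Q i)" "\<And>i. i \<le> n \<Longrightarrow> finitely_generated R (P i)"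
      "\<And>i. i \<le> n \<Longrightarrow> graded_projective_wrt TYPE(nat \<Rightarrow> 'r) R G (P i) (Q i)"
  shows "\<exists>m. haspres R pr m M q"
proof -
  have "\<exists>p. gmod R pr (P i) p \<and> Q i = (\<lambda>j. {x \<in> carrier (P i). p j x = x})" if "i \<le> n" for i
    by (rule graded_module_gmod[OF P(1)[OF that]])
  then have "\<forall>i\<in>{..n}. \<exists>p. gmod R pr (P i) p \<and> Q i = (\<lambda>j. {x \<in> carrier (P i). p j x = x})" by simp
  from bchoice[OF this] obtain p where
    "\<forall>i\<in>{..n}. gmod R pr (P i) (p i) \<and> Q i = (\<lambda>j. {x \<in> carrier (P i). p i j x = x})" ..
  then have p: "\<And>i. i \<le> n \<Longrightarrow> gmod R pr (P i) (p i)"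
    "\<And>i. i \<le> n \<Longrightarrow> Q i = (\<lambda>j. {x \<in> carrier (P i). p i j x = x})" by simp_all
  have fgpP: "fgp R pr (P i) (p i)" if i: "i \<le> n" for i
  proof (rule projective_fgp[OF p(1)[OF i] P(2)[OF i]])
    fix I \<delta> \<pi> assume \<pi>: "pres R pr I \<delta> (P i) (p i) \<pi>"
    let ?F = "lmod R (free R I)" and ?p = "shift_pr pr \<delta>"
    note F = gmod_free[OF presD(1)[OF \<pi>], of \<delta>]
    have id: "(\<lambda>x. x) \<in> graded_hom R (P i) (Q i) (P i) (Q i)"
      unfolding p(2)[OF i] by (rule ghom_graded_hom[OF ghom_id])
    have \<pi>h: "\<pi> \<in> graded_hom R ?F (\<lambda>j. {x \<in> carrier ?F. ?p j x = x}) (P i) (Q i)"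
      unfolding p(2)[OF i] by (rule ghom_graded_hom[OF presD(2)[OF \<pi>]])
    obtain s where s: "s \<in> graded_hom R (P i) (Q i) ?F (\<lambda>j. {x \<in> carrier ?F. ?p j x = x})" "\<forall>x\<in>carrier (P i). \<pi> (s x) = x"
      using P(3)[OF i, unfolded graded_projective_wrt_def, rule_format, of ?F "\<lambda>j. {x \<in> carrier ?F. ?p j x = x}" "P i" "Q i" \<pi> "\<lambda>x. x"]
        gmod_graded_module[OF F] P(1)[OF i] \<pi>h presD(4)[OF \<pi>] id by blast
    have "ghom R (P i) (p i) ?F ?p s"
      by (rule graded_hom_ghom[OF p(1)[OF i] F]) (use s(1) p(2)[OF i] in simp)
    then show "\<exists>s. ghom R (P i) (p i) ?F ?p s \<and> (\<forall>x\<in>carrier (P i). \<pi> (s x) = x)" using s(2) by blast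
  qed
  have "gres R pr M q n P p d \<epsilon>"
    unfolding gres_def
  proof (intro conjI allI impI res)
    show "gmod R pr (P i) (p i)" "fgp R pr (P i) (p i)" if "i \<le> n" for i using p(1) fgpP that by blast+
    show "ghom R (P (Suc i)) (p (Suc i)) (P i) (p i) (d i)" if "i < n" for i
      by (rule graded_hom_ghom[OF p(1) p(1)]) (use d[OF that] p(2)[of i] p(2)[of "Suc i"] that in auto)
    show "ghom R (P 0) (p 0) M q \<epsilon>"
      by (rule graded_hom_ghom[OF p(1) M]) (use \<epsilon> p(2)[of 0] in auto)
  qed
  then show ?thesis by (rule gres_haspres[OF M])
qed

lemma (in gr_ring) haspres_resolution:
  assumes M: "gmod R pr M q" and hp: "haspres R pr m M q"
  shows "\<exists>n (P :: nat \<Rightarrow> ('r, nat \<Rightarrow> 'r) module) d \<epsilon>. finite_resolution R M n P d \<epsilon> \<and>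
    (\<forall>i\<le>n. finitely_generated R (P i) \<and> projective_wrt TYPE('u) R (P i))"
proof -
  obtain P :: "nat \<Rightarrow> ('r, nat \<Rightarrow> 'r) module" and Q d \<epsilon> where g: "gres R pr M q (Suc m) P Q d \<epsilon>"
    using haspres_gres[OF M hp] by blast
  have P: "gmod R pr (P i) (Q i)" "fgp R pr (P i) (Q i)" if "i \<le> Suc m" for i using g that by (auto simp: gres_def)
  have "finitely_generated R (P i) \<and> projective_wrt TYPE('u) R (P i)" if "i \<le> Suc m" for i
    using fgp_finitely_generated[OF P[OF that]] fgp_projective[OF P[OF that]] by blast
  moreover have "finite_resolution R M (Suc m) P d \<epsilon>" using g by (simp add: gres_def)
  ultimately show ?thesis by blast
qed

lemma (in nat_gr_ring) haspres_graded_resolution: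
  assumes M: "gmod R pr M q" and hp: "haspres R pr m M q"
  shows "\<exists>n (P :: nat \<Rightarrow> ('r, nat \<Rightarrow> 'r) module) Q d \<epsilon>. finite_resolution R M n P d \<epsilon> \<and>
    (\<forall>i<n. d i \<in> graded_hom R (P (Suc i)) (Q (Suc i)) (P i) (Q i)) \<and>
    \<epsilon> \<in> graded_hom R (P 0) (Q 0) M (\<lambda>j. {x \<in> carrier M. q j x = x}) \<and>
    (\<forall>i\<le>n. graded_module R G (P i) (Q i) \<and> finitely_generated R (P i) \<and>
      graded_projective_wrt TYPE('u) R G (P i) (Q i))"
proof -
  obtain P :: "nat \<Rightarrow> ('r, nat \<Rightarrow> 'r) module" and p d \<epsilon> where g: "gres R pr M q (Suc m) P p d \<epsilon>"
    using haspres_gres[OF M hp] by blast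
  have P: "gmod R pr (P i) (p i)" "fgp R pr (P i) (p i)" if "i \<le> Suc m" for i using g that by (auto simp: gres_def)
  have d: "ghom R (P (Suc i)) (p (Suc i)) (P i) (p i) (d i)" if "i < Suc m" for i using g that by (auto simp: gres_def)
  have \<epsilon>: "ghom R (P 0) (p 0) M q \<epsilon>" using g by (auto simp: gres_def)
  define Q where "Q i = (\<lambda>j. {x \<in> carrier (P i). p i j x = x})" for i
  have "finite_resolution R M (Suc m) P d \<epsilon>" using g by (simp add: gres_def)
  moreover have "\<forall>i<Suc m. d i \<in> graded_hom R (P (Suc i)) (Q (Suc i)) (P i) (Q i)"
    unfolding Q_def using ghom_graded_hom[OF d] by blast
  moreover have "\<epsilon> \<in> graded_hom R (P 0) (Q 0) M (\<lambda>j. {x \<in> carrier M. q j x = x})"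
    unfolding Q_def by (rule ghom_graded_hom[OF \<epsilon>])
  moreover have "\<forall>i\<le>Suc m. graded_module R G (P i) (Q i) \<and> finitely_generated R (P i) \<and>
      graded_projective_wrt TYPE('u) R G (P i) (Q i)"
    unfolding Q_def using gmod_graded_module[OF P(1)] fgp_finitely_generated[OF P] fgp_graded_projective[OF P] by blast
  ultimately show ?thesis by blast
qed

section \<open>The enveloping algebra of a tensor product\<close>

text \<open>\<open>tlift\<close> takes a module record as its target, whereas functionals take
  values in the ring \<open>K\<close>; this record mediates.\<close>

definition self_module :: "('k, 'c) ring_scheme \<Rightarrow> ('k, 'k) module"
  where "self_module K = \<lparr>carrier = carrier K, mult = mult K, one = one K, zero = zero K, add = add K, smult = mult K\<rparr>"

lemma self_module_simps:
  "carrier (self_module K) = carrier K" "add (self_module K) = add K" "zero (self_module K) = zero K"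
  "smult (self_module K) = mult K" "same_add (self_module K) K"
  by (simp_all add: self_module_def same_add_def)

lemma module_self:
  assumes "cring K"
  shows "module K (self_module K)"
proof -
  interpret cring K by fact
  show ?thesis
    by (intro moduleI assms same_add_abelian_group[OF self_module_simps(5) abelian_group_axioms])
      (auto simp: self_module_simps l_distr r_distr m_assoc)
qed

text \<open>A map of four arguments is lifted first in \<open>(b, b')\<close>, with \<open>a\<close>
  and \<open>a'\<close> fixed, and then in \<open>(a, a')\<close>. It serves twice, with different
  pairings: for the map from \<open>A\<^sup>e \<times> B\<^sup>e\<close> to
  \<open>(A \<otimes> B)\<^sup>e\<close>, and for the functionals that show this map to be a tensor
  product.\<close>

lemma swap4:
  assumes P: "tensor_pair K A A'" and Q: "tensor_pair K B B'" and Z: "module K Z"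
    and F1: "\<And>b b'. b \<in> carrier B \<Longrightarrow> b' \<in> carrier B' \<Longrightarrow> tensor_pair.bilin K A A' Z (\<lambda>a a'. F a a' b b')"
    and F2: "\<And>a a'. a \<in> carrier A \<Longrightarrow> a' \<in> carrier A' \<Longrightarrow> tensor_pair.bilin K B B' Z (F a a')"
  shows "\<exists>\<beta>. tensor_pair.bilin K (tensor_product K A A') (tensor_product K B B') Z \<beta> \<and>
    (\<forall>a\<in>carrier A. \<forall>a'\<in>carrier A'. \<forall>b\<in>carrier B. \<forall>b'\<in>carrier B'.
      \<beta> (pure_tensor K A A' a a') (pure_tensor K B B' b b') = F a a' b b')"
proof -
  interpret P: tensor_pair K A A' by fact
  interpret Q: tensor_pair K B B' by fact
  interpret Z: module K Z by fact
  interpret PQ: tensor_pair K P.TAB Q.TAB by (intro tensor_pair.intro P.T_assoc_algebra Q.T_assoc_algebra)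
  note aZ = Z.abelian_group_axioms
  define g where "g Y a a' = Q.tlift Z (F a a') Y" for Y a a'
  have g: "addm Q.TAB Z (\<lambda>Y. g Y a a')" "\<And>c Y. c \<in> carrier K \<Longrightarrow> Y \<in> carrier Q.TAB \<Longrightarrow> g (c \<odot>\<^bsub>Q.TAB\<^esub> Y) a a' = c \<odot>\<^bsub>Z\<^esub> g Y a a'"
    "\<And>b b'. b \<in> carrier B \<Longrightarrow> b' \<in> carrier B' \<Longrightarrow> g (Q.pt b b') a a' = F a a' b b'"
    if "a \<in> carrier A" "a' \<in> carrier A'" for a a'
    unfolding g_def using Q.tlift[OF Z F2[OF that]] by blast+
  have smZ: "addm Z Z (\<lambda>z. c \<odot>\<^bsub>Z\<^esub> z)" if "c \<in> carrier K" for c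
    by (rule addmI) (use that in \<open>auto simp: Z.smult_r_distr\<close>)
  have F1D: "addm A Z (\<lambda>a. F a a' b b')" if "a' \<in> carrier A'" "b \<in> carrier B" "b' \<in> carrier B'" for a' b b'
    using F1[OF that(2,3)] that(1) by (auto simp: P.bilin_def)
  have F1D': "addm A' Z (\<lambda>a'. F a a' b b')" if "a \<in> carrier A" "b \<in> carrier B" "b' \<in> carrier B'" for a b b'
    using F1[OF that(2,3)] that(1) by (auto simp: P.bilin_def)
  have F1K: "F (c \<odot>\<^bsub>A\<^esub> a) a' b b' = c \<odot>\<^bsub>Z\<^esub> F a a' b b'" "F a (c \<odot>\<^bsub>A'\<^esub> a') b b' = c \<odot>\<^bsub>Z\<^esub> F a a' b b'"
    if "c \<in> carrier K" "a \<in> carrier A" "a' \<in> carrier A'" "b \<in> carrier B" "b' \<in> carrier B'" for c a a' b b'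
    using F1[OF that(4,5)] that(1-3) by (auto simp: P.bilin_def)
  have bil: "P.bilin Z (g Y)" if Y: "Y \<in> carrier Q.TAB" for Y
    unfolding P.bilin_def
  proof (intro conjI ballI addmI)
    fix a a' assume a: "a \<in> carrier A" "a' \<in> carrier A'"
    show "g Y a a' \<in> carrier Z" using addm_closed[OF g(1)[OF a] Y] .
    then show "g Y a a' \<in> carrier Z" .
    show "g Y (x \<oplus>\<^bsub>A\<^esub> y) a' = g Y x a' \<oplus>\<^bsub>Z\<^esub> g Y y a'" if x: "x \<in> carrier A" "y \<in> carrier A" for x y
      by (rule Q.T_eqI[OF aZ g(1) addm_plus[OF aZ g(1) g(1)] Y]) (use x a addm_add[OF F1D] in \<open>auto simp: g(3)\<close>)
    show "g Y a (x \<oplus>\<^bsub>A'\<^esub> y) = g Y a x \<oplus>\<^bsub>Z\<^esub> g Y a y" if x: "x \<in> carrier A'" "y \<in> carrier A'" for x y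
      by (rule Q.T_eqI[OF aZ g(1) addm_plus[OF aZ g(1) g(1)] Y]) (use x a addm_add[OF F1D'] in \<open>auto simp: g(3)\<close>)
    fix c assume c: "c \<in> carrier K"
    show "g Y (c \<odot>\<^bsub>A\<^esub> a) a' = c \<odot>\<^bsub>Z\<^esub> g Y a a'"
      by (rule Q.T_eqI[OF aZ g(1) addm_comp[OF g(1) smZ[OF c]] Y]) (use c a F1K in \<open>auto simp: g(3)\<close>)
    show "g Y a (c \<odot>\<^bsub>A'\<^esub> a') = c \<odot>\<^bsub>Z\<^esub> g Y a a'"
      by (rule Q.T_eqI[OF aZ g(1) addm_comp[OF g(1) smZ[OF c]] Y]) (use c a F1K in \<open>auto simp: g(3)\<close>)
  qed
  define \<beta> where "\<beta> X Y = P.tlift Z (g Y) X" for X Y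
  have \<beta>: "addm P.TAB Z (\<lambda>X. \<beta> X Y)" "\<And>c X. c \<in> carrier K \<Longrightarrow> X \<in> carrier P.TAB \<Longrightarrow> \<beta> (c \<odot>\<^bsub>P.TAB\<^esub> X) Y = c \<odot>\<^bsub>Z\<^esub> \<beta> X Y"
    "\<And>a a'. a \<in> carrier A \<Longrightarrow> a' \<in> carrier A' \<Longrightarrow> \<beta> (P.pt a a') Y = g Y a a'"
    if "Y \<in> carrier Q.TAB" for Y
    unfolding \<beta>_def using P.tlift[OF Z bil[OF that]] by blast+
  have "PQ.bilin Z \<beta>"
    unfolding PQ.bilin_def
  proof (intro conjI ballI)
    fix X assume X: "X \<in> carrier P.TAB"
    show "addm Q.TAB Z (\<beta> X)"
    proof (rule addmI)
      show "\<beta> X Y \<in> carrier Z" if "Y \<in> carrier Q.TAB" for Y using addm_closed[OF \<beta>(1)[OF that] X] .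
      show "\<beta> X (x \<oplus>\<^bsub>Q.TAB\<^esub> y) = \<beta> X x \<oplus>\<^bsub>Z\<^esub> \<beta> X y" if x: "x \<in> carrier Q.TAB" "y \<in> carrier Q.TAB" for x y
        by (rule P.T_eqI[OF aZ \<beta>(1) addm_plus[OF aZ \<beta>(1) \<beta>(1)] X]) (use x addm_add[OF g(1)] in \<open>auto simp: \<beta>(3)\<close>)
    qed
    fix c Y assume c: "c \<in> carrier K" and Y: "Y \<in> carrier Q.TAB"
    show "\<beta> (c \<odot>\<^bsub>P.TAB\<^esub> X) Y = c \<odot>\<^bsub>Z\<^esub> \<beta> X Y" by (rule \<beta>(2)[OF Y c X])
    show "\<beta> X (c \<odot>\<^bsub>Q.TAB\<^esub> Y) = c \<odot>\<^bsub>Z\<^esub> \<beta> X Y"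
      by (rule P.T_eqI[OF aZ \<beta>(1) addm_comp[OF \<beta>(1) smZ[OF c]] X]) (use c Y g(2) in \<open>auto simp: \<beta>(3)\<close>)
  qed (rule \<beta>(1))
  then show ?thesis using \<beta>(3) g(3) by (intro exI[of _ \<beta>]) auto
qed

lemma addm_opposite [simp]: "addm (opposite A) L f = addm A L f"
  by (rule same_add(6)[OF same_add_opposite])

lemma (in env) EA_pt_left: "a' \<in> carrier A \<Longrightarrow> addm A EA (\<lambda>a. E.pt a a')"
  using E.pt_left[of a'] by (simp add: EA_eq)

lemma (in env) EA_pt_right: "a \<in> carrier A \<Longrightarrow> addm A EA (E.pt a)"
  using E.pt_right[of a] by (simp add: EA_eq)

section \<open>The interchange map from two enveloping algebras to that of the tensor
  product\<close>

locale env_pair = K: field K + A: env K A + B: env K B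
  for K :: "('k, 'c) ring_scheme" and A :: "('k, 'a) module" and B :: "('k, 'b) module"
begin

sublocale P: tensor_pair K A B
  by (intro tensor_pair.intro A.assoc_algebra_axioms B.assoc_algebra_axioms)

sublocale U: env K "tensor_product K A B"
  by (intro env.intro P.T_assoc_algebra)

sublocale RA: assoc_algebra K A.EA by (rule A.EA_assoc_algebra)
sublocale RB: assoc_algebra K B.EA by (rule B.EA_assoc_algebra)
sublocale RU: assoc_algebra K U.EA by (rule U.EA_assoc_algebra)

sublocale RR: tensor_pair K A.EA B.EA
  by (intro tensor_pair.intro A.EA_assoc_algebra B.EA_assoc_algebra)

text \<open>The two middle factors change places. The right-acting elements \<open>a'\<close> and
  \<open>b'\<close> are joined in \<open>A \<otimes> B\<close> and regarded in the opposite of that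
  algebra, so this opposite never has to be identified with a tensor product of opposites.\<close>

definition swap :: "(('a \<times> 'a \<Rightarrow> 'k) set \<Rightarrow> ('b \<times> 'b \<Rightarrow> 'k) set \<Rightarrow>
    (('a \<times> 'b \<Rightarrow> 'k) set \<times> ('a \<times> 'b \<Rightarrow> 'k) set \<Rightarrow> 'k) set) \<Rightarrow> bool"
  where "swap \<beta> \<longleftrightarrow> RR.bilin U.EA \<beta> \<and> (\<forall>a\<in>carrier A. \<forall>a'\<in>carrier A. \<forall>b\<in>carrier B. \<forall>b'\<in>carrier B.
    \<beta> (A.E.pt a a') (B.E.pt b b') = U.E.pt (P.pt a b) (P.pt a' b'))"

lemma ex_swap: "\<exists>\<beta>. swap \<beta>"
proof -
  have "\<exists>\<beta>. tensor_pair.bilin K (tensor_product K A (opposite A)) (tensor_product K B (opposite B)) U.EA \<beta> \<and>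
    (\<forall>a\<in>carrier A. \<forall>a'\<in>carrier (opposite A). \<forall>b\<in>carrier B. \<forall>b'\<in>carrier (opposite B).
      \<beta> (A.E.pt a a') (B.E.pt b b') = U.E.pt (P.pt a b) (P.pt a' b'))"
  proof (rule swap4[OF A.E.tensor_pair_axioms B.E.tensor_pair_axioms RU.module_axioms])
    fix b b' assume b: "b \<in> carrier B" "b' \<in> carrier (opposite B)"
    show "A.E.bilin U.EA (\<lambda>a a'. U.E.pt (P.pt a b) (P.pt a' b'))"
      unfolding A.E.bilin_def U.EA_eq
    proof (intro conjI ballI)
      show "addm A U.E.TAB (\<lambda>a. U.E.pt (P.pt a b) (P.pt a' b'))" if "a' \<in> carrier (opposite A)" for a'
        by (rule addm_comp[OF P.pt_left U.E.pt_left]) (use b that in auto)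
      show "addm (opposite A) U.E.TAB (\<lambda>a'. U.E.pt (P.pt a b) (P.pt a' b'))" if "a \<in> carrier A" for a
        unfolding addm_opposite by (rule addm_comp[OF P.pt_left U.EA_pt_right[unfolded U.EA_eq]]) (use b that in auto)
    qed (use b in \<open>auto simp: P.pt_smult U.E.pt_smult U.E.pt_smult(2)[simplified]\<close>)
  next
    fix a a' assume a: "a \<in> carrier A" "a' \<in> carrier (opposite A)"
    show "B.E.bilin U.EA (\<lambda>b b'. U.E.pt (P.pt a b) (P.pt a' b'))"
      unfolding B.E.bilin_def U.EA_eq
    proof (intro conjI ballI)
      show "addm B U.E.TAB (\<lambda>b. U.E.pt (P.pt a b) (P.pt a' b'))" if "b' \<in> carrier (opposite B)" for b'
        by (rule addm_comp[OF P.pt_right U.E.pt_left]) (use a that in auto)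
      show "addm (opposite B) U.E.TAB (\<lambda>b'. U.E.pt (P.pt a b) (P.pt a' b'))" if "b \<in> carrier B" for b
        unfolding addm_opposite by (rule addm_comp[OF P.pt_right U.EA_pt_right[unfolded U.EA_eq]]) (use a that in auto)
    qed (use a in \<open>auto simp: P.pt_smult U.E.pt_smult U.E.pt_smult(2)[simplified]\<close>)
  qed
  then show ?thesis unfolding swap_def A.EA_eq B.EA_eq by simp
qed

context
  fixes \<beta> assumes \<beta>: "swap \<beta>"
begin

lemma swap_left: "s \<in> carrier B.EA \<Longrightarrow> addm A.EA U.EA (\<lambda>r. \<beta> r s)"
  and swap_right: "r \<in> carrier A.EA \<Longrightarrow> addm B.EA U.EA (\<beta> r)"
  and swap_scalar: "c \<in> carrier K \<Longrightarrow> r \<in> carrier A.EA \<Longrightarrow> s \<in> carrier B.EA \<Longrightarrow> \<beta> (c \<odot>\<^bsub>A.EA\<^esub> r) s = c \<odot>\<^bsub>U.EA\<^esub> \<beta> r s"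
    "c \<in> carrier K \<Longrightarrow> r \<in> carrier A.EA \<Longrightarrow> s \<in> carrier B.EA \<Longrightarrow> \<beta> r (c \<odot>\<^bsub>B.EA\<^esub> s) = c \<odot>\<^bsub>U.EA\<^esub> \<beta> r s"
  and swap_pt: "a \<in> carrier A \<Longrightarrow> a' \<in> carrier A \<Longrightarrow> b \<in> carrier B \<Longrightarrow> b' \<in> carrier B \<Longrightarrow>
    \<beta> (A.E.pt a a') (B.E.pt b b') = U.E.pt (P.pt a b) (P.pt a' b')"
  using \<beta> by (auto simp: swap_def RR.bilin_def)

lemma swap_closed: "r \<in> carrier A.EA \<Longrightarrow> s \<in> carrier B.EA \<Longrightarrow> \<beta> r s \<in> carrier U.EA"
  using addm_closed[OF swap_right] .

text \<open>Both sides are additive in four arguments, which are reduced to pure tensors one after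
  the other. The number of each auxiliary fact counts the arguments that are already pure.\<close>

lemma swap_mult:
  assumes r: "r \<in> carrier A.EA" "r' \<in> carrier A.EA" and s: "s \<in> carrier B.EA" "s' \<in> carrier B.EA"
  shows "\<beta> (r \<otimes>\<^bsub>A.EA\<^esub> r') (s \<otimes>\<^bsub>B.EA\<^esub> s') = \<beta> r s \<otimes>\<^bsub>U.EA\<^esub> \<beta> r' s'"
proof -
  note aU = RU.abelian_group_axioms
  have ml: "addm M M (\<lambda>x. x \<otimes>\<^bsub>M\<^esub> y)" and mr: "addm M M (\<lambda>x. y \<otimes>\<^bsub>M\<^esub> x)" if "ring M" "y \<in> carrier M" for y and M :: "('k, 'm) module"
  proof -
    interpret ring M by fact
    show "addm M M (\<lambda>x. x \<otimes>\<^bsub>M\<^esub> y)" "addm M M (\<lambda>x. y \<otimes>\<^bsub>M\<^esub> x)"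
      by (auto intro!: addmI simp: that l_distr r_distr)
  qed
  note mA = ml[OF RA.ring_axioms] mr[OF RA.ring_axioms] and mB = ml[OF RB.ring_axioms] mr[OF RB.ring_axioms]
    and mU = ml[OF RU.ring_axioms] mr[OF RU.ring_axioms]
  note c = swap_closed and pA = A.EA_pt and pB = B.EA_pt
  have 4: "\<beta> (A.E.pt a a' \<otimes>\<^bsub>A.EA\<^esub> A.E.pt d d') (B.E.pt b b' \<otimes>\<^bsub>B.EA\<^esub> B.E.pt e e') =
      \<beta> (A.E.pt a a') (B.E.pt b b') \<otimes>\<^bsub>U.EA\<^esub> \<beta> (A.E.pt d d') (B.E.pt e e')"
    if "a \<in> carrier A" "a' \<in> carrier A" "b \<in> carrier B" "b' \<in> carrier B" "d \<in> carrier A" "d' \<in> carrier A" "e \<in> carrier B" "e' \<in> carrier B"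
    for a a' b b' d d' e e'
    using that by (simp add: pA(2) pB(2) swap_pt U.EA_pt(2) P.pt_mult)
  have 3: "\<beta> (A.E.pt a a' \<otimes>\<^bsub>A.EA\<^esub> A.E.pt d d') (B.E.pt b b' \<otimes>\<^bsub>B.EA\<^esub> s') =
      \<beta> (A.E.pt a a') (B.E.pt b b') \<otimes>\<^bsub>U.EA\<^esub> \<beta> (A.E.pt d d') s'"
    if "a \<in> carrier A" "a' \<in> carrier A" "b \<in> carrier B" "b' \<in> carrier B" "d \<in> carrier A" "d' \<in> carrier A" for a a' b b' d d'
    by (rule B.EA_eqI[OF aU addm_comp[OF mB(2) swap_right] addm_comp[OF swap_right mU(2)] s(2)])
      (use that in \<open>simp_all add: 4 pA(1) pB(1) c\<close>)
  have 2: "\<beta> (A.E.pt a a' \<otimes>\<^bsub>A.EA\<^esub> r') (B.E.pt b b' \<otimes>\<^bsub>B.EA\<^esub> s') = \<beta> (A.E.pt a a') (B.E.pt b b') \<otimes>\<^bsub>U.EA\<^esub> \<beta> r' s'"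
    if "a \<in> carrier A" "a' \<in> carrier A" "b \<in> carrier B" "b' \<in> carrier B" for a a' b b'
    by (rule A.EA_eqI[OF aU addm_comp[OF mA(2) swap_left] addm_comp[OF swap_left mU(2)] r(2)])
      (use that s in \<open>simp_all add: 3 pA(1) pB(1) c\<close>)
  have 1: "\<beta> (A.E.pt a a' \<otimes>\<^bsub>A.EA\<^esub> r') (s \<otimes>\<^bsub>B.EA\<^esub> s') = \<beta> (A.E.pt a a') s \<otimes>\<^bsub>U.EA\<^esub> \<beta> r' s'"
    if "a \<in> carrier A" "a' \<in> carrier A" for a a'
    by (rule B.EA_eqI[OF aU addm_comp[OF mB(1) swap_right] addm_comp[OF swap_right mU(1)] s(1)])
      (use that r s in \<open>simp_all add: 2 pA(1) pB(1) c\<close>)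
  show ?thesis
    by (rule A.EA_eqI[OF aU addm_comp[OF mA(1) swap_left] addm_comp[OF swap_left mU(1)] r(1)])
      (use r s in \<open>simp_all add: 1 pA(1) pB(1) c\<close>)
qed

lemma swap_gen:
  assumes "x \<in> carrier U.EA"
  shows "x \<in> acl U.EA {\<beta> r s | r s. r \<in> carrier A.EA \<and> s \<in> carrier B.EA}" (is "x \<in> acl _ ?S")
proof -
  have A: "add_closed U.EA (acl U.EA ?S)" by (rule RU.add_closed_acl) (use swap_closed in auto)
  note aU = RU.abelian_group_axioms
  have l: "addm P.TAB U.EA (\<lambda>x. U.E.pt x y)" if "y \<in> carrier P.TAB" for y
    using U.EA_pt_left that .
  have r: "addm P.TAB U.EA (U.E.pt y)" if "y \<in> carrier P.TAB" for y
    using U.EA_pt_right that .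
  have "U.E.pt x y \<in> acl U.EA ?S" if x: "x \<in> carrier P.TAB" and y: "y \<in> carrier P.TAB" for x y
  proof (rule P.T_inI[OF aU l[OF y] A x])
    fix a b assume a: "a \<in> carrier A" "b \<in> carrier B"
    show "U.E.pt (P.pt a b) y \<in> acl U.EA ?S"
    proof (rule P.T_inI[OF aU r A y])
      fix a' b' assume a': "a' \<in> carrier A" "b' \<in> carrier B"
      have "U.E.pt (P.pt a b) (P.pt a' b') = \<beta> (A.E.pt a a') (B.E.pt b b')" using a a' swap_pt by simp
      then show "U.E.pt (P.pt a b) (P.pt a' b') \<in> acl U.EA ?S"
        using A.EA_pt(1)[OF a(1) a'(1)] B.EA_pt(1)[OF a(2) a'(2)] by (intro acl_base) blast
    qed (use a in simp)
  qed
  then show ?thesis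
    using U.E.T_inI[OF aU[unfolded U.EA_eq] addm_id A[unfolded U.EA_eq] assms[unfolded U.EA_eq]] by (simp add: U.EA_eq)
qed

text \<open>This shows, in terms of functionals, that the interchange map identifies no tensors. The
  product of \<open>\<psi>\<close> and \<open>\<phi>\<close> is read as a function of four elements
  and regrouped by \<open>swap4\<close> into the pairs \<open>(a, b)\<close> and
  \<open>(a', b')\<close>, which yields a functional on the enveloping algebra of the tensor
  product.\<close>

lemma swap_fnl:
  assumes \<psi>: "fnl K A.EA \<psi>" and \<phi>: "fnl K B.EA \<phi>"
  shows "\<exists>\<Lambda>. addm U.EA K \<Lambda> \<and> (\<forall>r\<in>carrier A.EA. \<forall>s\<in>carrier B.EA. \<Lambda> (\<beta> r s) = \<psi> r \<otimes>\<^bsub>K\<^esub> \<phi> s)"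
proof -
  let ?K = "self_module K"
  note mK = module_self[OF K.cring_axioms]
  note aK = K.abelian_group_axioms
  have \<psi>D: "addm A.EA K \<psi>" "\<And>c x. c \<in> carrier K \<Longrightarrow> x \<in> carrier A.EA \<Longrightarrow> \<psi> (c \<odot>\<^bsub>A.EA\<^esub> x) = c \<otimes>\<^bsub>K\<^esub> \<psi> x"
    and \<phi>D: "addm B.EA K \<phi>" "\<And>c x. c \<in> carrier K \<Longrightarrow> x \<in> carrier B.EA \<Longrightarrow> \<phi> (c \<odot>\<^bsub>B.EA\<^esub> x) = c \<otimes>\<^bsub>K\<^esub> \<phi> x"
    using \<psi> \<phi> by (auto simp: fnl_def)
  have \<psi>c: "\<psi> (A.E.pt a a') \<in> carrier K" if "a \<in> carrier A" "a' \<in> carrier A" for a a'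
    using addm_closed[OF \<psi>D(1) A.EA_pt(1)] that .
  have \<phi>c: "\<phi> (B.E.pt a a') \<in> carrier K" if "a \<in> carrier B" "a' \<in> carrier B" for a a'
    using addm_closed[OF \<phi>D(1) B.EA_pt(1)] that .
  have kl: "addm K K (\<lambda>x. x \<otimes>\<^bsub>K\<^esub> y)" "addm K K (\<lambda>x. y \<otimes>\<^bsub>K\<^esub> x)" if "y \<in> carrier K" for y
    by (rule addmI; use that in \<open>simp add: K.l_distr K.r_distr\<close>)+
  have Al: "addm A K (\<lambda>a. \<psi> (A.E.pt a a'))" "addm A K (\<lambda>a. \<psi> (A.E.pt a' a))" if "a' \<in> carrier A" for a'
    by (rule addm_comp[OF A.EA_pt_left \<psi>D(1)], fact that, rule addm_comp[OF A.EA_pt_right \<psi>D(1)], fact that)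
  have Bl: "addm B K (\<lambda>a. \<phi> (B.E.pt a a'))" "addm B K (\<lambda>a. \<phi> (B.E.pt a' a))" if "a' \<in> carrier B" for a'
    by (rule addm_comp[OF B.EA_pt_left \<phi>D(1)], fact that, rule addm_comp[OF B.EA_pt_right \<phi>D(1)], fact that)
  have As: "\<psi> (A.E.pt (c \<odot>\<^bsub>A\<^esub> a) a') = c \<otimes>\<^bsub>K\<^esub> \<psi> (A.E.pt a a')" "\<psi> (A.E.pt a (c \<odot>\<^bsub>A\<^esub> a')) = c \<otimes>\<^bsub>K\<^esub> \<psi> (A.E.pt a a')"
    if "c \<in> carrier K" "a \<in> carrier A" "a' \<in> carrier A" for c a a'
    using A.E.pt_smult[of c a a'] \<psi>D(2)[of c "A.E.pt a a'"] A.EA_pt(1)[of a a'] that by (simp_all add: A.EA_eq)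
  have Bs: "\<phi> (B.E.pt (c \<odot>\<^bsub>B\<^esub> a) a') = c \<otimes>\<^bsub>K\<^esub> \<phi> (B.E.pt a a')" "\<phi> (B.E.pt a (c \<odot>\<^bsub>B\<^esub> a')) = c \<otimes>\<^bsub>K\<^esub> \<phi> (B.E.pt a a')"
    if "c \<in> carrier K" "a \<in> carrier B" "a' \<in> carrier B" for c a a'
    using B.E.pt_smult[of c a a'] \<phi>D(2)[of c "B.E.pt a a'"] B.EA_pt(1)[of a a'] that by (simp_all add: B.EA_eq)
  have tK: "addm M ?K f \<longleftrightarrow> addm M K f" for M :: "('k, 'm) module" and f using same_add(7)[OF self_module_simps(5)] .
  have "\<exists>\<gamma>. tensor_pair.bilin K (tensor_product K A B) (tensor_product K A B) ?K \<gamma> \<and>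
    (\<forall>a\<in>carrier A. \<forall>b\<in>carrier B. \<forall>a'\<in>carrier A. \<forall>b'\<in>carrier B.
      \<gamma> (P.pt a b) (P.pt a' b') = \<psi> (A.E.pt a a') \<otimes>\<^bsub>K\<^esub> \<phi> (B.E.pt b b'))"
  proof (rule swap4[OF P.tensor_pair_axioms P.tensor_pair_axioms mK])
    show "P.bilin ?K (\<lambda>a b. \<psi> (A.E.pt a a') \<otimes>\<^bsub>K\<^esub> \<phi> (B.E.pt b b'))" if a: "a' \<in> carrier A" "b' \<in> carrier B" for a' b'
      unfolding P.bilin_def tK
    proof (intro conjI ballI)
      show "addm A K (\<lambda>a. \<psi> (A.E.pt a a') \<otimes>\<^bsub>K\<^esub> \<phi> (B.E.pt b b'))" if "b \<in> carrier B" for b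
        by (rule addm_comp[OF Al(1) kl(1)]) (use a that \<phi>c in auto)
      show "addm B K (\<lambda>b. \<psi> (A.E.pt x a') \<otimes>\<^bsub>K\<^esub> \<phi> (B.E.pt b b'))" if "x \<in> carrier A" for x
        by (rule addm_comp[OF Bl(1) kl(2)]) (use a that \<psi>c in auto)
    qed (use a \<psi>c \<phi>c in \<open>simp_all add: As Bs self_module_simps K.m_ac\<close>)
    show "P.bilin ?K (\<lambda>a' b'. \<psi> (A.E.pt a a') \<otimes>\<^bsub>K\<^esub> \<phi> (B.E.pt b b'))" if a: "a \<in> carrier A" "b \<in> carrier B" for a b
      unfolding P.bilin_def tK
    proof (intro conjI ballI)
      show "addm A K (\<lambda>a'. \<psi> (A.E.pt a a') \<otimes>\<^bsub>K\<^esub> \<phi> (B.E.pt b b'))" if "b' \<in> carrier B" for b'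
        by (rule addm_comp[OF Al(2) kl(1)]) (use a that \<phi>c in auto)
      show "addm B K (\<lambda>b'. \<psi> (A.E.pt a x) \<otimes>\<^bsub>K\<^esub> \<phi> (B.E.pt b b'))" if "x \<in> carrier A" for x
        by (rule addm_comp[OF Bl(2) kl(2)]) (use a that \<psi>c in auto)
    qed (use a \<psi>c \<phi>c in \<open>simp_all add: As Bs self_module_simps K.m_ac\<close>)
  qed
  then obtain \<gamma> where \<gamma>: "tensor_pair.bilin K P.TAB P.TAB ?K \<gamma>"
    "\<And>a b a' b'. a \<in> carrier A \<Longrightarrow> b \<in> carrier B \<Longrightarrow> a' \<in> carrier A \<Longrightarrow> b' \<in> carrier B \<Longrightarrow>
      \<gamma> (P.pt a b) (P.pt a' b') = \<psi> (A.E.pt a a') \<otimes>\<^bsub>K\<^esub> \<phi> (B.E.pt b b')" by auto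
  interpret TT: tensor_pair K P.TAB P.TAB by (intro tensor_pair.intro P.T_assoc_algebra)
  \<comment> \<open>\<open>swap4\<close> yields a map that is bilinear on two copies of the tensor
    product. The second copy is replaced by its opposite, which has the same addition and the same
    scalars.\<close>
  have "U.E.bilin ?K \<gamma>" using \<gamma>(1) unfolding TT.bilin_def U.E.bilin_def
    by simp
  note L = U.E.tlift[OF mK this, folded U.EA_eq]
  let ?L = "U.E.tlift ?K \<gamma>"
  have LA: "addm U.EA K ?L" using L(1) by (simp add: tK)
  have Lpt: "?L (\<beta> (A.E.pt a a') (B.E.pt b b')) = \<psi> (A.E.pt a a') \<otimes>\<^bsub>K\<^esub> \<phi> (B.E.pt b b')"
    if "a \<in> carrier A" "a' \<in> carrier A" "b \<in> carrier B" "b' \<in> carrier B" for a a' b b'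
    using that by (simp add: swap_pt L(3) \<gamma>(2))
  have 1: "?L (\<beta> (A.E.pt a a') s) = \<psi> (A.E.pt a a') \<otimes>\<^bsub>K\<^esub> \<phi> s"
    if a: "a \<in> carrier A" "a' \<in> carrier A" and s: "s \<in> carrier B.EA" for a a' s
    by (rule B.EA_eqI[OF aK addm_comp[OF swap_right LA] addm_comp[OF \<phi>D(1) kl(2)] s])
      (use a A.EA_pt(1) \<psi>c Lpt in auto)
  have "?L (\<beta> r s) = \<psi> r \<otimes>\<^bsub>K\<^esub> \<phi> s" if r: "r \<in> carrier A.EA" and s: "s \<in> carrier B.EA" for r s
    by (rule A.EA_eqI[OF aK addm_comp[OF swap_left LA] addm_comp[OF \<psi>D(1) kl(1)] r])
      (use s addm_closed[OF \<phi>D(1)] 1 in auto)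
  then show ?thesis using LA by blast
qed

text \<open>The bimodule \<open>A \<otimes> B\<close> is the tensor product of the bimodules
  \<open>A\<close> and \<open>B\<close> along the interchange map. On pure tensors both sides
  multiply \<open>m\<close> and \<open>n\<close> from the left and from the right, factor by
  factor.\<close>

lemma swap_regular:
  assumes r: "r \<in> carrier A.EA" and s: "s \<in> carrier B.EA" and m: "m \<in> carrier A" and n: "n \<in> carrier B"
  shows "P.pt (r \<odot>\<^bsub>A.RB\<^esub> m) (s \<odot>\<^bsub>B.RB\<^esub> n) = \<beta> r s \<odot>\<^bsub>U.RB\<^esub> P.pt m n"
proof -
  note aT = P.T.abelian_group_axioms
  have mn: "P.pt m n \<in> carrier P.TAB" using m n by simp
  note LU = U.regular_addm[OF mn]
  have 2: "P.pt (A.E.pt a a' \<odot>\<^bsub>A.RB\<^esub> m) (B.E.pt b b' \<odot>\<^bsub>B.RB\<^esub> n) = \<beta> (A.E.pt a a') (B.E.pt b b') \<odot>\<^bsub>U.RB\<^esub> P.pt m n"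
    if "a \<in> carrier A" "a' \<in> carrier A" "b \<in> carrier B" "b' \<in> carrier B" for a a' b b'
    using that m n by (simp add: swap_pt A.regular_pt B.regular_pt U.regular_pt P.pt_mult)
  have 1: "P.pt (A.E.pt a a' \<odot>\<^bsub>A.RB\<^esub> m) (s \<odot>\<^bsub>B.RB\<^esub> n) = \<beta> (A.E.pt a a') s \<odot>\<^bsub>U.RB\<^esub> P.pt m n"
    if "a \<in> carrier A" "a' \<in> carrier A" for a a'
    by (rule B.EA_eqI[OF aT addm_comp[OF B.regular_addm[OF n] P.pt_right] addm_comp[OF swap_right LU] s])
      (use that m 2 A.EA_pt(1) A.regular_closed in auto)
  show ?thesis
    by (rule A.EA_eqI[OF aT addm_comp[OF A.regular_addm[OF m] P.pt_left] addm_comp[OF swap_left LU] r])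
      (use s n 1 B.regular_closed in auto)
qed

text \<open>\<open>haspres_tens\<close> is applied to the regular bimodules with pure tensors as the
  bilinear map. The main remaining point is separation, which again comes from products of
  functionals on the two factors.\<close>

lemma haspres_regular:
  assumes gr: "gr_ring A.EA prA" "gr_ring B.EA prB" "gr_ring U.EA prU"
    and gm: "gmod A.EA prA A.RB qA" "gmod B.EA prB B.RB qB" "gmod U.EA prU U.RB qU"
    and deg: "\<And>r s i j. r \<in> carrier A.EA \<Longrightarrow> s \<in> carrier B.EA \<Longrightarrow> prA i r = r \<Longrightarrow> prB j s = s \<Longrightarrow> prU (i + j) (\<beta> r s) = \<beta> r s"
    and qdeg: "\<And>m n i j. m \<in> carrier A \<Longrightarrow> n \<in> carrier B \<Longrightarrow> qA i m = m \<Longrightarrow> qB j n = n \<Longrightarrow> qU (i + j) (P.pt m n) = P.pt m n"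
    and hp: "haspres A.EA prA k A.RB qA" "haspres B.EA prB l B.RB qB"
  shows "\<exists>n. haspres U.EA prU n U.RB qU"
proof -
  interpret tensor_rings K A.EA prA B.EA prB U.EA prU \<beta>
    by (intro tensor_rings.intro tensor_rings_axioms.intro K.field_axioms gr A.EA_assoc_algebra B.EA_assoc_algebra
        swap_left swap_right swap_mult swap_gen swap_fnl deg) (auto simp: swap_scalar)
  note sA = regular_simps(4)[of K A] and sB = regular_simps(4)[of K B] and sT = regular_simps(4)[of K "tensor_product K A B"]
  have sep: "tens_sep A.RB B.RB U.RB P.pt"
    unfolding tens_sep_def
  proof (intro ballI allI impI)
    fix u H w assume u: "u \<in> carrier A.RB" "u \<noteq> \<zero>\<^bsub>A.RB\<^esub>" and H: "add_closed B.RB H"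
      and Hc: "\<forall>c\<in>carrier K. \<forall>h\<in>H. (c \<odot>\<^bsub>B.EA\<^esub> \<one>\<^bsub>B.EA\<^esub>) \<odot>\<^bsub>B.RB\<^esub> h \<in> H" and w: "w \<in> carrier B.RB" "w \<notin> H"
    have HB: "h \<in> carrier B" if "h \<in> H" for h using add_closedD(1)[OF H that] by (simp add: regular_simps)
    \<comment> \<open>A scalar from \<open>K\<close> acts on \<open>B\<close> through the multiple
      of one in the enveloping algebra, so the closure condition on \<open>H\<close> makes it a
      subspace of \<open>B\<close>.\<close>
    have sH: "sbsp K B H"
    proof (rule sbspI)
      show "add_closed B H" using H by (simp only: same_add(5)[OF sB])
      fix c h assume c: "c \<in> carrier K" "h \<in> H"
      have "(c \<odot>\<^bsub>B.EA\<^esub> \<one>\<^bsub>B.EA\<^esub>) \<odot>\<^bsub>B.RB\<^esub> h = c \<odot>\<^bsub>B\<^esub> (\<one>\<^bsub>B.EA\<^esub> \<odot>\<^bsub>B.RB\<^esub> h)"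
        by (rule B.regular_scalar) (use c HB in auto)
      also have "\<dots> = c \<odot>\<^bsub>B\<^esub> h" using HB[OF c(2)] by (simp add: B.EA_pt(3) B.regular_pt)
      finally show "c \<odot>\<^bsub>B\<^esub> h \<in> H" using Hc c by metis
    qed
    have uc: "u \<in> carrier A" "u \<notin> {\<zero>\<^bsub>A\<^esub>}" and wc: "w \<in> carrier B" using u w by (auto simp: regular_simps)
    obtain \<psi> where \<psi>: "fnl K A \<psi>" "\<psi> u = \<one>\<^bsub>K\<^esub>"
      using functional_exists[OF K.field_axioms A.module_axioms sbsp_zero[OF A.module_axioms] uc] by blast
    obtain \<phi> where \<phi>: "fnl K B \<phi>" "\<forall>x\<in>H. \<phi> x = \<zero>\<^bsub>K\<^esub>" "\<phi> w = \<one>\<^bsub>K\<^esub>"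
      using functional_exists[OF K.field_axioms B.module_axioms sH wc w(2)] by blast
    have \<psi>D: "addm A K \<psi>" "\<And>c x. c \<in> carrier K \<Longrightarrow> x \<in> carrier A \<Longrightarrow> \<psi> (c \<odot>\<^bsub>A\<^esub> x) = c \<otimes>\<^bsub>K\<^esub> \<psi> x"
      and \<phi>D: "addm B K \<phi>" "\<And>c x. c \<in> carrier K \<Longrightarrow> x \<in> carrier B \<Longrightarrow> \<phi> (c \<odot>\<^bsub>B\<^esub> x) = c \<otimes>\<^bsub>K\<^esub> \<phi> x"
      using \<psi> \<phi> by (auto simp: fnl_def)
    note cl = addm_closed[OF \<psi>D(1)] addm_closed[OF \<phi>D(1)]
    have "P.bilin (self_module K) (\<lambda>a b. \<psi> a \<otimes>\<^bsub>K\<^esub> \<phi> b)"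
      unfolding P.bilin_def same_add(7)[OF self_module_simps(5)]
      by (intro conjI ballI addmI)
        (auto simp: cl \<psi>D(2) \<phi>D(2) addm_add[OF \<psi>D(1)] addm_add[OF \<phi>D(1)] K.l_distr K.r_distr self_module_simps K.m_ac)
    note L = P.tlift[OF module_self[OF K.cring_axioms] this]
    let ?L = "P.tlift (self_module K) (\<lambda>a b. \<psi> a \<otimes>\<^bsub>K\<^esub> \<phi> b)"
    have "addm U.RB K ?L" using L(1) by (simp add: same_add(6)[OF sT] same_add(7)[OF self_module_simps(5)])
    moreover have "?L (P.pt u w) \<noteq> \<zero>\<^bsub>K\<^esub>" using L(3)[of u w] uc wc \<psi>(2) \<phi>(3) by simp
    moreover have "\<forall>v\<in>carrier A.RB. \<forall>h\<in>H. ?L (P.pt v h) = \<zero>\<^bsub>K\<^esub>"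
      using L(3) \<phi>(2) HB cl by (simp add: regular_simps)
    ultimately show "\<exists>\<Lambda>. addm U.RB K \<Lambda> \<and> \<Lambda> (P.pt u w) \<noteq> \<zero>\<^bsub>K\<^esub> \<and> (\<forall>v\<in>carrier A.RB. \<forall>h\<in>H. \<Lambda> (P.pt v h) = \<zero>\<^bsub>K\<^esub>)"
      by blast
  qed
  have "tens A.RB qA B.RB qB U.RB qU P.pt"
    unfolding tens_def same_add(6)[OF sA] same_add(6)[OF sB] same_add(7)[OF sT]
  proof (intro conjI gm sep ballI allI impI)
    show "carrier U.RB \<subseteq> acl U.RB {P.pt m n |m n. m \<in> carrier A.RB \<and> n \<in> carrier B.RB}"
      using acl_cong[OF sT P.pt_gen] by (auto simp: regular_simps)
  qed (auto simp: regular_simps P.pt_left P.pt_right swap_regular qdeg)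
  from haspres_tens[OF this hp] show ?thesis .
qed

end

end

text \<open>Connects the definitions, which grade by subsets, with gradings by projections. The
  bimodule takes over the integer-indexed projections of \<open>A\<close>, and their components are
  the sets of \<open>extend_by_zero\<close>.\<close>

lemma regular_gmod:
  fixes K :: "('k, 'c) ring_scheme" and A :: "('k, 'a) module"
  assumes gA: "graded_algebra K A G"
  shows "\<exists>pr q. nat_gr_ring (enveloping K A) pr (enveloping_grading K A G) \<and>
    gmod (enveloping K A) pr (regular_bimodule K A) q \<and>
    extend_by_zero A G = (\<lambda>j. {x \<in> carrier (regular_bimodule K A). q j x = x})"
proof -
  note D = graded_algebraD[OF gA]
  interpret env K A by (rule env.intro[OF D(1)])
  have gop: "graded_algebra K (opposite A) G" by (rule graded_algebra_opposite[OF gA])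
  have gE: "graded_algebra K EA (enveloping_grading K A G)"
    unfolding EA_eq enveloping_grading_def by (rule E.graded_algebra_tensor[OF gA gop])
  obtain pr where pr: "nat_gr_ring EA pr (enveloping_grading K A G)" using graded_algebra_nat_gr_ring[OF gE] by blast
  interpret pr: nat_gr_ring EA pr "enveloping_grading K A G" by fact
  obtain pA where pA: "nat_gr_ring A pA G" using graded_algebra_nat_gr_ring[OF gA] by blast
  interpret pA: nat_gr_ring A pA G by fact
  have ext: "extend_by_zero A G = (\<lambda>j. {x \<in> carrier RB. pA j x = x})"
  proof
    fix j
    show "extend_by_zero A G j = {x \<in> carrier RB. pA j x = x}"
      using pA.pr_neg[of j] pA.q_zero[of j] by (auto simp: extend_by_zero_def regular_simps pA.G_eq)
  qed
  interpret M: left_module EA RB by (rule regular_left_module)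
  have "graded_module EA (enveloping_grading K A G) RB (extend_by_zero A G)"
  proof (intro graded_module.intro graded_module_axioms.intro regular_left_module)
    show "internal_direct_sum RB (extend_by_zero A G)"
      unfolding ext by (rule grading.internal_direct_sum[OF grading_cong[OF regular_simps(4) pA.grading_axioms]])
    fix a m x j assume a: "a \<in> enveloping_grading K A G m" and x: "x \<in> extend_by_zero A G j"
    have ac: "a \<in> carrier EA" using a by (simp add: pr.G_eq)
    show "a \<odot>\<^bsub>RB\<^esub> x \<in> extend_by_zero A G (int m + j)"
    proof (cases "j < 0")
      case True
      then have "x = \<zero>\<^bsub>RB\<^esub>" using x by (simp add: extend_by_zero_def regular_simps)
      then have "a \<odot>\<^bsub>RB\<^esub> x = \<zero>\<^bsub>RB\<^esub>" using M.smult_r_null[OF ac] by simp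
      then show ?thesis using pA.q_zero by (simp add: ext regular_simps)
    next
      case False
      then have xG: "x \<in> G (nat j)" using x by (simp add: extend_by_zero_def)
      then have xc: "x \<in> carrier A" by (simp add: pA.G_eq)
      \<comment> \<open>The scalars that move \<open>x\<close> into the required degree form a
        subspace, so it is enough to test the homogeneous pure tensors that span the degree.\<close>
      have "a \<in> {X \<in> carrier EA. X \<odot>\<^bsub>RB\<^esub> x \<in> G (m + nat j)}"
      proof (rule E.total_grading_least[of G G m, folded enveloping_grading_def EA_eq, OF _ _ a])
        show "sbsp K EA {X \<in> carrier EA. X \<odot>\<^bsub>RB\<^esub> x \<in> G (m + nat j)}"
          by (rule sbsp_vimage[OF _ module_axioms regular_addm[OF xc] _ D(3)])
            (use regular_scalar[OF xc] assoc_algebra.axioms(1)[OF EA_assoc_algebra] in auto)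
        fix b c k l assume b: "b \<in> G k" "c \<in> G l" "k + l = m"
        have bc: "b \<in> carrier A" "c \<in> carrier A" using b by (simp_all add: pA.G_eq)
        have "b \<otimes>\<^bsub>A\<^esub> x \<otimes>\<^bsub>A\<^esub> c \<in> G (k + nat j + l)" by (intro D(5) b xG)
        moreover have "k + nat j + l = m + nat j" using b by simp
        ultimately show "E.pt b c \<in> {X \<in> carrier EA. X \<odot>\<^bsub>RB\<^esub> x \<in> G (m + nat j)}"
          using EA_pt(1)[OF bc] bc xc by (simp add: regular_pt)
      qed
      then have "a \<odot>\<^bsub>RB\<^esub> x \<in> G (m + nat j)" by simp
      moreover have "nat (int m + j) = m + nat j" using False by simp
      ultimately show ?thesis using False by (simp add: extend_by_zero_def)
    qed
  qed
  from pr.graded_module_gmod[OF this] show ?thesis using pr by blast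
qed

theorem proposition3p16:
  fixes K :: "'k ring"
    and A :: "('k, 'a) module"
    and B :: "('k, 'b) module"
  assumes "field K"
  shows "(homologically_smooth K A \<and> homologically_smooth K B \<longrightarrow>
            homologically_smooth K (tensor_product K A B)) \<and>
         (\<forall>G H. graded_homologically_smooth K A G \<and> graded_homologically_smooth K B H \<longrightarrow>
            graded_homologically_smooth K (tensor_product K A B) (total_grading K A G B H))"
proof (intro conjI impI allI; elim conjE)
  assume sm: "homologically_smooth K A" "homologically_smooth K B"
  then have "assoc_algebra K A" "assoc_algebra K B" by (auto simp: homologically_smooth_def)
  then interpret env_pair K A B by (intro env_pair.intro env.intro assms)
  obtain \<beta> where \<beta>: "swap \<beta>" using ex_swap by blast
  \<comment> \<open>Stated for an algebra \<open>C\<close> of arbitrary element type, since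
    \<open>A\<close> and \<open>B\<close> have different ones.\<close>
  have in_res: "\<exists>m. haspres (enveloping K C) (triv (enveloping K C)) m (regular_bimodule K C) (triv (regular_bimodule K C))"
    if sC: "homologically_smooth K C" for C :: "('k, 'e) module"
  proof -
    interpret C: env K C using that by (auto simp: homologically_smooth_def intro: env.intro)
    obtain n and P :: "nat \<Rightarrow> (('e \<times> 'e \<Rightarrow> 'k) set, nat \<Rightarrow> ('e \<times> 'e \<Rightarrow> 'k) set) module" and d \<epsilon>
      where "finite_resolution C.EA C.RB n P d \<epsilon>"
        "\<forall>i\<le>n. finitely_generated C.EA (P i) \<and> projective_wrt TYPE(nat \<Rightarrow> ('e \<times> 'e \<Rightarrow> 'k) set) C.EA (P i)"
      using conjunct2[OF sC[unfolded homologically_smooth_def]] by (elim exE conjE) (rule that)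
    then show ?thesis by (intro resolution_haspres[OF C.regular_left_module]) auto
  qed
  obtain k l where hp: "haspres A.EA (triv A.EA) k A.RB (triv A.RB)" "haspres B.EA (triv B.EA) l B.RB (triv B.RB)"
    using in_res[OF sm(1)] in_res[OF sm(2)] by blast
  note gm = gmod_triv[OF A.regular_left_module] gmod_triv[OF B.regular_left_module] gmod_triv[OF U.regular_left_module]
  note gr = gr_ring_triv[OF RA.ring_axioms] gr_ring_triv[OF RB.ring_axioms] gr_ring_triv[OF RU.ring_axioms]
  have z: "P.pt \<zero>\<^bsub>A\<^esub> n = \<zero>\<^bsub>P.TAB\<^esub>" if "n \<in> carrier B" for n
    by (rule addm_zero[OF A.abelian_group_axioms P.T.abelian_group_axioms P.pt_left[OF that]])
  have z': "P.pt m \<zero>\<^bsub>B\<^esub> = \<zero>\<^bsub>P.TAB\<^esub>" if "m \<in> carrier A" for m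
    by (rule addm_zero[OF B.abelian_group_axioms P.T.abelian_group_axioms P.pt_right[OF that]])
  have zb: "\<beta> \<zero>\<^bsub>A.EA\<^esub> n = \<zero>\<^bsub>U.EA\<^esub>" if "n \<in> carrier B.EA" for n
    by (rule addm_zero[OF RA.abelian_group_axioms RU.abelian_group_axioms swap_left[OF \<beta> that]])
  have zb': "\<beta> m \<zero>\<^bsub>B.EA\<^esub> = \<zero>\<^bsub>U.EA\<^esub>" if "m \<in> carrier A.EA" for m
    by (rule addm_zero[OF RB.abelian_group_axioms RU.abelian_group_axioms swap_right[OF \<beta> that]])
  have "\<exists>n. haspres U.EA (triv U.EA) n U.RB (triv U.RB)"
  proof (rule haspres_regular[OF \<beta> gr gm _ _ hp])
    \<comment> \<open>In the trivial grading an element homogeneous of nonzero degree is zero, and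
      then so is the value of the bilinear map.\<close>
    show "triv U.EA (i + j) (\<beta> r s) = \<beta> r s"
      if "r \<in> carrier A.EA" "s \<in> carrier B.EA" "triv A.EA i r = r" "triv B.EA j s = s" for r s i j
      using that(1,2) zb zb' triv_eqD[OF that(3)] triv_eqD[OF that(4)] by (auto simp: triv_def)
    show "triv U.RB (i + j) (P.pt m n) = P.pt m n"
      if "m \<in> carrier A" "n \<in> carrier B" "triv A.RB i m = m" "triv B.RB j n = n" for m n i j
      using that(1,2) z z' triv_eqD[OF that(3)] triv_eqD[OF that(4)] by (auto simp: triv_def regular_simps)
  qed
  then obtain m where "haspres U.EA (triv U.EA) m U.RB (triv U.RB)" by blast
  from gr_ring.haspres_resolution[OF gr(3) gm(3) this]
  show "homologically_smooth K (tensor_product K A B)"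
    unfolding homologically_smooth_def using P.T_assoc_algebra by blast
next
  fix G H
  assume sm: "graded_homologically_smooth K A G" "graded_homologically_smooth K B H"
  then have gA: "graded_algebra K A G" and gB: "graded_algebra K B H" by (auto simp: graded_homologically_smooth_def)
  then interpret env_pair K A B by (intro env_pair.intro env.intro assms graded_algebraD(1))
  obtain \<beta> where \<beta>: "swap \<beta>" using ex_swap by blast
  let ?T = "total_grading K A G B H"
  have gT: "graded_algebra K P.TAB ?T" by (rule P.graded_algebra_tensor[OF gA gB])
  have in_res: "\<exists>m. haspres (enveloping K C) pr m (regular_bimodule K C) q"
    if sm: "graded_homologically_smooth K C L" and pr: "nat_gr_ring (enveloping K C) pr (enveloping_grading K C L)"
      and q: "gmod (enveloping K C) pr (regular_bimodule K C) q"
      "extend_by_zero C L = (\<lambda>j. {x \<in> carrier (regular_bimodule K C). q j x = x})"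
    for C :: "('k, 'e) module" and L pr q
  proof -
    obtain n and P :: "nat \<Rightarrow> (('e \<times> 'e \<Rightarrow> 'k) set, nat \<Rightarrow> ('e \<times> 'e \<Rightarrow> 'k) set) module" and Q d \<epsilon>
      where res: "finite_resolution (enveloping K C) (regular_bimodule K C) n P d \<epsilon>"
      "\<forall>i<n. d i \<in> graded_hom (enveloping K C) (P (Suc i)) (Q (Suc i)) (P i) (Q i)"
      "\<epsilon> \<in> graded_hom (enveloping K C) (P 0) (Q 0) (regular_bimodule K C) (extend_by_zero C L)"
      "\<forall>i\<le>n. graded_module (enveloping K C) (enveloping_grading K C L) (P i) (Q i) \<and>
        finitely_generated (enveloping K C) (P i) \<and>
        graded_projective_wrt TYPE(nat \<Rightarrow> ('e \<times> 'e \<Rightarrow> 'k) set)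
          (enveloping K C) (enveloping_grading K C L) (P i) (Q i)"
      using conjunct2[OF sm[unfolded graded_homologically_smooth_def]] by (elim exE conjE) (rule that)
    show ?thesis
      by (rule nat_gr_ring.graded_resolution_haspres[OF pr q(1) res(1), where Q = Q])
        (use res(2-4) in \<open>auto simp: q(2)\<close>)
  qed
  obtain prA qA where A': "nat_gr_ring A.EA prA (enveloping_grading K A G)" "gmod A.EA prA A.RB qA"
    "extend_by_zero A G = (\<lambda>j. {x \<in> carrier A.RB. qA j x = x})" using regular_gmod[OF gA] by blast
  obtain prB qB where B': "nat_gr_ring B.EA prB (enveloping_grading K B H)" "gmod B.EA prB B.RB qB"
    "extend_by_zero B H = (\<lambda>j. {x \<in> carrier B.RB. qB j x = x})" using regular_gmod[OF gB] by blast
  obtain prU qU where U': "nat_gr_ring U.EA prU (enveloping_grading K P.TAB ?T)" "gmod U.EA prU U.RB qU"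
    "extend_by_zero P.TAB ?T = (\<lambda>j. {x \<in> carrier U.RB. qU j x = x})" using regular_gmod[OF gT] by blast
  interpret nA: nat_gr_ring A.EA prA "enveloping_grading K A G" by (rule A')
  interpret nB: nat_gr_ring B.EA prB "enveloping_grading K B H" by (rule B')
  interpret nU: nat_gr_ring U.EA prU "enveloping_grading K P.TAB ?T" by (rule U')
  interpret gU: grading U.RB qU by (rule gmodD[OF U'(2)])
  obtain k l where hp: "haspres A.EA prA k A.RB qA" "haspres B.EA prB l B.RB qB"
    using in_res[OF sm(1) A'] in_res[OF sm(2) B'] by blast
  note DA = graded_algebraD[OF gA] and DB = graded_algebraD[OF gB]
  note GA = sbspD(3)[OF DA(3)] and GB = sbspD(3)[OF DB(3)]
  \<comment> \<open>The interchange map adds degrees. Each grading is the span of homogeneous pure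
    tensors, so minimality of the span reduces first \<open>r\<close> and then \<open>s\<close> to
    such a tensor, where the four degrees are merely regrouped.\<close>
  have deg: "\<beta> r s \<in> enveloping_grading K P.TAB ?T (m + n)"
    if r: "r \<in> enveloping_grading K A G m" and s: "s \<in> enveloping_grading K B H n" for r s m n
  proof -
    have gUn: "sbsp K U.EA (enveloping_grading K P.TAB ?T n)" for n
      using graded_algebraD(3)[OF U.E.graded_algebra_tensor[OF gT graded_algebra_opposite[OF gT]]]
      by (simp add: enveloping_grading_def U.EA_eq)
    have sc: "s \<in> carrier B.EA" using s by (simp add: nB.G_eq)
    have "r \<in> {X \<in> carrier A.EA. \<beta> X s \<in> enveloping_grading K P.TAB ?T (m + n)}"
    proof (rule A.E.total_grading_least[of G G m, folded enveloping_grading_def A.EA_eq, OF _ _ r])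
      show "sbsp K A.EA {X \<in> carrier A.EA. \<beta> X s \<in> enveloping_grading K P.TAB ?T (m + n)}"
        by (rule sbsp_vimage[OF RA.module_axioms RU.module_axioms swap_left[OF \<beta> sc] _ gUn])
          (use swap_scalar(1)[OF \<beta>] sc in auto)
      fix a a' i i' assume a: "a \<in> G i" "a' \<in> G i'" "i + i' = m"
      have ac: "A.E.pt a a' \<in> carrier A.EA" using A.EA_pt(1) GA a by simp
      have "s \<in> {X \<in> carrier B.EA. \<beta> (A.E.pt a a') X \<in> enveloping_grading K P.TAB ?T (m + n)}"
      proof (rule B.E.total_grading_least[of H H n, folded enveloping_grading_def B.EA_eq, OF _ _ s])
        show "sbsp K B.EA {X \<in> carrier B.EA. \<beta> (A.E.pt a a') X \<in> enveloping_grading K P.TAB ?T (m + n)}"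
          by (rule sbsp_vimage[OF RB.module_axioms RU.module_axioms swap_right[OF \<beta> ac] _ gUn])
            (use swap_scalar(2)[OF \<beta>] ac in auto)
        fix b b' j j' assume b: "b \<in> H j" "b' \<in> H j'" "j + j' = n"
        have "U.E.pt (P.pt a b) (P.pt a' b') \<in> enveloping_grading K P.TAB ?T ((i + j) + (i' + j'))"
          unfolding enveloping_grading_def
          by (rule U.E.pt_total_grading[of _ ?T "i + j" _ ?T "i' + j'"])
            (rule P.pt_total_grading[of _ G i _ H j, OF a(1) b(1)], rule P.pt_total_grading[of _ G i' _ H j', OF a(2) b(2)])
        moreover have "(i + j) + (i' + j') = m + n" using a b by simp
        ultimately show "B.E.pt b b' \<in> {X \<in> carrier B.EA. \<beta> (A.E.pt a a') X \<in> enveloping_grading K P.TAB ?T (m + n)}"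
          using swap_pt[OF \<beta>] GA GB a b B.EA_pt(1) by simp
      qed
      then show "A.E.pt a a' \<in> {X \<in> carrier A.EA. \<beta> X s \<in> enveloping_grading K P.TAB ?T (m + n)}" using ac by simp
    qed
    then show ?thesis by simp
  qed
  have "\<exists>n. haspres U.EA prU n U.RB qU"
  proof (rule haspres_regular[OF \<beta> nA.gr_ring_axioms nB.gr_ring_axioms nU.gr_ring_axioms A'(2) B'(2) U'(2) _ _ hp])
    fix r s i j assume r: "r \<in> carrier A.EA" "prA i r = r" and s: "s \<in> carrier B.EA" "prB j s = s"
    have z: "\<beta> \<zero>\<^bsub>A.EA\<^esub> s = \<zero>\<^bsub>U.EA\<^esub>" "\<beta> r \<zero>\<^bsub>B.EA\<^esub> = \<zero>\<^bsub>U.EA\<^esub>"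
      using addm_zero[OF RA.abelian_group_axioms RU.abelian_group_axioms swap_left[OF \<beta> s(1)]]
        addm_zero[OF RB.abelian_group_axioms RU.abelian_group_axioms swap_right[OF \<beta> r(1)]] by simp_all
    show "prU (i + j) (\<beta> r s) = \<beta> r s"
    \<comment> \<open>The projections are indexed by integers but the gradings by natural numbers;
      in a negative degree there is only zero, which the bilinear map preserves.\<close>
    proof (cases "i < 0 \<or> j < 0")
      case True
      then have "r = \<zero>\<^bsub>A.EA\<^esub> \<or> s = \<zero>\<^bsub>B.EA\<^esub>" using nA.pr_neg[of i r] nB.pr_neg[of j s] r s by auto
      then show ?thesis using z nU.q_zero by auto
    next
      case False
      then have "r \<in> enveloping_grading K A G (nat i)" "s \<in> enveloping_grading K B H (nat j)"
        using r s by (simp_all add: nA.G_eq nB.G_eq)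
      from deg[OF this] show ?thesis using False by (simp add: nU.G_eq)
    qed
  next
    fix m n i j assume m: "m \<in> carrier A" "qA i m = m" and n: "n \<in> carrier B" "qB j n = n"
    have me: "m \<in> extend_by_zero A G i" and ne: "n \<in> extend_by_zero B H j"
      using m n A'(3) B'(3) by (simp_all add: regular_simps)
    have z: "P.pt \<zero>\<^bsub>A\<^esub> n = \<zero>\<^bsub>P.TAB\<^esub>" "P.pt m \<zero>\<^bsub>B\<^esub> = \<zero>\<^bsub>P.TAB\<^esub>"
      using addm_zero[OF A.abelian_group_axioms P.T.abelian_group_axioms P.pt_left[OF n(1)]]
        addm_zero[OF B.abelian_group_axioms P.T.abelian_group_axioms P.pt_right[OF m(1)]] by simp_all
    show "qU (i + j) (P.pt m n) = P.pt m n"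
    proof (cases "i < 0 \<or> j < 0")
      case True
      then have "m = \<zero>\<^bsub>A\<^esub> \<or> n = \<zero>\<^bsub>B\<^esub>" using me ne by (auto simp: extend_by_zero_def)
      then show ?thesis using z gU.q_zero[of "i + j"] by (auto simp: regular_simps)
    next
      case False
      then have "m \<in> G (nat i)" "n \<in> H (nat j)" using me ne by (simp_all add: extend_by_zero_def)
      from P.pt_total_grading[of m G "nat i" n H "nat j", OF this] have "P.pt m n \<in> extend_by_zero P.TAB ?T (i + j)"
        using False by (simp add: extend_by_zero_def nat_add_distrib)
      then show ?thesis unfolding U'(3) by simp
    qed
  qed
  then obtain m where "haspres U.EA prU m U.RB qU" by blast
  from nU.haspres_graded_resolution[OF U'(2) this, folded U'(3)]
  show "graded_homologically_smooth K (tensor_product K A B) ?T"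
    unfolding graded_homologically_smooth_def using gT by blast
qed

end
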